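(* Let $\mathcal X_\infty$ be the infinite Ginibre ensemble and let $U$ be an open subset of $\mathbb D$ which satisfies either (a) there exists a sequence of open sets $U_n$ with $\overline U\subset U_n\subseteq\mathbb D$ for all $n$ such that the balayage measures on $\partial U_n$ converge weakly to the balayage measure on $\partial U$; or (b) the exterior ball condition: there exists $\epsilon>0$ such that for every $z\in\partial U$ there is $\eta\in U^c$ with $B(\eta,\epsilon)\subset U^c$ and $|z-\eta|=\epsilon$. Then $$\lim_{r\to\infty}\frac1{r^4}\log\mathbf P\big[\mathcal X_\infty(rU)=0\big]=R_\emptyset-R_U.$$
   Context: $\mathcal X_\infty$ is the determinantal point process on $\mathbb C$ with kernel $\mathbb K(z,w)=\frac1\pi e^{z\overline w-\frac12|z|^2-\frac12|w|^2}$ w.r.t. Lebesgue measure $m$. $\mathcal X(A)$ is the number of points in $A$; $rU=\{rz:z\in U\}$; $\mathbb D$ open unit disk; $U^c=\mathbb C\setminus U$. For $E\subseteq\mathbb C$, $\mathcal P(E)$ is the set of compactly supported Borel probability measures supported in $E$; $R_\mu=\iint\log\frac1{|z-w|}d\mu(z)d\mu(w)+\int|z|^2d\mu(z)$, $R_U=\inf_{\mu\in\mathcal P(U^c)}R_\mu$, $R_\emptyset=\inf_{\mu\in\mathcal P(\mathbb C)}R_\mu$ $(=3/4)$. A Borel set $B$ is polar if $\iint\log\frac1{|z-w|}d\mu d\mu=+\infty$ for every compactly supported probability $\mu$ supported in $B$. For a bounded open $V$, the balayage measure on $\partial V$ is the unique positive Borel measure $\nu$ on $\partial V$ with $\nu(B)=0$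 for all Borel polar $B$ and $\int\log\frac1{|z-w|}d\nu(w)=\frac1\pi\int_V\log\frac1{|z-w|}dm(w)$ for all $z\in\mathbb C\setminus V$ outside a Borel polar set. *)

theory Defs
  imports "HOL-Probability.Probability"
begin

definition ginibre_kernel :: "complex \<Rightarrow> complex \<Rightarrow> complex" where
  "ginibre_kernel z w =
     complex_of_real (1 / pi) * exp (z * cnj w - complex_of_real ((cmod z)\<^sup>2 / 2 + (cmod w)\<^sup>2 / 2))"

definition det_fun :: "nat \<Rightarrow> (nat \<Rightarrow> nat \<Rightarrow> complex) \<Rightarrow> complex" where
  "det_fun k A = (\<Sum>p | p permutes {..<k}. of_int (sign p) * (\<Prod>i<k. A i (p i)))"

text \<open>A simple point process on the complex plane is given by a probability space M and
  a random locally finite configuration S. It is determinantal with kernel K if its joint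
  intensities (w.r.t. Lebesgue measure) are det[K(z_i,z_j)], i.e. for all pairwise disjoint
  bounded Borel sets A_0..A_(k-1), E[prod X(A_i)] = integral over A_0 x ... x A_(k-1) of
  det[K(z_i,z_j)].\<close>
definition determinantal_pp ::
  "'a measure \<Rightarrow> ('a \<Rightarrow> complex set) \<Rightarrow> (complex \<Rightarrow> complex \<Rightarrow> complex) \<Rightarrow> bool" where
  "determinantal_pp M S K \<longleftrightarrow>
     prob_space M \<and>
     (\<forall>\<omega>\<in>space M. \<forall>A. bounded A \<longrightarrow> finite (S \<omega> \<inter> A)) \<and>
     (\<forall>A\<in>sets borel. bounded A \<longrightarrow> (\<lambda>\<omega>. card (S \<omega> \<inter> A)) \<in> M \<rightarrow>\<^sub>M count_space UNIV) \<and>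
     (\<forall>k (A :: nat \<Rightarrow> complex set).
        (\<forall>i<k. A i \<in> sets borel \<and> bounded (A i)) \<and> disjoint_family_on A {..<k} \<longrightarrow>
        (\<integral>\<^sup>+\<omega>. (\<Prod>i<k. of_nat (card (S \<omega> \<inter> A i))) \<partial>M) =
        (\<integral>\<^sup>+z\<in>(\<Pi>\<^sub>E i\<in>{..<k}. A i).
            ennreal (Re (det_fun k (\<lambda>i j. K (z i) (z j)))) \<partial>(\<Pi>\<^sub>M i\<in>{..<k}. lborel)))"

definition logk_pos :: "complex \<Rightarrow> complex \<Rightarrow> ennreal" where
  "logk_pos z w = (if z = w then \<infinity> else ennreal (max 0 (- ln (cmod (z - w)))))"

definition logk_neg :: "complex \<Rightarrow> complex \<Rightarrow> ennreal" where
  "logk_neg z w = ennreal (max 0 (ln (cmod (z - w))))"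

definition log_energy :: "complex measure \<Rightarrow> ereal" where
  "log_energy \<mu> =
     enn2ereal (\<integral>\<^sup>+p. logk_pos (fst p) (snd p) \<partial>(\<mu> \<Otimes>\<^sub>M \<mu>))
   - enn2ereal (\<integral>\<^sup>+p. logk_neg (fst p) (snd p) \<partial>(\<mu> \<Otimes>\<^sub>M \<mu>))"

definition log_pot :: "complex measure \<Rightarrow> complex \<Rightarrow> ereal" where
  "log_pot \<nu> z =
     enn2ereal (\<integral>\<^sup>+w. logk_pos z w \<partial>\<nu>) - enn2ereal (\<integral>\<^sup>+w. logk_neg z w \<partial>\<nu>)"

definition prob_meas_in :: "complex set \<Rightarrow> complex measure \<Rightarrow> bool" where
  "prob_meas_in E \<mu> \<longleftrightarrow> sets \<mu> = sets borel \<and> prob_space \<mu> \<and>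
     (\<exists>C. compact C \<and> C \<subseteq> E \<and> emeasure \<mu> (UNIV - C) = 0)"

definition R_mu :: "complex measure \<Rightarrow> ereal" where
  "R_mu \<mu> = log_energy \<mu> + ereal (\<integral>z. (cmod z)\<^sup>2 \<partial>\<mu>)"

definition R_set :: "complex set \<Rightarrow> ereal" where
  "R_set U = (INF \<mu>\<in>{\<mu>. prob_meas_in (- U) \<mu>}. R_mu \<mu>)"

definition polar :: "complex set \<Rightarrow> bool" where
  "polar B \<longleftrightarrow> (\<forall>\<mu>. prob_meas_in B \<mu> \<longrightarrow> log_energy \<mu> = \<infinity>)"

definition is_balayage :: "complex set \<Rightarrow> complex measure \<Rightarrow> bool" where
  "is_balayage V \<nu> \<longleftrightarrow> sets \<nu> = sets borel \<and> emeasure \<nu> (UNIV - frontier V) = 0 \<and>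
     (\<forall>B\<in>sets borel. polar B \<longrightarrow> emeasure \<nu> B = 0) \<and>
     (\<exists>P\<in>sets borel. polar P \<and>
        (\<forall>z. z \<notin> V \<and> z \<notin> P \<longrightarrow>
           log_pot \<nu> z = ereal ((1 / pi) * (LINT w:V|lborel. - ln (cmod (z - w))))))"

definition weak_conv_cmeas :: "(nat \<Rightarrow> complex measure) \<Rightarrow> complex measure \<Rightarrow> bool" where
  "weak_conv_cmeas \<nu>s \<nu> \<longleftrightarrow>
     (\<forall>n. finite_measure (\<nu>s n) \<and> sets (\<nu>s n) = sets borel) \<and>
     finite_measure \<nu> \<and> sets \<nu> = sets borel \<and>
     (\<forall>f :: complex \<Rightarrow> real. continuous_on UNIV f \<and> bounded (range f) \<longrightarrow>
        (\<lambda>n. \<integral>z. f z \<partial>\<nu>s n) \<longlonglongrightarrow> (\<integral>z. f z \<partial>\<nu>))"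

end

(* The determinantal structure makes hole probabilities limits of N x N Gram determinants of the
   orthonormal functions z^a exp(-r^2 |z|^2 / 2). The ratio of consecutive determinants is at
   least the one for the full disc, so up to a factor exp(o(r^4)) the limit may be replaced by
   N = floor (r^2), and the determinant is then a ratio of partition functions of the
   N-particle Coulomb gas confined to the complement of U and to the plane. Their
   exponential rates are the weighted energies R_set: the upper bound is the maximum principle
   together with compactness of probability measures on the complement of U in the disc (pulled
   back to an interval by a space-filling curve); the lower bound places particles greedily with
   energy at most that of a given measure and uses a Bernstein-Markov inequality on discs
   contained in the complement of U, of which the exterior ball condition provides enough. In case (a) the
   measures live on the complement of U_n, and positive definiteness of the
   logarithmic kernel identifies the infimum with 1/2 + (second moment of the swept measure)/2,
   which is continuous under weak convergence of the balayage. *)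
theory Submission
  imports Defs "Jordan_Normal_Form.Determinant" "HOL-Complex_Analysis.Complex_Analysis" "HOL-Real_Asymp.Real_Asymp"
begin

section \<open>Schur complement ratios, principal minors and the Vandermonde determinant\<close>

section \<open>Determinants of Hermitian matrices\<close>

text \<open>For fixed \<open>r\<close> the determinants converge to the hole probability as their
  size grows, whereas the Coulomb gas has size about r^2. The two regimes are joined by ratios of
  consecutive determinants: such a ratio is a Schur complement, the least value of a Hermitian form
  on an affine hyperplane, hence monotone in the weight and explicit for a rotation invariant one.
  Beyond the size r^2 only O(r^2) ratios matter, and together they cost exp(O(r^2 log r)). With n at
  most r^2, the part \<open>n - 1\<close> of the field balances the n - 1 interactions of each
  particle, and the rest leaves an integrable Gaussian factor. \<open>R_set {}\<close> is never
  evaluated: it is the rate of the normalising integral, found from the same limit with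
  \<open>U = {}\<close>. Energies are written with a nonnegative pair kernel, so that they are
  integrals in \<open>ennreal\<close> without indeterminate differences; inequalities between them
  are therefore stated additively. The boundary of \<open>U\<close> shapes the lower bound: a
  minimiser may live on it, while an integral over configurations needs discs of admissible points.
  Conditions (a) and (b) are two ways to find them.\<close>

abbreviation fmat :: "nat \<Rightarrow> (nat \<Rightarrow> nat \<Rightarrow> complex) \<Rightarrow> complex mat" where
  "fmat n A \<equiv> Matrix.mat n n (\<lambda>(i, j). A i j)"

text \<open>Opens adjugates, cofactors and row operations to matrices given as functions on index
  pairs.\<close>

lemma det_fun_eq_det: "det_fun n A = Determinant.det (fmat n A)"
proof -
  have "signof p = (of_int (sign p) :: complex)" for p :: "nat \<Rightarrow> nat"
    by (simp add: sign_def)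
  moreover have "A i (p i) = fmat n A $$ (i, p i)" if "p permutes {..<n}" "i < n" for p i
    using that permutes_in_image[OF that(1), of i] by simp
  ultimately show ?thesis
    unfolding det_fun_def
    by (subst det_def'[of _ n]) (auto simp: lessThan_atLeast0 intro!: sum.cong prod.cong)
qed

lemma det_fun_cong: "(\<And>i j. i < n \<Longrightarrow> j < n \<Longrightarrow> A i j = B i j) \<Longrightarrow> det_fun n A = det_fun n B"
  unfolding det_fun_eq_det by (rule arg_cong[where f="Determinant.det"]) (auto intro!: eq_matI)

lemma det_fun_0 [simp]: "det_fun 0 A = 1"
  by (simp add: det_fun_eq_det)

lemma det_fun_identical_rows:
  assumes "i < n" "j < n" "i \<noteq> j" "\<And>l. l < n \<Longrightarrow> A i l = A j l"
  shows "det_fun n A = 0"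
  unfolding det_fun_eq_det
  by (rule det_identical_rows[of _ n i j]) (use assms in \<open>auto intro!: eq_vecI\<close>)

text \<open>Read off from \<open>A * adj A = det A * 1\<close>: the last column of the adjugate
  solves the system whose right-hand side is concentrated in row \<open>n\<close>, and its last
  entry is the leading minor of size \<open>n\<close>. Up to scaling this column is the minimiser in
  \<open>pos_def_ratio\<close>.\<close>

lemma det_fun_adjugate_column:
  fixes A :: "nat \<Rightarrow> nat \<Rightarrow> complex"
  obtains x where "x n = det_fun n A"
    "\<And>i. i \<le> n \<Longrightarrow> (\<Sum>j<Suc n. A i j * x j) = (if i = n then det_fun (Suc n) A else 0)"
proof -
  let ?M = "fmat (Suc n) A"
  define x where "x j = cofactor ?M n j" for j
  have M: "?M \<in> carrier_mat (Suc n) (Suc n)" by simp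
  have del: "mat_delete ?M n n = fmat n A"
    by (rule eq_matI) (auto simp: mat_delete_def)
  have 1: "x n = det_fun n A"
    by (simp add: x_def cofactor_def del det_fun_eq_det mult_2[symmetric] power_mult flip: mult_2)
  have "(\<Sum>j<Suc n. A i j * x j) = (if i = n then det_fun (Suc n) A else 0)" if "i \<le> n" for i
  proof -
    have "(?M * adj_mat ?M) $$ (i, n) = (Determinant.det ?M \<cdot>\<^sub>m 1\<^sub>m (Suc n)) $$ (i, n)"
      using adj_mat(2)[OF M] by simp
    also have "\<dots> = (if i = n then det_fun (Suc n) A else 0)"
      using that by (simp add: det_fun_eq_det)
    also have "(?M * adj_mat ?M) $$ (i, n) = (\<Sum>j<Suc n. A i j * x j)"
      using that adj_mat(1)[OF M]
      by (simp add: scalar_prod_def x_def adj_mat_def lessThan_atLeast0 del: sum.op_ivl_Suc)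
    finally show ?thesis .
  qed
  with 1 show ?thesis by (intro that)
qed

definition herm_form :: "nat \<Rightarrow> (nat \<Rightarrow> nat \<Rightarrow> complex) \<Rightarrow> (nat \<Rightarrow> complex) \<Rightarrow> complex" where
  "herm_form n A x = (\<Sum>i<n. \<Sum>j<n. cnj (x i) * A i j * x j)"

text \<open>All leading sections of an infinite array are covered at once, so that a single
  hypothesis serves every size in an induction.\<close>

definition pos_def :: "(nat \<Rightarrow> nat \<Rightarrow> complex) \<Rightarrow> bool" where
  "pos_def A \<longleftrightarrow> (\<forall>i j. A j i = cnj (A i j)) \<and>
     (\<forall>n x. (\<exists>i<n. x i \<noteq> 0) \<longrightarrow> 0 < Re (herm_form n A x))"

lemma herm_form_real:
  assumes "\<And>i j. A j i = cnj (A i j)"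
  shows "herm_form n A x = complex_of_real (Re (herm_form n A x))"
proof -
  have "cnj (herm_form n A x) = (\<Sum>i<n. \<Sum>j<n. x i * A j i * cnj (x j))"
    unfolding herm_form_def by (simp add: assms[symmetric])
  also have "\<dots> = herm_form n A x"
    unfolding herm_form_def by (subst sum.swap) (simp add: mult_ac)
  finally show ?thesis
    by (metis Reals_cnj_iff complex_is_Real_iff complex_eq_iff Re_complex_of_real Im_complex_of_real)
qed

lemma herm_form_rows: "herm_form n A x = (\<Sum>i<n. cnj (x i) * (\<Sum>j<n. A i j * x j))"
  by (simp add: herm_form_def sum_distrib_left mult_ac)

text \<open>Sylvester's criterion: at the adjugate column the form takes the value conj(d) * d',
  where d and d' are the leading minors of sizes \<open>n\<close> and \<open>Suc n\<close>.
  Positivity of d and of the form gives positivity of d'.\<close>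

lemma det_fun_pos_def:
  assumes "pos_def A"
  shows "0 < Re (det_fun n A) \<and> det_fun n A = complex_of_real (Re (det_fun n A))"
proof (induction n)
  case (Suc n)
  obtain x where x: "x n = det_fun n A"
    "\<And>i. i \<le> n \<Longrightarrow> (\<Sum>j<Suc n. A i j * x j) = (if i = n then det_fun (Suc n) A else 0)"
    using det_fun_adjugate_column[of n A] by blast
  let ?d = "Re (det_fun n A)"
  have "herm_form (Suc n) A x = cnj (x n) * det_fun (Suc n) A"
    unfolding herm_form_rows by (simp add: x(2) del: sum.lessThan_Suc) (simp add: x(2))
  also have "\<dots> = of_real ?d * det_fun (Suc n) A"
    using Suc x(1) by (metis complex_cnj_complex_of_real)
  finally have eq: "herm_form (Suc n) A x = of_real ?d * det_fun (Suc n) A" .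
  have "x n \<noteq> 0" using Suc x(1) by auto
  then have pos: "0 < Re (herm_form (Suc n) A x)"
    using assms unfolding pos_def_def by blast
  have "herm_form (Suc n) A x = of_real (Re (herm_form (Suc n) A x))"
    using assms herm_form_real unfolding pos_def_def by blast
  then have "det_fun (Suc n) A = of_real (Re (herm_form (Suc n) A x) / ?d)"
    using eq Suc by (metis less_numeral_extra(3) nonzero_mult_div_cancel_left of_real_divide of_real_eq_0_iff)
  with pos Suc show ?case by (metis Re_complex_of_real divide_pos_pos)
qed auto

text \<open>The ratio of consecutive leading minors is a Schur complement, that is, the minimum of
  the form over vectors with last coordinate 1. For a Gram matrix it is the squared distance of the
  last function from the span of the earlier ones.\<close>

lemma pos_def_ratio:
  assumes A: "pos_def A"
  obtains x where "x n = 1" "Re (herm_form (Suc n) A x) = Re (det_fun (Suc n) A) / Re (det_fun n A)"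
    "\<And>y. y n = 1 \<Longrightarrow> Re (det_fun (Suc n) A) / Re (det_fun n A) \<le> Re (herm_form (Suc n) A y)"
proof -
  obtain x where x: "x n = det_fun n A"
    "\<And>i. i \<le> n \<Longrightarrow> (\<Sum>j<Suc n. A i j * x j) = (if i = n then det_fun (Suc n) A else 0)"
    using det_fun_adjugate_column[of n A] by blast
  define d where "d = Re (det_fun n A)"
  define e where "e = Re (det_fun (Suc n) A)"
  have d: "d > 0" "det_fun n A = of_real d" and e: "e > 0" "det_fun (Suc n) A = of_real e"
    using det_fun_pos_def[OF A] by (auto simp: d_def e_def)
  have herm: "A j i = cnj (A i j)" for i j using A unfolding pos_def_def by blast
  define y where "y j = x j / d" for j
  have yn: "y n = 1" using d x by (simp add: y_def)
  have y: "(\<Sum>j<Suc n. A i j * y j) = (if i = n then of_real (e / d) else 0)" if "i \<le> n" for i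
  proof -
    have "(\<Sum>j<Suc n. A i j * y j) = (\<Sum>j<Suc n. A i j * x j) / d"
      unfolding sum_divide_distrib by (simp add: y_def)
    then show ?thesis using x(2)[OF that] e(2) by simp
  qed
  have Ay: "herm_form (Suc n) A y = of_real (e / d)"
    unfolding herm_form_rows by (simp add: y yn del: sum.lessThan_Suc of_real_divide) (simp add: y yn del: of_real_divide)
  \<comment> \<open>Write \<open>z\<close> as \<open>y + u\<close> with \<open>u n = 0\<close>.
    Since A y is concentrated in row \<open>n\<close>, both cross terms vanish, and only the
    nonnegative value of the form at \<open>u\<close> is added.\<close>
  have "e / d \<le> Re (herm_form (Suc n) A z)" if z: "z n = 1" for z
  proof -
    define u where "u j = z j - y j" for j
    have un: "u n = 0" using z yn by (simp add: u_def)
    have z_eq: "z j = y j + u j" for j by (simp add: u_def)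
    have c1: "(\<Sum>i<Suc n. cnj (u i) * (\<Sum>j<Suc n. A i j * y j)) = 0"
      using un by (intro sum.neutral) (auto simp: y less_Suc_eq_le simp del: sum.lessThan_Suc)
    have "(\<Sum>i<Suc n. \<Sum>j<Suc n. cnj (y i) * A i j * u j) = cnj (\<Sum>i<Suc n. cnj (u i) * (\<Sum>j<Suc n. A i j * y j))"
      unfolding sum_distrib_left
      by (subst sum.swap) (simp add: herm[symmetric] mult_ac del: sum.lessThan_Suc)
    then have c2: "(\<Sum>i<Suc n. \<Sum>j<Suc n. cnj (y i) * A i j * u j) = 0" by (simp only: c1 complex_cnj_zero)
    have "herm_form (Suc n) A z = herm_form (Suc n) A y + herm_form (Suc n) A u
        + (\<Sum>i<Suc n. cnj (u i) * (\<Sum>j<Suc n. A i j * y j))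
        + (\<Sum>i<Suc n. \<Sum>j<Suc n. cnj (y i) * A i j * u j)"
      unfolding herm_form_def z_eq sum_distrib_left sum.distrib[symmetric]
      by (intro sum.cong refl) (simp add: algebra_simps)
    then have "Re (herm_form (Suc n) A z) = e / d + Re (herm_form (Suc n) A u)"
      unfolding c1 c2 Ay by simp
    moreover have "0 \<le> Re (herm_form (Suc n) A u)"
    proof (cases "\<exists>i<Suc n. u i \<noteq> 0")
      case True
      then show ?thesis using A unfolding pos_def_def by (meson less_imp_le)
    next
      case False
      then show ?thesis by (simp add: herm_form_def del: sum.lessThan_Suc)
    qed
    ultimately show ?thesis by simp
  qed
  with yn Ay show ?thesis
    by (intro that[of y]) (simp_all add: d_def e_def del: of_real_divide)
qed

text \<open>A larger form has a larger minimum on the same hyperplane. All comparisons with rotation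
  invariant weights rest on this.\<close>

lemma det_fun_ratio_mono:
  assumes A: "pos_def A" and B: "pos_def B"
    and le: "\<And>n x. Re (herm_form n A x) \<le> Re (herm_form n B x)"
  shows "Re (det_fun (Suc n) A) / Re (det_fun n A) \<le> Re (det_fun (Suc n) B) / Re (det_fun n B)"
proof -
  obtain x where x: "x n = 1" "Re (herm_form (Suc n) B x) = Re (det_fun (Suc n) B) / Re (det_fun n B)"
    using pos_def_ratio[OF B] by metis
  have "Re (det_fun (Suc n) A) / Re (det_fun n A) \<le> Re (herm_form (Suc n) A x)"
    using pos_def_ratio[OF A] x(1) by metis
  also have "\<dots> \<le> Re (herm_form (Suc n) B x)" by (rule le)
  finally show ?thesis using x by simp
qed

lemma det_fun_diagonal:
  assumes "\<And>i j. i < n \<Longrightarrow> j < n \<Longrightarrow> i \<noteq> j \<Longrightarrow> A i j = 0"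
  shows "det_fun n A = (\<Prod>i<n. A i i)"
proof -
  have "det_fun n A = prod_list (diag_mat (fmat n A))"
    unfolding det_fun_eq_det
    by (rule det_upper_triangular[of _ n]) (auto intro!: upper_triangularI simp: assms)
  also have "\<dots> = (\<Prod>i<n. A i i)"
    by (simp add: prod_list_diag_prod lessThan_atLeast0)
  finally show ?thesis .
qed

section \<open>Principal minors and the finite Fredholm expansion\<close>

text \<open>The principal minor on the rows and columns in \<open>S\<close>. Permutations of the set
  itself are used, so that no enumeration of \<open>S\<close> has to be chosen.\<close>

definition det_set :: "nat set \<Rightarrow> (nat \<Rightarrow> nat \<Rightarrow> complex) \<Rightarrow> complex" where
  "det_set S A = (\<Sum>p | p permutes S. of_int (sign p) * (\<Prod>i\<in>S. A i (p i)))"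

lemma det_fun_det_set: "det_fun n A = det_set {..<n} A"
  by (simp add: det_fun_def det_set_def)

lemma det_set_reindex:
  assumes a: "inj_on a T" and T: "finite T"
  shows "det_set T (\<lambda>i j. A (a i) (a j)) = det_set (a ` T) A"
proof -
  let ?h = "map_permutation T a"
  have b: "bij_betw a T (a ` T)" using a by (simp add: bij_betw_def)
  have bij: "bij_betw ?h {p. p permutes T} {p. p permutes (a ` T)}"
    by (rule bij_betw_permutations[OF b, unfolded o_def, THEN bij_betw_cong[THEN iffD1, rotated]])
       (auto simp: map_permutation_def)
  show ?thesis
    unfolding det_set_def
  proof (subst sum.reindex_bij_betw[OF bij, symmetric], intro sum.cong refl)
    fix p assume "p \<in> {p. p permutes T}"
    then have p: "p permutes T" by simp
    have "(\<Prod>i\<in>a ` T. A i (?h p i)) = (\<Prod>i\<in>T. A (a i) (?h p (a i)))"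
      by (subst prod.reindex[OF a]) simp
    also have "\<dots> = (\<Prod>i\<in>T. A (a i) (a (p i)))"
      by (intro prod.cong refl) (simp add: map_permutation_def a)
    finally show "of_int (sign p) * (\<Prod>i\<in>T. A (a i) (a (p i)))
        = of_int (sign (?h p)) * (\<Prod>i\<in>a ` T. A i (?h p i))"
      using sign_map_permutation[OF a p T] by simp
  qed
qed

text \<open>Expand every factor of the Leibniz products and let \<open>S\<close> be the set of
  indices where the summand \<open>t * G\<close> was taken. The Kronecker factors outside
  \<open>S\<close> force the permutation to fix the complement of \<open>S\<close>, so it is a
  permutation of \<open>S\<close>.\<close>

lemma det_fun_one_plus:
  "det_fun n (\<lambda>i j. (if i = j then 1 else 0) + t * G i j)
     = (\<Sum>S\<in>Pow {..<n}. t ^ card S * det_set S G)"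
proof -
  have "det_fun n (\<lambda>i j. (if i = j then 1 else 0) + t * G i j)
      = (\<Sum>p | p permutes {..<n}. of_int (sign p) *
          (\<Sum>S\<in>Pow {..<n}. (\<Prod>i\<in>S. t * G i (p i)) * (\<Prod>i\<in>{..<n} - S. if i = p i then 1 else 0)))"
    unfolding det_fun_def by (subst add.commute, subst prod_add) simp_all
  also have "\<dots> = (\<Sum>S\<in>Pow {..<n}. \<Sum>p | p permutes {..<n}. of_int (sign p) *
          ((\<Prod>i\<in>S. t * G i (p i)) * (\<Prod>i\<in>{..<n} - S. if i = p i then 1 else 0)))"
    unfolding sum_distrib_left by (rule sum.swap)
  also have "\<dots> = (\<Sum>S\<in>Pow {..<n}. t ^ card S * det_set S G)"
  proof (intro sum.cong refl)
    fix S assume S: "S \<in> Pow {..<n}"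
    then have fin: "finite S" by (auto intro: finite_subset)
    have "(\<Sum>p | p permutes {..<n}. of_int (sign p) *
          ((\<Prod>i\<in>S. t * G i (p i)) * (\<Prod>i\<in>{..<n} - S. if i = p i then 1 else 0)))
        = (\<Sum>p | p permutes S. of_int (sign p) * (\<Prod>i\<in>S. t * G i (p i)))"
    proof (rule sum.mono_neutral_cong_right)
      show "finite {p. p permutes {..<n}}" by (simp add: finite_permutations)
      show "{p. p permutes S} \<subseteq> {p. p permutes {..<n}}" using S by (auto intro: permutes_subset)
      show "\<forall>p\<in>{p. p permutes {..<n}} - {p. p permutes S}. of_int (sign p) *
          ((\<Prod>i\<in>S. t * G i (p i)) * (\<Prod>i\<in>{..<n} - S. if i = p i then 1 else 0)) = 0"
      proof
        fix p assume p: "p \<in> {p. p permutes {..<n}} - {p. p permutes S}"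
        then have "\<exists>i\<in>{..<n} - S. p i \<noteq> i"
          using permutes_superset[of p "{..<n}" S] by blast
        then obtain i where "i \<in> {..<n} - S" "p i \<noteq> i" by blast
        then have "(\<Prod>i\<in>{..<n} - S. if i = p i then 1 else 0 :: complex) = 0"
          by (intro prod_zero bexI[of _ i]) auto
        then show "of_int (sign p) *
          ((\<Prod>i\<in>S. t * G i (p i)) * (\<Prod>i\<in>{..<n} - S. if i = p i then 1 else 0)) = 0" by simp
      qed
      fix p assume "p \<in> {p. p permutes S}"
      then have "(\<Prod>i\<in>{..<n} - S. if i = p i then 1 else 0 :: complex) = 1"
        by (intro prod.neutral) (auto simp: permutes_not_in)
      then show "of_int (sign p) *
          ((\<Prod>i\<in>S. t * G i (p i)) * (\<Prod>i\<in>{..<n} - S. if i = p i then 1 else 0))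
          = of_int (sign p) * (\<Prod>i\<in>S. t * G i (p i))" by simp
    qed
    also have "\<dots> = t ^ card S * det_set S G"
      unfolding det_set_def sum_distrib_left by (simp add: prod.distrib mult_ac)
    finally show "(\<Sum>p | p permutes {..<n}. of_int (sign p) *
          ((\<Prod>i\<in>S. t * G i (p i)) * (\<Prod>i\<in>{..<n} - S. if i = p i then 1 else 0)))
        = t ^ card S * det_set S G" .
  qed
  finally show ?thesis .
qed

lemma det_fun_not_inj:
  assumes "\<not> inj_on a {..<k}"
  shows "det_fun k (\<lambda>i j. G (a i) (a j)) = 0"
proof -
  obtain i j where "i < k" "j < k" "i \<noteq> j" "a i = a j"
    using assms by (auto simp: inj_on_def)
  then show ?thesis by (intro det_fun_identical_rows[of i k j]) auto
qed

text \<open>Tuples with a repetition give two equal rows; every set of size k is the image of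
  exactly k! injective tuples.\<close>

lemma sum_det_fun_principal:
  "(\<Sum>a\<in>{..<k} \<rightarrow>\<^sub>E {..<n}. det_fun k (\<lambda>i j. G (a i) (a j)))
     = fact k * (\<Sum>S | S \<subseteq> {..<n} \<and> card S = k. det_set S G)"
proof -
  let ?X = "{a \<in> {..<k} \<rightarrow>\<^sub>E {..<n}. inj_on a {..<k}}"
  have "(\<Sum>a\<in>{..<k} \<rightarrow>\<^sub>E {..<n}. det_fun k (\<lambda>i j. G (a i) (a j)))
      = (\<Sum>a\<in>?X. det_fun k (\<lambda>i j. G (a i) (a j)))"
    by (rule sum.mono_neutral_right) (auto simp: det_fun_not_inj finite_PiE)
  also have "\<dots> = (\<Sum>a\<in>?X. det_set (a ` {..<k}) G)"
    by (intro sum.cong refl) (simp add: det_fun_det_set det_set_reindex)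
  also have "\<dots> = (\<Sum>S | S \<subseteq> {..<n} \<and> card S = k. \<Sum>a\<in>{a\<in>?X. a ` {..<k} = S}. det_set (a ` {..<k}) G)"
  proof -
    have 1: "finite ?X" by (rule finite_subset[of _ "{..<k} \<rightarrow>\<^sub>E {..<n}"]) (auto intro: finite_PiE)
    have 2: "finite {S. S \<subseteq> {..<n} \<and> card S = k}"
      by (rule finite_subset[of _ "Pow {..<n}"]) auto
    have 3: "(\<lambda>a. a ` {..<k}) ` ?X \<subseteq> {S. S \<subseteq> {..<n} \<and> card S = k}"
    proof (rule image_subsetI)
      fix f assume "f \<in> ?X"
      then have "f ` {..<k} \<subseteq> {..<n}" "inj_on f {..<k}" by blast+
      then show "f ` {..<k} \<in> {S. S \<subseteq> {..<n} \<and> card S = k}"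
        using card_image[of f "{..<k}"] by simp
    qed
    show ?thesis using sum.group[OF 1 2 3, of "\<lambda>a. det_set (a ` {..<k}) G"] by (rule sym)
  qed
  also have "\<dots> = (\<Sum>S | S \<subseteq> {..<n} \<and> card S = k. fact k * det_set S G)"
  proof (intro sum.cong refl)
    fix S assume S: "S \<in> {S. S \<subseteq> {..<n} \<and> card S = k}"
    then have fin: "finite S" by (auto intro: finite_subset)
    have "{a\<in>?X. a ` {..<k} = S} = {f \<in> {..<k} \<rightarrow>\<^sub>E S. inj_on f {..<k}}"
    proof (intro equalityI subsetI)
      fix f assume f: "f \<in> {f \<in> {..<k} \<rightarrow>\<^sub>E S. inj_on f {..<k}}"
      then have "f ` {..<k} = S"
        using S fin by (intro card_subset_eq) (auto simp: card_image)
      with f S show "f \<in> {a\<in>?X. a ` {..<k} = S}" by auto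
    qed auto
    moreover have "card {f \<in> {..<k} \<rightarrow>\<^sub>E S. inj_on f {..<k}} = fact k"
      using card_inj_on_subset_funcset[of "{..<k}" S] S fin by (simp add: fact_prod_rev)
    ultimately have "card {a\<in>?X. a ` {..<k} = S} = fact k" by simp
    then show "(\<Sum>a\<in>{a\<in>?X. a ` {..<k} = S}. det_set (a ` {..<k}) G) = fact k * det_set S G"
      by simp
  qed
  also have "\<dots> = fact k * (\<Sum>S | S \<subseteq> {..<n} \<and> card S = k. det_set S G)"
    by (simp add: sum_distrib_left)
  finally show ?thesis .
qed

text \<open>Sums over all index tuples are the form in which integrals of correlation functions
  appear later. At \<open>t = -1\<close> the left side becomes the hole determinant, at
  \<open>t = 2\<close> it controls the tail of the series.\<close>

lemma det_fun_one_plus_series: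
  "det_fun n (\<lambda>i j. (if i = j then 1 else 0) + t * G i j)
     = (\<Sum>k\<le>n. t ^ k / fact k * (\<Sum>a\<in>{..<k} \<rightarrow>\<^sub>E {..<n}. det_fun k (\<lambda>i j. G (a i) (a j))))"
proof -
  have "(\<Sum>S\<in>Pow {..<n}. t ^ card S * det_set S G)
      = (\<Sum>k\<le>n. \<Sum>S | S \<in> Pow {..<n} \<and> card S = k. t ^ card S * det_set S G)"
    by (rule sum.group[symmetric]) (auto dest: card_mono[rotated])
  also have "\<dots> = (\<Sum>k\<le>n. t ^ k * (\<Sum>S | S \<subseteq> {..<n} \<and> card S = k. det_set S G))"
    by (intro sum.cong refl) (simp add: sum_distrib_left)
  finally show ?thesis
    unfolding det_fun_one_plus sum_det_fun_principal by simp
qed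

text \<open>In the induction step the last node becomes a variable \<open>w\<close>. The determinant
  is then a polynomial in \<open>w\<close> of degree at most \<open>n\<close> with the earlier nodes
  as roots, and its leading coefficient is the smaller Vandermonde determinant.\<close>

lemma det_fun_vandermonde:
  "det_fun n (\<lambda>i j. z i ^ j) = (\<Prod>j<n. \<Prod>i<j. (z j - z i))"
proof (induction n)
  case (Suc n)
  show ?case
  \<comment> \<open>The count of roots needs distinct nodes; when two of them coincide, both sides
    vanish.\<close>
  proof (cases "inj_on z {..<n}")
    case False
    then obtain i j where ij: "i < n" "j < n" "i \<noteq> j" "z i = z j" by (auto simp: inj_on_def)
    have "(\<Prod>j<n. \<Prod>i<j. (z j - z i)) = 0"
    proof -
      obtain a b where ab: "a < b" "b < n" "z a = z b"
        using ij by (metis linorder_neqE_nat)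
      have "(\<Prod>i<b. (z b - z i)) = 0"
        by (rule prod_zero) (use ab in \<open>auto intro!: bexI[of _ a]\<close>)
      then have "\<exists>b\<in>{..<n}. (\<Prod>i<b. (z b - z i)) = 0"
        using ab(2) by (metis lessThan_iff)
      then show ?thesis by (rule prod_zero[OF finite_lessThan])
    qed
    moreover have "det_fun (Suc n) (\<lambda>i j. z i ^ j) = 0"
      by (rule det_fun_identical_rows[of i _ j]) (use ij in auto)
    ultimately show ?thesis by simp
  next
    case True
    let ?M = "\<lambda>w. fmat (Suc n) (\<lambda>i j. (if i = n then w else z i) ^ j)"
    define c where "c j = cofactor (?M 0) n j" for j
    define P where "P = (\<Sum>j\<le>n. Polynomial.monom (c j) j)"
    have cof: "cofactor (?M w) n j = c j" for w j
    proof -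
      have "mat_delete (?M w) n j = mat_delete (?M 0) n j"
        by (rule eq_matI) (auto simp: mat_delete_def)
      then show ?thesis by (simp add: c_def cofactor_def)
    qed
    have P: "Determinant.det (?M w) = poly P w" for w
    proof -
      have "Determinant.det (?M w) = (\<Sum>j<Suc n. ?M w $$ (n, j) * cofactor (?M w) n j)"
        by (rule laplace_expansion_row[where n="Suc n"]) auto
      also have "\<dots> = (\<Sum>j<Suc n. w ^ j * c j)"
        by (intro sum.cong refl) (auto simp: cof)
      finally show ?thesis
        by (simp add: P_def poly_sum poly_monom lessThan_Suc_atMost mult.commute)
    qed
    have cn: "c n = det_fun n (\<lambda>i j. z i ^ j)"
    proof -
      have "mat_delete (?M 0) n n = fmat n (\<lambda>i j. z i ^ j)"
        by (rule eq_matI) (auto simp: mat_delete_def)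
      then show ?thesis by (simp add: c_def cofactor_def det_fun_eq_det power_mult flip: mult_2)
    qed
    define R where "R = Polynomial.smult (c n) (\<Prod>i<n. [:- z i, 1:])"
    have degprod: "Polynomial.degree (\<Prod>i<n. [:- z i, 1:]) = n"
      by (subst degree_prod_eq_sum_degree) auto
    have lead: "Polynomial.coeff (\<Prod>i<n. [:- z i, 1:]) n = 1"
      using lead_coeff_prod[of "\<lambda>i. [:- z i, 1:]" "{..<n}"] degprod by simp
    \<comment> \<open>Both polynomials have coefficient \<open>c n\<close> in degree
      \<open>n\<close>, so a nonzero difference would have degree below \<open>n\<close> and yet
      \<open>n\<close> roots.\<close>
    have "P - R = 0"
    proof (rule ccontr)
      assume ne: "P - R \<noteq> 0"
      have "Polynomial.coeff P n = c n" by (simp add: P_def coeff_sum)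
      then have "Polynomial.coeff (P - R) n = 0" using lead by (simp add: R_def)
      moreover have "Polynomial.degree P \<le> n"
        unfolding P_def by (rule degree_sum_le) (auto intro: order_trans[OF degree_monom_le])
      moreover have "Polynomial.degree R \<le> n" unfolding R_def using degprod by (metis degree_smult_le)
      ultimately have "Polynomial.degree (P - R) < n \<or> n = 0"
        using degree_diff_le[of P n R] ne by (metis le_neq_implies_less leading_coeff_0_iff)
      moreover have "n \<noteq> 0"
        using ne \<open>Polynomial.coeff (P - R) n = 0\<close> \<open>Polynomial.degree P \<le> n\<close> \<open>Polynomial.degree R \<le> n\<close>
        by (metis degree_diff_le le_zero_eq leading_coeff_0_iff)
      moreover have "z ` {..<n} \<subseteq> {w. poly (P - R) w = 0}"
      proof safe
        fix i assume i: "i < n"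
        have "det_fun (Suc n) (\<lambda>a j. (if a = n then z i else z a) ^ j) = 0"
          by (rule det_fun_identical_rows[of i _ n]) (use i in auto)
        then have "poly P (z i) = 0" by (simp add: P[symmetric] det_fun_eq_det)
        moreover have "poly R (z i) = 0" using i by (auto simp: R_def poly_prod intro!: prod_zero)
        ultimately show "poly (P - R) (z i) = 0" by simp
      qed
      then have "n \<le> card {w. poly (P - R) w = 0}"
        using card_mono[OF poly_roots_finite[OF ne]] True by (metis card_image card_lessThan)
      moreover have "card {w. poly (P - R) w = 0} \<le> Polynomial.degree (P - R)"
        using ne by (rule card_poly_roots_bound)
      ultimately show False by linarith
    qed
    then have "det_fun (Suc n) (\<lambda>i j. z i ^ j) = poly R (z n)"
    proof -
      assume "P - R = 0"
      moreover have "det_fun (Suc n) (\<lambda>i j. z i ^ j) = Determinant.det (?M (z n))"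
        unfolding det_fun_eq_det[symmetric] by (rule det_fun_cong) auto
      ultimately show ?thesis by (simp add: P)
    qed
    then show ?thesis by (simp add: R_def cn Suc poly_prod)
  qed
qed simp

section \<open>Rotations, dilations and radial integration for planar Lebesgue measure\<close>

section \<open>Lebesgue measure on the plane\<close>

lemma measurable_Complex_pair [measurable]: "(\<lambda>p. Complex (fst p) (snd p)) \<in> borel \<rightarrow>\<^sub>M borel"
  by (intro borel_measurable_continuous_onI)
     (auto simp: complex_eq_iff Complex_eq intro!: continuous_intros)

lemma measurable_cnj [measurable]: "cnj \<in> borel_measurable borel"
  by (intro borel_measurable_continuous_onI continuous_intros)

text \<open>Lebesgue measure is determined by its values on boxes, and boxes are products of
  intervals. This makes integration one coordinate at a time available.\<close>

lemma lborel_complex_eq: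
  "(lborel :: complex measure) = distr (lborel \<Otimes>\<^sub>M lborel) borel (\<lambda>p. Complex (fst p) (snd p))"
proof (rule lborel_eqI)
  fix l u :: complex assume le: "\<And>b. b \<in> Basis \<Longrightarrow> l \<bullet> b \<le> u \<bullet> b"
  have le': "Re l \<le> Re u" "Im l \<le> Im u"
    using le[of 1] le[of \<i>] by (auto simp: Basis_complex_def)
  have "(\<lambda>p. Complex (fst p) (snd p)) -` box l u = {Re l<..<Re u} \<times> {Im l<..<Im u}"
    by (auto simp: box_def Basis_complex_def)
  then have "emeasure (distr (lborel \<Otimes>\<^sub>M lborel) borel (\<lambda>p. Complex (fst p) (snd p))) (box l u)
      = emeasure (lborel \<Otimes>\<^sub>M lborel) ({Re l<..<Re u} \<times> {Im l<..<Im u})"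
    by (subst emeasure_distr) (auto simp: lborel_prod space_pair_measure)
  also have "\<dots> = ennreal (Re u - Re l) * ennreal (Im u - Im l)"
    using le' by (subst lborel.emeasure_pair_measure_Times) auto
  also have "\<dots> = (\<Prod>b\<in>Basis. (u - l) \<bullet> b)"
    using le' by (simp add: Basis_complex_def ennreal_mult)
  finally show "emeasure (distr (lborel \<Otimes>\<^sub>M lborel) borel (\<lambda>p. Complex (fst p) (snd p))) (box l u)
      = (\<Prod>b\<in>Basis. (u - l) \<bullet> b)" .
qed simp

lemma nn_integral_complex:
  assumes [measurable]: "f \<in> borel_measurable (borel :: complex measure)"
  shows "(\<integral>\<^sup>+z. f z \<partial>lborel) = (\<integral>\<^sup>+y. \<integral>\<^sup>+x. f (Complex x y) \<partial>lborel \<partial>lborel)"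
    "(\<integral>\<^sup>+z. f z \<partial>lborel) = (\<integral>\<^sup>+x. \<integral>\<^sup>+y. f (Complex x y) \<partial>lborel \<partial>lborel)"
proof -
  have [measurable]: "(\<lambda>p. Complex (fst p) (snd p)) \<in> lborel \<Otimes>\<^sub>M lborel \<rightarrow>\<^sub>M borel"
    by (simp add: lborel_prod)
  have m: "(\<lambda>p. f (Complex (fst p) (snd p))) \<in> borel_measurable (lborel \<Otimes>\<^sub>M lborel)"
    by (rule measurable_compose[OF _ assms]) measurable
  have "(\<integral>\<^sup>+z. f z \<partial>lborel) = (\<integral>\<^sup>+p. f (Complex (fst p) (snd p)) \<partial>(lborel \<Otimes>\<^sub>M lborel))"
    by (subst lborel_complex_eq) (simp add: nn_integral_distr)
  then show "(\<integral>\<^sup>+z. f z \<partial>lborel) = (\<integral>\<^sup>+y. \<integral>\<^sup>+x. f (Complex x y) \<partial>lborel \<partial>lborel)"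
    "(\<integral>\<^sup>+z. f z \<partial>lborel) = (\<integral>\<^sup>+x. \<integral>\<^sup>+y. f (Complex x y) \<partial>lborel \<partial>lborel)"
    using lborel_pair.nn_integral_snd[OF m] lborel.nn_integral_fst[OF m] by simp_all
qed

text \<open>With one coordinate frozen a shear is a translation of the other, so it preserves area
  by integrating the moving coordinate first.\<close>

lemma nn_integral_shear:
  assumes [measurable]: "f \<in> borel_measurable (borel :: complex measure)"
  shows "(\<integral>\<^sup>+z. f (Complex (Re z + a * Im z) (Im z)) \<partial>lborel) = (\<integral>\<^sup>+z. f z \<partial>lborel)"
    "(\<integral>\<^sup>+z. f (Complex (Re z) (Im z + a * Re z)) \<partial>lborel) = (\<integral>\<^sup>+z. f z \<partial>lborel)"
proof -
  have m1 [measurable]: "(\<lambda>z. Complex (Re z + a * Im z) (Im z)) \<in> borel \<rightarrow>\<^sub>M borel"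
    "(\<lambda>z. Complex (Re z) (Im z + a * Re z)) \<in> borel \<rightarrow>\<^sub>M borel"
    by (intro borel_measurable_continuous_onI; auto simp: Complex_eq intro!: continuous_intros)+
  have [measurable]: "(\<lambda>x. f (Complex x y)) \<in> borel_measurable borel" "(\<lambda>x. f (Complex y x)) \<in> borel_measurable borel" for y
    by (rule measurable_compose[OF _ assms], intro borel_measurable_continuous_onI,
        auto simp: Complex_eq intro!: continuous_intros)+
  have "(\<integral>\<^sup>+x. f (Complex (x + a * y) y) \<partial>lborel) = (\<integral>\<^sup>+x. f (Complex x y) \<partial>lborel)" for y
    using nn_integral_real_affine[of "\<lambda>x. f (Complex x y)" 1 "a * y"] by (simp add: add.commute)
  then show "(\<integral>\<^sup>+z. f (Complex (Re z + a * Im z) (Im z)) \<partial>lborel) = (\<integral>\<^sup>+z. f z \<partial>lborel)"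
    by (subst (1 2) nn_integral_complex(1)) simp_all
  have "(\<integral>\<^sup>+x. f (Complex y (x + a * y)) \<partial>lborel) = (\<integral>\<^sup>+x. f (Complex y x) \<partial>lborel)" for y
    using nn_integral_real_affine[of "\<lambda>x. f (Complex y x)" 1 "a * y"] by (simp add: add.commute)
  then show "(\<integral>\<^sup>+z. f (Complex (Re z) (Im z + a * Re z)) \<partial>lborel) = (\<integral>\<^sup>+z. f z \<partial>lborel)"
    by (subst (1 2) nn_integral_complex(2)) simp_all
qed

text \<open>A plane rotation other than the half turn is a product of three shears.\<close>

lemma nn_integral_rotate:
  assumes u: "cmod u = 1" and f: "f \<in> borel_measurable (borel :: complex measure)"
  shows "(\<integral>\<^sup>+z. f (u * z) \<partial>lborel) = (\<integral>\<^sup>+z. f z \<partial>lborel)"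
proof -
  have gen: "(\<integral>\<^sup>+z. g (v * z) \<partial>lborel) = (\<integral>\<^sup>+z. g z \<partial>lborel)"
    if v: "cmod v = 1" "Re v \<noteq> -1" and g[measurable]: "g \<in> borel_measurable borel" for v g
  proof -
    define a where "a = Re v"
    define b where "b = Im v"
    \<comment> \<open>\<open>t\<close> is the tangent of half the rotation angle. The rotation is
      the shear by \<open>-t\<close>, then by \<open>b\<close>, then by \<open>-t\<close>; excluding
      \<open>-1\<close> keeps the denominator nonzero.\<close>
    define t where "t = b / (1 + a)"
    have ab: "a\<^sup>2 + b\<^sup>2 = 1" using v(1) by (simp add: cmod_def a_def b_def)
    have a1: "1 + a \<noteq> 0" using v(2) by (simp add: a_def)
    have "b * b = (1 - a) * (1 + a)" using ab by (simp add: algebra_simps power2_eq_square)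
    then have tb: "t * b = 1 - a" using a1 by (simp add: t_def field_simps)
    have ta: "t * (1 + a) = b" using a1 by (simp add: t_def)
    define X where "X = (\<lambda>z. Complex (Re z + (- t) * Im z) (Im z))"
    define Y where "Y = (\<lambda>z. Complex (Re z) (Im z + b * Re z))"
    have [measurable]: "X \<in> borel \<rightarrow>\<^sub>M borel" "Y \<in> borel \<rightarrow>\<^sub>M borel"
      unfolding X_def Y_def by (intro borel_measurable_continuous_onI; auto simp: Complex_eq intro!: continuous_intros)+
    have Xeq: "Complex (Re z - t * Im z) (Im z) = X z" and Yeq: "Complex (Re z) (Im z + b * Re z) = Y z" for z
      by (simp_all add: X_def Y_def)
    have "X (Y (X z)) = v * z" for z
    proof -
      have 1: "x + - t * y + - t * (y + b * (x + - t * y)) = a * x - b * y" for x y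
      proof -
        have "x + - t * y + - t * (y + b * (x + - t * y)) = x * (1 - t * b) - y * (t * (1 + (1 - t * b)))"
          by (simp add: algebra_simps)
        then show ?thesis using tb ta by (simp add: mult.commute)
      qed
      have 2: "y + b * (x + - t * y) = a * y + b * x" for x y
      proof -
        have "y + b * (x + - t * y) = y * (1 - t * b) + b * x" by (simp add: algebra_simps)
        then show ?thesis using tb by (simp add: mult.commute)
      qed
      show ?thesis
        unfolding X_def Y_def complex_eq_iff
        using 1[of "Re z" "Im z"] 2[of "Im z" "Re z"] by (simp add: a_def b_def)
    qed
    then have "(\<integral>\<^sup>+z. g (v * z) \<partial>lborel) = (\<integral>\<^sup>+z. g (X (Y (X z))) \<partial>lborel)" by simp
    also have "\<dots> = (\<integral>\<^sup>+z. g (X (Y z)) \<partial>lborel)"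
      using nn_integral_shear(1)[of "\<lambda>z. g (X (Y z))" "- t"] Xeq by simp
    also have "\<dots> = (\<integral>\<^sup>+z. g (X z) \<partial>lborel)"
      using nn_integral_shear(2)[of "\<lambda>z. g (X z)" b] Yeq by simp
    also have "\<dots> = (\<integral>\<^sup>+z. g z \<partial>lborel)"
      using nn_integral_shear(1)[of g "- t"] Xeq by simp
    finally show ?thesis .
  qed
  show ?thesis
  proof (cases "Re u = -1")
    case False
    then show ?thesis using gen u f by blast
  next
    case True
    then have "(Im u)\<^sup>2 = 0" using u by (simp add: cmod_def)
    \<comment> \<open>The half turn is two quarter turns, to which the shear argument
      applies.\<close>
    then have "u = \<i> * \<i>" using True by (simp add: complex_eq_iff)
    moreover have "(\<integral>\<^sup>+z. f (\<i> * (\<i> * z)) \<partial>lborel) = (\<integral>\<^sup>+z. f (\<i> * z) \<partial>lborel)"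
      by (rule gen[of \<i> "\<lambda>z. f (\<i> * z)"]) (use f in auto)
    moreover have "(\<integral>\<^sup>+z. f (\<i> * z) \<partial>lborel) = (\<integral>\<^sup>+z. f z \<partial>lborel)"
      by (rule gen) (use f in auto)
    ultimately show ?thesis by (simp add: mult.assoc)
  qed
qed

lemma lborel_distr_rotate:
  assumes u: "cmod u = 1"
  shows "distr lborel borel ((*) u) = (lborel :: complex measure)"
proof (rule measure_eqI)
  fix A assume "A \<in> sets (distr lborel borel ((*) u))"
  then have [measurable]: "A \<in> sets borel" by simp
  have "emeasure (distr lborel borel ((*) u)) A = (\<integral>\<^sup>+z. indicator A z \<partial>distr lborel borel ((*) u))"
    by simp
  also have "\<dots> = (\<integral>\<^sup>+z. indicator A (u * z) \<partial>lborel)" by (subst nn_integral_distr) auto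
  also have "\<dots> = emeasure lborel A" by (subst nn_integral_rotate[OF u]) auto
  finally show "emeasure (distr lborel borel ((*) u)) A = emeasure lborel A" .
qed simp

lemma integral_rotate:
  fixes f :: "complex \<Rightarrow> 'b::{banach, second_countable_topology}"
  assumes u: "cmod u = 1" and [measurable]: "f \<in> borel_measurable borel"
  shows "(\<integral>z. f (u * z) \<partial>lborel) = (\<integral>z. f z \<partial>lborel)"
  by (subst (2) lborel_distr_rotate[OF u, symmetric]) (simp add: integral_distr)

lemma nn_integral_scale:
  fixes c :: real
  assumes c: "c \<noteq> 0" and [measurable]: "f \<in> borel_measurable (borel :: complex measure)"
  shows "(\<integral>\<^sup>+z. f z \<partial>lborel) = ennreal (c\<^sup>2) * (\<integral>\<^sup>+z. f (t + of_real c * z) \<partial>lborel)"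
  by (subst lborel_affine[OF c, of t])
     (simp add: nn_integral_density nn_integral_distr nn_integral_cmult scaleR_conv_of_real)

lemma integral_scale:
  fixes c :: real and f :: "complex \<Rightarrow> complex"
  assumes c: "c \<noteq> 0" and [measurable]: "f \<in> borel_measurable (borel :: complex measure)"
  shows "(\<integral>z. f z \<partial>lborel) = of_real (c\<^sup>2) * (\<integral>z. f (t + of_real c * z) \<partial>lborel)"
  by (subst lborel_affine[OF c, of t])
     (simp add: integral_density integral_distr scaleR_conv_of_real)

text \<open>The disc of squared radius a has area pi * a. In the variable |z|^2 the area element
  therefore has constant density, and radial integrals need no Jacobian.\<close>

lemma distr_norm_square:
  "distr lborel borel (\<lambda>z. (cmod z)\<^sup>2) = density lborel (\<lambda>s. ennreal pi * indicator {0..} s)"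
    (is "?M = ?N")
proof (rule measure_eqI_generator_eq[where E="range (\<lambda>a::real. {..a})" and \<Omega>=UNIV and A="\<lambda>n. {..real n}"])
  show "Int_stable (range (\<lambda>a::real. {..a}))"
    by (auto simp: Int_stable_def)
  have M: "emeasure ?M {..a} = (if a < 0 then 0 else ennreal (pi * a))" for a :: real
  proof -
    have "(\<lambda>z::complex. (cmod z)\<^sup>2) -` {..a} = (if a < 0 then {} else cball 0 (sqrt a))"
      using order_less_le_trans[of a 0 "(cmod _)\<^sup>2"] by (auto simp: real_le_rsqrt real_sqrt_le_iff' simp del: zero_le_power2)
         (metis abs_norm_cancel real_sqrt_abs real_sqrt_le_iff real_sqrt_pow2 not_less power_mono norm_ge_zero)+
    then show ?thesis
      by (subst emeasure_distr) (auto simp: emeasure_cball unit_ball_vol_2)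
  qed
  have N: "emeasure ?N {..a} = (if a < 0 then 0 else ennreal (pi * a))" for a :: real
  proof -
    have "emeasure ?N {..a} = (\<integral>\<^sup>+s. ennreal pi * indicator ({..a} \<inter> {0..}) s \<partial>lborel)"
      by (subst emeasure_density) (auto intro!: nn_integral_cong split: split_indicator)
    also have "\<dots> = ennreal pi * emeasure lborel ({..a} \<inter> {0..})" by (simp add: nn_integral_cmult)
    also have "{..a} \<inter> {0..} = {0..a}" by auto
    finally show ?thesis by (auto simp: ennreal_mult)
  qed
  show "emeasure ?M X = emeasure ?N X" if "X \<in> range (\<lambda>a::real. {..a})" for X
    using that M N by auto
  show "sets ?M = sigma_sets UNIV (range (\<lambda>a::real. {..a}))"
    "sets ?N = sigma_sets UNIV (range (\<lambda>a::real. {..a}))"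
    by (simp_all add: borel_eq_atMost)
  show "(\<Union>i. {..real i}) = UNIV" by (auto intro: real_arch_simple)
  show "emeasure ?M {..real i} \<noteq> \<infinity>" for i by (simp add: M)
qed auto

lemma nn_integral_radial:
  assumes [measurable]: "f \<in> borel_measurable borel"
  shows "(\<integral>\<^sup>+z. f ((cmod z)\<^sup>2) \<partial>lborel) = ennreal pi * (\<integral>\<^sup>+s. f s * indicator {0..} s \<partial>lborel)"
proof -
  have "(\<integral>\<^sup>+z. f ((cmod z)\<^sup>2) \<partial>lborel) = (\<integral>\<^sup>+s. f s \<partial>distr lborel borel (\<lambda>z. (cmod z)\<^sup>2))"
    by (subst nn_integral_distr) auto
  also have "\<dots> = (\<integral>\<^sup>+s. ennreal pi * (f s * indicator {0..} s) \<partial>lborel)"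
    unfolding distr_norm_square by (subst nn_integral_density) (auto simp: mult_ac)
  finally show ?thesis by (simp add: nn_integral_cmult)
qed

text \<open>A suitable rotation multiplies the integrand by -1 and preserves the measure, so the
  integral equals its own negative.\<close>

lemma integral_radial_orthogonal:
  fixes h :: "complex \<Rightarrow> complex"
  assumes [measurable]: "h \<in> borel_measurable borel" and h: "\<And>u z. cmod u = 1 \<Longrightarrow> h (u * z) = h z"
    and ab: "a \<noteq> (b::nat)"
  shows "(\<integral>z. h z * (z ^ a * cnj z ^ b) \<partial>lborel) = 0"
proof -
  \<comment> \<open>This angle gives u^a * conj(u)^b = -1. The difference is formed in the reals, so
    both orders of \<open>a\<close> and \<open>b\<close> are covered.\<close>
  define u where "u = cis (pi / (real a - real b))"
  have u1: "cmod u = 1" by (simp add: u_def)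
  define \<theta> where "\<theta> = pi / (real a - real b)"
  have "u ^ a * cnj u ^ b = cis (real a * \<theta>) * cis (real b * - \<theta>)"
    unfolding u_def \<theta>_def[symmetric] cis_cnj Complex.DeMoivre ..
  also have "\<dots> = cis (real a * \<theta> + real b * - \<theta>)"
    by (rule cis_mult)
  also have "real a * \<theta> + real b * - \<theta> = (real a - real b) * \<theta>" by (simp add: algebra_simps)
  also have "\<dots> = pi" using ab by (simp add: \<theta>_def)
  finally have u2: "u ^ a * cnj u ^ b = -1" by simp
  have "(\<integral>z. h z * (z ^ a * cnj z ^ b) \<partial>lborel) = (\<integral>z. h (u * z) * ((u * z) ^ a * cnj (u * z) ^ b) \<partial>lborel)"
    by (rule integral_rotate[OF u1, symmetric]) measurable
  also have "\<dots> = (\<integral>z. (u ^ a * cnj u ^ b) * (h z * (z ^ a * cnj z ^ b)) \<partial>lborel)"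
    unfolding h[OF u1] complex_cnj_mult power_mult_distrib by (simp only: mult_ac)
  also have "\<dots> = - (\<integral>z. h z * (z ^ a * cnj z ^ b) \<partial>lborel)"
    unfolding u2 by simp
  finally show ?thesis by simp
qed

text \<open>In the variable |z|^2 the integrand is an unnormalised Erlang density. The distribution
  function that appears is also the probability that a Poisson variable with mean \<open>s^2\<close>
  exceeds \<open>n\<close>.\<close>

lemma nn_integral_gaussian_moment:
  assumes "0 \<le> s"
  shows "(\<integral>\<^sup>+z. ennreal ((cmod z) ^ (2 * n) * exp (- (cmod z)\<^sup>2)) * indicator (cball 0 s) z \<partial>lborel)
     = ennreal (pi * fact n * erlang_CDF n 1 (s\<^sup>2))"
proof -
  have "(\<integral>\<^sup>+z. ennreal ((cmod z) ^ (2 * n) * exp (- (cmod z)\<^sup>2)) * indicator (cball 0 s) z \<partial>lborel)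
      = (\<integral>\<^sup>+z. (\<lambda>x. ennreal (x ^ n * exp (- x)) * indicator {..s\<^sup>2} x) ((cmod z)\<^sup>2) \<partial>lborel)"
    using assms by (intro nn_integral_cong) (auto simp: power_mult abs_le_square_iff[symmetric] split: split_indicator)
  also have "\<dots> = ennreal pi * (\<integral>\<^sup>+x. ennreal (x ^ n * exp (- x)) * indicator {..s\<^sup>2} x * indicator {0..} x \<partial>lborel)"
    by (rule nn_integral_radial) measurable
  also have "(\<integral>\<^sup>+x. ennreal (x ^ n * exp (- x)) * indicator {..s\<^sup>2} x * indicator {0..} x \<partial>lborel)
     = (\<integral>\<^sup>+x. ennreal (fact n) * (ennreal (erlang_density n 1 x) * indicator {..s\<^sup>2} x) \<partial>lborel)"
    by (intro nn_integral_cong)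
       (auto simp: erlang_density_def ennreal_mult[symmetric] split: split_indicator)
  also have "\<dots> = ennreal (fact n) * ennreal (erlang_CDF n 1 (s\<^sup>2))"
    by (simp add: nn_integral_cmult nn_integral_erlang_density)
  finally show ?thesis
    by (simp add: ennreal_mult[symmetric] mult_ac)
qed

lemma nn_integral_gaussian_moment_full:
  "(\<integral>\<^sup>+z. ennreal ((cmod z) ^ (2 * n) * exp (- (cmod z)\<^sup>2)) \<partial>lborel) = ennreal (pi * fact n)"
proof -
  have "(\<integral>\<^sup>+z. ennreal ((cmod z) ^ (2 * n) * exp (- (cmod z)\<^sup>2)) \<partial>lborel)
      = (\<integral>\<^sup>+z. (\<lambda>x. ennreal (x ^ n * exp (- x))) ((cmod z)\<^sup>2) \<partial>lborel)"
    by (intro nn_integral_cong) (auto simp: power_mult)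
  also have "\<dots> = ennreal pi * (\<integral>\<^sup>+x. ennreal (x ^ n * exp (- x)) * indicator {0..} x \<partial>lborel)"
    by (rule nn_integral_radial) measurable
  finally show ?thesis
    by (simp add: nn_intergal_power_times_exp_Ici ennreal_mult[symmetric])
qed

section \<open>Integrals of determinants, the Ginibre functions and comparison with the disc\<close>

section \<open>Gram determinants\<close>

interpretation plane: product_sigma_finite "\<lambda>_::nat. lborel :: complex measure" ..

lemma det_fun_permute_rows:
  assumes "p permutes {..<n}"
  shows "det_fun n (\<lambda>i j. A (p i) j) = of_int (sign p) * det_fun n A"
proof -
  have "p i < n" if "i < n" for i using permutes_in_image[OF assms, of i] that by simp
  then have "fmat n (\<lambda>i j. A (p i) j) = Matrix.mat n n (\<lambda>(i, j). fmat n A $$ (p i, j))"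
    by (intro eq_matI) auto
  moreover have "signof p = (of_int (sign p) :: complex)"
    by (simp add: sign_def)
  ultimately show ?thesis
    using det_permute_rows[of "fmat n A" n p] assms
    by (simp add: det_fun_eq_det lessThan_atLeast0)
qed

text \<open>The weight is the only thing that varies: the indicator of \<open>- U\<close> gives the
  hole determinant, \<open>1 + t * indicator U\<close> generates factorial moments, and the constant
  1 gives the identity for orthonormal functions.\<close>

definition gram :: "(complex \<Rightarrow> real) \<Rightarrow> (nat \<Rightarrow> complex \<Rightarrow> complex) \<Rightarrow> nat \<Rightarrow> nat \<Rightarrow> complex" where
  "gram h \<phi> a b = (\<integral>z. of_real (h z) * \<phi> a z * cnj (\<phi> b z) \<partial>lborel)"

lemma Re_complex_of_real_mult: "Re (complex_of_real x * z) = x * Re z"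
  by simp

text \<open>Andreief's identity, the continuous Cauchy-Binet formula. In the double Leibniz sum for
  the squared modulus every summand is a product of functions of single variables; after
  integration, each outer permutation contributes the same determinant, since the sign of the
  permuted rows cancels its own sign.\<close>

lemma andreief:
  assumes int: "\<And>a b. integrable lborel (\<lambda>z. of_real (h z) * \<phi> a z * cnj (\<phi> b z))"
  shows "integrable (Pi\<^sub>M {..<n} (\<lambda>_. lborel)) (\<lambda>z. (\<Prod>i<n. h (z i)) * (cmod (det_fun n (\<lambda>i a. \<phi> a (z i))))\<^sup>2)"
    and "(\<integral>z. (\<Prod>i<n. h (z i)) * (cmod (det_fun n (\<lambda>i a. \<phi> a (z i))))\<^sup>2 \<partial>Pi\<^sub>M {..<n} (\<lambda>_. lborel))
      = fact n * Re (det_fun n (gram h \<phi>))"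
proof -
  let ?P = "{p. p permutes {..<n}}"
  let ?F = "\<lambda>z. (\<Sum>p\<in>?P. \<Sum>q\<in>?P. of_int (sign p) * of_int (sign q) *
      (\<Prod>i<n. of_real (h (z i)) * \<phi> (p i) (z i) * cnj (\<phi> (q i) (z i))))"
  have eq: "complex_of_real ((\<Prod>i<n. h (z i)) * (cmod (det_fun n (\<lambda>i a. \<phi> a (z i))))\<^sup>2) = ?F z" for z
  proof -
    have "complex_of_real ((\<Prod>i<n. h (z i)) * (cmod (det_fun n (\<lambda>i a. \<phi> a (z i))))\<^sup>2)
        = (\<Prod>i<n. of_real (h (z i))) * (det_fun n (\<lambda>i a. \<phi> a (z i)) * cnj (det_fun n (\<lambda>i a. \<phi> a (z i))))"
      by (simp only: complex_norm_square of_real_mult of_real_prod)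
    also have "det_fun n (\<lambda>i a. \<phi> a (z i)) * cnj (det_fun n (\<lambda>i a. \<phi> a (z i)))
        = (\<Sum>p\<in>?P. \<Sum>q\<in>?P. (of_int (sign p) * (\<Prod>i<n. \<phi> (p i) (z i))) * cnj (of_int (sign q) * (\<Prod>i<n. \<phi> (q i) (z i))))"
      unfolding det_fun_def cnj_sum sum_product ..
    also have "(\<Prod>i<n. of_real (h (z i))) * \<dots> = ?F z"
      unfolding sum_distrib_left by (intro sum.cong refl) (simp add: prod.distrib mult_ac)
    finally show ?thesis .
  qed
  have int1: "integrable (Pi\<^sub>M {..<n} (\<lambda>_. lborel))
     (\<lambda>z. of_int (sign p) * of_int (sign q) * (\<Prod>i<n. of_real (h (z i)) * \<phi> (p i) (z i) * cnj (\<phi> (q i) (z i))))" for p q :: "nat \<Rightarrow> nat"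
    by (intro integrable_mult_right plane.product_integrable_prod finite_lessThan int)
  then have intF: "integrable (Pi\<^sub>M {..<n} (\<lambda>_. lborel)) ?F"
    by (intro Bochner_Integration.integrable_sum)
  have intc: "integrable (Pi\<^sub>M {..<n} (\<lambda>_. lborel))
    (\<lambda>z. complex_of_real ((\<Prod>i<n. h (z i)) * (cmod (det_fun n (\<lambda>i a. \<phi> a (z i))))\<^sup>2))"
    unfolding eq by (rule intF)
  then show int2: "integrable (Pi\<^sub>M {..<n} (\<lambda>_. lborel)) (\<lambda>z. (\<Prod>i<n. h (z i)) * (cmod (det_fun n (\<lambda>i a. \<phi> a (z i))))\<^sup>2)"
    using integrable_Re[OF intc] by (simp only: Re_complex_of_real)
  have "(\<integral>z. ?F z \<partial>Pi\<^sub>M {..<n} (\<lambda>_. lborel))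
      = (\<Sum>p\<in>?P. \<Sum>q\<in>?P. of_int (sign p) * of_int (sign q) * (\<Prod>i<n. gram h \<phi> (p i) (q i)))"
    using int1
    by (simp add: Bochner_Integration.integral_sum Bochner_Integration.integrable_sum
        plane.product_integral_prod[OF finite_lessThan int] gram_def)
  also have "\<dots> = (\<Sum>p\<in>?P. of_int (sign p) * det_fun n (\<lambda>i j. gram h \<phi> (p i) j))"
    unfolding det_fun_def by (simp add: sum_distrib_left mult_ac)
  also have "\<dots> = (\<Sum>p\<in>?P. det_fun n (gram h \<phi>))"
    by (intro sum.cong refl)
       (simp add: det_fun_permute_rows sign_def)
  also have "\<dots> = fact n * det_fun n (gram h \<phi>)"
    using card_permutations[of "{..<n}" n] by simp
  finally have fin: "complex_of_real (\<integral>z. (\<Prod>i<n. h (z i)) * (cmod (det_fun n (\<lambda>i a. \<phi> a (z i))))\<^sup>2 \<partial>Pi\<^sub>M {..<n} (\<lambda>_. lborel))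
      = fact n * det_fun n (gram h \<phi>)"
    unfolding integral_complex_of_real[symmetric] eq .
  show "(\<integral>z. (\<Prod>i<n. h (z i)) * (cmod (det_fun n (\<lambda>i a. \<phi> a (z i))))\<^sup>2 \<partial>Pi\<^sub>M {..<n} (\<lambda>_. lborel))
      = fact n * Re (det_fun n (gram h \<phi>))"
    using arg_cong[OF fin, of Re] unfolding of_real_fact[symmetric, where 'a=complex]
    by (simp only: Re_complex_of_real Re_complex_of_real_mult)
qed

text \<open>For orthonormal functions this is the kernel of the projection onto the span of the
  first \<open>n\<close> of them.\<close>

definition part_kernel :: "nat \<Rightarrow> (nat \<Rightarrow> complex \<Rightarrow> complex) \<Rightarrow> complex \<Rightarrow> complex \<Rightarrow> complex" where
  "part_kernel n \<phi> z w = (\<Sum>a<n. \<phi> a z * cnj (\<phi> a w))"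

text \<open>Each kernel entry is a finite sum, so the determinant expands over index tuples;
  integrating variable by variable leaves minors of the Gram matrix. Together with the Fredholm
  expansion this identifies factorial moments.\<close>

lemma integral_det_part_kernel:
  assumes int: "\<And>a b. integrable lborel (\<lambda>z. of_real (h z) * \<phi> a z * cnj (\<phi> b z))"
  shows "integrable (Pi\<^sub>M {..<k} (\<lambda>_. lborel))
      (\<lambda>z. (\<Prod>i<k. of_real (h (z i))) * det_fun k (\<lambda>i j. part_kernel n \<phi> (z i) (z j)))"
    and "(\<integral>z. (\<Prod>i<k. of_real (h (z i))) * det_fun k (\<lambda>i j. part_kernel n \<phi> (z i) (z j)) \<partial>Pi\<^sub>M {..<k} (\<lambda>_. lborel))
      = (\<Sum>a\<in>{..<k} \<rightarrow>\<^sub>E {..<n}. det_fun k (\<lambda>i j. gram h \<phi> (a i) (a j)))"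
proof -
  let ?P = "{p. p permutes {..<k}}"
  let ?A = "{..<k} \<rightarrow>\<^sub>E {..<n}"
  let ?T = "\<lambda>p a z. of_int (sign p) * (\<Prod>i<k. of_real (h (z i)) * \<phi> (a i) (z i) * cnj (\<phi> (a (Hilbert_Choice.inv p i)) (z i)))"
  have eq: "(\<Prod>i<k. of_real (h (z i))) * det_fun k (\<lambda>i j. part_kernel n \<phi> (z i) (z j))
     = (\<Sum>p\<in>?P. \<Sum>a\<in>?A. ?T p a z)" for z
  proof -
    have "(\<Prod>i<k. of_real (h (z i))) * det_fun k (\<lambda>i j. part_kernel n \<phi> (z i) (z j))
       = (\<Sum>p\<in>?P. of_int (sign p) * ((\<Prod>i<k. of_real (h (z i))) * (\<Prod>i<k. \<Sum>a<n. \<phi> a (z i) * cnj (\<phi> a (z (p i))))))"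
      by (simp add: det_fun_def part_kernel_def sum_distrib_left mult_ac)
    also have "\<dots> = (\<Sum>p\<in>?P. \<Sum>a\<in>?A. ?T p a z)"
    proof (intro sum.cong refl)
      fix p assume "p \<in> ?P"
      then have p: "p permutes {..<k}" by simp
      have "(\<Prod>i<k. \<Sum>a<n. \<phi> a (z i) * cnj (\<phi> a (z (p i))))
          = (\<Sum>a\<in>?A. \<Prod>i<k. \<phi> (a i) (z i) * cnj (\<phi> (a i) (z (p i))))"
        by (rule prod_sum_PiE) auto
      \<comment> \<open>The conjugated factor of row \<open>i\<close> sits at the point with index
        \<open>p i\<close>. Reindexing by the inverse permutation collects both factors at the same
        point, so the integral splits.\<close>
      also have "\<dots> = (\<Sum>a\<in>?A. \<Prod>i<k. \<phi> (a i) (z i) * cnj (\<phi> (a (Hilbert_Choice.inv p i)) (z i)))"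
      proof (intro sum.cong refl)
        fix a
        have "(\<Prod>i<k. cnj (\<phi> (a i) (z (p i)))) = (\<Prod>i<k. cnj (\<phi> (a (Hilbert_Choice.inv p i)) (z i)))"
          by (rule prod.reindex_bij_betw[OF permutes_imp_bij[OF p], of "\<lambda>i. cnj (\<phi> (a (Hilbert_Choice.inv p i)) (z i))", unfolded permutes_inverses(2)[OF p]])
        then show "(\<Prod>i<k. \<phi> (a i) (z i) * cnj (\<phi> (a i) (z (p i)))) = (\<Prod>i<k. \<phi> (a i) (z i) * cnj (\<phi> (a (Hilbert_Choice.inv p i)) (z i)))"
          by (simp add: prod.distrib)
      qed
      finally show "of_int (sign p) * ((\<Prod>i<k. of_real (h (z i))) * (\<Prod>i<k. \<Sum>a<n. \<phi> a (z i) * cnj (\<phi> a (z (p i)))))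
          = (\<Sum>a\<in>?A. ?T p a z)"
        by (simp add: sum_distrib_left prod.distrib mult_ac)
    qed
    finally show ?thesis .
  qed
  have int1: "integrable (Pi\<^sub>M {..<k} (\<lambda>_. lborel)) (?T p a)" for p a
    by (intro integrable_mult_right plane.product_integrable_prod finite_lessThan int)
  show "integrable (Pi\<^sub>M {..<k} (\<lambda>_. lborel))
      (\<lambda>z. (\<Prod>i<k. of_real (h (z i))) * det_fun k (\<lambda>i j. part_kernel n \<phi> (z i) (z j)))"
    unfolding eq by (intro Bochner_Integration.integrable_sum int1)
  have "(\<integral>z. (\<Prod>i<k. of_real (h (z i))) * det_fun k (\<lambda>i j. part_kernel n \<phi> (z i) (z j)) \<partial>Pi\<^sub>M {..<k} (\<lambda>_. lborel))
     = (\<Sum>p\<in>?P. \<Sum>a\<in>?A. of_int (sign p) * (\<Prod>i<k. gram h \<phi> (a i) (a (Hilbert_Choice.inv p i))))"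
    unfolding eq using int1
    by (simp add: Bochner_Integration.integral_sum Bochner_Integration.integrable_sum
        plane.product_integral_prod[OF finite_lessThan int] gram_def)
  also have "\<dots> = (\<Sum>a\<in>?A. \<Sum>p\<in>?P. of_int (sign p) * (\<Prod>i<k. gram h \<phi> (a i) (a (Hilbert_Choice.inv p i))))"
    by (rule sum.swap)
  also have "\<dots> = (\<Sum>a\<in>?A. det_fun k (\<lambda>i j. gram h \<phi> (a i) (a j)))"
  proof (intro sum.cong refl)
    fix a :: "nat \<Rightarrow> nat"
    have "det_fun k (\<lambda>i j. gram h \<phi> (a i) (a j)) = (\<Sum>p\<in>?P. of_int (sign (Hilbert_Choice.inv p)) * (\<Prod>i<k. gram h \<phi> (a i) (a (Hilbert_Choice.inv p i))))"
      unfolding det_fun_def by (rule sum_permutations_inverse)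
    also have "\<dots> = (\<Sum>p\<in>?P. of_int (sign p) * (\<Prod>i<k. gram h \<phi> (a i) (a (Hilbert_Choice.inv p i))))"
      by (intro sum.cong refl) (simp add: sign_inverse permutation_permutes[THEN iffD2] exI[of _ "{..<k}"])
    finally show "(\<Sum>p\<in>?P. of_int (sign p) * (\<Prod>i<k. gram h \<phi> (a i) (a (Hilbert_Choice.inv p i)))) = det_fun k (\<lambda>i j. gram h \<phi> (a i) (a j))" ..
  qed
  finally show "(\<integral>z. (\<Prod>i<k. of_real (h (z i))) * det_fun k (\<lambda>i j. part_kernel n \<phi> (z i) (z j)) \<partial>Pi\<^sub>M {..<k} (\<lambda>_. lborel))
      = (\<Sum>a\<in>{..<k} \<rightarrow>\<^sub>E {..<n}. det_fun k (\<lambda>i j. gram h \<phi> (a i) (a j)))" .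
qed

lemma herm_form_part_kernel:
  "herm_form m (\<lambda>i j. part_kernel n \<phi> (z i) (z j)) x
     = of_real (\<Sum>a<n. (cmod (\<Sum>i<m. cnj (x i) * \<phi> a (z i)))\<^sup>2)"
proof -
  have "herm_form m (\<lambda>i j. part_kernel n \<phi> (z i) (z j)) x
     = (\<Sum>i<m. \<Sum>j<m. \<Sum>a<n. (cnj (x i) * \<phi> a (z i)) * (x j * cnj (\<phi> a (z j))))"
    unfolding herm_form_def part_kernel_def by (simp add: sum_distrib_left sum_distrib_right mult_ac)
  also have "\<dots> = (\<Sum>i<m. \<Sum>a<n. \<Sum>j<m. (cnj (x i) * \<phi> a (z i)) * (x j * cnj (\<phi> a (z j))))"
    by (intro sum.cong refl sum.swap)
  also have "\<dots> = (\<Sum>a<n. \<Sum>i<m. \<Sum>j<m. (cnj (x i) * \<phi> a (z i)) * (x j * cnj (\<phi> a (z j))))"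
    by (rule sum.swap)
  also have "\<dots> = (\<Sum>a<n. (\<Sum>i<m. cnj (x i) * \<phi> a (z i)) * cnj (\<Sum>i<m. cnj (x i) * \<phi> a (z i)))"
    by (simp add: sum_product)
  finally show ?thesis by (simp only: complex_norm_square of_real_sum)
qed

text \<open>The kernel matrix is only positive semidefinite: its rank is at most \<open>n\<close>,
  and points may coincide. Adding a small multiple of the identity makes it definite, and the
  conclusion survives the limit.\<close>

lemma det_part_kernel_nonneg:
  "0 \<le> Re (det_fun m (\<lambda>i j. part_kernel n \<phi> (z i) (z j)))"
  "Im (det_fun m (\<lambda>i j. part_kernel n \<phi> (z i) (z j))) = 0"
proof -
  let ?K = "\<lambda>i j. part_kernel n \<phi> (z i) (z j)"
  define A where "A e i j = ?K i j + of_real e * (if i = j then 1 else 0)" for e :: real and i j :: nat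
  have "pos_def (A e)" if e: "e > 0" for e
    unfolding pos_def_def
  proof (intro conjI allI impI)
    show "A e j i = cnj (A e i j)" for i j
      by (auto simp: A_def part_kernel_def mult.commute)
    fix m :: nat and x assume "\<exists>i<m. x i \<noteq> (0::complex)"
    then obtain i where "i < m" "x i \<noteq> 0" by blast
    then have pos: "0 < (\<Sum>i<m. (cmod (x i))\<^sup>2)"
      by (intro sum_pos2[of _ i]) auto
    have "herm_form m (A e) x = herm_form m ?K x + of_real e * (\<Sum>i<m. \<Sum>j<m. if i = j then cnj (x i) * x j else 0)"
      unfolding herm_form_def A_def sum_distrib_left sum.distrib[symmetric]
      by (intro sum.cong refl) (auto simp: algebra_simps)
    also have "(\<Sum>i<m. \<Sum>j<m. if i = j then cnj (x i) * x j else 0) = (\<Sum>i<m. x i * cnj (x i))"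
      by (simp add: mult.commute)
    also have "\<dots> = of_real (\<Sum>i<m. (cmod (x i))\<^sup>2)" by (simp only: complex_norm_square of_real_sum)
    finally have "Re (herm_form m (A e) x) = (\<Sum>a<n. (cmod (\<Sum>i<m. cnj (x i) * \<phi> a (z i)))\<^sup>2) + e * (\<Sum>i<m. (cmod (x i))\<^sup>2)"
      unfolding herm_form_part_kernel by simp
    also have "\<dots> > 0" using pos e by (intro add_nonneg_pos sum_nonneg mult_pos_pos) auto
    finally show "0 < Re (herm_form m (A e) x)" .
  qed
  then have pos: "0 < Re (det_fun m (A e)) \<and> det_fun m (A e) = complex_of_real (Re (det_fun m (A e)))" if "e > 0" for e
    using det_fun_pos_def that by blast
  have "((\<lambda>e. det_fun m (A e)) \<longlongrightarrow> det_fun m (A 0)) (at_right 0)"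
    unfolding det_fun_def A_def by (intro tendsto_intros)
  moreover have "det_fun m (A 0) = det_fun m ?K"
    by (rule det_fun_cong) (simp add: A_def)
  ultimately have lim: "((\<lambda>e. det_fun m (A e)) \<longlongrightarrow> det_fun m ?K) (at_right 0)" by simp
  have ev: "\<forall>\<^sub>F e in at_right 0. (0::real) < e"
    by (rule eventually_at_right_less)
  show "0 \<le> Re (det_fun m ?K)"
  proof (rule tendsto_lowerbound[OF tendsto_Re[OF lim]])
    show "\<forall>\<^sub>F e in at_right 0. 0 \<le> Re (det_fun m (A e))"
      using ev by eventually_elim (use pos in \<open>auto intro: less_imp_le\<close>)
  qed simp
  have "\<forall>\<^sub>F e in at_right 0. Im (det_fun m (A e)) = 0"
    using ev by eventually_elim (use pos in \<open>metis Im_complex_of_real\<close>)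
  then have "((\<lambda>e. Im (det_fun m (A e))) \<longlongrightarrow> 0) (at_right 0)"
    by (rule tendsto_eventually)
  then show "Im (det_fun m ?K) = 0"
    using tendsto_unique[OF trivial_limit_at_right_real tendsto_Im[OF lim]] by blast
qed

section \<open>The rescaled Ginibre functions\<close>

text \<open>Dilation of the orthonormal family for parameter 1: \<open>phi r a z\<close> is r times
  \<open>phi 1 a\<close> at r * z. Holes in r * U for the fixed process become holes in
  \<open>U\<close> with parameter \<open>r\<close>.\<close>

definition phi :: "real \<Rightarrow> nat \<Rightarrow> complex \<Rightarrow> complex" where
  "phi r a z = of_real (sqrt (r ^ (2 * a + 2) / (pi * fact a)) * exp (- (r * cmod z)\<^sup>2 / 2)) * z ^ a"

lemma exp_sums_real: "(\<lambda>k. x ^ k / fact k) sums exp (x::real)"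
  using exp_converges[of x] by (simp add: divide_inverse mult.commute)

lemma phi_measurable [measurable]: "phi r a \<in> borel_measurable borel"
  unfolding phi_def[abs_def] by measurable

lemma cmod_phi_sq:
  "(cmod (phi r a z))\<^sup>2 = r\<^sup>2 / (pi * fact a) * ((cmod (of_real r * z)) ^ (2 * a) * exp (- (cmod (of_real r * z))\<^sup>2))"
proof -
  have e: "exp (- (r * cmod z)\<^sup>2 / 2) ^ 2 = exp (- (r * cmod z)\<^sup>2)"
    by (simp flip: exp_of_nat_mult)
  have p: "0 \<le> r ^ (2 * a + 2) / (pi * fact a)"
    by (intro divide_nonneg_nonneg zero_le_even_power) auto
  have "(cmod (phi r a z))\<^sup>2 = r ^ (2 * a + 2) / (pi * fact a) * exp (- (r * cmod z)\<^sup>2) * (cmod z) ^ (2 * a)"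
    using p e by (simp add: phi_def norm_mult norm_power power_mult_distrib power_mult[symmetric] mult.commute[of a])
  also have "\<dots> = r\<^sup>2 / (pi * fact a) * ((cmod (of_real r * z)) ^ (2 * a) * exp (- (cmod (of_real r * z))\<^sup>2))"
  proof -
    have 1: "(cmod (of_real r * z)) ^ (2 * a) = r ^ (2 * a) * cmod z ^ (2 * a)"
      by (simp add: norm_mult power_mult_distrib power_even_abs)
    have 2: "(cmod (of_real r * z))\<^sup>2 = (r * cmod z)\<^sup>2"
      by (simp add: norm_mult power_mult_distrib)
    show ?thesis unfolding 1 2 by (simp add: power_add power2_eq_square)
  qed
  finally show ?thesis .
qed

lemma nn_integral_phi_sq:
  assumes r: "0 < r"
  shows "(\<integral>\<^sup>+z. ennreal ((cmod (phi r a z))\<^sup>2) \<partial>lborel) = 1"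
    and "0 \<le> s \<Longrightarrow> (\<integral>\<^sup>+z. ennreal ((cmod (phi r a z))\<^sup>2) * indicator (cball 0 s) z \<partial>lborel) = ennreal (erlang_CDF a 1 ((r * s)\<^sup>2))"
proof -
  let ?g = "\<lambda>z::complex. ennreal ((cmod z) ^ (2 * a) * exp (- (cmod z)\<^sup>2))"
  have eq: "ennreal ((cmod (phi r a z))\<^sup>2) = ennreal (r\<^sup>2) * (ennreal (1 / (pi * fact a)) * ?g (of_real r * z))" for z
    unfolding cmod_phi_sq by (simp add: ennreal_mult[symmetric])
  have "(\<integral>\<^sup>+z. ennreal ((cmod (phi r a z))\<^sup>2) \<partial>lborel) = ennreal (1 / (pi * fact a)) * (ennreal (r\<^sup>2) * (\<integral>\<^sup>+z. ?g (0 + of_real r * z) \<partial>lborel))"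
    unfolding eq by (simp add: nn_integral_cmult mult_ac)
  also have "ennreal (r\<^sup>2) * (\<integral>\<^sup>+z. ?g (0 + of_real r * z) \<partial>lborel) = (\<integral>\<^sup>+z. ?g z \<partial>lborel)"
    using r by (intro nn_integral_scale[symmetric]) auto
  finally show "(\<integral>\<^sup>+z. ennreal ((cmod (phi r a z))\<^sup>2) \<partial>lborel) = 1"
    unfolding nn_integral_gaussian_moment_full by (simp add: ennreal_mult[symmetric])
  assume s: "0 \<le> s"
  define k where "k z = ?g z * indicator (cball 0 (r * s)) z" for z :: complex
  have [measurable]: "cball 0 (r * s) \<in> sets (borel :: complex measure)" by simp
  have [measurable]: "k \<in> borel_measurable borel" unfolding k_def[abs_def] by measurable
  have ind: "indicator (cball 0 s) z = (indicator (cball 0 (r * s)) (of_real r * z) :: ennreal)" for z :: complex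
    using r by (auto simp: norm_mult split: split_indicator)
  have "ennreal ((cmod (phi r a z))\<^sup>2) * indicator (cball 0 s) z = ennreal (r\<^sup>2) * (ennreal (1 / (pi * fact a)) * k (of_real r * z))" for z
    unfolding eq ind k_def by (simp add: mult_ac)
  then have "(\<integral>\<^sup>+z. ennreal ((cmod (phi r a z))\<^sup>2) * indicator (cball 0 s) z \<partial>lborel)
      = (\<integral>\<^sup>+z. ennreal (r\<^sup>2) * (ennreal (1 / (pi * fact a)) * k (of_real r * z)) \<partial>lborel)"
    by simp
  also have "\<dots> = ennreal (r\<^sup>2) * (ennreal (1 / (pi * fact a)) * (\<integral>\<^sup>+z. k (of_real r * z) \<partial>lborel))"
    by (simp add: nn_integral_cmult)
  also have "\<dots> = ennreal (1 / (pi * fact a)) * (ennreal (r\<^sup>2) * (\<integral>\<^sup>+z. k (0 + of_real r * z) \<partial>lborel))"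
    by (simp add: mult.left_commute)
  also have "ennreal (r\<^sup>2) * (\<integral>\<^sup>+z. k (0 + of_real r * z) \<partial>lborel) = (\<integral>\<^sup>+z. k z \<partial>lborel)"
    using r by (intro nn_integral_scale[symmetric]) auto
  also have "(\<integral>\<^sup>+z. k z \<partial>lborel) = ennreal (pi * fact a * erlang_CDF a 1 ((r * s)\<^sup>2))"
    unfolding k_def using r s by (intro nn_integral_gaussian_moment) auto
  finally show "(\<integral>\<^sup>+z. ennreal ((cmod (phi r a z))\<^sup>2) * indicator (cball 0 s) z \<partial>lborel) = ennreal (erlang_CDF a 1 ((r * s)\<^sup>2))"
    by (simp add: ennreal_mult[symmetric])
qed

lemma integrable_phi_sq:
  assumes "0 < r"
  shows "integrable lborel (\<lambda>z. (cmod (phi r a z))\<^sup>2)" "(\<integral>z. (cmod (phi r a z))\<^sup>2 \<partial>lborel) = 1"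
proof -
  have "has_bochner_integral lborel (\<lambda>z. (cmod (phi r a z))\<^sup>2) 1"
    by (rule has_bochner_integral_nn_integral) (use nn_integral_phi_sq(1)[OF assms] in auto)
  then show "integrable lborel (\<lambda>z. (cmod (phi r a z))\<^sup>2)" "(\<integral>z. (cmod (phi r a z))\<^sup>2 \<partial>lborel) = 1"
    by (auto simp: has_bochner_integral_iff)
qed

lemma integrable_phi:
  assumes r: "0 < r" and [measurable]: "h \<in> borel_measurable borel" and h: "\<And>z. \<bar>h z\<bar> \<le> B"
  shows "integrable lborel (\<lambda>z. of_real (h z) * phi r a z * cnj (phi r b z))"
proof (rule Bochner_Integration.integrable_bound)
  show "integrable lborel (\<lambda>z. B * ((cmod (phi r a z))\<^sup>2 + (cmod (phi r b z))\<^sup>2))"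
    using integrable_phi_sq[OF r] by auto
  show "AE z in lborel. norm (of_real (h z) * phi r a z * cnj (phi r b z)) \<le> norm (B * ((cmod (phi r a z))\<^sup>2 + (cmod (phi r b z))\<^sup>2))"
  proof (rule AE_I2)
    fix z
    have B: "0 \<le> B" using h[of z] by linarith
    have "x * y \<le> x\<^sup>2 + y\<^sup>2" for x y :: real
    proof -
      have "0 \<le> x\<^sup>2 + y\<^sup>2 + (x - y)\<^sup>2" by simp
      then show ?thesis by (simp add: power2_diff)
    qed
    then have "\<bar>h z\<bar> * (cmod (phi r a z) * cmod (phi r b z)) \<le> B * ((cmod (phi r a z))\<^sup>2 + (cmod (phi r b z))\<^sup>2)"
      by (intro mult_mono h B) auto
    then show "norm (of_real (h z) * phi r a z * cnj (phi r b z)) \<le> norm (B * ((cmod (phi r a z))\<^sup>2 + (cmod (phi r b z))\<^sup>2))"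
      using B by (simp add: norm_mult mult_ac)
  qed
qed measurable

lemma gram_hermitian: "gram h \<phi> b a = cnj (gram h \<phi> a b)"
proof -
  have "(\<integral>z. cnj (of_real (h z) * \<phi> a z * cnj (\<phi> b z)) \<partial>lborel) = cnj (gram h \<phi> a b)"
    unfolding gram_def by (rule Bochner_Integration.integral_cnj)
  then show ?thesis by (simp add: gram_def mult_ac)
qed

lemma herm_form_gram:
  assumes int: "\<And>a b. integrable lborel (\<lambda>z. of_real (h z) * \<phi> a z * cnj (\<phi> b z))"
  shows "integrable lborel (\<lambda>z. h z * (cmod (\<Sum>i<n. cnj (x i) * \<phi> i z))\<^sup>2)"
    and "Re (herm_form n (gram h \<phi>) x) = (\<integral>z. h z * (cmod (\<Sum>i<n. cnj (x i) * \<phi> i z))\<^sup>2 \<partial>lborel)"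
proof -
  have eq: "complex_of_real (h z * (cmod (\<Sum>i<n. cnj (x i) * \<phi> i z))\<^sup>2)
      = (\<Sum>i<n. \<Sum>j<n. cnj (x i) * (of_real (h z) * \<phi> i z * cnj (\<phi> j z)) * x j)" for z
  proof -
    have "complex_of_real (h z * (cmod (\<Sum>i<n. cnj (x i) * \<phi> i z))\<^sup>2)
      = of_real (h z) * ((\<Sum>i<n. cnj (x i) * \<phi> i z) * cnj (\<Sum>i<n. cnj (x i) * \<phi> i z))"
      by (simp only: complex_norm_square of_real_mult)
    also have "\<dots> = of_real (h z) * (\<Sum>i<n. \<Sum>j<n. (cnj (x i) * \<phi> i z) * cnj (cnj (x j) * \<phi> j z))"
      by (simp only: cnj_sum sum_product)
    also have "\<dots> = (\<Sum>i<n. \<Sum>j<n. of_real (h z) * ((cnj (x i) * \<phi> i z) * cnj (cnj (x j) * \<phi> j z)))"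
      by (simp only: sum_distrib_left)
    finally show ?thesis by (simp add: mult_ac)
  qed
  have int1: "integrable lborel (\<lambda>z. cnj (x i) * (of_real (h z) * \<phi> i z * cnj (\<phi> j z)) * x j)" for i j
    using int by auto
  have intc: "integrable lborel (\<lambda>z. complex_of_real (h z * (cmod (\<Sum>i<n. cnj (x i) * \<phi> i z))\<^sup>2))"
    unfolding eq by (intro Bochner_Integration.integrable_sum int1)
  then show "integrable lborel (\<lambda>z. h z * (cmod (\<Sum>i<n. cnj (x i) * \<phi> i z))\<^sup>2)"
    using integrable_Re[OF intc] by (simp only: Re_complex_of_real)
  have "herm_form n (gram h \<phi>) x = (\<integral>z. (\<Sum>i<n. \<Sum>j<n. cnj (x i) * (of_real (h z) * \<phi> i z * cnj (\<phi> j z)) * x j) \<partial>lborel)"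
    unfolding herm_form_def gram_def using int1 int
    by (simp add: Bochner_Integration.integral_sum Bochner_Integration.integrable_sum)
  also have "\<dots> = complex_of_real (\<integral>z. h z * (cmod (\<Sum>i<n. cnj (x i) * \<phi> i z))\<^sup>2 \<partial>lborel)"
    unfolding eq[symmetric] by (rule integral_complex_of_real)
  finally show "Re (herm_form n (gram h \<phi>) x) = (\<integral>z. h z * (cmod (\<Sum>i<n. cnj (x i) * \<phi> i z))\<^sup>2 \<partial>lborel)"
    by simp
qed

text \<open>A nontrivial combination is a Gaussian times a nonzero polynomial and has finitely many
  zeros. It cannot vanish almost everywhere on |z| > 1, where the weight is positive whenever the
  hole lies in the unit disc.\<close>

lemma pos_def_gram_phi:
  assumes r: "0 < r" and [measurable]: "h \<in> borel_measurable borel" and h: "\<And>z. \<bar>h z\<bar> \<le> B"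
    and h0: "\<And>z. 0 \<le> h z" and h1: "\<And>z. 1 < cmod z \<Longrightarrow> 0 < h z"
  shows "pos_def (gram h (phi r))"
  unfolding pos_def_def
proof (intro conjI allI impI)
  show "gram h (phi r) j i = cnj (gram h (phi r) i j)" for i j by (rule gram_hermitian)
  fix n :: nat and x :: "nat \<Rightarrow> complex" assume x: "\<exists>i<n. x i \<noteq> 0"
  note int = integrable_phi[OF r assms(2) h]
  let ?f = "\<lambda>z. h z * (cmod (\<Sum>i<n. cnj (x i) * phi r i z))\<^sup>2"
  note I = herm_form_gram[OF int, where n=n and x=x]
  have f0: "0 \<le> ?f z" for z using h0 by simp
  have "(\<integral>z. ?f z \<partial>lborel) \<noteq> 0"
  proof
    assume "(\<integral>z. ?f z \<partial>lborel) = 0"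
    then have ae: "AE z in lborel. ?f z = 0"
      using integral_nonneg_eq_0_iff_AE[OF I(1)] f0 by auto
    define c where "c i = cnj (x i) * of_real (sqrt (r ^ (2 * i + 2) / (pi * fact i)))" for i
    let ?Z = "{z. (\<Sum>i\<le>n - 1. c i * z ^ i) = 0}"
    obtain i where i: "i < n" "x i \<noteq> 0" using x by blast
    then have ci: "c i \<noteq> 0" "i \<le> n - 1" using r by (auto simp: c_def)
    have fin: "finite ?Z" using polyfun_rootbound[where n="n - 1" and c=c] ci by blast
    have sum_eq: "(\<Sum>i<n. cnj (x i) * phi r i z) = of_real (exp (- (r * cmod z)\<^sup>2 / 2)) * (\<Sum>i\<le>n - 1. c i * z ^ i)" for z
    proof -
      have "{..<n} = {..n - 1}" using i by auto
      then show ?thesis by (simp add: phi_def c_def sum_distrib_left mult_ac)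
    qed
    have "AE z in lborel. z \<notin> ?Z"
      using fin by (intro AE_not_in finite_imp_null_set_lborel)
    with ae have "AE z in lborel. z \<notin> {z. 1 < cmod z}"
    proof eventually_elim
      case (elim z)
      then have "(\<Sum>i<n. cnj (x i) * phi r i z) \<noteq> 0" unfolding sum_eq by simp
      then show ?case using elim h1[of z] by auto
    qed
    then have "emeasure lborel {z::complex. 1 < cmod z} = 0"
      by (subst (asm) AE_iff_measurable[OF _ refl]) auto
    \<comment> \<open>Any disc outside the closed unit disc would do; it certifies that the region
      of positive weight has positive area.\<close>
    moreover have "ball 3 1 \<subseteq> {z::complex. 1 < cmod z}"
    proof
      fix z :: complex assume "z \<in> ball 3 1"
      then have "cmod (3 - z) < 1" by (simp add: dist_norm)
      moreover have "3 \<le> cmod (3 - z) + cmod z" using norm_triangle_ineq[of "3 - z" z] by simp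
      ultimately show "z \<in> {z. 1 < cmod z}" by simp
    qed
    then have "emeasure lborel (ball (3::complex) 1) \<le> emeasure lborel {z::complex. 1 < cmod z}"
      by (intro emeasure_mono) auto
    ultimately show False by (simp add: emeasure_ball unit_ball_vol_2)
  qed
  moreover have "0 \<le> (\<integral>z. ?f z \<partial>lborel)" using f0 by (intro integral_nonneg_AE) auto
  ultimately show "0 < Re (herm_form n (gram h (phi r)) x)" unfolding I(2) by linarith
qed

lemma herm_form_gram_mono:
  assumes r: "0 < r" and m: "h \<in> borel_measurable borel" "h' \<in> borel_measurable borel"
    and h: "\<And>z. \<bar>h z\<bar> \<le> B" and h': "\<And>z. \<bar>h' z\<bar> \<le> B'" and le: "\<And>z. h z \<le> h' z"
  shows "Re (herm_form n (gram h (phi r)) x) \<le> Re (herm_form n (gram h' (phi r)) x)"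
proof -
  note 1 = herm_form_gram[OF integrable_phi[OF r m(1) h]]
  note 2 = herm_form_gram[OF integrable_phi[OF r m(2) h']]
  show ?thesis
    unfolding 1(2) 2(2) by (intro integral_mono 1(1) 2(1) mult_right_mono le) auto
qed

lemma gram_radial_diagonal:
  assumes [measurable]: "h \<in> borel_measurable borel" and h: "\<And>u z. cmod u = 1 \<Longrightarrow> h (u * z) = h z"
    and "a \<noteq> b"
  shows "gram h (phi r) a b = 0"
proof -
  let ?H = "\<lambda>z. complex_of_real (h z * (sqrt (r ^ (2 * a + 2) / (pi * fact a)) * exp (- (r * cmod z)\<^sup>2 / 2))
      * (sqrt (r ^ (2 * b + 2) / (pi * fact b)) * exp (- (r * cmod z)\<^sup>2 / 2)))"
  have "gram h (phi r) a b = (\<integral>z. ?H z * (z ^ a * cnj z ^ b) \<partial>lborel)"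
    unfolding gram_def phi_def by (intro Bochner_Integration.integral_cong) (auto simp: mult_ac)
  also have "\<dots> = 0"
    by (rule integral_radial_orthogonal) (use assms in \<open>auto simp: norm_mult\<close>)
  finally show ?thesis .
qed

lemma gram_diagonal: "gram h \<phi> a a = of_real (\<integral>z. h z * (cmod (\<phi> a z))\<^sup>2 \<partial>lborel)"
  unfolding gram_def integral_complex_of_real[symmetric]
  by (intro Bochner_Integration.integral_cong refl) (simp only: of_real_mult complex_norm_square mult.assoc)

lemma gram_one_plus:
  assumes r: "0 < r" and [measurable]: "A \<in> sets borel"
  shows "gram (\<lambda>z. 1 + t * indicator A z) (phi r) i j
     = (if i = j then 1 else 0) + of_real t * gram (indicator A) (phi r) i j"
proof -
  have 1: "gram (\<lambda>_. 1) (phi r) i j = (if i = j then 1 else 0)"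
    using gram_radial_diagonal[of "\<lambda>_. 1" i j r] gram_diagonal[of "\<lambda>_. 1" "phi r" i] integrable_phi_sq(2)[OF r, of i]
    by auto
  have i1: "integrable lborel (\<lambda>z. of_real 1 * phi r i z * cnj (phi r j z))"
    by (rule integrable_phi[OF r, where B=1]) auto
  have i2: "integrable lborel (\<lambda>z. of_real (indicator A z) * phi r i z * cnj (phi r j z))"
    by (rule integrable_phi[OF r, where B=1]) (auto split: split_indicator)
  have "gram (\<lambda>z. 1 + t * indicator A z) (phi r) i j
     = (\<integral>z. of_real 1 * phi r i z * cnj (phi r j z) + of_real t * (of_real (indicator A z) * phi r i z * cnj (phi r j z)) \<partial>lborel)"
    unfolding gram_def by (intro Bochner_Integration.integral_cong) (auto simp: algebra_simps)
  also have "\<dots> = gram (\<lambda>_. 1) (phi r) i j + of_real t * gram (indicator A) (phi r) i j"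
    unfolding gram_def using i1 i2 by (simp add: Bochner_Integration.integral_add)
  finally show ?thesis using 1 by simp
qed

text \<open>Both bounds estimate the tail of the exponential series after index n. The first
  compares consecutive terms and is useful once n is at least x; the second keeps only the constant
  term and works for every n.\<close>

lemma erlang_CDF_bounds:
  assumes "0 \<le> x"
  shows "erlang_CDF n 1 x \<le> x / (n + 1)" "erlang_CDF n 1 x \<le> 1 - exp (- x)"
proof -
  let ?t = "\<lambda>k. x ^ k / fact k"
  have sums: "?t sums exp x" by (rule exp_sums_real)
  have sm: "summable ?t" using sums by (rule sums_summable)
  have "exp x - (\<Sum>k<Suc n. ?t k) = (\<Sum>k. ?t (k + Suc n))"
    using suminf_split_initial_segment[OF sm, of "Suc n"] sums_unique[OF sums] by simp
  also have "\<dots> \<le> (\<Sum>k. x / (n + 1) * ?t (k + n))"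
  proof (intro suminf_le)
    fix k
    have "?t (k + Suc n) = x / (k + n + 1) * ?t (k + n)" by (simp add: field_simps)
    also have "\<dots> \<le> x / (n + 1) * ?t (k + n)"
      using assms by (intro mult_right_mono divide_left_mono) auto
    finally show "?t (k + Suc n) \<le> x / (n + 1) * ?t (k + n)" .
  next
    show "summable (\<lambda>k. ?t (k + Suc n))" by (rule summable_ignore_initial_segment[OF sm])
    show "summable (\<lambda>k. x / (n + 1) * ?t (k + n))"
      by (intro summable_mult summable_ignore_initial_segment[OF sm])
  qed
  also have "\<dots> = x / (n + 1) * (\<Sum>k. ?t (k + n))"
    by (intro suminf_mult summable_ignore_initial_segment[OF sm])
  also have "\<dots> \<le> x / (n + 1) * exp x"
  proof (rule mult_left_mono)
    show "(\<Sum>k. ?t (k + n)) \<le> exp x"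
      using suminf_split_initial_segment[OF sm, of n] sums_unique[OF sums] assms by (simp add: sum_nonneg)
  qed (use assms in simp)
  finally have le: "exp x - (\<Sum>k<Suc n. ?t k) \<le> x / (n + 1) * exp x" .
  have eq: "erlang_CDF n 1 x = exp (- x) * (exp x - (\<Sum>k<Suc n. ?t k))"
    using assms by (simp add: erlang_CDF_def lessThan_Suc_atMost right_diff_distrib sum_distrib_left exp_minus mult_ac del: sum.lessThan_Suc)
  have "erlang_CDF n 1 x \<le> exp (- x) * (x / (n + 1) * exp x)"
    unfolding eq by (intro mult_left_mono le) auto
  then show "erlang_CDF n 1 x \<le> x / (n + 1)" by (simp add: exp_minus field_simps)
  have "1 \<le> (\<Sum>k<Suc n. ?t k)"
    using assms by (subst sum.lessThan_Suc_shift) (auto intro!: sum_nonneg)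
  then have "exp (- x) \<le> exp (- x) * (\<Sum>k<Suc n. ?t k)" by simp
  then show "erlang_CDF n 1 x \<le> 1 - exp (- x)"
    unfolding eq right_diff_distrib by (simp add: exp_minus)
qed

text \<open>The probability that the n-particle ensemble leaves \<open>U\<close> empty;
  \<open>hole_det_partfn\<close> writes it as a quotient of partition functions.\<close>

definition hole_det :: "real \<Rightarrow> complex set \<Rightarrow> nat \<Rightarrow> real" where
  "hole_det r U n = Re (det_fun n (gram (indicator (- U)) (phi r)))"

text \<open>The weight lies between those of the exterior of the closed disc and of the whole plane.
  Both are rotation invariant, so their Gram matrices are diagonal and their determinant ratios are
  a diagonal entry: 1 for the plane, and the mass of the n-th function outside the disc.\<close>

lemma
  assumes r: "0 < r" and [measurable]: "U \<in> sets borel" and U: "U \<subseteq> cball 0 1"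
  shows hole_det_pos: "0 < hole_det r U n"
    and hole_det_Suc_le: "hole_det r U (Suc n) \<le> hole_det r U n"
    and hole_det_Suc_ge: "(1 - erlang_CDF n 1 (r\<^sup>2)) * hole_det r U n \<le> hole_det r U (Suc n)"
proof -
  have pdU: "pos_def (gram (indicator (- U)) (phi r))"
    by (rule pos_def_gram_phi[OF r, where B=1]) (use U in \<open>auto split: split_indicator\<close>)
  then show pos: "0 < hole_det r U n" for n
    using det_fun_pos_def unfolding hole_det_def by blast
  have [simp]: "det_fun m (gram (\<lambda>_. 1) (phi r)) = 1" for m
    using gram_radial_diagonal[of "\<lambda>_. 1" _ _ r] gram_diagonal[of "\<lambda>_. 1" "phi r"] integrable_phi_sq(2)[OF r]
    by (subst det_fun_diagonal) auto
  have "hole_det r U (Suc n) / hole_det r U n \<le> Re (det_fun (Suc n) (gram (\<lambda>_. 1) (phi r))) / Re (det_fun n (gram (\<lambda>_. 1) (phi r)))"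
    unfolding hole_det_def
    by (intro det_fun_ratio_mono pdU pos_def_gram_phi[OF r, where B=1] herm_form_gram_mono[OF r, where B=1 and B'=1])
       (auto split: split_indicator)
  then show "hole_det r U (Suc n) \<le> hole_det r U n" using pos[of n] by simp
  let ?C = "- cball 0 1 :: complex set"
  have pdC: "pos_def (gram (indicator ?C) (phi r))"
    by (rule pos_def_gram_phi[OF r, where B=1]) (auto split: split_indicator)
  have C: "det_fun m (gram (indicator ?C) (phi r)) = (\<Prod>i<m. gram (indicator ?C) (phi r) i i)" for m
    by (rule det_fun_diagonal, rule gram_radial_diagonal) (auto simp: norm_mult split: split_indicator)
  have "has_bochner_integral lborel (\<lambda>z. (cmod (phi r n z))\<^sup>2 * indicator (cball 0 1) z) (erlang_CDF n 1 ((r * 1)\<^sup>2))"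
  proof (rule has_bochner_integral_nn_integral)
    show "(\<integral>\<^sup>+z. ennreal ((cmod (phi r n z))\<^sup>2 * indicator (cball 0 1) z) \<partial>lborel) = ennreal (erlang_CDF n 1 ((r * 1)\<^sup>2))"
      using nn_integral_phi_sq(2)[OF r, of 1 n] by (simp add: ennreal_mult' ennreal_indicator)
    have [measurable]: "cball 0 1 \<in> sets (borel :: complex measure)" by simp
    show "(\<lambda>z. (cmod (phi r n z))\<^sup>2 * indicator (cball 0 1) z) \<in> borel_measurable lborel"
      by measurable
  qed (use erlang_CDF_nonneg in auto)
  then have "(\<integral>z. (cmod (phi r n z))\<^sup>2 - (cmod (phi r n z))\<^sup>2 * indicator (cball 0 1) z \<partial>lborel) = 1 - erlang_CDF n 1 (r\<^sup>2)"
    using integrable_phi_sq[OF r, of n] by (simp add: has_bochner_integral_iff)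
  also have "(\<lambda>z. (cmod (phi r n z))\<^sup>2 - (cmod (phi r n z))\<^sup>2 * indicator (cball 0 1) z) = (\<lambda>z. indicator ?C z * (cmod (phi r n z))\<^sup>2)"
    by (auto split: split_indicator)
  finally have Cn: "gram (indicator ?C) (phi r) n n = of_real (1 - erlang_CDF n 1 (r\<^sup>2))"
    unfolding gram_diagonal by simp
  have posC: "0 < Re (det_fun m (gram (indicator ?C) (phi r)))" for m
    using det_fun_pos_def[OF pdC] by blast
  have "Re (det_fun (Suc n) (gram (indicator ?C) (phi r))) / Re (det_fun n (gram (indicator ?C) (phi r)))
      \<le> hole_det r U (Suc n) / hole_det r U n"
    unfolding hole_det_def
    by (intro det_fun_ratio_mono pdU pdC herm_form_gram_mono[OF r, where B=1 and B'=1])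
       (use U in \<open>auto split: split_indicator\<close>)
  also have "Re (det_fun (Suc n) (gram (indicator ?C) (phi r)))
      = (1 - erlang_CDF n 1 (r\<^sup>2)) * Re (det_fun n (gram (indicator ?C) (phi r)))"
    unfolding C by (simp only: prod.lessThan_Suc Cn mult.commute[of _ "of_real _"] Re_complex_of_real_mult)
  finally show "(1 - erlang_CDF n 1 (r\<^sup>2)) * hole_det r U n \<le> hole_det r U (Suc n)"
    using posC[of n] pos[of n] by (simp add: pos_le_divide_eq)
qed

text \<open>The sum is a partial sum of an exponential series: the density of particles never
  exceeds its bulk value r^2/pi.\<close>

lemma sum_cmod_phi_sq_le: "(\<Sum>a<n. (cmod (phi r a z))\<^sup>2) \<le> r\<^sup>2 / pi"
proof -
  let ?x = "(cmod (of_real r * z))\<^sup>2"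
  have "(\<Sum>a<n. (cmod (phi r a z))\<^sup>2) = r\<^sup>2 / pi * exp (- ?x) * (\<Sum>a<n. ?x ^ a / fact a)"
    unfolding cmod_phi_sq sum_distrib_left by (intro sum.cong refl) (simp add: power_mult)
  also have "\<dots> \<le> r\<^sup>2 / pi * exp (- ?x) * exp ?x"
  proof (rule mult_left_mono)
    show "(\<Sum>a<n. ?x ^ a / fact a) \<le> exp ?x"
      unfolding sums_unique[OF exp_sums_real]
      by (rule sum_le_suminf[OF sums_summable[OF exp_sums_real]]) auto
  qed simp
  also have "\<dots> = r\<^sup>2 / pi" by (simp add: exp_minus)
  finally show ?thesis .
qed

text \<open>The bound is uniform in \<open>n\<close>, which later permits exchanging limits and
  series. Comparison with the disc makes the matrix diagonal, 1 + x is at most e^x, and the trace is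
  at most the area pi times the maximal density r^2/pi.\<close>

lemma det_one_plus_gram_le:
  assumes r: "0 < r" and [measurable]: "U \<in> sets borel" and U: "U \<subseteq> cball 0 1" and t: "0 \<le> t"
  shows "Re (det_fun n (\<lambda>i j. (if i = j then 1 else 0) + of_real t * gram (indicator U) (phi r) i j)) \<le> exp (t * r\<^sup>2)"
proof -
  let ?h = "\<lambda>A z. 1 + t * indicator A z"
  let ?D = "\<lambda>A n. Re (det_fun n (gram (?h A) (phi r)))"
  let ?C = "cball 0 1 :: complex set"
  have [measurable]: "?C \<in> sets borel" by simp
  have b: "\<bar>?h A z\<bar> \<le> 1 + t" for A and z :: complex using t by (auto split: split_indicator)
  have pd: "pos_def (gram (?h A) (phi r))" if "A \<in> sets borel" for A
    by (rule pos_def_gram_phi[OF r _ b]) (use t that in \<open>auto split: split_indicator\<close>)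
  have pos: "0 < ?D A n" if "A \<in> sets borel" for A n
    using det_fun_pos_def[OF pd[OF that]] by blast
  \<comment> \<open>Only ratios are directly comparable, so the determinants are compared by
    multiplying up the ratios from size 0.\<close>
  have le: "?D U n \<le> ?D ?C n"
  proof (induction n)
    case (Suc n)
    have "?D U (Suc n) / ?D U n \<le> ?D ?C (Suc n) / ?D ?C n"
      by (intro det_fun_ratio_mono pd herm_form_gram_mono[OF r _ _ b b])
         (use U t in \<open>auto split: split_indicator\<close>)
    then have "?D U (Suc n) / ?D U n * ?D U n \<le> ?D ?C (Suc n) / ?D ?C n * ?D ?C n"
      using Suc pos[of U n] pos[of ?C n] pos[of ?C "Suc n"]
      by (intro mult_mono) (auto intro!: divide_nonneg_nonneg less_imp_le simp del: of_real_add)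
    then show ?case using pos[of U n] pos[of ?C n] by auto
  qed simp
  have diag: "gram (?h ?C) (phi r) i i = of_real (1 + t * (\<integral>z. indicator ?C z * (cmod (phi r i z))\<^sup>2 \<partial>lborel))" for i
    unfolding gram_one_plus[OF r borel_closed[OF closed_cball]] unfolding gram_diagonal by simp
  have "det_fun n (gram (?h ?C) (phi r)) = (\<Prod>i<n. gram (?h ?C) (phi r) i i)"
    by (rule det_fun_diagonal, rule gram_radial_diagonal) (auto simp: norm_mult split: split_indicator)
  then have "?D ?C n = (\<Prod>i<n. 1 + t * (\<integral>z. indicator ?C z * (cmod (phi r i z))\<^sup>2 \<partial>lborel))"
    unfolding diag of_real_prod[symmetric] by (simp only: Re_complex_of_real)
  also have "\<dots> \<le> (\<Prod>i<n. exp (t * (\<integral>z. indicator ?C z * (cmod (phi r i z))\<^sup>2 \<partial>lborel)))"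
    using t by (intro prod_mono conjI exp_ge_add_one_self add_nonneg_nonneg mult_nonneg_nonneg integral_nonneg_AE) auto
  also have "\<dots> = exp (t * (\<Sum>i<n. \<integral>z. indicator ?C z * (cmod (phi r i z))\<^sup>2 \<partial>lborel))"
    by (simp add: exp_sum sum_distrib_left)
  also have "(\<Sum>i<n. \<integral>z. indicator ?C z * (cmod (phi r i z))\<^sup>2 \<partial>lborel) \<le> r\<^sup>2"
  proof -
    have int: "integrable lborel (\<lambda>z. indicator ?C z * (cmod (phi r i z))\<^sup>2)" for i
      by (rule integrable_real_mult_indicator[where A="?C", OF _ integrable_phi_sq(1)[OF r, of i], simplified mult.commute]) auto
    have "(\<Sum>i<n. \<integral>z. indicator ?C z * (cmod (phi r i z))\<^sup>2 \<partial>lborel)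
        = (\<integral>z. indicator ?C z * (\<Sum>i<n. (cmod (phi r i z))\<^sup>2) \<partial>lborel)"
      by (simp add: Bochner_Integration.integral_sum[OF int, symmetric] sum_distrib_left)
    also have "\<dots> \<le> (\<integral>z. indicator ?C z * (r\<^sup>2 / pi) \<partial>lborel)"
    proof (rule integral_mono)
      show "integrable lborel (\<lambda>z. indicator ?C z * (\<Sum>i<n. (cmod (phi r i z))\<^sup>2))"
        unfolding sum_distrib_left by (intro Bochner_Integration.integrable_sum int)
      show "integrable lborel (\<lambda>z::complex. indicator ?C z * (r\<^sup>2 / pi))"
        by (intro integrable_mult_left integrable_real_indicator) (auto simp: emeasure_cball)
      show "indicator ?C z * (\<Sum>i<n. (cmod (phi r i z))\<^sup>2) \<le> indicator ?C z * (r\<^sup>2 / pi)" for z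
        by (intro mult_left_mono sum_cmod_phi_sq_le) auto
    qed
    also have "\<dots> = r\<^sup>2"
      by (simp add: measure_def emeasure_cball unit_ball_vol_2)
    finally show ?thesis .
  qed
  finally have "?D ?C n \<le> exp (t * r\<^sup>2)" using t by (simp add: mult_left_mono)
  moreover have "det_fun n (\<lambda>i j. (if i = j then 1 else 0) + of_real t * gram (indicator U) (phi r) i j) = det_fun n (gram (?h U) (phi r))"
    by (rule det_fun_cong) (simp only: gram_one_plus[OF r assms(2)])
  ultimately show ?thesis using le by simp
qed

lemma hole_det_one_minus:
  assumes r: "0 < r" and U: "U \<in> sets borel"
  shows "hole_det r U n = Re (det_fun n (\<lambda>i j. (if i = j then 1 else 0) + (- 1) * gram (indicator U) (phi r) i j))"
proof -
  have "(indicator (- U) :: complex \<Rightarrow> real) = (\<lambda>z. 1 + (- 1) * indicator U z)"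
    by (auto split: split_indicator)
  then have "gram (indicator (- U)) (phi r) i j = (if i = j then 1 else 0) + (- 1) * gram (indicator U) (phi r) i j" for i j
    using gram_one_plus[OF r U, of "-1" i j] by simp
  then show ?thesis unfolding hole_det_def by (metis (no_types, lifting) det_fun_cong)
qed

section \<open>From joint intensities to the hole probability of the infinite process\<close>

section \<open>Factorial moments and hole probabilities\<close>

text \<open>Integer coordinates of the dyadic square of side 2^-m containing the point. Joint
  intensities are prescribed only on disjoint sets, so a single set has to be cut into small
  pieces.\<close>

definition cell :: "nat \<Rightarrow> complex \<Rightarrow> int \<times> int" where
  "cell m z = (\<lfloor>2 ^ m * Re z\<rfloor>, \<lfloor>2 ^ m * Im z\<rfloor>)"

lemma cell_Suc: "cell (Suc m) z = cell (Suc m) w \<Longrightarrow> cell m z = cell m w"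
proof -
  have "\<lfloor>2 ^ m * x\<rfloor> = \<lfloor>2 ^ Suc m * x\<rfloor> div 2" for x :: real
    using floor_divide_real_eq_div[of 2 "2 ^ Suc m * x"] by simp
  then show "cell (Suc m) z = cell (Suc m) w \<Longrightarrow> cell m z = cell m w"
    unfolding cell_def by (metis prod.inject)
qed

lemma cell_mono: "m \<le> n \<Longrightarrow> cell n z = cell n w \<Longrightarrow> cell m z = cell m w"
proof (induction n rule: dec_induct)
  case (step n)
  then show ?case using cell_Suc by blast
qed

lemma cell_separates:
  assumes "z \<noteq> w"
  shows "\<exists>m. cell m z \<noteq> cell m w"
proof (rule ccontr)
  assume "\<not> ?thesis"
  then have eq: "cell m z = cell m w" for m by blast
  have aux: "x = y" if "\<And>m. \<lfloor>2 ^ m * x\<rfloor> = \<lfloor>2 ^ m * y\<rfloor>" for x y :: real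
  proof (rule ccontr)
    assume "x \<noteq> y"
    then obtain m where m: "1 / \<bar>x - y\<bar> < 2 ^ m"
      using real_arch_pow[of 2 "1 / \<bar>x - y\<bar>"] by auto
    have "\<bar>2 ^ m * x - 2 ^ m * y\<bar> < 1"
      using that[of m] by linarith
    moreover have "1 < 2 ^ m * \<bar>x - y\<bar>" using m \<open>x \<noteq> y\<close> by (simp add: field_simps)
    ultimately show False by (simp add: abs_mult right_diff_distrib[symmetric])
  qed
  have "Re z = Re w" "Im z = Im w"
    by (rule aux, use eq in \<open>simp add: cell_def\<close>)+
  then show False using assms complex_eqI by blast
qed

lemma finite_cell_image:
  assumes "bounded A"
  shows "finite (cell m ` A)"
proof -
  obtain B where B: "\<And>z. z \<in> A \<Longrightarrow> cmod z \<le> B" using assms by (auto simp: bounded_iff)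
  have aux: "\<lfloor>2 ^ m * x\<rfloor> \<in> {\<lfloor>- (2 ^ m * B)\<rfloor>..\<lfloor>2 ^ m * B\<rfloor>}" if "\<bar>x\<bar> \<le> B" for x :: real
  proof -
    have "\<bar>2 ^ m * x\<bar> \<le> 2 ^ m * B" using that by (simp add: abs_mult)
    then have "- (2 ^ m * B) \<le> 2 ^ m * x" "2 ^ m * x \<le> 2 ^ m * B" by linarith+
    then show ?thesis by (simp add: floor_mono)
  qed
  have "cell m ` A \<subseteq> {\<lfloor>- (2 ^ m * B)\<rfloor>..\<lfloor>2 ^ m * B\<rfloor>} \<times> {\<lfloor>- (2 ^ m * B)\<rfloor>..\<lfloor>2 ^ m * B\<rfloor>}"
  proof
    fix c assume "c \<in> cell m ` A"
    then obtain z where z: "z \<in> A" "c = cell m z" by blast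
    have "\<bar>Re z\<bar> \<le> B" "\<bar>Im z\<bar> \<le> B"
      using B[OF z(1)] abs_Re_le_cmod[of z] abs_Im_le_cmod[of z] by linarith+
    then show "c \<in> {\<lfloor>- (2 ^ m * B)\<rfloor>..\<lfloor>2 ^ m * B\<rfloor>} \<times> {\<lfloor>- (2 ^ m * B)\<rfloor>..\<lfloor>2 ^ m * B\<rfloor>}"
      using aux z(2) unfolding cell_def by blast
  qed
  then show ?thesis by (rule finite_subset) auto
qed

lemma cell_measurable: "cell m -` {c} \<in> sets (borel :: complex measure)"
proof -
  have "cell m -` {c} = (\<lambda>z. \<lfloor>2 ^ m * Re z\<rfloor>) -` {fst c} \<inter> (\<lambda>z. \<lfloor>2 ^ m * Im z\<rfloor>) -` {snd c}"
    by (auto simp: cell_def)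
  also have "\<dots> \<in> sets borel"
    using measurable_sets[of "\<lambda>z::complex. \<lfloor>2 ^ m * Re z\<rfloor>" borel "count_space UNIV" "{fst c}"]
      measurable_sets[of "\<lambda>z::complex. \<lfloor>2 ^ m * Im z\<rfloor>" borel "count_space UNIV" "{snd c}"]
    by auto
  finally show ?thesis .
qed

text \<open>Tuples already separated at dyadic level \<open>m\<close>. As \<open>m\<close> grows
  they increase to the injective tuples, and each level is a finite disjoint union of products of
  cells.\<close>

definition sep_tuples :: "nat \<Rightarrow> nat \<Rightarrow> complex set \<Rightarrow> (nat \<Rightarrow> complex) set" where
  "sep_tuples m k A = {z \<in> {..<k} \<rightarrow>\<^sub>E A. inj_on (\<lambda>i. cell m (z i)) {..<k}}"

definition cell_tuples :: "nat \<Rightarrow> nat \<Rightarrow> complex set \<Rightarrow> (nat \<Rightarrow> int \<times> int) set" where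
  "cell_tuples m k A = {c \<in> {..<k} \<rightarrow>\<^sub>E cell m ` A. inj_on c {..<k}}"

lemma finite_cell_tuples:
  assumes "bounded A"
  shows "finite (cell_tuples m k A)"
proof (rule finite_subset)
  show "cell_tuples m k A \<subseteq> {..<k} \<rightarrow>\<^sub>E cell m ` A" unfolding cell_tuples_def by blast
  show "finite ({..<k} \<rightarrow>\<^sub>E cell m ` A)"
    by (intro finite_PiE finite_lessThan finite_cell_image assms)
qed

text \<open>A separated tuple determines its cells, hence lies in exactly one of the products. This
  gives both the disjointness needed for counting and the identity of indicators.\<close>

lemma sep_tuples_iff:
  assumes "B \<subseteq> A" "c \<in> cell_tuples m k A"
  shows "z \<in> (\<Pi>\<^sub>E i\<in>{..<k}. B \<inter> cell m -` {c i}) \<longleftrightarrow>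
     z \<in> sep_tuples m k B \<and> c = (\<lambda>i\<in>{..<k}. cell m (z i))"
proof
  assume z: "z \<in> (\<Pi>\<^sub>E i\<in>{..<k}. B \<inter> cell m -` {c i})"
  then have 1: "cell m (z i) = c i" "z i \<in> B" if "i < k" for i using that by (auto simp: PiE_iff)
  have "c = (\<lambda>i\<in>{..<k}. cell m (z i))"
    using assms(2) 1 by (auto simp: cell_tuples_def fun_eq_iff restrict_def PiE_iff extensional_def)
  moreover have "inj_on (\<lambda>i. cell m (z i)) {..<k}"
    using assms(2) 1 by (simp add: cell_tuples_def inj_on_def)
  moreover have "z \<in> {..<k} \<rightarrow>\<^sub>E B"
    using z 1 by (simp add: PiE_iff)
  ultimately show "z \<in> sep_tuples m k B \<and> c = (\<lambda>i\<in>{..<k}. cell m (z i))"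
    unfolding sep_tuples_def by blast
next
  assume "z \<in> sep_tuples m k B \<and> c = (\<lambda>i\<in>{..<k}. cell m (z i))"
  then show "z \<in> (\<Pi>\<^sub>E i\<in>{..<k}. B \<inter> cell m -` {c i})"
    by (simp add: sep_tuples_def PiE_iff)
qed

lemma cell_tuples_of_sep:
  assumes "B \<subseteq> A" "z \<in> sep_tuples m k B"
  shows "(\<lambda>i\<in>{..<k}. cell m (z i)) \<in> cell_tuples m k A"
proof -
  have "inj_on (\<lambda>i. cell m (z i)) {..<k}" "\<And>i. i < k \<Longrightarrow> z i \<in> A"
    using assms unfolding sep_tuples_def by blast+
  then show ?thesis
    unfolding cell_tuples_def by (simp add: inj_on_restrict_eq)
qed

lemma sep_tuples_eq_UN:
  assumes "B \<subseteq> A"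
  shows "sep_tuples m k B = (\<Union>c\<in>cell_tuples m k A. \<Pi>\<^sub>E i\<in>{..<k}. B \<inter> cell m -` {c i})"
proof (intro equalityI subsetI)
  fix z assume z: "z \<in> sep_tuples m k B"
  note c = cell_tuples_of_sep[OF assms z]
  show "z \<in> (\<Union>c\<in>cell_tuples m k A. \<Pi>\<^sub>E i\<in>{..<k}. B \<inter> cell m -` {c i})"
    by (rule UN_I[OF c], subst sep_tuples_iff[OF assms c]) (use z in simp)
next
  fix z assume "z \<in> (\<Union>c\<in>cell_tuples m k A. \<Pi>\<^sub>E i\<in>{..<k}. B \<inter> cell m -` {c i})"
  then obtain c where "c \<in> cell_tuples m k A" "z \<in> (\<Pi>\<^sub>E i\<in>{..<k}. B \<inter> cell m -` {c i})" by (rule UN_E)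
  then show "z \<in> sep_tuples m k B" using sep_tuples_iff[OF assms] by metis
qed

lemma card_sep_tuples:
  assumes "bounded A" "finite (P \<inter> A)"
  shows "card (sep_tuples m k (P \<inter> A)) = (\<Sum>c\<in>cell_tuples m k A. \<Prod>i<k. card (P \<inter> (A \<inter> cell m -` {c i})))"
proof -
  let ?B = "P \<inter> A"
  have "sep_tuples m k ?B = (\<Union>c\<in>cell_tuples m k A. \<Pi>\<^sub>E i\<in>{..<k}. ?B \<inter> cell m -` {c i})"
    by (rule sep_tuples_eq_UN) simp
  also have "card \<dots> = (\<Sum>c\<in>cell_tuples m k A. card (\<Pi>\<^sub>E i\<in>{..<k}. ?B \<inter> cell m -` {c i}))"
  proof (rule card_UN_disjoint)
    show "finite (cell_tuples m k A)" by (rule finite_cell_tuples[OF assms(1)])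
    show "\<forall>c\<in>cell_tuples m k A. finite (\<Pi>\<^sub>E i\<in>{..<k}. ?B \<inter> cell m -` {c i})"
      using assms(2) by (auto intro!: finite_PiE)
    show "\<forall>c\<in>cell_tuples m k A. \<forall>d\<in>cell_tuples m k A. c \<noteq> d \<longrightarrow>
        (\<Pi>\<^sub>E i\<in>{..<k}. ?B \<inter> cell m -` {c i}) \<inter> (\<Pi>\<^sub>E i\<in>{..<k}. ?B \<inter> cell m -` {d i}) = {}"
    proof (intro ballI impI equals0I)
      fix c d z assume "c \<in> cell_tuples m k A" "d \<in> cell_tuples m k A" "c \<noteq> d"
        and z: "z \<in> (\<Pi>\<^sub>E i\<in>{..<k}. ?B \<inter> cell m -` {c i}) \<inter> (\<Pi>\<^sub>E i\<in>{..<k}. ?B \<inter> cell m -` {d i})"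
      then show False
        using sep_tuples_iff[OF Int_lower2, of c m k A z P] sep_tuples_iff[OF Int_lower2, of d m k A z P] by simp
    qed
  qed
  also have "\<dots> = (\<Sum>c\<in>cell_tuples m k A. \<Prod>i<k. card (P \<inter> (A \<inter> cell m -` {c i})))"
    by (simp add: card_PiE Int_assoc)
  finally show ?thesis .
qed

lemma indicator_sep_tuples:
  assumes "bounded A"
  shows "(\<Sum>c\<in>cell_tuples m k A. indicator (\<Pi>\<^sub>E i\<in>{..<k}. A \<inter> cell m -` {c i}) z) = (indicator (sep_tuples m k A) z :: ennreal)"
proof -
  define w where "w = (\<lambda>i\<in>{..<k}. cell m (z i))"
  have "indicator (\<Pi>\<^sub>E i\<in>{..<k}. A \<inter> cell m -` {c i}) z = (if w = c then indicator (sep_tuples m k A) z else (0::ennreal))"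
    if "c \<in> cell_tuples m k A" for c
    unfolding indicator_def sep_tuples_iff[OF order_refl that] w_def[symmetric] by simp
  then have "(\<Sum>c\<in>cell_tuples m k A. indicator (\<Pi>\<^sub>E i\<in>{..<k}. A \<inter> cell m -` {c i}) z)
      = (\<Sum>c\<in>cell_tuples m k A. if w = c then indicator (sep_tuples m k A) z else (0::ennreal))"
    by (rule sum.cong[OF refl])
  also have "\<dots> = (if w \<in> cell_tuples m k A then indicator (sep_tuples m k A) z else 0)"
    by (rule sum.delta'[OF finite_cell_tuples[OF assms]])
  also have "\<dots> = indicator (sep_tuples m k A) z"
    using cell_tuples_of_sep[OF order_refl, of z m k A] unfolding w_def[symmetric] by (auto simp: indicator_def)
  finally show ?thesis .
qed

lemma sep_tuples_mono: "m \<le> n \<Longrightarrow> sep_tuples m k A \<subseteq> sep_tuples n k A"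
proof
  fix z assume mn: "m \<le> n" and z: "z \<in> sep_tuples m k A"
  have "inj_on (\<lambda>i. cell n (z i)) {..<k}"
  proof (rule inj_onI)
    fix i j assume "i \<in> {..<k}" "j \<in> {..<k}" "cell n (z i) = cell n (z j)"
    moreover from this(3) have "cell m (z i) = cell m (z j)" by (rule cell_mono[OF mn])
    moreover have "inj_on (\<lambda>i. cell m (z i)) {..<k}" using z unfolding sep_tuples_def by blast
    ultimately show "i = j" by (metis inj_onD)
  qed
  with z show "z \<in> sep_tuples n k A" unfolding sep_tuples_def by blast
qed

lemma sep_tuples_eventually:
  assumes "z \<in> {..<k} \<rightarrow>\<^sub>E A" "inj_on z {..<k}"
  shows "\<forall>\<^sub>F m in sequentially. z \<in> sep_tuples m k A"
proof -
  have "\<forall>\<^sub>F m in sequentially. cell m (z i) \<noteq> cell m (z j)" if ij: "i < k" "j < k" "i \<noteq> j" for i j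
  proof -
    obtain m where m: "cell m (z i) \<noteq> cell m (z j)"
      using cell_separates[of "z i" "z j"] inj_onD[OF assms(2), of i j] ij by (metis lessThan_iff)
    show ?thesis
      using eventually_ge_at_top[of m] by eventually_elim (use m cell_mono in blast)
  qed
  then have "\<forall>\<^sub>F m in sequentially. \<forall>i\<in>{..<k}. \<forall>j\<in>{..<k}. i \<noteq> j \<longrightarrow> cell m (z i) \<noteq> cell m (z j)"
    by (intro eventually_ball_finite ballI) (auto intro: eventually_mono)
  then show ?thesis
    by eventually_elim (use assms(1) in \<open>auto simp: sep_tuples_def inj_on_def\<close>)
qed

lemma sep_tuples_inj:
  assumes "z \<in> sep_tuples m k A"
  shows "z \<in> {..<k} \<rightarrow>\<^sub>E A \<and> inj_on z {..<k}"
proof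
  note z = assms
  then have "inj_on (cell m \<circ> z) {..<k}" by (simp add: sep_tuples_def comp_def)
  then show "inj_on z {..<k}" by (rule inj_on_imageI2)
  show "z \<in> {..<k} \<rightarrow>\<^sub>E A" using z unfolding sep_tuples_def by blast
qed

lemma prod_diff_eq_fact_choose: "prod ((-) n) {0..<k} = fact k * (n choose k)" for n k :: nat
proof (induction k)
  case (Suc k)
  have "prod ((-) n) {0..<Suc k} = fact k * ((n - k) * (n choose k))"
    using Suc by (simp add: mult_ac)
  also have "(n - k) * (n choose k) = Suc k * (n choose Suc k)"
    by (metis binomial_absorb_comp binomial_absorption)
  finally show ?case by (simp add: algebra_simps)
qed simp

lemma det_fun_measurable:
  assumes "\<And>i j. i < k \<Longrightarrow> j < k \<Longrightarrow> (\<lambda>x. A x i j) \<in> borel_measurable N"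
  shows "(\<lambda>x. det_fun k (A x)) \<in> borel_measurable N"
  unfolding det_fun_def
proof (intro borel_measurable_sum borel_measurable_times borel_measurable_prod borel_measurable_const)
  fix p i assume "p \<in> {p. p permutes {..<k}}" "i \<in> {..<k}"
  then show "(\<lambda>x. A x i (p i)) \<in> borel_measurable N"
    using permutes_in_image[of p "{..<k}" i] assms by auto
qed

lemma determinantal_pp_intensity:
  assumes "determinantal_pp M S K" "\<forall>i<k. A i \<in> sets borel \<and> bounded (A i)" "disjoint_family_on A {..<k}"
  shows "(\<integral>\<^sup>+\<omega>. (\<Prod>i<k. of_nat (card (S \<omega> \<inter> A i))) \<partial>M)
      = (\<integral>\<^sup>+z\<in>(\<Pi>\<^sub>E i\<in>{..<k}. A i). ennreal (Re (det_fun k (\<lambda>i j. K (z i) (z j)))) \<partial>Pi\<^sub>M {..<k} (\<lambda>_. lborel))"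
proof -
  note * = assms(1)[unfolded determinantal_pp_def, THEN conjunct2, THEN conjunct2, THEN conjunct2]
  show ?thesis using *[THEN spec[of _ k], THEN spec[of _ A], THEN mp, OF conjI[OF assms(2,3)]] .
qed

text \<open>The falling factorial of the number of points counts injective tuples of points. Tuples
  separated at level \<open>m\<close> are counted by products over disjoint cells, where the
  intensities apply; monotone convergence in \<open>m\<close> on both sides gives the claim.\<close>

lemma factorial_moment:
  assumes dpp: "determinantal_pp M S K"
    and K: "(\<lambda>p. K (fst p) (snd p)) \<in> borel_measurable (borel \<Otimes>\<^sub>M borel)"
    and A: "A \<in> sets borel" "bounded A"
  shows "(\<integral>\<^sup>+\<omega>. of_nat (fact k * (card (S \<omega> \<inter> A) choose k)) \<partial>M)
     = (\<integral>\<^sup>+z\<in>(\<Pi>\<^sub>E i\<in>{..<k}. A). ennreal (Re (det_fun k (\<lambda>i j. K (z i) (z j)))) \<partial>Pi\<^sub>M {..<k} (\<lambda>_. lborel))"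
proof -
  let ?P = "Pi\<^sub>M {..<k} (\<lambda>_. lborel :: complex measure)"
  let ?\<rho> = "\<lambda>z. ennreal (Re (det_fun k (\<lambda>i j. K (z i) (z j))))"
  let ?C = "\<lambda>m (c :: nat \<Rightarrow> int \<times> int) i. A \<inter> cell m -` {c i}"
  have meas: "(\<lambda>\<omega>. card (S \<omega> \<inter> B)) \<in> M \<rightarrow>\<^sub>M count_space UNIV" if "B \<in> sets borel" "bounded B" for B
    using dpp that unfolding determinantal_pp_def by blast
  have fin: "finite (S \<omega> \<inter> A)" if "\<omega> \<in> space M" for \<omega>
    using dpp A(2) that unfolding determinantal_pp_def by blast
  have C: "?C m c i \<in> sets borel" "bounded (?C m c i)" for m c i
    using A cell_measurable bounded_subset[OF A(2)] by auto
  have \<rho>[measurable]: "?\<rho> \<in> borel_measurable ?P"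
  proof -
    have "(\<lambda>z. K (z i) (z j)) \<in> borel_measurable ?P" if ij: "i < k" "j < k" for i j
    proof -
      have "(\<lambda>z. (z i, z j)) \<in> ?P \<rightarrow>\<^sub>M borel \<Otimes>\<^sub>M borel"
        using ij measurable_component_singleton[of i "{..<k}" "\<lambda>_. lborel :: complex measure"]
          measurable_component_singleton[of j "{..<k}" "\<lambda>_. lborel :: complex measure"]
        by (intro measurable_Pair) simp_all
      from measurable_compose[OF this K] show ?thesis by simp
    qed
    then have [measurable]: "(\<lambda>z. det_fun k (\<lambda>i j. K (z i) (z j))) \<in> borel_measurable ?P"
      by (rule det_fun_measurable)
    show ?thesis by measurable
  qed
  have PiE[measurable]: "(\<Pi>\<^sub>E i\<in>{..<k}. ?C m c i) \<in> sets ?P" for m c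
    by (rule sets_PiM_I_finite) (simp_all only: sets_lborel C finite_lessThan)
  have int_eq: "(\<integral>\<^sup>+\<omega>. of_nat (card (sep_tuples m k (S \<omega> \<inter> A))) \<partial>M) = (\<integral>\<^sup>+z. ?\<rho> z * indicator (sep_tuples m k A) z \<partial>?P)" for m
  proof -
    have "(\<integral>\<^sup>+\<omega>. of_nat (card (sep_tuples m k (S \<omega> \<inter> A))) \<partial>M)
        = (\<integral>\<^sup>+\<omega>. (\<Sum>c\<in>cell_tuples m k A. \<Prod>i<k. of_nat (card (S \<omega> \<inter> ?C m c i))) \<partial>M)"
      by (intro nn_integral_cong) (simp add: card_sep_tuples[OF A(2) fin])
    also have "\<dots> = (\<Sum>c\<in>cell_tuples m k A. \<integral>\<^sup>+\<omega>. (\<Prod>i<k. of_nat (card (S \<omega> \<inter> ?C m c i))) \<partial>M)"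
    proof (rule nn_integral_sum)
      fix c
      have "(\<lambda>\<omega>. of_nat (card (S \<omega> \<inter> ?C m c i)) :: ennreal) \<in> borel_measurable M" for i
        by (rule measurable_compose[OF meas[OF C]]) auto
      then show "(\<lambda>\<omega>. \<Prod>i<k. of_nat (card (S \<omega> \<inter> ?C m c i)) :: ennreal) \<in> borel_measurable M" by simp
    qed
    also have "\<dots> = (\<Sum>c\<in>cell_tuples m k A. \<integral>\<^sup>+z\<in>(\<Pi>\<^sub>E i\<in>{..<k}. ?C m c i). ?\<rho> z \<partial>?P)"
    proof (intro sum.cong refl)
      fix c assume c: "c \<in> cell_tuples m k A"
      then have "disjoint_family_on (?C m c) {..<k}"
        by (auto simp: disjoint_family_on_def cell_tuples_def inj_on_def)
      moreover have "\<forall>i<k. ?C m c i \<in> sets borel \<and> bounded (?C m c i)" using C by blast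
      ultimately show "(\<integral>\<^sup>+\<omega>. (\<Prod>i<k. of_nat (card (S \<omega> \<inter> ?C m c i))) \<partial>M) = (\<integral>\<^sup>+z\<in>(\<Pi>\<^sub>E i\<in>{..<k}. ?C m c i). ?\<rho> z \<partial>?P)"
        by (intro determinantal_pp_intensity[OF dpp])
    qed
    also have "\<dots> = (\<integral>\<^sup>+z. (\<Sum>c\<in>cell_tuples m k A. ?\<rho> z * indicator (\<Pi>\<^sub>E i\<in>{..<k}. ?C m c i) z) \<partial>?P)"
      by (intro nn_integral_sum[symmetric]) measurable
    also have "\<dots> = (\<integral>\<^sup>+z. ?\<rho> z * indicator (sep_tuples m k A) z \<partial>?P)"
      by (simp add: indicator_sep_tuples[OF A(2), symmetric] sum_distrib_left)
    finally show ?thesis .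
  qed
  have sep_meas[measurable]: "sep_tuples m k A \<in> sets ?P" for m
  proof -
    have "sep_tuples m k A = (\<Union>c\<in>cell_tuples m k A. \<Pi>\<^sub>E i\<in>{..<k}. ?C m c i)"
      by (rule sep_tuples_eq_UN) simp
    then show ?thesis using finite_cell_tuples[OF A(2)] PiE by (auto intro!: sets.finite_UN)
  qed
  have lim1: "(\<lambda>m. \<integral>\<^sup>+\<omega>. of_nat (card (sep_tuples m k (S \<omega> \<inter> A))) * indicator (space M) \<omega> \<partial>M) \<longlonglongrightarrow>
      (\<integral>\<^sup>+\<omega>. of_nat (fact k * (card (S \<omega> \<inter> A) choose k)) * indicator (space M) \<omega> \<partial>M)"
  proof (rule nn_integral_LIMSEQ)
    have fin_sep: "finite (sep_tuples m k (S \<omega> \<inter> A))" if "\<omega> \<in> space M" for m \<omega>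
      using fin[OF that] unfolding sep_tuples_def by (auto intro!: finite_PiE)
    show "incseq (\<lambda>m \<omega>. of_nat (card (sep_tuples m k (S \<omega> \<inter> A))) * indicator (space M) \<omega> :: ennreal)"
      unfolding incseq_def le_fun_def
      by (auto intro!: card_mono fin_sep sep_tuples_mono split: split_indicator)
    show "(\<lambda>\<omega>. of_nat (card (sep_tuples m k (S \<omega> \<inter> A))) * indicator (space M) \<omega> :: ennreal) \<in> borel_measurable M" for m
    proof -
      have "(\<lambda>\<omega>. of_nat (card (S \<omega> \<inter> ?C m c i)) :: ennreal) \<in> borel_measurable M" for i c
        by (rule measurable_compose[OF meas[OF C]]) auto
      then have "(\<lambda>\<omega>. (\<Sum>c\<in>cell_tuples m k A. \<Prod>i<k. of_nat (card (S \<omega> \<inter> ?C m c i))) :: ennreal) \<in> borel_measurable M" by simp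
      then show ?thesis
        by (subst measurable_cong[where g="\<lambda>\<omega>. (\<Sum>c\<in>cell_tuples m k A. \<Prod>i<k. of_nat (card (S \<omega> \<inter> ?C m c i)))"])
           (simp_all add: card_sep_tuples[OF A(2) fin])
    qed
    show "(\<lambda>m. of_nat (card (sep_tuples m k (S \<omega> \<inter> A))) * indicator (space M) \<omega> :: ennreal) \<longlonglongrightarrow>
        of_nat (fact k * (card (S \<omega> \<inter> A) choose k)) * indicator (space M) \<omega>" for \<omega>
    proof (cases "\<omega> \<in> space M")
      case True
      let ?X = "{f \<in> {..<k} \<rightarrow>\<^sub>E (S \<omega> \<inter> A). inj_on f {..<k}}"
      have finX: "finite ?X" using fin[OF True] by (auto intro!: finite_PiE)
      have "\<forall>\<^sub>F m in sequentially. \<forall>f\<in>?X. f \<in> sep_tuples m k (S \<omega> \<inter> A)"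
        by (intro eventually_ball_finite finX ballI sep_tuples_eventually) auto
      then have "\<forall>\<^sub>F m in sequentially. sep_tuples m k (S \<omega> \<inter> A) = ?X"
        by eventually_elim (use sep_tuples_inj in blast)
      then have "\<forall>\<^sub>F m in sequentially. of_nat (card (sep_tuples m k (S \<omega> \<inter> A))) * indicator (space M) \<omega>
          = (of_nat (fact k * (card (S \<omega> \<inter> A) choose k)) * indicator (space M) \<omega> :: ennreal)"
      proof eventually_elim
        case (elim m)
        have "card ?X = fact k * (card (S \<omega> \<inter> A) choose k)"
          using card_inj_on_subset_funcset[of "{..<k}" "S \<omega> \<inter> A" "{..<k}"] fin[OF True]
          by (simp add: prod_diff_eq_fact_choose)
        then show ?case unfolding elim by simp
      qed
      then show ?thesis by (rule tendsto_eventually)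
    qed simp
  qed
  have lim2: "(\<lambda>m. \<integral>\<^sup>+z. ?\<rho> z * indicator (sep_tuples m k A) z \<partial>?P) \<longlonglongrightarrow> (\<integral>\<^sup>+z. ?\<rho> z * indicator (\<Pi>\<^sub>E i\<in>{..<k}. A) z \<partial>?P)"
  proof (rule nn_integral_LIMSEQ)
    show "incseq (\<lambda>m z. ?\<rho> z * indicator (sep_tuples m k A) z)"
      unfolding incseq_def le_fun_def
    proof (intro allI impI mult_left_mono)
      fix m n and z :: "nat \<Rightarrow> complex" assume "m \<le> (n :: nat)"
      from sep_tuples_mono[OF this, of k A] show "indicator (sep_tuples m k A) z \<le> (indicator (sep_tuples n k A) z :: ennreal)"
        by (auto simp: indicator_def)
    qed simp
    show "(\<lambda>z. ?\<rho> z * indicator (sep_tuples m k A) z) \<in> borel_measurable ?P" for m by measurable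
    show "(\<lambda>m. ?\<rho> z * indicator (sep_tuples m k A) z) \<longlonglongrightarrow> ?\<rho> z * indicator (\<Pi>\<^sub>E i\<in>{..<k}. A) z" for z
    proof (cases "z \<in> {..<k} \<rightarrow>\<^sub>E A \<and> inj_on z {..<k}")
      case True
      then have "\<forall>\<^sub>F m in sequentially. z \<in> sep_tuples m k A"
        by (intro sep_tuples_eventually) simp_all
      then have "\<forall>\<^sub>F m in sequentially. ?\<rho> z * indicator (sep_tuples m k A) z = ?\<rho> z * indicator (\<Pi>\<^sub>E i\<in>{..<k}. A) z"
        by eventually_elim (use True in \<open>simp add: indicator_def\<close>)
      then show ?thesis by (rule tendsto_eventually)
    next
      case False
      then have z: "z \<notin> sep_tuples m k A" for m using sep_tuples_inj by blast
      \<comment> \<open>The integral over the full product includes tuples with repetitions, which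
        are never separated. They contribute nothing because two rows of the determinant
        agree.\<close>
      have zz: "?\<rho> z * indicator (\<Pi>\<^sub>E i\<in>{..<k}. A) z = 0"
        using False det_fun_not_inj[of z k K]
        by (cases "inj_on z {..<k}") (auto split: split_indicator)
      show ?thesis unfolding zz using z by simp
    qed
  qed
  have eqs: "(\<integral>\<^sup>+\<omega>. f \<omega> * indicator (space M) \<omega> \<partial>M) = (\<integral>\<^sup>+\<omega>. f \<omega> \<partial>M)" for f
    by (intro nn_integral_cong) auto
  show ?thesis
    using lim1 lim2 unfolding eqs int_eq by (rule LIMSEQ_unique)
qed

lemma phi_1_mult_cnj:
  "phi 1 a z * cnj (phi 1 a w) = of_real (1 / pi * (exp (- (cmod z)\<^sup>2 / 2) * exp (- (cmod w)\<^sup>2 / 2))) * ((z * cnj w) ^ a /\<^sub>R fact a)"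
proof -
  define s where "s = sqrt (1 / (pi * fact a))"
  have s: "s * s = 1 / (pi * fact a)" by (simp add: s_def)
  have phi: "phi 1 a z = of_real (s * exp (- (cmod z)\<^sup>2 / 2)) * z ^ a" for z
    by (simp add: phi_def s_def)
  have "phi 1 a z * cnj (phi 1 a w) = of_real ((s * s) * (exp (- (cmod z)\<^sup>2 / 2) * exp (- (cmod w)\<^sup>2 / 2))) * (z * cnj w) ^ a"
    unfolding phi by (simp add: power_mult_distrib mult_ac)
  also have "\<dots> = of_real (1 / pi * (exp (- (cmod z)\<^sup>2 / 2) * exp (- (cmod w)\<^sup>2 / 2))) * (of_real (inverse (fact a)) * (z * cnj w) ^ a)"
  proof -
    have "1 / (pi * fact a) * e = 1 / pi * e * inverse (fact a)" for e :: real
      by (simp add: field_simps)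
    then show ?thesis unfolding s by (simp only: of_real_mult mult.assoc)
  qed
  finally show ?thesis unfolding scaleR_conv_of_real .
qed

lemma part_kernel_tendsto: "(\<lambda>n. part_kernel n (phi 1) z w) \<longlonglongrightarrow> ginibre_kernel z w"
proof -
  let ?c = "of_real (1 / pi * (exp (- (cmod z)\<^sup>2 / 2) * exp (- (cmod w)\<^sup>2 / 2))) :: complex"
  have "(\<lambda>a. phi 1 a z * cnj (phi 1 a w)) sums (?c * exp (z * cnj w))"
    unfolding phi_1_mult_cnj by (intro sums_mult exp_converges)
  also have "?c * exp (z * cnj w) = ginibre_kernel z w"
  proof -
    have 1: "exp (- (cmod z)\<^sup>2 / 2) * exp (- (cmod w)\<^sup>2 / 2) = exp (- ((cmod z)\<^sup>2 / 2 + (cmod w)\<^sup>2 / 2))"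
      by (simp flip: exp_add)
    have 2: "exp (z * cnj w - of_real x) = of_real (exp (- x)) * exp (z * cnj w)" for x :: real
      by (simp add: exp_diff exp_minus exp_of_real field_simps)
    show ?thesis unfolding ginibre_kernel_def 1 2 of_real_mult by (simp only: mult.assoc)
  qed
  finally show ?thesis unfolding part_kernel_def sums_def .
qed

lemma cmod_part_kernel_le: "cmod (part_kernel n (phi 1) z w) \<le> 1 / pi"
proof -
  have "cmod (part_kernel n (phi 1) z w) \<le> (\<Sum>a<n. cmod (phi 1 a z) * cmod (phi 1 a w))"
    unfolding part_kernel_def by (rule order_trans[OF norm_sum]) (simp add: norm_mult)
  also have "\<dots> \<le> (\<Sum>a<n. ((cmod (phi 1 a z))\<^sup>2 + (cmod (phi 1 a w))\<^sup>2) / 2)"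
  proof (intro sum_mono)
    fix a
    have "0 \<le> (cmod (phi 1 a z) - cmod (phi 1 a w))\<^sup>2" by simp
    then show "cmod (phi 1 a z) * cmod (phi 1 a w) \<le> ((cmod (phi 1 a z))\<^sup>2 + (cmod (phi 1 a w))\<^sup>2) / 2"
      by (simp add: power2_diff)
  qed
  also have "\<dots> = ((\<Sum>a<n. (cmod (phi 1 a z))\<^sup>2) + (\<Sum>a<n. (cmod (phi 1 a w))\<^sup>2)) / 2"
    by (simp add: sum.distrib flip: sum_divide_distrib)
  also have "\<dots> \<le> (1 / pi + 1 / pi) / 2"
    using sum_cmod_phi_sq_le[of 1 z n] sum_cmod_phi_sq_le[of 1 w n] by (intro divide_right_mono add_mono) auto
  finally show ?thesis by simp
qed

lemma cmod_det_fun_le: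
  assumes "\<And>i j. cmod (A i j) \<le> B"
  shows "cmod (det_fun k A) \<le> fact k * B ^ k"
proof -
  have B: "0 \<le> B" using assms[of 0 0] norm_ge_zero order_trans by blast
  have "cmod (det_fun k A) \<le> (\<Sum>p | p permutes {..<k}. B ^ k)"
    unfolding det_fun_def
  proof (rule order_trans[OF norm_sum], intro sum_mono)
    fix p :: "nat \<Rightarrow> nat"
    have "cmod (of_int (sign p) * (\<Prod>i<k. A i (p i))) = (\<Prod>i<k. cmod (A i (p i)))"
      by (simp add: norm_mult prod_norm sign_def)
    also have "\<dots> \<le> (\<Prod>i<k. B)" by (intro prod_mono) (auto simp: assms)
    finally show "cmod (of_int (sign p) * (\<Prod>i<k. A i (p i))) \<le> B ^ k" by simp
  qed
  also have "\<dots> = fact k * B ^ k"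
    using card_permutations[of "{..<k}" k] by simp
  finally show ?thesis .
qed

text \<open>The k-th factorial moment of the number of points in \<open>A\<close> for the process
  with the kernel cut off at \<open>n\<close> functions; \<open>trunc_moment_eq_integral\<close>
  shows it as the integral of the correlation function.\<close>

definition trunc_moment :: "complex set \<Rightarrow> nat \<Rightarrow> nat \<Rightarrow> real" where
  "trunc_moment A n k = Re (\<Sum>a\<in>{..<k} \<rightarrow>\<^sub>E {..<n}. det_fun k (\<lambda>i j. gram (indicator A) (phi 1) (a i) (a j)))"

lemma trunc_moment_eq_integral:
  assumes A[measurable]: "A \<in> sets borel"
  shows "integrable (Pi\<^sub>M {..<k} (\<lambda>_. lborel)) (\<lambda>z. (\<Prod>i<k. indicator A (z i)) * Re (det_fun k (\<lambda>i j. part_kernel n (phi 1) (z i) (z j))))"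
    and "trunc_moment A n k = (\<integral>z. (\<Prod>i<k. indicator A (z i)) * Re (det_fun k (\<lambda>i j. part_kernel n (phi 1) (z i) (z j))) \<partial>Pi\<^sub>M {..<k} (\<lambda>_. lborel))"
proof -
  have int: "integrable lborel (\<lambda>z. of_real (indicator A z) * phi 1 a z * cnj (phi 1 b z))" for a b
    by (rule integrable_phi[where B=1]) (auto split: split_indicator)
  note I = integral_det_part_kernel[where h="indicator A" and \<phi>="phi 1" and k=k and n=n, OF int]
  have eq: "(\<Prod>i<k. of_real (indicator A (z i))) * det_fun k (\<lambda>i j. part_kernel n (phi 1) (z i) (z j))
      = complex_of_real ((\<Prod>i<k. indicator A (z i)) * Re (det_fun k (\<lambda>i j. part_kernel n (phi 1) (z i) (z j))))" for z
    using det_part_kernel_nonneg(2)[of k n "phi 1" z] by (simp add: complex_eq_iff)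
  show "integrable (Pi\<^sub>M {..<k} (\<lambda>_. lborel)) (\<lambda>z. (\<Prod>i<k. indicator A (z i)) * Re (det_fun k (\<lambda>i j. part_kernel n (phi 1) (z i) (z j))))"
    using integrable_Re[OF I(1)[unfolded eq]] by (simp only: Re_complex_of_real)
  show "trunc_moment A n k = (\<integral>z. (\<Prod>i<k. indicator A (z i)) * Re (det_fun k (\<lambda>i j. part_kernel n (phi 1) (z i) (z j))) \<partial>Pi\<^sub>M {..<k} (\<lambda>_. lborel))"
    unfolding trunc_moment_def I(2)[symmetric] eq integral_complex_of_real by simp
qed

lemma trunc_moment_nonneg:
  assumes "A \<in> sets borel"
  shows "0 \<le> trunc_moment A n k"
  unfolding trunc_moment_eq_integral(2)[OF assms]
proof (rule integral_nonneg_AE, rule AE_I2)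
  fix z :: "nat \<Rightarrow> complex"
  show "0 \<le> (\<Prod>i<k. indicator A (z i)) * Re (det_fun k (\<lambda>i j. part_kernel n (phi 1) (z i) (z j)))"
    by (rule mult_nonneg_nonneg[OF prod_nonneg det_part_kernel_nonneg(1)]) simp
qed

lemma det_fun_tendsto:
  assumes "\<And>i j. ((\<lambda>n. A n i j) \<longlongrightarrow> B i j) F"
  shows "((\<lambda>n. det_fun k (A n)) \<longlongrightarrow> det_fun k B) F"
  unfolding det_fun_def by (intro tendsto_intros assms)

text \<open>Every truncated kernel is bounded by 1/pi, so the determinants are bounded by k! pi^-k
  uniformly in \<open>n\<close>, and dominated convergence applies over a product of bounded
  sets.\<close>

lemma trunc_moment_tendsto:
  assumes A[measurable]: "A \<in> sets borel" and bA: "bounded A"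
  obtains F where "0 \<le> F" "(\<lambda>n. trunc_moment A n k) \<longlonglongrightarrow> F"
    "(\<integral>\<^sup>+z\<in>(\<Pi>\<^sub>E i\<in>{..<k}. A). ennreal (Re (det_fun k (\<lambda>i j. ginibre_kernel (z i) (z j)))) \<partial>Pi\<^sub>M {..<k} (\<lambda>_. lborel)) = ennreal F"
proof -
  let ?P = "Pi\<^sub>M {..<k} (\<lambda>_. lborel :: complex measure)"
  let ?w = "\<lambda>z. \<Prod>i<k. indicator A (z i) :: real"
  let ?s = "\<lambda>n z. ?w z * Re (det_fun k (\<lambda>i j. part_kernel n (phi 1) (z i) (z j)))"
  let ?f = "\<lambda>z. ?w z * Re (det_fun k (\<lambda>i j. ginibre_kernel (z i) (z j)))"
  have lim: "(\<lambda>n. ?s n z) \<longlonglongrightarrow> ?f z" for z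
    by (intro tendsto_intros tendsto_Re det_fun_tendsto part_kernel_tendsto)
  have fin: "emeasure lborel A < \<infinity>"
    using bA emeasure_bounded_finite by blast
  have intA: "integrable lborel (indicator A :: complex \<Rightarrow> real)"
    using fin by (intro integrable_real_indicator) auto
  have intw: "integrable ?P (\<lambda>z. ?w z * (fact k * (1 / pi) ^ k))"
    by (intro integrable_mult_left plane.product_integrable_prod finite_lessThan intA)
  have ints: "?s n \<in> borel_measurable ?P" for n
    using trunc_moment_eq_integral(1)[OF A, of k n] by (rule borel_measurable_integrable)
  have mf: "?f \<in> borel_measurable ?P"
    by (rule borel_measurable_LIMSEQ_real[OF lim ints])
  have bound: "AE z in ?P. norm (?s n z) \<le> ?w z * (fact k * (1 / pi) ^ k)" for n
  proof (rule AE_I2)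
    fix z
    have w: "0 \<le> ?w z" by (intro prod_nonneg) auto
    have "\<bar>Re (det_fun k (\<lambda>i j. part_kernel n (phi 1) (z i) (z j)))\<bar> \<le> fact k * (1 / pi) ^ k"
      by (rule order_trans[OF abs_Re_le_cmod cmod_det_fun_le[OF cmod_part_kernel_le]])
    then show "norm (?s n z) \<le> ?w z * (fact k * (1 / pi) ^ k)"
      using w by (simp add: abs_mult mult_left_mono)
  qed
  have f0: "0 \<le> ?f z" for z
    by (rule LIMSEQ_le_const[OF lim])
       (auto intro!: mult_nonneg_nonneg prod_nonneg det_part_kernel_nonneg(1))
  have intf: "integrable ?P ?f"
    by (rule integrable_dominated_convergence[where s="?s", OF mf ints intw AE_I2[OF lim] bound])
  have "(\<lambda>n. \<integral>z. ?s n z \<partial>?P) \<longlonglongrightarrow> (\<integral>z. ?f z \<partial>?P)"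
    by (rule integral_dominated_convergence[where s="?s", OF mf ints intw AE_I2[OF lim] bound])
  moreover have "0 \<le> (\<integral>z. ?f z \<partial>?P)" by (intro integral_nonneg_AE AE_I2 f0)
  moreover have "(\<integral>\<^sup>+z\<in>(\<Pi>\<^sub>E i\<in>{..<k}. A). ennreal (Re (det_fun k (\<lambda>i j. ginibre_kernel (z i) (z j)))) \<partial>?P) = (\<integral>\<^sup>+z. ennreal (?f z) \<partial>?P)"
  proof (intro nn_integral_cong)
    fix z assume "z \<in> space ?P"
    then have "z \<in> extensional {..<k}" by (auto simp: space_PiM PiE_def)
    then have "z \<in> (\<Pi>\<^sub>E i\<in>{..<k}. A) \<longleftrightarrow> (\<forall>i\<in>{..<k}. z i \<in> A)" by (auto simp: PiE_def)
    moreover have "?w z = (if \<forall>i\<in>{..<k}. z i \<in> A then 1 else 0)"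
      by (auto intro!: prod.neutral prod_zero simp: indicator_def)
    ultimately show "ennreal (Re (det_fun k (\<lambda>i j. ginibre_kernel (z i) (z j)))) * indicator (\<Pi>\<^sub>E i\<in>{..<k}. A) z = ennreal (?f z)"
      by (simp add: indicator_def)
  qed
  ultimately show ?thesis
    by (intro that[of "\<integral>z. ?f z \<partial>?P"]) (simp_all add: trunc_moment_eq_integral(2)[OF A] nn_integral_eq_integral[OF intf] f0)
qed

text \<open>Two factors r from the functions match the area factor r^2 of the substitution.\<close>

lemma gram_scale:
  assumes r: "0 < r" and [measurable]: "U \<in> sets borel" "(\<lambda>z. of_real r * z) ` U \<in> sets borel"
  shows "gram (indicator ((\<lambda>z. of_real r * z) ` U)) (phi 1) a b = gram (indicator U) (phi r) a b"
proof -
  let ?A = "(\<lambda>z. of_real r * z) ` U"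
  have ind: "indicator ?A (of_real r * z) = (indicator U z :: real)" for z
    using r by (auto simp: indicator_def)
  have ph: "of_real r * phi 1 a (of_real r * z) = phi r a z" for a z
  proof -
    have "sqrt (r ^ (2 * a + 2) / (pi * fact a)) = r ^ Suc a * sqrt (1 / (pi * fact a))"
    proof -
      have "r ^ (2 * a + 2) = (r ^ Suc a)\<^sup>2" 
        unfolding power_mult[symmetric] by (rule arg_cong[where f="(^) r"]) simp
      then show ?thesis using r by (simp add: real_sqrt_divide)
    qed
    then show ?thesis
      using r by (simp add: phi_def norm_mult power_mult_distrib mult_ac)
  qed
  have "gram (indicator ?A) (phi 1) a b
     = of_real (r\<^sup>2) * (\<integral>z. of_real (indicator ?A (0 + of_real r * z)) * phi 1 a (0 + of_real r * z) * cnj (phi 1 b (0 + of_real r * z)) \<partial>lborel)"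
    unfolding gram_def using r by (intro integral_scale) auto
  also have "\<dots> = (\<integral>z. of_real (r\<^sup>2) * (of_real (indicator U z) * phi 1 a (of_real r * z) * cnj (phi 1 b (of_real r * z))) \<partial>lborel)"
    by (simp add: ind)
  also have "\<dots> = gram (indicator U) (phi r) a b"
    unfolding gram_def by (intro Bochner_Integration.integral_cong refl)
      (simp add: ph[symmetric] power2_eq_square mult_ac)
  finally show ?thesis .
qed

lemma trunc_moment_series:
  assumes r: "0 < r" and [measurable]: "U \<in> sets borel" "(\<lambda>z. of_real r * z) ` U \<in> sets borel"
  shows "Re (det_fun n (\<lambda>i j. (if i = j then 1 else 0) + of_real t * gram (indicator U) (phi r) i j))
     = (\<Sum>k\<le>n. t ^ k / fact k * trunc_moment ((\<lambda>z. of_real r * z) ` U) n k)"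
proof -
  have e: "of_real t ^ k / fact k = (of_real (t ^ k / fact k) :: complex)" for k by simp
  show ?thesis
    unfolding det_fun_one_plus_series gram_scale[OF r assms(2,3), symmetric] e trunc_moment_def Re_sum
    by (intro sum.cong refl) (simp only: Re_complex_of_real_mult Re_sum)
qed

lemma trunc_moment_eq_0:
  assumes "n < k"
  shows "trunc_moment A n k = 0"
proof -
  have "det_fun k (\<lambda>i j. gram (indicator A) (phi 1) (a i) (a j)) = 0" if "a \<in> {..<k} \<rightarrow>\<^sub>E {..<n}" for a
  proof (rule det_fun_not_inj)
    show "\<not> inj_on a {..<k}"
    proof
      assume "inj_on a {..<k}"
      moreover have "a ` {..<k} \<subseteq> {..<n}" using that by blast
      ultimately show False using card_inj_on_le[of a "{..<k}" "{..<n}"] assms by simp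
    qed
  qed
  then show ?thesis unfolding trunc_moment_def by simp
qed

text \<open>Inclusion-exclusion on both sides. The indicator of X = 0 is the alternating sum of the
  binomials \<open>X choose k\<close>, and the hole determinant has the same expansion with
  truncated moments. The generating function at 2 yields geometric decay, which justifies both
  limits.\<close>

lemma hole_det_tendsto:
  assumes dpp: "determinantal_pp M S ginibre_kernel"
    and r: "0 < r" and U[measurable]: "U \<in> sets borel" "(\<lambda>z. of_real r * z) ` U \<in> sets borel" and U1: "U \<subseteq> cball 0 1"
  shows "(\<lambda>n. hole_det r U n) \<longlonglongrightarrow> measure M {\<omega>\<in>space M. S \<omega> \<inter> ((\<lambda>z. of_real r * z) ` U) = {}}"
proof -
  let ?A = "(\<lambda>z. of_real r * z) ` U"
  interpret prob_space M by (rule dpp[unfolded determinantal_pp_def, THEN conjunct1])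
  have bA: "bounded ?A"
    by (rule bounded_subset[of "cball 0 r"]) (use U1 r in \<open>auto simp: norm_mult mult_left_le\<close>)
  define X where "X \<omega> = card (S \<omega> \<inter> ?A)" for \<omega>
  have X[measurable]: "X \<in> M \<rightarrow>\<^sub>M count_space UNIV"
    unfolding X_def
    by (rule dpp[unfolded determinantal_pp_def, THEN conjunct2, THEN conjunct2, THEN conjunct1, rule_format, OF U(2) bA])
  have fin: "finite (S \<omega> \<inter> ?A)" if "\<omega> \<in> space M" for \<omega>
    by (rule dpp[unfolded determinantal_pp_def, THEN conjunct2, THEN conjunct1, rule_format, OF that bA])
  have "\<forall>k. \<exists>F. 0 \<le> F \<and> (\<lambda>n. trunc_moment ?A n k) \<longlonglongrightarrow> F \<and>
     (\<integral>\<^sup>+z\<in>(\<Pi>\<^sub>E i\<in>{..<k}. ?A). ennreal (Re (det_fun k (\<lambda>i j. ginibre_kernel (z i) (z j)))) \<partial>Pi\<^sub>M {..<k} (\<lambda>_. lborel)) = ennreal F"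
  proof
    fix k
    obtain F where "0 \<le> F" "(\<lambda>n. trunc_moment ?A n k) \<longlonglongrightarrow> F"
      "(\<integral>\<^sup>+z\<in>(\<Pi>\<^sub>E i\<in>{..<k}. ?A). ennreal (Re (det_fun k (\<lambda>i j. ginibre_kernel (z i) (z j)))) \<partial>Pi\<^sub>M {..<k} (\<lambda>_. lborel)) = ennreal F"
      by (rule trunc_moment_tendsto[OF U(2) bA])
    then show "\<exists>F. 0 \<le> F \<and> (\<lambda>n. trunc_moment ?A n k) \<longlonglongrightarrow> F \<and>
     (\<integral>\<^sup>+z\<in>(\<Pi>\<^sub>E i\<in>{..<k}. ?A). ennreal (Re (det_fun k (\<lambda>i j. ginibre_kernel (z i) (z j)))) \<partial>Pi\<^sub>M {..<k} (\<lambda>_. lborel)) = ennreal F"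
      by (intro exI[of _ F] conjI)
  qed
  then obtain F where F': "\<forall>k. 0 \<le> F k \<and> (\<lambda>n. trunc_moment ?A n k) \<longlonglongrightarrow> F k \<and>
     (\<integral>\<^sup>+z\<in>(\<Pi>\<^sub>E i\<in>{..<k}. ?A). ennreal (Re (det_fun k (\<lambda>i j. ginibre_kernel (z i) (z j)))) \<partial>Pi\<^sub>M {..<k} (\<lambda>_. lborel)) = ennreal (F k)"
    by (rule choice[THEN exE])
  note F = F'[THEN spec, THEN conjunct1] F'[THEN spec, THEN conjunct2, THEN conjunct1] F'[THEN spec, THEN conjunct2, THEN conjunct2]
  have K: "(\<lambda>p. ginibre_kernel (fst p) (snd p)) \<in> borel_measurable (borel \<Otimes>\<^sub>M borel)"
    unfolding ginibre_kernel_def by measurable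
  have EX: "(\<integral>\<^sup>+\<omega>. ennreal (real (X \<omega> choose k)) \<partial>M) = ennreal (F k / fact k)" for k
  proof -
    have "ennreal (fact k) * (\<integral>\<^sup>+\<omega>. ennreal (real (X \<omega> choose k)) \<partial>M) = (\<integral>\<^sup>+\<omega>. of_nat (fact k * (X \<omega> choose k)) \<partial>M)"
      by (subst nn_integral_cmult[symmetric]) (auto simp: ennreal_of_nat_eq_real_of_nat ennreal_mult intro!: nn_integral_cong)
    also have "\<dots> = ennreal (F k)"
      unfolding X_def using factorial_moment[OF dpp K U(2) bA, of k] F(3)[of k] by simp
    also have "\<dots> = ennreal (fact k) * ennreal (F k / fact k)"
      using F(1)[of k] by (simp add: ennreal_mult[symmetric])
    finally show ?thesis
      by (subst (asm) ennreal_mult_cancel_left) auto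
  qed
  \<comment> \<open>One term of a sum of nonnegative terms is at most the whole sum. Any base above
    1 in place of 2 would give a summable bound.\<close>
  have bnd: "trunc_moment ?A n k / fact k \<le> exp (2 * r\<^sup>2) * (1 / 2) ^ k" for n k
  proof (cases "k \<le> n")
    case True
    have "2 ^ k / fact k * trunc_moment ?A n k \<le> (\<Sum>k\<le>n. 2 ^ k / fact k * trunc_moment ?A n k)"
      using True by (intro member_le_sum mult_nonneg_nonneg divide_nonneg_nonneg trunc_moment_nonneg[OF U(2)]) auto
    also have "\<dots> \<le> exp (2 * r\<^sup>2)"
      using det_one_plus_gram_le[OF r U(1) U1, of 2 n] unfolding trunc_moment_series[OF r U] by simp
    finally show ?thesis by (simp add: field_simps power_divide)
  next
    case False
    then show ?thesis by (simp add: trunc_moment_eq_0)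
  qed
  have Fb: "F k / fact k \<le> exp (2 * r\<^sup>2) * (1 / 2) ^ k" for k
    by (rule LIMSEQ_le_const2[OF tendsto_divide[OF F(2) tendsto_const]]) (use bnd in auto)
  have sM: "summable (\<lambda>k. exp (2 * r\<^sup>2) * (1 / 2 :: real) ^ k)"
    by (intro summable_mult summable_geometric) auto
  have lim1: "(\<lambda>n. \<Sum>k. (- 1) ^ k * (trunc_moment ?A n k / fact k)) \<longlonglongrightarrow> (\<Sum>k. (- 1) ^ k * (F k / fact k))"
  proof -
    have "(\<lambda>n. (- 1) ^ k * (trunc_moment ?A n k / fact k)) \<longlonglongrightarrow> (- 1) ^ k * (F k / fact k)" for k
      by (intro tendsto_intros F(2)) auto
    moreover have "\<forall>\<^sub>F (k, n) in at_top \<times>\<^sub>F sequentially. norm ((- 1) ^ k * (trunc_moment ?A n k / fact k)) \<le> exp (2 * r\<^sup>2) * (1 / 2) ^ k"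
      by (rule always_eventually) (use bnd trunc_moment_nonneg[OF U(2)] in \<open>auto simp: abs_mult power_abs\<close>)
    ultimately show ?thesis
      using tannerys_theorem[where a="\<lambda>k n. (- 1) ^ k * (trunc_moment ?A n k / fact k)" and F=sequentially and M="\<lambda>k. exp (2 * r\<^sup>2) * (1 / 2) ^ k"] sM
      by simp
  qed
  have hd: "hole_det r U n = (\<Sum>k. (- 1) ^ k * (trunc_moment ?A n k / fact k))" for n
  proof -
    have "hole_det r U n = (\<Sum>k\<le>n. (- 1) ^ k / fact k * trunc_moment ?A n k)"
      unfolding hole_det_one_minus[OF r U(1)] using trunc_moment_series[OF r U, of n "-1"] by simp
    also have "\<dots> = (\<Sum>k. (- 1) ^ k * (trunc_moment ?A n k / fact k))"
      by (subst suminf_finite[of "{..n}"]) (auto simp: trunc_moment_eq_0)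
    finally show ?thesis .
  qed
  have "(\<lambda>m. \<integral>\<omega>. (\<Sum>k<m. (- 1) ^ k * real (X \<omega> choose k)) \<partial>M) \<longlonglongrightarrow> (\<integral>\<omega>. indicator {\<omega>\<in>space M. X \<omega> = 0} \<omega> \<partial>M)"
  proof (rule integral_dominated_convergence)
    \<comment> \<open>The alternating partial sums are dominated by the sum of all binomials, which
      is 2^X; its mean is the sum of the moments just bounded.\<close>
    show "integrable M (\<lambda>\<omega>. 2 ^ X \<omega> :: real)"
    proof (rule integrableI_bounded)
      have "ennreal (norm (2 ^ X \<omega> :: real)) = (\<Sum>k. ennreal (real (X \<omega> choose k)))" for \<omega>
      proof -
        have "(\<Sum>k. ennreal (real (X \<omega> choose k))) = (\<Sum>k\<le>X \<omega>. ennreal (real (X \<omega> choose k)))"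
          by (rule suminf_finite) auto
        also have "\<dots> = ennreal (\<Sum>k\<le>X \<omega>. real (X \<omega> choose k))" by (subst sum_ennreal) auto
        also have "(\<Sum>k\<le>X \<omega>. real (X \<omega> choose k)) = 2 ^ X \<omega>"
          using choose_row_sum[of "X \<omega>"] by (simp flip: of_nat_sum)
        finally show ?thesis by simp
      qed
      then have "(\<integral>\<^sup>+\<omega>. ennreal (norm (2 ^ X \<omega> :: real)) \<partial>M) = (\<Sum>k. ennreal (F k / fact k))"
        by (simp add: nn_integral_suminf EX)
      also have "\<dots> \<le> (\<Sum>k. ennreal (exp (2 * r\<^sup>2) * (1 / 2) ^ k))"
        by (intro suminf_le summableI ennreal_leI Fb)
      also have "\<dots> < \<infinity>"
        using sM by (subst suminf_ennreal2) auto
      finally show "(\<integral>\<^sup>+\<omega>. ennreal (norm (2 ^ X \<omega> :: real)) \<partial>M) < \<infinity>" .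
    qed measurable
    show "AE \<omega> in M. (\<lambda>m. \<Sum>k<m. (- 1) ^ k * real (X \<omega> choose k)) \<longlonglongrightarrow> indicator {\<omega>\<in>space M. X \<omega> = 0} \<omega>"
    proof (rule AE_I2)
      fix \<omega> assume \<omega>: "\<omega> \<in> space M"
      have "(\<lambda>k. (- 1) ^ k * real (X \<omega> choose k)) sums (\<Sum>k\<le>X \<omega>. (- 1) ^ k * real (X \<omega> choose k))"
        by (rule sums_finite) auto
      also have "(\<Sum>k\<le>X \<omega>. (- 1) ^ k * real (X \<omega> choose k)) = indicator {\<omega>\<in>space M. X \<omega> = 0} \<omega>"
        using choose_alternating_sum[of "X \<omega>", where 'a=real] \<omega> by (cases "X \<omega> = 0") auto
      finally show "(\<lambda>m. \<Sum>k<m. (- 1) ^ k * real (X \<omega> choose k)) \<longlonglongrightarrow> indicator {\<omega>\<in>space M. X \<omega> = 0} \<omega>"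
        unfolding sums_def .
    qed
    show "AE \<omega> in M. norm (\<Sum>k<m. (- 1) ^ k * real (X \<omega> choose k)) \<le> 2 ^ X \<omega>" for m
    proof (rule AE_I2)
      fix \<omega>
      have "norm (\<Sum>k<m. (- 1) ^ k * real (X \<omega> choose k)) \<le> (\<Sum>k<m. real (X \<omega> choose k))"
        by (rule order_trans[OF norm_sum]) (simp add: abs_mult power_abs)
      also have "\<dots> \<le> (\<Sum>k\<in>{..<m} \<union> {..X \<omega>}. real (X \<omega> choose k))" by (intro sum_mono2) auto
      also have "\<dots> = (\<Sum>k\<le>X \<omega>. real (X \<omega> choose k))" by (intro sum.mono_neutral_right) auto
      also have "\<dots> = 2 ^ X \<omega>" using choose_row_sum[of "X \<omega>"] by (simp flip: of_nat_sum)
      finally show "norm (\<Sum>k<m. (- 1) ^ k * real (X \<omega> choose k)) \<le> 2 ^ X \<omega>" .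
    qed
  qed measurable
  moreover have "(\<integral>\<omega>. (\<Sum>k<m. (- 1) ^ k * real (X \<omega> choose k)) \<partial>M) = (\<Sum>k<m. (- 1) ^ k * (F k / fact k))" for m
  proof -
    have b: "has_bochner_integral M (\<lambda>\<omega>. real (X \<omega> choose k)) (F k / fact k)" for k
      by (rule has_bochner_integral_nn_integral) (use EX F(1) in auto)
    show ?thesis
      using has_bochner_integral_sum[of "{..<m}" M "\<lambda>k \<omega>. (- 1) ^ k * real (X \<omega> choose k)" "\<lambda>k. (- 1) ^ k * (F k / fact k)"]
        has_bochner_integral_mult_right[OF b] has_bochner_integral_integral_eq by blast
  qed
  ultimately have "(\<lambda>k. (- 1) ^ k * (F k / fact k)) sums (\<integral>\<omega>. indicator {\<omega>\<in>space M. X \<omega> = 0} \<omega> \<partial>M)"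
    unfolding sums_def by simp
  then have "(\<Sum>k. (- 1) ^ k * (F k / fact k)) = measure M {\<omega>\<in>space M. X \<omega> = 0}"
    by (simp add: sums_iff)
  also have "{\<omega>\<in>space M. X \<omega> = 0} = {\<omega>\<in>space M. S \<omega> \<inter> ?A = {}}"
  proof -
    have "X \<omega> = 0 \<longleftrightarrow> S \<omega> \<inter> ?A = {}" if "\<omega> \<in> space M" for \<omega>
      unfolding X_def by (rule card_0_eq[OF fin[OF that]])
    then show ?thesis by blast
  qed
  finally show ?thesis using lim1 unfolding hd by simp
qed

section \<open>Coulomb gas integrals: the maximum principle above, Bernstein-Markov below\<close>

section \<open>Partition functions\<close>

text \<open>The product runs over ordered pairs, so it is the squared modulus of the Vandermonde
  product. An arbitrary index set allows one particle to be split off.\<close>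

definition vd :: "nat set \<Rightarrow> (nat \<Rightarrow> complex) \<Rightarrow> real" where
  "vd I z = (\<Prod>i\<in>I. \<Prod>j\<in>I - {i}. cmod (z i - z j))"

lemma vd_nonneg: "0 \<le> vd I z"
  unfolding vd_def by (intro prod_nonneg) auto

lemma vd_insert:
  assumes "finite I" "i \<notin> I"
  shows "vd (insert i I) z = (\<Prod>j\<in>I. cmod (z i - z j))\<^sup>2 * vd I z"
proof -
  have "(\<Prod>k\<in>I. \<Prod>j\<in>insert i I - {k}. cmod (z k - z j)) = (\<Prod>k\<in>I. cmod (z i - z k) * (\<Prod>j\<in>I - {k}. cmod (z k - z j)))"
  proof (intro prod.cong refl)
    fix k assume k: "k \<in> I"
    then have "insert i I - {k} = insert i (I - {k})" using assms by auto
    then show "(\<Prod>j\<in>insert i I - {k}. cmod (z k - z j)) = cmod (z i - z k) * (\<Prod>j\<in>I - {k}. cmod (z k - z j))"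
      using assms by (simp add: norm_minus_commute)
  qed
  then have "vd (insert i I) z = (\<Prod>j\<in>I. cmod (z i - z j)) * (\<Prod>k\<in>I. cmod (z i - z k) * (\<Prod>j\<in>I - {k}. cmod (z k - z j)))"
    unfolding vd_def using assms by simp
  then show ?thesis by (simp add: vd_def prod.distrib power2_eq_square)
qed

lemma vd_cong: "(\<And>i. i \<in> I \<Longrightarrow> z i = w i) \<Longrightarrow> vd I z = vd I w"
  unfolding vd_def by (intro prod.cong refl) auto

lemma vd_remove:
  assumes "finite I" "i \<in> I"
  shows "vd I (z(i := x)) = (\<Prod>j\<in>I - {i}. cmod (x - z j))\<^sup>2 * vd (I - {i}) z"
proof -
  have "vd I (z(i := x)) = vd (insert i (I - {i})) (z(i := x))"
    using assms by (simp add: insert_absorb)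
  also have "\<dots> = (\<Prod>j\<in>I - {i}. cmod ((z(i := x)) i - (z(i := x)) j))\<^sup>2 * vd (I - {i}) (z(i := x))"
    using assms by (intro vd_insert) auto
  also have "(\<Prod>j\<in>I - {i}. cmod ((z(i := x)) i - (z(i := x)) j)) = (\<Prod>j\<in>I - {i}. cmod (x - z j))"
    by (intro prod.cong refl) auto
  also have "vd (I - {i}) (z(i := x)) = vd (I - {i}) z"
    by (intro vd_cong) auto
  finally show ?thesis .
qed

lemma vandermonde_vd: "(cmod (\<Prod>j<n. \<Prod>i<j. (z j - z i)))\<^sup>2 = vd {..<n} z"
proof (induction n)
  case 0
  show ?case by (simp add: vd_def)
next
  case (Suc n)
  have "vd {..<Suc n} z = (\<Prod>j<n. cmod (z n - z j))\<^sup>2 * vd {..<n} z"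
    unfolding lessThan_Suc by (rule vd_insert) auto
  then show ?case
    using Suc by (simp add: norm_mult power_mult_distrib prod_norm mult.commute)
qed

text \<open>The unnormalised joint density of n particles confined to \<open>F\<close>.\<close>

definition ens :: "real \<Rightarrow> complex set \<Rightarrow> nat \<Rightarrow> (nat \<Rightarrow> complex) \<Rightarrow> real" where
  "ens r F n z = (\<Prod>i<n. indicator F (z i) * exp (- (r * cmod (z i))\<^sup>2)) * vd {..<n} z"

definition partfn :: "real \<Rightarrow> complex set \<Rightarrow> nat \<Rightarrow> real" where
  "partfn r F n = (\<integral>z. ens r F n z \<partial>Pi\<^sub>M {..<n} (\<lambda>_. lborel))"

definition phi_const :: "real \<Rightarrow> nat \<Rightarrow> real" where
  "phi_const r n = (\<Prod>a<n. r ^ (2 * a + 2) / (pi * fact a))"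

lemma det_phi_eq:
  assumes r: "0 < r"
  shows "(cmod (det_fun n (\<lambda>i a. phi r a (z i))))\<^sup>2
    = phi_const r n * ((\<Prod>i<n. exp (- (r * cmod (z i))\<^sup>2)) * vd {..<n} z)"
proof -
  let ?s = "\<lambda>a. sqrt (r ^ (2 * a + 2) / (pi * fact a))"
  let ?e = "\<lambda>i. exp (- (r * cmod (z i))\<^sup>2 / 2)"
  have "det_fun n (\<lambda>i a. phi r a (z i)) = (\<Prod>a<n. of_real (?s a)) * (\<Prod>i<n. of_real (?e i)) * det_fun n (\<lambda>i a. z i ^ a)"
  proof -
    have "(\<Prod>i<n. of_real (?s (p i))) = (\<Prod>a<n. complex_of_real (?s a))" if "p permutes {..<n}" for p
      using prod.reindex_bij_betw[OF permutes_imp_bij[OF that], of "\<lambda>a. complex_of_real (?s a)"] .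
    then show ?thesis
      unfolding det_fun_def sum_distrib_left
      by (intro sum.cong refl) (simp add: phi_def prod.distrib mult_ac)
  qed
  then have "(cmod (det_fun n (\<lambda>i a. phi r a (z i))))\<^sup>2
     = (\<Prod>a<n. (cmod (of_real (?s a)))\<^sup>2) * (\<Prod>i<n. (cmod (of_real (?e i)))\<^sup>2) * (cmod (det_fun n (\<lambda>i a. z i ^ a)))\<^sup>2"
    by (simp only: norm_mult power_mult_distrib prod_norm[symmetric] prod_power_distrib)
  also have "(\<Prod>a<n. (cmod (complex_of_real (?s a)))\<^sup>2) = phi_const r n"
    unfolding phi_const_def using r by (intro prod.cong refl) (simp add: real_sqrt_pow2)
  also have "(\<Prod>i<n. (cmod (complex_of_real (?e i)))\<^sup>2) = (\<Prod>i<n. exp (- (r * cmod (z i))\<^sup>2))"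
    by (intro prod.cong refl) (simp flip: exp_of_nat_mult)
  also have "(cmod (det_fun n (\<lambda>i a. z i ^ a)))\<^sup>2 = vd {..<n} z"
    unfolding det_fun_vandermonde by (rule vandermonde_vd)
  finally show ?thesis by simp
qed

lemma phi_const_pos: "0 < r \<Longrightarrow> 0 < phi_const r n"
  unfolding phi_const_def by (intro prod_pos) auto

text \<open>By Andreief's identity, since the squared modulus of the determinant of the Ginibre
  functions is the Gaussian weight times the squared Vandermonde product, up to the constant
  \<open>phi_const\<close>.\<close>

lemma partfn_eq:
  assumes r: "0 < r" and [measurable]: "U \<in> sets borel"
  shows "integrable (Pi\<^sub>M {..<n} (\<lambda>_. lborel)) (ens r (- U) n)"
    and "fact n * hole_det r U n = phi_const r n * partfn r (- U) n"
proof -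
  have int: "integrable lborel (\<lambda>z. of_real (indicator (- U) z) * phi r a z * cnj (phi r b z))" for a b
    by (rule integrable_phi[OF r, where B=1]) (auto split: split_indicator)
  note A = andreief[where h="indicator (- U)" and \<phi>="phi r" and n=n, OF int]
  have eq: "(\<Prod>i<n. indicator (- U) (z i)) * (cmod (det_fun n (\<lambda>i a. phi r a (z i))))\<^sup>2 = phi_const r n * ens r (- U) n z" for z
    unfolding det_phi_eq[OF r] ens_def by (simp add: prod.distrib)
  have "integrable (Pi\<^sub>M {..<n} (\<lambda>_. lborel)) (\<lambda>z. (1 / phi_const r n) * (phi_const r n * ens r (- U) n z))"
    using A(1) unfolding eq by (rule integrable_mult_right)
  then show "integrable (Pi\<^sub>M {..<n} (\<lambda>_. lborel)) (ens r (- U) n)"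
    using phi_const_pos[OF r, of n] by simp
  show "fact n * hole_det r U n = phi_const r n * partfn r (- U) n"
    using A(2) unfolding eq hole_det_def partfn_def by simp
qed

lemma hole_det_empty:
  assumes r: "0 < r"
  shows "hole_det r {} n = 1"
proof -
  have "hole_det r {} n = Re (det_fun n (\<lambda>i j. if i = j then 1 else 0))"
    unfolding hole_det_one_minus[OF r sets.empty_sets] by (simp add: gram_def)
  also have "det_fun n (\<lambda>i j. if i = j then 1 else 0 :: complex) = 1"
    by (subst det_fun_diagonal) auto
  finally show ?thesis by simp
qed

text \<open>The normalising constant and n! disappear against the same identity for the empty hole,
  whose determinant is 1.\<close>

lemma hole_det_partfn:
  assumes r: "0 < r" and U: "U \<in> sets borel"
  shows "hole_det r U n = partfn r (- U) n / partfn r UNIV n" "0 < partfn r UNIV n"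
proof -
  have 1: "fact n = phi_const r n * partfn r UNIV n"
    using partfn_eq(2)[OF r sets.empty_sets, of n] hole_det_empty[OF r, of n] by simp
  have "0 < phi_const r n * partfn r UNIV n" unfolding 1[symmetric] by simp
  then show pos: "0 < partfn r UNIV n"
    using phi_const_pos[OF r, of n] zero_less_mult_pos by blast
  show "hole_det r U n = partfn r (- U) n / partfn r UNIV n"
    using partfn_eq(2)[OF r U, of n] phi_const_pos[OF r, of n] pos unfolding 1
    by (simp add: field_simps)
qed

text \<open>Inversion v = 1/u turns the monic polynomial into |v|^m times the modulus of a
  polynomial in u, controlled on the closed disc by its values on the circle. The remaining factor
  |v|^m exp(-m |v|^2 / 2) is largest at |v| = 1.\<close>

lemma monic_poly_max_outside_disc:
  assumes J: "finite J" and z: "1 \<le> cmod z"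
  obtains w where "cmod w = 1"
    "(\<Prod>j\<in>J. cmod (z - a j)) * exp (- (real (card J) * (cmod z)\<^sup>2 / 2)) \<le> (\<Prod>j\<in>J. cmod (w - a j)) * exp (- (real (card J) * (cmod w)\<^sup>2 / 2))"
proof -
  \<comment> \<open>The reversed polynomial: p(v) = v^m g(1/v) for nonzero v.\<close>
  define g where "g u = (\<Prod>j\<in>J. (1 - a j * u))" for u
  define m where "m = card J"
  have hol: "g holomorphic_on A" for A unfolding g_def by (intro holomorphic_intros)
  have "\<exists>u0\<in>sphere 0 1. \<forall>u\<in>sphere 0 1. cmod (g u) \<le> cmod (g u0)"
    by (rule continuous_attains_sup)
       (auto intro!: continuous_on_norm holomorphic_on_imp_continuous_on hol exI[of _ 1])
  then obtain u0 where u0: "cmod u0 = 1" "\<And>u. cmod u = 1 \<Longrightarrow> cmod (g u) \<le> cmod (g u0)" by auto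
  have max: "cmod (g u) \<le> cmod (g u0)" if "u \<in> cball 0 1" for u
    by (rule maximum_modulus_frontier[of g "cball 0 1"])
       (use that u0(2) hol in \<open>auto intro: holomorphic_on_imp_continuous_on\<close>)
  have p: "(\<Prod>j\<in>J. cmod (v - a j)) = cmod v ^ m * cmod (g (1 / v))" if "v \<noteq> 0" for v
  proof -
    have "(\<Prod>j\<in>J. cmod (v - a j)) = (\<Prod>j\<in>J. cmod v * cmod (1 - a j * (1 / v)))"
      using that by (intro prod.cong refl) (simp add: norm_mult[symmetric] right_diff_distrib)
    then show ?thesis by (simp add: prod.distrib g_def m_def prod_norm)
  qed
  define w where "w = 1 / u0"
  have w: "cmod w = 1" using u0 by (simp add: w_def norm_divide)
  have u0n: "u0 \<noteq> 0" using u0(1) by auto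
  have pw: "(\<Prod>j\<in>J. cmod (w - a j)) = cmod (g u0)"
    using p[of w] w u0n by (auto simp: w_def)
  \<comment> \<open>This is the bound for a single factor, from (|z| - 1)^2 being nonnegative and
    e^x being at least 1 + x; its m-th power is used below.\<close>
  have "cmod z \<le> exp (((cmod z)\<^sup>2 - 1) / 2)"
  proof -
    have "0 \<le> (cmod z - 1)\<^sup>2" by simp
    then have "cmod z \<le> 1 + ((cmod z)\<^sup>2 - 1) / 2" by (simp add: power2_diff field_simps)
    also have "\<dots> \<le> exp (((cmod z)\<^sup>2 - 1) / 2)" by (rule exp_ge_add_one_self)
    finally show ?thesis .
  qed
  then have "cmod z ^ m \<le> exp (((cmod z)\<^sup>2 - 1) / 2) ^ m" by (intro power_mono) auto
  also have "\<dots> = exp (real m * (cmod z)\<^sup>2 / 2) * exp (- (real m / 2))"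
    by (simp flip: exp_of_nat_mult exp_add add: field_simps)
  finally have zm: "cmod z ^ m \<le> exp (real m * (cmod z)\<^sup>2 / 2) * exp (- (real m / 2))" .
  have zn: "z \<noteq> 0" using z by auto
  have "(\<Prod>j\<in>J. cmod (z - a j)) \<le> cmod z ^ m * cmod (g u0)"
    unfolding p[OF zn] using z by (intro mult_left_mono max) (auto simp: norm_divide divide_le_eq_1)
  also have "\<dots> \<le> (exp (real m * (cmod z)\<^sup>2 / 2) * exp (- (real m / 2))) * cmod (g u0)"
    by (intro mult_right_mono zm) auto
  finally have "(\<Prod>j\<in>J. cmod (z - a j)) * exp (- (real m * (cmod z)\<^sup>2 / 2))
      \<le> (exp (real m * (cmod z)\<^sup>2 / 2) * exp (- (real m / 2))) * cmod (g u0) * exp (- (real m * (cmod z)\<^sup>2 / 2))"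
    by (intro mult_right_mono) auto
  also have "\<dots> = cmod (g u0) * exp (- (real m / 2))"
    by (simp add: exp_minus)
  finally show ?thesis
    using w pw by (intro that[of w]) (simp_all add: m_def)
qed

text \<open>The coefficient is \<open>n - 1\<close> rather than n or r^2 because each particle
  occurs in n - 1 pairs. In one variable the square root is then exactly a weighted polynomial to
  which \<open>monic_poly_max_outside_disc\<close> applies, and \<open>wvd\<close> is the
  exponential of a pure pair energy.\<close>

definition wvd :: "nat \<Rightarrow> (nat \<Rightarrow> complex) \<Rightarrow> real" where
  "wvd n z = vd {..<n} z * exp (- (real (n - 1) * (\<Sum>i<n. (cmod (z i))\<^sup>2)))"

lemma wvd_update_le:
  assumes i: "i < n"
    and le: "(\<Prod>j\<in>{..<n} - {i}. cmod (z i - z j)) * exp (- (real (n - 1) * (cmod (z i))\<^sup>2 / 2))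
      \<le> (\<Prod>j\<in>{..<n} - {i}. cmod (w - z j)) * exp (- (real (n - 1) * (cmod w)\<^sup>2 / 2))"
  shows "wvd n z \<le> wvd n (z(i := w))"
proof -
  let ?R = "vd ({..<n} - {i}) z * exp (- (real (n - 1) * (\<Sum>j\<in>{..<n} - {i}. (cmod (z j))\<^sup>2)))"
  have eq: "wvd n (z(i := x)) = ((\<Prod>j\<in>{..<n} - {i}. cmod (x - z j)) * exp (- (real (n - 1) * (cmod x)\<^sup>2 / 2)))\<^sup>2 * ?R" for x
  proof -
    have 1: "(\<Sum>j<n. (cmod ((z(i := x)) j))\<^sup>2) = (cmod x)\<^sup>2 + (\<Sum>j\<in>{..<n} - {i}. (cmod (z j))\<^sup>2)"
      using i by (subst sum.remove[of _ i]) auto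
    have 2: "exp (- (c * (a + b))) = exp (- (c * a / 2)) ^ 2 * exp (- (c * b))" for a b c :: real
      by (simp add: distrib_left flip: exp_of_nat_mult exp_add)
    have 3: "vd {..<n} (z(i := x)) = (\<Prod>j\<in>{..<n} - {i}. cmod (x - z j))\<^sup>2 * vd ({..<n} - {i}) z"
      using i by (intro vd_remove) auto
    show ?thesis
      unfolding wvd_def 1 2 3 power_mult_distrib by (simp only: mult_ac)
  qed
  have "wvd n z = wvd n (z(i := z i))" by simp
  also have "\<dots> \<le> wvd n (z(i := w))"
    unfolding eq
    by (intro mult_right_mono power_mono le mult_nonneg_nonneg vd_nonneg prod_nonneg) auto
  finally show ?thesis .
qed

text \<open>Particles outside the disc are moved to the unit circle one after another. The circle
  lies in \<open>F\<close> because \<open>F\<close> contains the complement of the open disc, and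
  each move does not decrease \<open>wvd\<close>.\<close>

lemma wvd_le_disc:
  assumes F: "- ball 0 1 \<subseteq> F" and z: "\<And>i. i < n \<Longrightarrow> z i \<in> F"
  obtains w where "\<And>i. i < n \<Longrightarrow> w i \<in> F \<inter> cball 0 1" "wvd n z \<le> wvd n w"
proof -
  have "\<exists>w. (\<forall>i<m. w i \<in> F \<inter> cball 0 1) \<and> (\<forall>i<n. w i \<in> F) \<and> wvd n z \<le> wvd n w" if "m \<le> n" for m
    using that
  proof (induction m)
    case 0
    then show ?case using z by auto
  next
    case (Suc m)
    then obtain w where w: "\<forall>i<m. w i \<in> F \<inter> cball 0 1" "\<forall>i<n. w i \<in> F" "wvd n z \<le> wvd n w" by auto
    show ?case
    proof (cases "cmod (w m) \<le> 1")
      case True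
      then show ?thesis using w Suc.prems by (intro exI[of _ w]) (auto simp: less_Suc_eq)
    next
      case False
      obtain x where x: "cmod x = 1"
        "(\<Prod>j\<in>{..<n} - {m}. cmod (w m - w j)) * exp (- (real (card ({..<n} - {m})) * (cmod (w m))\<^sup>2 / 2))
         \<le> (\<Prod>j\<in>{..<n} - {m}. cmod (x - w j)) * exp (- (real (card ({..<n} - {m})) * (cmod x)\<^sup>2 / 2))"
        using monic_poly_max_outside_disc[of "{..<n} - {m}" "w m" w] False by auto
      have "card ({..<n} - {m}) = n - 1" using Suc.prems by simp
      then have "wvd n w \<le> wvd n (w(m := x))"
        using x(2) Suc.prems by (intro wvd_update_le) auto
      moreover have "x \<in> F" using F x(1) by auto
      moreover have "wvd n z \<le> wvd n (w(m := x))"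
        by (rule order_trans[OF w(3) calculation(1)])
      moreover have "\<forall>i<Suc m. (w(m := x)) i \<in> F \<inter> cball 0 1" "\<forall>i<n. (w(m := x)) i \<in> F"
        using w x(1) \<open>x \<in> F\<close> by (auto simp: less_Suc_eq)
      ultimately show ?thesis by blast
    qed
  qed
  from this[of n] show ?thesis using that by auto
qed

text \<open>As r^2 is at least n = (n - 1) + 1, the field pays for \<open>wvd\<close> and leaves a
  factor exp(-|z|^2) per particle, whose integral pi is the source of pi^n.\<close>

lemma partfn_le:
  assumes r: "0 < r" and U: "U \<in> sets borel" "U \<subseteq> ball 0 1" and n: "real n \<le> r\<^sup>2"
    and B: "\<And>w. (\<And>i. i < n \<Longrightarrow> w i \<in> - U \<inter> cball 0 1) \<Longrightarrow> wvd n w \<le> B"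
  shows "partfn r (- U) n \<le> B * pi ^ n"
proof (cases "n = 0")
  case True
  then show ?thesis
    using B[of "\<lambda>_. 1"] by (simp add: partfn_def ens_def vd_def PiM_empty wvd_def lebesgue_integral_count_space_finite)
next
  case n0: False
  have B0: "0 \<le> B"
    by (rule order_trans[OF _ B[of "\<lambda>_. 1"]]) (use U(2) vd_nonneg in \<open>auto simp: wvd_def\<close>)
  have le: "ens r (- U) n z \<le> B * (\<Prod>i<n. exp (- (cmod (z i))\<^sup>2))" for z
  proof (cases "\<forall>i<n. z i \<in> - U")
    case True
    obtain w where w: "\<And>i. i < n \<Longrightarrow> w i \<in> - U \<inter> cball 0 1" "wvd n z \<le> wvd n w"
      by (rule wvd_le_disc[of "- U" n z]) (use True U(2) in auto)
    have W: "wvd n z \<le> B" by (rule order_trans[OF w(2) B[OF w(1)]])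
    \<comment> \<open>The split of the field into the share of the pair energy and the integrable
      remainder.\<close>
    have e: "exp (- (r * x)\<^sup>2) \<le> exp (- (real (n - 1) * x\<^sup>2)) * exp (- x\<^sup>2)" for x :: real
    proof -
      have "real (n - 1) * x\<^sup>2 + x\<^sup>2 = real n * x\<^sup>2" using n0 by (simp add: of_nat_diff algebra_simps)
      also have "\<dots> \<le> (r * x)\<^sup>2" using n by (simp add: power_mult_distrib mult_right_mono)
      finally show ?thesis by (simp flip: exp_add)
    qed
    have "ens r (- U) n z \<le> (\<Prod>i<n. exp (- (real (n - 1) * (cmod (z i))\<^sup>2)) * exp (- (cmod (z i))\<^sup>2)) * vd {..<n} z"
      unfolding ens_def
    proof (intro mult_right_mono prod_mono conjI vd_nonneg)
      fix i
      have "indicator (- U) (z i) * exp (- (r * cmod (z i))\<^sup>2) \<le> 1 * exp (- (r * cmod (z i))\<^sup>2)"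
        by (intro mult_right_mono) (auto split: split_indicator)
      then show "indicator (- U) (z i) * exp (- (r * cmod (z i))\<^sup>2) \<le> exp (- (real (n - 1) * (cmod (z i))\<^sup>2)) * exp (- (cmod (z i))\<^sup>2)"
        using e[of "cmod (z i)"] by linarith
    qed auto
    also have "\<dots> = wvd n z * (\<Prod>i<n. exp (- (cmod (z i))\<^sup>2))"
      by (simp add: wvd_def prod.distrib sum_distrib_left exp_sum[symmetric] sum_negf[symmetric] mult_ac)
    also have "\<dots> \<le> B * (\<Prod>i<n. exp (- (cmod (z i))\<^sup>2))"
      by (intro mult_right_mono W prod_nonneg) auto
    finally show ?thesis .
  next
    case False
    then have p0: "(\<Prod>i<n. indicator (- U) (z i) * exp (- (r * cmod (z i))\<^sup>2)) = 0"
      by (intro prod_zero) (auto simp: indicator_def)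
    show ?thesis unfolding ens_def p0 using B0 by (simp add: prod_nonneg)
  qed
  have int: "integrable lborel (\<lambda>z::complex. exp (- (cmod z)\<^sup>2))" and val: "(\<integral>z. exp (- (cmod z)\<^sup>2) \<partial>lborel) = pi"
  proof -
    have "has_bochner_integral lborel (\<lambda>z::complex. exp (- (cmod z)\<^sup>2)) pi"
      by (rule has_bochner_integral_nn_integral) (use nn_integral_gaussian_moment_full[of 0] in auto)
    then show "integrable lborel (\<lambda>z::complex. exp (- (cmod z)\<^sup>2))" "(\<integral>z. exp (- (cmod z)\<^sup>2) \<partial>lborel) = pi"
      by (auto simp: has_bochner_integral_iff)
  qed
  have "partfn r (- U) n \<le> (\<integral>z. B * (\<Prod>i<n. exp (- (cmod (z i))\<^sup>2)) \<partial>Pi\<^sub>M {..<n} (\<lambda>_. lborel))"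
    unfolding partfn_def
    by (intro integral_mono partfn_eq(1)[OF r U(1)] le integrable_mult_right plane.product_integrable_prod int) auto
  also have "\<dots> = B * (\<Prod>i<n. pi)"
    unfolding Bochner_Integration.integral_mult_right_zero plane.product_integral_prod[OF finite_lessThan int] val ..
  finally show ?thesis by simp
qed

section \<open>Polynomials on discs and the Bernstein-Markov inequality\<close>

lemma disc_moment:
  assumes "0 \<le> s"
  shows "integrable lborel (\<lambda>z. indicator (ball 0 s) z * (cmod z) ^ (2 * k))"
    and "(\<integral>z. indicator (ball 0 s) z * (cmod z) ^ (2 * k) \<partial>lborel) = pi * s ^ (2 * k + 2) / (k + 1)"
proof -
  have [measurable]: "ball 0 s \<in> sets (borel :: complex measure)" by simp
  have "(\<integral>\<^sup>+z. ennreal (indicator (ball 0 s) z * (cmod z) ^ (2 * k)) \<partial>lborel)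
      = (\<integral>\<^sup>+z. (\<lambda>x. ennreal (indicator {..<s\<^sup>2} x * x ^ k)) ((cmod z)\<^sup>2) \<partial>lborel)"
  proof (intro nn_integral_cong)
    fix z :: complex
    have "cmod z < s \<longleftrightarrow> (cmod z)\<^sup>2 < s\<^sup>2"
      using assms by (meson norm_ge_zero power2_less_imp_less power_strict_mono zero_less_numeral)
    then show "ennreal (indicator (ball 0 s) z * (cmod z) ^ (2 * k)) = (\<lambda>x. ennreal (indicator {..<s\<^sup>2} x * x ^ k)) ((cmod z)\<^sup>2)"
      by (simp add: indicator_def power_mult)
  qed
  also have "\<dots> = ennreal pi * (\<integral>\<^sup>+x. ennreal (indicator {..<s\<^sup>2} x * x ^ k) * indicator {0..} x \<partial>lborel)"
    by (rule nn_integral_radial) measurable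
  also have "(\<integral>\<^sup>+x. ennreal (indicator {..<s\<^sup>2} x * x ^ k) * indicator {0..} x \<partial>lborel)
      = (\<integral>\<^sup>+x. ennreal (x ^ k) * indicator {0..s\<^sup>2} x \<partial>lborel)"
  proof (rule nn_integral_cong_AE)
    have "AE x in lborel. x \<noteq> s\<^sup>2" by (rule AE_lborel_singleton)
    then show "AE x in lborel. ennreal (indicator {..<s\<^sup>2} x * x ^ k) * indicator {0..} x = ennreal (x ^ k) * indicator {0..s\<^sup>2} x"
      by eventually_elim (auto split: split_indicator)
  qed
  also have "\<dots> = ennreal ((s\<^sup>2) ^ (k + 1) / (k + 1) - 0 ^ (k + 1) / (k + 1))"
    by (rule nn_integral_FTC_Icc) (auto intro!: derivative_eq_intros, cases k, auto simp: field_simps)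
  finally have "(\<integral>\<^sup>+z. ennreal (indicator (ball 0 s) z * (cmod z) ^ (2 * k)) \<partial>lborel) = ennreal (pi * s ^ (2 * k + 2) / (k + 1))"
  proof -
    have q: "(s\<^sup>2) ^ (k + 1) / (k + 1) - 0 ^ (k + 1) / (k + 1) = s ^ (2 * k + 2) / (k + 1)"
      by (simp only: power_mult[symmetric]) simp
    assume "(\<integral>\<^sup>+z. ennreal (indicator (ball 0 s) z * (cmod z) ^ (2 * k)) \<partial>lborel) = ennreal pi * ennreal ((s\<^sup>2) ^ (k + 1) / (k + 1) - 0 ^ (k + 1) / (k + 1))"
    then show ?thesis unfolding q using assms by (subst (asm) ennreal_mult[symmetric]) auto
  qed
  then have "has_bochner_integral lborel (\<lambda>z. indicator (ball 0 s) z * (cmod z) ^ (2 * k)) (pi * s ^ (2 * k + 2) / (k + 1))"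
    using assms by (intro has_bochner_integral_nn_integral) auto
  then show "integrable lborel (\<lambda>z. indicator (ball 0 s) z * (cmod z) ^ (2 * k))"
    "(\<integral>z. indicator (ball 0 s) z * (cmod z) ^ (2 * k) \<partial>lborel) = pi * s ^ (2 * k + 2) / (k + 1)"
    by (auto simp: has_bochner_integral_iff)
qed

text \<open>Monomials are orthogonal on a centred disc, so the off-diagonal terms of the expanded
  square vanish.\<close>

lemma disc_parseval:
  assumes s: "0 \<le> s"
  shows "integrable lborel (\<lambda>z. indicator (ball 0 s) z * (cmod (\<Sum>k<n. a k * z ^ k))\<^sup>2)"
    and "(\<integral>z. indicator (ball 0 s) z * (cmod (\<Sum>k<n. a k * z ^ k))\<^sup>2 \<partial>lborel)
      = (\<Sum>k<n. (cmod (a k))\<^sup>2 * (pi * s ^ (2 * k + 2) / (k + 1)))"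
proof -
  have [measurable]: "ball 0 s \<in> sets (borel :: complex measure)" by simp
  let ?h = "\<lambda>z::complex. complex_of_real (indicator (ball 0 s) z)"
  have int: "integrable lborel (\<lambda>z. ?h z * (z ^ k * cnj z ^ l))" for k l
  proof (rule Bochner_Integration.integrable_bound)
    have "integrable lborel (indicator (ball 0 s) :: complex \<Rightarrow> real)"
      by (intro integrable_real_indicator emeasure_lborel_ball_finite) auto
    then show "integrable lborel (\<lambda>z::complex. indicator (ball 0 s) z * s ^ (k + l))" by simp
    show "AE z in lborel. norm (?h z * (z ^ k * cnj z ^ l)) \<le> norm (indicator (ball 0 s) z * s ^ (k + l))"
    proof (rule AE_I2)
      fix z :: complex
      have "cmod z ^ k * cmod z ^ l \<le> s ^ k * s ^ l" if "cmod z < s"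
        using that s by (intro mult_mono power_mono) auto
      then show "norm (?h z * (z ^ k * cnj z ^ l)) \<le> norm (indicator (ball 0 s) z * s ^ (k + l))"
        using s by (auto simp: norm_mult norm_power power_add split: split_indicator)
    qed
  qed measurable
  have eq: "complex_of_real (indicator (ball 0 s) z * (cmod (\<Sum>k<n. a k * z ^ k))\<^sup>2)
      = (\<Sum>k<n. \<Sum>l<n. (a k * cnj (a l)) * (?h z * (z ^ k * cnj z ^ l)))" for z
  proof -
    have "complex_of_real (indicator (ball 0 s) z * (cmod (\<Sum>k<n. a k * z ^ k))\<^sup>2)
        = ?h z * ((\<Sum>k<n. a k * z ^ k) * cnj (\<Sum>k<n. a k * z ^ k))"
      by (simp only: complex_norm_square of_real_mult)
    also have "\<dots> = ?h z * (\<Sum>k<n. \<Sum>l<n. (a k * z ^ k) * cnj (a l * z ^ l))"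
      by (simp only: cnj_sum sum_product)
    also have "\<dots> = (\<Sum>k<n. \<Sum>l<n. (a k * cnj (a l)) * (?h z * (z ^ k * cnj z ^ l)))"
      unfolding sum_distrib_left by (intro sum.cong refl) (simp add: mult_ac)
    finally show ?thesis .
  qed
  have intc: "integrable lborel (\<lambda>z. complex_of_real (indicator (ball 0 s) z * (cmod (\<Sum>k<n. a k * z ^ k))\<^sup>2))"
    unfolding eq by (intro Bochner_Integration.integrable_sum integrable_mult_right int)
  then show "integrable lborel (\<lambda>z. indicator (ball 0 s) z * (cmod (\<Sum>k<n. a k * z ^ k))\<^sup>2)"
    using integrable_Re[OF intc] by (simp only: Re_complex_of_real)
  have orth: "(\<integral>z. ?h z * (z ^ k * cnj z ^ l) \<partial>lborel) = (if k = l then of_real (pi * s ^ (2 * k + 2) / (k + 1)) else 0)" for k l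
  proof (cases "k = l")
    case True
    have "?h z * (z ^ k * cnj z ^ k) = of_real (indicator (ball 0 s) z * (cmod z) ^ (2 * k))" for z
    proof -
      have "z ^ k * cnj z ^ k = of_real ((cmod z) ^ (2 * k))"
      proof -
        have "complex_of_real ((cmod z) ^ (2 * k)) = (of_real ((cmod z)\<^sup>2)) ^ k" by (simp add: power_mult)
        also have "\<dots> = z ^ k * cnj z ^ k" by (simp only: complex_norm_square power_mult_distrib)
        finally show ?thesis ..
      qed
      then show ?thesis by simp
    qed
    then have "(\<integral>z. ?h z * (z ^ k * cnj z ^ k) \<partial>lborel) = of_real (pi * s ^ (2 * k + 2) / (k + 1))"
      unfolding disc_moment(2)[OF s, symmetric] by (simp only: integral_complex_of_real)
    then show ?thesis using True by simp
  next
    case False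
    then show ?thesis
      by (subst integral_radial_orthogonal) (auto simp: norm_mult indicator_def)
  qed
  have "complex_of_real (\<integral>z. indicator (ball 0 s) z * (cmod (\<Sum>k<n. a k * z ^ k))\<^sup>2 \<partial>lborel)
     = (\<Sum>k<n. \<Sum>l<n. (a k * cnj (a l)) * (if k = l then of_real (pi * s ^ (2 * k + 2) / (k + 1)) else 0))"
    unfolding integral_complex_of_real[symmetric] eq orth[symmetric]
    by (simp add: Bochner_Integration.integral_sum Bochner_Integration.integrable_sum integrable_mult_right int del: of_real_mult)
  also have "\<dots> = (\<Sum>k<n. a k * cnj (a k) * of_real (pi * s ^ (2 * k + 2) / (k + 1)))"
    by (simp add: if_distrib cong: if_cong)
  also have "\<dots> = of_real (\<Sum>k<n. (cmod (a k))\<^sup>2 * (pi * s ^ (2 * k + 2) / (k + 1)))"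
    by (simp only: complex_norm_square of_real_mult of_real_sum)
  finally show "(\<integral>z. indicator (ball 0 s) z * (cmod (\<Sum>k<n. a k * z ^ k))\<^sup>2 \<partial>lborel)
      = (\<Sum>k<n. (cmod (a k))\<^sup>2 * (pi * s ^ (2 * k + 2) / (k + 1)))"
    by (simp only: of_real_eq_iff)
qed

lemma prod_shift_poly:
  assumes "finite J" "card J < n"
  shows "\<exists>a. \<forall>z. (\<Prod>j\<in>J. (c + z - b j)) = (\<Sum>k<n. a k * z ^ k :: complex)"
  using assms
proof (induction J arbitrary: n rule: finite_induct)
  case empty
  then show ?case
  proof (intro exI[of _ "\<lambda>k. if k = 0 then 1 else 0"] allI)
    fix z
    have "(\<Sum>k<n. (if k = 0 then 1 else 0) * z ^ k) = (\<Sum>k<n. if k = 0 then 1 else 0 :: complex)"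
      by (intro sum.cong) auto
    then show "(\<Prod>j\<in>{}. (c + z - b j)) = (\<Sum>k<n. (if k = 0 then 1 else 0) * z ^ k)"
      using empty by simp
  qed
next
  case (insert i J)
  then obtain m where m: "n = Suc m" "card J < m" by (cases n) auto
  obtain a where a: "\<And>z. (\<Prod>j\<in>J. (c + z - b j)) = (\<Sum>k<m. a k * z ^ k)"
    using insert.IH[OF m(2)] by blast
  define a' where "a' k = (if k < m then (c - b i) * a k else 0) + (if k = 0 then 0 else a (k - 1))" for k
  have "(\<Prod>j\<in>insert i J. (c + z - b j)) = (\<Sum>k<n. a' k * z ^ k)" for z
  proof -
    have "(\<Prod>j\<in>insert i J. (c + z - b j)) = (\<Sum>k<m. (c - b i) * a k * z ^ k) + (\<Sum>k<m. a k * z ^ Suc k)"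
    proof -
      have "(\<Prod>j\<in>insert i J. (c + z - b j)) = (c - b i) * (\<Sum>k<m. a k * z ^ k) + z * (\<Sum>k<m. a k * z ^ k)"
        unfolding prod.insert[OF insert.hyps] a by (simp add: algebra_simps)
      then show ?thesis unfolding sum_distrib_left by (simp add: mult_ac)
    qed
    also have "(\<Sum>k<m. (c - b i) * a k * z ^ k) = (\<Sum>k<n. (if k < m then (c - b i) * a k else 0) * z ^ k)"
      unfolding m by simp
    also have "(\<Sum>k<m. a k * z ^ Suc k) = (\<Sum>k<n. (if k = 0 then 0 else a (k - 1)) * z ^ k)"
      unfolding m by (subst sum.lessThan_Suc_shift) simp
    finally show ?thesis by (simp add: a'_def sum.distrib distrib_right)
  qed
  then show ?case by blast
qed

text \<open>Parseval bounds each Taylor coefficient at the centre by the L2 norm on the disc.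
  Leaving the disc by the factor 1 + 1/n multiplies the k-th term by at most (1 + 1/n)^n, which is
  at most e. This tolerance is what makes points near the boundary of \<open>F\<close>
  accessible.\<close>

lemma bernstein_markov_disc:
  assumes J: "finite J" "card J < n" and s: "0 < s" and w: "cmod (w - c) \<le> (1 + 1 / n) * s"
  shows "integrable lborel (\<lambda>z. indicator (ball c s) z * (\<Prod>j\<in>J. cmod (z - b j))\<^sup>2)"
    and "(\<Prod>j\<in>J. cmod (w - b j))\<^sup>2 \<le> (exp 1 * (real n)\<^sup>2 / s)\<^sup>2 * (\<integral>z. indicator (ball c s) z * (\<Prod>j\<in>J. cmod (z - b j))\<^sup>2 \<partial>lborel)"
proof -
  have n: "0 < n" using J by simp
  obtain a where a: "\<And>z. (\<Prod>j\<in>J. (c + z - b j)) = (\<Sum>k<n. a k * z ^ k)"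
    using prod_shift_poly[OF J] by blast
  have a': "(\<Prod>j\<in>J. cmod (c + z - b j)) = cmod (\<Sum>k<n. a k * z ^ k)" for z
    unfolding prod_norm a ..
  let ?f = "\<lambda>z. indicator (ball c s) z * (\<Prod>j\<in>J. cmod (z - b j))\<^sup>2"
  have [measurable]: "ball c s \<in> sets (borel :: complex measure)" by simp
  have sh: "?f (c + of_real 1 * z) = indicator (ball 0 s) z * (cmod (\<Sum>k<n. a k * z ^ k))\<^sup>2" for z
    using a'[of z] by (simp add: indicator_def dist_norm norm_minus_commute)
  note P = disc_parseval[OF less_imp_le[OF s], where n=n and a=a]
  have lb': "(lborel :: complex measure) = distr lborel borel (\<lambda>x. c + x)"
    by (rule lborel_distr_plus[symmetric])
  have "integrable (distr lborel borel (\<lambda>x. c + x)) ?f"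
    using P(1) sh by (subst integrable_distr_eq) (auto)
  then show "integrable lborel ?f" using lb' by simp
  have I: "(\<integral>z. ?f z \<partial>lborel) = (\<Sum>k<n. (cmod (a k))\<^sup>2 * (pi * s ^ (2 * k + 2) / (k + 1)))"
  proof -
    have "(\<integral>z. ?f z \<partial>lborel) = (\<integral>z. ?f z \<partial>distr lborel borel (\<lambda>x. c + x))" using lb' by simp
    also have "\<dots> = (\<integral>z. ?f (c + z) \<partial>lborel)" by (subst integral_distr) auto
    finally show ?thesis using sh P(2) by simp
  qed
  let ?I = "\<integral>z. ?f z \<partial>lborel"
  have I0: "0 \<le> ?I" unfolding I by (intro sum_nonneg mult_nonneg_nonneg divide_nonneg_nonneg) (use s in auto)
  \<comment> \<open>Parseval contributes the factor pi/(k + 1); it is at least 1/n^2 because k < n,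
    which trades the dependence on k for a harmless power of n.\<close>
  have coef: "cmod (a k) * s ^ k \<le> sqrt ?I * n / s" if k: "k < n" for k
  proof -
    have "(cmod (a k))\<^sup>2 * (pi * s ^ (2 * k + 2) / (k + 1)) \<le> ?I"
      unfolding I using k s by (intro member_le_sum) (auto intro!: mult_nonneg_nonneg divide_nonneg_nonneg)
    moreover have "(cmod (a k) * s ^ k * s / n)\<^sup>2 \<le> (cmod (a k))\<^sup>2 * (pi * s ^ (2 * k + 2) / (k + 1))"
    proof -
      have "(cmod (a k) * s ^ k * s / n)\<^sup>2 = (cmod (a k))\<^sup>2 * s ^ (2 * k + 2) * (1 / (real n)\<^sup>2)"
      proof -
        have "s ^ (2 * k + 2) = (s ^ Suc k)\<^sup>2"
          unfolding power_mult[symmetric] by (rule arg_cong[where f="(^) s"]) simp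
        then have "s ^ (2 * k + 2) = (s ^ k * s)\<^sup>2" by (simp only: power_Suc mult.commute)
        then show ?thesis by (simp add: power_mult_distrib power_divide)
      qed
      also have "\<dots> \<le> (cmod (a k))\<^sup>2 * s ^ (2 * k + 2) * (pi / (k + 1))"
      proof (intro mult_left_mono)
        have "real (k + 1) \<le> real n" using k by simp
        also have "\<dots> \<le> pi * (real n)\<^sup>2"
        proof -
          have "1 * (real n * 1) \<le> pi * (real n * real n)"
            using n pi_gt3 by (intro mult_mono) auto
          then show ?thesis by (simp add: power2_eq_square)
        qed
        finally show "1 / (real n)\<^sup>2 \<le> pi / (k + 1)" using n by (simp add: field_simps)
      qed (use s in auto)
      also have "\<dots> = (cmod (a k))\<^sup>2 * (pi * s ^ (2 * k + 2) / (k + 1))"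
        by (simp add: field_simps)
      finally show ?thesis .
    qed
    ultimately have "(cmod (a k) * s ^ k * s / n)\<^sup>2 \<le> ?I" by linarith
    then have "cmod (a k) * s ^ k * s / n \<le> sqrt ?I" by (rule real_le_rsqrt)
    then show ?thesis using n s by (simp add: field_simps)
  qed
  have e: "(1 + 1 / real n) ^ k \<le> exp 1" if "k < n" for k
  proof -
    have "(1 + 1 / real n) ^ k \<le> (1 + 1 / real n) ^ n" using that by (intro power_increasing) auto
    also have "\<dots> \<le> exp (1 / real n) ^ n" by (intro power_mono exp_ge_add_one_self) auto
    also have "\<dots> = exp 1" using n by (simp flip: exp_of_nat_mult)
    finally show ?thesis .
  qed
  have "(\<Prod>j\<in>J. cmod (w - b j)) \<le> (\<Sum>k<n. cmod (a k) * cmod (w - c) ^ k)"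
    using a'[of "w - c"] norm_sum[of "\<lambda>k. a k * (w - c) ^ k" "{..<n}"] by (simp add: norm_mult norm_power)
  also have "\<dots> \<le> (\<Sum>k<n. sqrt ?I * n / s * exp 1)"
  proof (intro sum_mono)
    fix k assume k: "k \<in> {..<n}"
    have "cmod (a k) * cmod (w - c) ^ k \<le> cmod (a k) * ((1 + 1 / n) * s) ^ k"
      by (intro mult_left_mono power_mono w) auto
    also have "\<dots> = (cmod (a k) * s ^ k) * (1 + 1 / n) ^ k" by (simp add: power_mult_distrib mult_ac)
    also have "\<dots> \<le> (sqrt ?I * n / s) * exp 1"
      using k I0 s by (intro mult_mono coef e) auto
    finally show "cmod (a k) * cmod (w - c) ^ k \<le> sqrt ?I * n / s * exp 1" .
  qed
  also have "\<dots> = (exp 1 * (real n)\<^sup>2 / s) * sqrt ?I" by (simp add: power2_eq_square)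
  finally have "(\<Prod>j\<in>J. cmod (w - b j))\<^sup>2 \<le> ((exp 1 * (real n)\<^sup>2 / s) * sqrt ?I)\<^sup>2"
    by (intro power_mono prod_nonneg) auto
  also have "\<dots> = (exp 1 * (real n)\<^sup>2 / s)\<^sup>2 * ?I" by (simp only: power_mult_distrib real_sqrt_pow2[OF I0])
  finally show "(\<Prod>j\<in>J. cmod (w - b j))\<^sup>2 \<le> (exp 1 * (real n)\<^sup>2 / s)\<^sup>2 * ?I" .
qed

text \<open>Every point of \<open>F'\<close> is almost inside a ball contained in \<open>F\<close>.
  The relative excess \<open>\<theta>\<close> and the size \<open>\<rho>\<close> are separate
  because they will be 1/n and a multiple of 1/n: the excess must fit the Bernstein-Markov
  inequality, and the radius may shrink only polynomially.\<close>

definition thick_in :: "complex set \<Rightarrow> complex set \<Rightarrow> bool" where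
  "thick_in F' F \<longleftrightarrow> (\<exists>\<epsilon>>0. \<forall>\<theta>\<in>{0<..1}. \<forall>\<rho>\<in>{0<..\<epsilon>}. \<forall>z\<in>F'. \<exists>c s.
     \<theta> * \<rho> \<le> s \<and> s \<le> \<rho> \<and> ball c s \<subseteq> F \<and> cmod (z - c) \<le> (1 + \<theta>) * s)"

text \<open>Integrates one coordinate at a time: each integration is bounded below by the value at
  \<open>w i\<close> with a loss of \<open>\<kappa>\<close>, for arbitrary values of the other
  coordinates.\<close>

lemma PiM_coordinatewise_lower_bound:
  fixes I :: "nat set" and f :: "(nat \<Rightarrow> complex) \<Rightarrow> ennreal"
  assumes "finite I"
    and f: "f \<in> borel_measurable (Pi\<^sub>M I (\<lambda>_. lborel))"
    and w: "w \<in> extensional I"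
    and le: "\<And>i x. i \<in> I \<Longrightarrow> x \<in> extensional I \<Longrightarrow> \<kappa> * f (x(i := w i)) \<le> (\<integral>\<^sup>+y. f (x(i := y)) \<partial>(lborel :: complex measure))"
  shows "\<kappa> ^ card I * f w \<le> (\<integral>\<^sup>+x. f x \<partial>Pi\<^sub>M I (\<lambda>_::nat. lborel))"
  using assms
proof (induction I arbitrary: f w rule: finite_induct)
  case empty
  then have "w = (\<lambda>_. undefined)" by (auto simp: extensional_def)
  then show ?case by (simp add: plane.nn_integral_empty)
next
  case (insert i I)
  note [measurable] = insert.prems(1)
  have meas: "(\<lambda>x. f (x(i := y))) \<in> borel_measurable (Pi\<^sub>M I (\<lambda>_. lborel))" for y
    by (rule measurable_compose[OF measurable_fun_upd insert.prems(1)]) auto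
  have meas2: "(\<lambda>y. f (x(i := y))) \<in> borel_measurable lborel" if "x \<in> space (Pi\<^sub>M I (\<lambda>_. lborel))" for x
    by (rule measurable_compose[OF measurable_fun_upd insert.prems(1)]) (use that in auto)
  let ?w = "restrict w I"
  have wi: "?w(i := w i) = w"
    using insert.prems(2) insert.hyps by (auto simp: fun_eq_iff extensional_def restrict_def)
  have "\<kappa> ^ card (insert i I) * f w = \<kappa> * (\<kappa> ^ card I * f (?w(i := w i)))"
    using insert.hyps wi by (simp add: mult_ac)
  also have "\<dots> \<le> \<kappa> * (\<integral>\<^sup>+x. f (x(i := w i)) \<partial>Pi\<^sub>M I (\<lambda>_. lborel))"
  proof (intro mult_left_mono insert.IH meas)
    fix j and x :: "nat \<Rightarrow> complex" assume j: "j \<in> I" and x: "x \<in> extensional I"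
    then have ne: "j \<noteq> i" using insert.hyps by auto
    have xe: "x(i := w i) \<in> extensional (insert i I)" using x by (auto simp: extensional_def)
    have le: "\<kappa> * f ((x(i := w i))(j := w j)) \<le> (\<integral>\<^sup>+y. f ((x(i := w i))(j := y)) \<partial>lborel)"
      by (rule insert.prems(3)[OF _ xe]) (use j in simp)
    have wj: "?w j = w j" using j by simp
    show "\<kappa> * f (x(j := ?w j, i := w i)) \<le> (\<integral>\<^sup>+y. f (x(j := y, i := w i)) \<partial>lborel)"
      unfolding fun_upd_twist[OF ne] wj by (rule le)
  qed (auto simp: extensional_def)
  also have "\<dots> = (\<integral>\<^sup>+x. \<kappa> * f (x(i := w i)) \<partial>Pi\<^sub>M I (\<lambda>_. lborel))"
    by (rule nn_integral_cmult[symmetric, OF meas])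
  also have "\<dots> \<le> (\<integral>\<^sup>+x. (\<integral>\<^sup>+y. f (x(i := y)) \<partial>lborel) \<partial>Pi\<^sub>M I (\<lambda>_. lborel))"
  proof (intro nn_integral_mono)
    fix x assume "x \<in> space (Pi\<^sub>M I (\<lambda>_. lborel :: complex measure))"
    then have xe: "x(i := undefined) \<in> extensional (insert i I)"
      by (auto simp: space_PiM PiE_def extensional_def)
    have xu: "(x(i := undefined))(i := y) = x(i := y)" for y by simp
    show "\<kappa> * f (x(i := w i)) \<le> (\<integral>\<^sup>+y. f (x(i := y)) \<partial>lborel)"
      using insert.prems(3)[OF insertI1 xe] unfolding xu .
  qed
  also have "\<dots> = (\<integral>\<^sup>+x. f x \<partial>Pi\<^sub>M (insert i I) (\<lambda>_. lborel))"
    using insert.hyps by (intro plane.product_nn_integral_insert[symmetric]) auto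
  finally show ?case .
qed

text \<open>As a function of one particle the density is a Gaussian times the squared modulus of a
  polynomial of degree n - 1. The Bernstein-Markov inequality bounds its value by an average over a
  small disc in \<open>F\<close> up to a power of n, so n particles lose only exp(O(n log
  n)).\<close>

lemma partfn_lower_bound:
  assumes th: "thick_in F' F" and F: "closed F" and F': "F' \<subseteq> F"
  shows "\<exists>\<kappa>>0. \<forall>r::real. 0 < r \<longrightarrow> (\<forall>n w. n \<ge> 1 \<longrightarrow> r\<^sup>2 \<le> n + 1 \<longrightarrow> (\<forall>i<n. w i \<in> F' \<inter> cball 0 R) \<longrightarrow>
     (\<kappa> / real n ^ 8) ^ n * ens r F n w \<le> partfn r F n)"
proof -
  obtain \<epsilon>0 where \<epsilon>0: "\<epsilon>0 > 0" "\<And>\<theta> \<rho> z. \<theta> \<in> {0<..1} \<Longrightarrow> \<rho> \<in> {0<..\<epsilon>0} \<Longrightarrow> z \<in> F' \<Longrightarrow> \<exists>c s.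
     \<theta> * \<rho> \<le> s \<and> s \<le> \<rho> \<and> ball c s \<subseteq> F \<and> cmod (z - c) \<le> (1 + \<theta>) * s"
    using th unfolding thick_in_def by blast
  define \<epsilon> where "\<epsilon> = min 1 \<epsilon>0"
  have \<epsilon>: "0 < \<epsilon>" "\<epsilon> \<le> 1" "\<epsilon> \<le> \<epsilon>0" using \<epsilon>0 by (auto simp: \<epsilon>_def)
  \<comment> \<open>On the disc |y| exceeds |w i| by at most 3 s, so the squared modulus grows by at
    most s (6|R| + 9); the factor 2 bounds r^2 * s.\<close>
  define D where "D = 2 * (6 * \<bar>R\<bar> + 9)"
  \<comment> \<open>The radius is at least \<epsilon>/n^2, so the constant (e n^2 / s)^2 of the
    Bernstein-Markov inequality is at most e^2 n^8 / \<epsilon>^2. This is where the eighth power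
    comes from.\<close>
  define \<kappa> where "\<kappa> = exp (- D) * \<epsilon>\<^sup>2 / (exp 1)\<^sup>2"
  have \<kappa>: "0 < \<kappa>" using \<epsilon> by (simp add: \<kappa>_def)
  have main: "(\<kappa> / real n ^ 8) ^ n * ens r F n w \<le> partfn r F n"
    if r: "r > 0" and n: "n \<ge> 1" "r\<^sup>2 \<le> n + 1" and w: "\<forall>i<n. w i \<in> F' \<inter> cball 0 R" for r :: real and n w
  proof -
    have Fb: "- F \<in> sets borel" using F by auto
    have intens: "integrable (Pi\<^sub>M {..<n} (\<lambda>_. lborel)) (ens r F n)"
      using partfn_eq(1)[where U="- F" and n=n, OF r Fb] by simp
    have ens0: "0 \<le> ens r F n z" for z
      unfolding ens_def by (intro mult_nonneg_nonneg prod_nonneg vd_nonneg) auto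
    have pf: "(\<integral>\<^sup>+z. ennreal (ens r F n z) \<partial>Pi\<^sub>M {..<n} (\<lambda>_. lborel)) = ennreal (partfn r F n)"
      unfolding partfn_def by (rule nn_integral_eq_integral[OF intens]) (use ens0 in auto)
    let ?w = "restrict w {..<n}"
    let ?k = "ennreal (\<kappa> / real n ^ 8)"
    have "?k ^ card {..<n} * ennreal (ens r F n ?w) \<le> (\<integral>\<^sup>+z. ennreal (ens r F n z) \<partial>Pi\<^sub>M {..<n} (\<lambda>_. lborel))"
    proof (rule PiM_coordinatewise_lower_bound)
      show "(\<lambda>z. ennreal (ens r F n z)) \<in> borel_measurable (Pi\<^sub>M {..<n} (\<lambda>_. lborel))"
        using borel_measurable_integrable[OF intens] by measurable
      fix i and x :: "nat \<Rightarrow> complex" assume i: "i \<in> {..<n}"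
      let ?J = "{..<n} - {i}"
      have J: "finite ?J" "card ?J < n" using i by auto
      define C where "C = (\<Prod>j\<in>?J. indicator F (x j) * exp (- (r * cmod (x j))\<^sup>2)) * vd ?J x"
      have C0: "0 \<le> C" unfolding C_def by (intro mult_nonneg_nonneg prod_nonneg vd_nonneg) auto
      have ens_eq: "ens r F n (x(i := y)) = C * (indicator F y * exp (- (r * cmod y)\<^sup>2) * (\<Prod>j\<in>?J. cmod (y - x j))\<^sup>2)" for y
      proof -
        have "(\<Prod>j<n. indicator F ((x(i := y)) j) * exp (- (r * cmod ((x(i := y)) j))\<^sup>2))
            = (indicator F y * exp (- (r * cmod y)\<^sup>2)) * (\<Prod>j\<in>?J. indicator F (x j) * exp (- (r * cmod (x j))\<^sup>2))"
          using i by (subst prod.remove[of _ i]) auto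
        moreover have "vd {..<n} (x(i := y)) = (\<Prod>j\<in>?J. cmod (y - x j))\<^sup>2 * vd ?J x"
          by (rule vd_remove) (use i in auto)
        ultimately show ?thesis unfolding ens_def C_def by (simp only: mult_ac)
      qed
      let ?v = "w i"
      have v: "?v \<in> F'" "cmod ?v \<le> \<bar>R\<bar>" using w i by auto
      have n0: "0 < real n" using n by simp
      \<comment> \<open>The excess 1/n is the one tolerated by polynomials of degree below n, and
        the radius is at most \<epsilon>/n so that the Gaussian varies by a bounded factor
        only.\<close>
      obtain c s where cs: "1 / n * (\<epsilon> / n) \<le> s" "s \<le> \<epsilon> / n" "ball c s \<subseteq> F" "cmod (?v - c) \<le> (1 + 1 / n) * s"
      proof -
        have "\<epsilon> / n \<le> \<epsilon> / 1" using \<epsilon> n by (intro divide_left_mono) auto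
        then have "\<epsilon> / n \<in> {0<..\<epsilon>0}" using \<epsilon> n0 by simp
        moreover have "1 / real n \<in> {0<..1}" using n by simp
        ultimately show ?thesis using \<epsilon>0(2)[of "1 / n" "\<epsilon> / n" ?v] v(1) that by blast
      qed
      have s: "0 < s" using cs(1) \<epsilon> n0 by (auto intro: less_le_trans[OF _ cs(1)])
      have s1: "s \<le> 1" "s * n \<le> 1"
      proof -
        have "s * n \<le> \<epsilon>" using cs(2) n0 by (simp add: field_simps)
        then show "s * n \<le> 1" using \<epsilon> by linarith
        moreover have "s * 1 \<le> s * n" using s n by (intro mult_left_mono) auto
        ultimately show "s \<le> 1" by simp
      qed
      note B = bernstein_markov_disc[OF J s cs(4), of x]
      let ?I = "\<integral>z. indicator (ball c s) z * (\<Prod>j\<in>?J. cmod (z - x j))\<^sup>2 \<partial>lborel"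
      have I0: "0 \<le> ?I" by (intro integral_nonneg_AE AE_I2) auto
      have wt: "exp (- D) * exp (- (r * cmod ?v)\<^sup>2) \<le> exp (- (r * cmod y)\<^sup>2)" if y: "y \<in> ball c s" for y
      proof -
        have "cmod (y - ?v) \<le> cmod (y - c) + cmod (?v - c)"
          using norm_triangle_ineq4[of "y - c" "?v - c"] by simp
        also have "\<dots> \<le> s + (1 + 1 / n) * s" using y cs(4) by (intro add_mono) (auto simp: dist_norm norm_minus_commute)
        also have "\<dots> \<le> 3 * s"
        proof -
          have "1 / real n \<le> 1" using n by simp
          then have "1 / real n * s \<le> 1 * s" using s by (intro mult_right_mono) auto
          then show ?thesis by (simp add: algebra_simps)
        qed
        finally have "cmod y \<le> cmod ?v + 3 * s" using norm_triangle_ineq2[of y ?v] by linarith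
        then have "(cmod y)\<^sup>2 \<le> (cmod ?v + 3 * s)\<^sup>2" by (intro power_mono) auto
        also have "\<dots> = (cmod ?v)\<^sup>2 + s * (6 * cmod ?v + 9 * s)" by (simp add: power2_eq_square algebra_simps)
        also have "\<dots> \<le> (cmod ?v)\<^sup>2 + s * (6 * \<bar>R\<bar> + 9)"
          using s s1 v by (intro add_left_mono mult_left_mono add_mono) auto
        finally have "r\<^sup>2 * (cmod y)\<^sup>2 \<le> r\<^sup>2 * ((cmod ?v)\<^sup>2 + s * (6 * \<bar>R\<bar> + 9))" by (intro mult_left_mono) auto
        also have "\<dots> = r\<^sup>2 * (cmod ?v)\<^sup>2 + r\<^sup>2 * s * (6 * \<bar>R\<bar> + 9)" by (simp add: algebra_simps)
        also have "r\<^sup>2 * s * (6 * \<bar>R\<bar> + 9) \<le> 2 * (6 * \<bar>R\<bar> + 9)"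
        proof (intro mult_right_mono)
          have "r\<^sup>2 * s \<le> (real n + 1) * s" using n s by (intro mult_right_mono) auto
          also have "\<dots> = s * n + s" by (simp add: algebra_simps)
          finally show "r\<^sup>2 * s \<le> 2" using s1 by linarith
        qed auto
        finally have "(r * cmod y)\<^sup>2 \<le> (r * cmod ?v)\<^sup>2 + D" by (simp add: power_mult_distrib D_def)
        then show ?thesis by (simp flip: exp_add)
      qed
      have "(\<kappa> / real n ^ 8) * ens r F n (x(i := ?v)) \<le> C * (exp (- D) * exp (- (r * cmod ?v)\<^sup>2) * ?I)"
      proof -
        have "ens r F n (x(i := ?v)) \<le> C * (exp (- (r * cmod ?v)\<^sup>2) * ((exp 1 * (real n)\<^sup>2 / s)\<^sup>2 * ?I))"
          unfolding ens_eq using v F' B(2) C0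
          by (intro mult_left_mono mult_mono) (auto simp: indicator_def)
        moreover have "(exp 1 * (real n)\<^sup>2 / s)\<^sup>2 \<le> (exp 1)\<^sup>2 * real n ^ 8 / \<epsilon>\<^sup>2"
        proof -
          have "\<epsilon> / (real n)\<^sup>2 \<le> s" using cs(1) by (simp add: power2_eq_square)
          then have "exp 1 * (real n)\<^sup>2 / s \<le> exp 1 * (real n)\<^sup>2 / (\<epsilon> / (real n)\<^sup>2)"
            using \<epsilon> n0 s by (intro divide_left_mono) auto
          then have "(exp 1 * (real n)\<^sup>2 / s)\<^sup>2 \<le> (exp 1 * (real n)\<^sup>2 / (\<epsilon> / (real n)\<^sup>2))\<^sup>2"
            using s by (intro power_mono) auto
          also have "\<dots> = (exp 1)\<^sup>2 * real n ^ 8 / \<epsilon>\<^sup>2"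
            by (simp add: power_mult_distrib power_divide flip: power_add power_mult)
          finally show ?thesis .
        qed
        ultimately have "ens r F n (x(i := ?v)) \<le> C * (exp (- (r * cmod ?v)\<^sup>2) * ((exp 1)\<^sup>2 * real n ^ 8 / \<epsilon>\<^sup>2 * ?I))"
          using C0 I0 by (meson exp_ge_zero mult_left_mono mult_right_mono order_trans)
        then have "(\<kappa> / real n ^ 8) * ens r F n (x(i := ?v)) \<le> (\<kappa> / real n ^ 8) * (C * (exp (- (r * cmod ?v)\<^sup>2) * ((exp 1)\<^sup>2 * real n ^ 8 / \<epsilon>\<^sup>2 * ?I)))"
          using \<kappa> by (intro mult_left_mono) auto
        also have "\<dots> = C * (exp (- D) * exp (- (r * cmod ?v)\<^sup>2) * ?I)"
          using n0 \<epsilon> by (simp add: \<kappa>_def field_simps)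
        finally show ?thesis .
      qed
      then have "?k * ennreal (ens r F n (x(i := ?v))) \<le> ennreal (C * (exp (- D) * exp (- (r * cmod ?v)\<^sup>2)) * ?I)"
        using \<kappa> ens0 by (simp add: ennreal_mult'[symmetric] ennreal_leI mult.assoc)
      also have "\<dots> = (\<integral>\<^sup>+y. ennreal (C * (exp (- D) * exp (- (r * cmod ?v)\<^sup>2)) * (indicator (ball c s) y * (\<Prod>j\<in>?J. cmod (y - x j))\<^sup>2)) \<partial>lborel)"
        using B(1) C0
        by (subst nn_integral_eq_integral) (auto intro!: mult_nonneg_nonneg)
      also have "\<dots> \<le> (\<integral>\<^sup>+y. ennreal (ens r F n (x(i := y))) \<partial>lborel)"
      proof (intro nn_integral_mono ennreal_leI)
        fix y
        show "C * (exp (- D) * exp (- (r * cmod ?v)\<^sup>2)) * (indicator (ball c s) y * (\<Prod>j\<in>?J. cmod (y - x j))\<^sup>2) \<le> ens r F n (x(i := y))"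
        proof (cases "y \<in> ball c s")
          case True
          then have "y \<in> F" using cs(3) by auto
          have "exp (- D) * exp (- (r * cmod ?v)\<^sup>2) * (\<Prod>j\<in>?J. cmod (y - x j))\<^sup>2 \<le> exp (- (r * cmod y)\<^sup>2) * (\<Prod>j\<in>?J. cmod (y - x j))\<^sup>2"
            by (rule mult_right_mono[OF wt[OF True]]) simp
          from mult_left_mono[OF this C0] show ?thesis
            unfolding ens_eq using True \<open>y \<in> F\<close> by (simp add: mult.assoc)
        next
          case False
          then show ?thesis using ens0[of "x(i := y)"] by simp
        qed
      qed
      finally show "?k * ennreal (ens r F n (x(i := ?w i))) \<le> (\<integral>\<^sup>+y. ennreal (ens r F n (x(i := y))) \<partial>lborel)"
        using i by simp
    qed (auto simp: extensional_def)
    moreover have "ens r F n ?w = ens r F n w"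
      unfolding ens_def by (intro arg_cong2[where f="(*)"] prod.cong vd_cong refl) auto
    moreover have "0 \<le> partfn r F n" unfolding partfn_def by (intro integral_nonneg_AE AE_I2 ens0)
    ultimately show ?thesis
      unfolding pf using \<kappa> ens0[of w]
      by (simp add: ennreal_power ennreal_mult'[symmetric])
  qed
  show ?thesis by (intro exI[of _ \<kappa>] conjI \<kappa> allI impI main) auto
qed

section \<open>A nonnegative energy kernel and configurations of small energy\<close>

section \<open>Weighted energy\<close>

text \<open>The field is shared between the two particles of a pair: against a probability measure
  squared, the two halves add up to the second moment once.\<close>

definition kr :: "complex \<Rightarrow> complex \<Rightarrow> real" where
  "kr z w = - ln (cmod (z - w)) + ((cmod z)\<^sup>2 + (cmod w)\<^sup>2) / 2"

definition kk :: "complex \<Rightarrow> complex \<Rightarrow> ennreal" where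
  "kk z w = (if z = w then \<infinity> else ennreal (kr z w))"

text \<open>ln x is at most x - 1, and |z| + |w| - 1 is at most half the sum of the squares. Thanks
  to this sign the energy is a single integral in \<open>ennreal\<close>, and restricting a measure
  cannot increase it.\<close>

lemma kr_nonneg:
  assumes "z \<noteq> w"
  shows "0 \<le> kr z w"
proof -
  have "ln (cmod (z - w)) \<le> cmod (z - w) - 1" using assms by (intro ln_le_minus_one) simp
  also have "\<dots> \<le> cmod z + cmod w - 1" using norm_triangle_ineq4[of z w] by simp
  also have "\<dots> \<le> ((cmod z)\<^sup>2 + (cmod w)\<^sup>2) / 2"
  proof -
    have "0 \<le> (cmod z - 1)\<^sup>2 + (cmod w - 1)\<^sup>2" by simp
    then show ?thesis by (simp add: power2_diff field_simps)
  qed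
  finally show ?thesis by (simp add: kr_def)
qed

lemma kernels_measurable [measurable]:
  "(\<lambda>p. kk (fst p) (snd p)) \<in> borel_measurable (borel \<Otimes>\<^sub>M borel)"
  "(\<lambda>p. logk_pos (fst p) (snd p)) \<in> borel_measurable (borel \<Otimes>\<^sub>M borel)"
  "(\<lambda>p. logk_neg (fst p) (snd p)) \<in> borel_measurable (borel \<Otimes>\<^sub>M borel)"
  unfolding kk_def kr_def logk_pos_def logk_neg_def by measurable

text \<open>Written without subtraction so that it also holds on the diagonal and can be integrated
  in \<open>ennreal\<close>.\<close>

lemma kernel_split:
  "logk_pos z w + ennreal (((cmod z)\<^sup>2 + (cmod w)\<^sup>2) / 2) = kk z w + logk_neg z w"
proof (cases "z = w")
  case False
  define l where "l = ln (cmod (z - w))"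
  define a where "a = ((cmod z)\<^sup>2 + (cmod w)\<^sup>2) / 2"
  have a: "0 \<le> a" "0 \<le> - l + a" using kr_nonneg[OF False] by (auto simp: a_def l_def kr_def)
  have "ennreal (max 0 (- l)) + ennreal a = ennreal (max 0 (- l) + a)" using a by (intro ennreal_plus[symmetric]) auto
  also have "max 0 (- l) + a = (- l + a) + max 0 l" by simp
  also have "ennreal \<dots> = ennreal (- l + a) + ennreal (max 0 l)" using a by (intro ennreal_plus) auto
  finally show ?thesis
    using False by (simp add: logk_pos_def logk_neg_def kk_def kr_def a_def l_def)
qed (simp add: logk_pos_def kk_def)

lemma prob_meas_inE:
  assumes "prob_meas_in E \<mu>"
  obtains C where "compact C" "C \<subseteq> E" "AE z in \<mu>. z \<in> C" "prob_space \<mu>" "sets \<mu> = sets borel"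
proof -
  obtain C where C: "compact C" "C \<subseteq> E" "emeasure \<mu> (UNIV - C) = 0" and s: "sets \<mu> = sets borel" and p: "prob_space \<mu>"
    using assms unfolding prob_meas_in_def by blast
  have "AE z in \<mu>. z \<in> C"
    by (rule AE_I'[of "UNIV - C"]) (use C s in \<open>auto simp: null_sets_def compact_imp_closed intro!: borel_closed sets.Diff\<close>)
  with C s p show ?thesis by (intro that)
qed

lemma nn_integral_pair:
  assumes "sets \<mu> = sets borel" "prob_space \<mu>" "sets \<nu> = sets borel" "finite_measure \<nu>"
    and "f \<in> borel_measurable (borel \<Otimes>\<^sub>M borel)"
  shows "(\<integral>\<^sup>+p. f p \<partial>(\<mu> \<Otimes>\<^sub>M \<nu>)) = (\<integral>\<^sup>+x. \<integral>\<^sup>+y. f (x, y) \<partial>\<nu> \<partial>\<mu>)"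
proof -
  interpret \<nu>: finite_measure \<nu> by fact
  have eq: "sets (\<mu> \<Otimes>\<^sub>M \<nu>) = sets (borel \<Otimes>\<^sub>M borel)"
    by (rule sets_pair_measure_cong[OF assms(1,3)])
  have "f \<in> borel_measurable (\<mu> \<Otimes>\<^sub>M \<nu>)"
    unfolding measurable_cong_sets[OF eq refl] by (rule assms(5))
  then show ?thesis by (rule \<nu>.nn_integral_fst[symmetric])
qed

text \<open>On a compact support the negative part of the logarithmic kernel is bounded, hence its
  integral is finite and may be cancelled. This identifies the extended real difference defining the
  energy with one nonnegative integral.\<close>

lemma R_mu_eq:
  assumes "prob_meas_in E \<mu>"
  shows "R_mu \<mu> = enn2ereal (\<integral>\<^sup>+p. kk (fst p) (snd p) \<partial>(\<mu> \<Otimes>\<^sub>M \<mu>))"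
proof -
  obtain C where C: "compact C" "C \<subseteq> E" "AE z in \<mu>. z \<in> C" and p: "prob_space \<mu>" and s[simp, measurable_cong]: "sets \<mu> = sets borel"
    using prob_meas_inE[OF assms] .
  interpret prob_space \<mu> by fact
  obtain B where B: "\<And>z. z \<in> C \<Longrightarrow> cmod z \<le> B" "1 \<le> B"
  proof -
    obtain B where "\<And>z. z \<in> C \<Longrightarrow> cmod z \<le> B" using compact_imp_bounded[OF C(1)] by (auto simp: bounded_iff)
    then show ?thesis by (intro that[of "max B 1"]) (auto intro: max.coboundedI1)
  qed
  let ?P = "\<mu> \<Otimes>\<^sub>M \<mu>"
  have sP: "sets ?P = sets (borel \<Otimes>\<^sub>M borel)" by (intro sets_pair_measure_cong) auto
  have mb: "f \<in> borel_measurable ?P" if "f \<in> borel_measurable (borel \<Otimes>\<^sub>M borel)" for f :: "complex \<times> complex \<Rightarrow> ennreal"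
    unfolding measurable_cong_sets[OF sP refl] by (rule that)
  note pair = nn_integral_pair[OF s p s finite_measure_axioms]
  have intsq: "integrable \<mu> (\<lambda>z. (cmod z)\<^sup>2)"
    by (rule integrable_const_bound[of _ "B\<^sup>2"]) (use C(3) B in \<open>auto intro!: power_mono elim!: eventually_mono\<close>)
  define m where "m = (\<integral>z. (cmod z)\<^sup>2 \<partial>\<mu>)"
  have m0: "0 \<le> m" unfolding m_def by (intro integral_nonneg_AE) auto
  have msq: "(\<integral>\<^sup>+z. ennreal ((cmod z)\<^sup>2) \<partial>\<mu>) = ennreal m"
    unfolding m_def by (rule nn_integral_eq_integral[OF intsq]) auto
  have quad: "(\<integral>\<^sup>+p. ennreal (((cmod (fst p))\<^sup>2 + (cmod (snd p))\<^sup>2) / 2) \<partial>?P) = ennreal m"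
  proof -
    have msq2: "(\<integral>\<^sup>+z. ennreal ((cmod z)\<^sup>2 / 2) \<partial>\<mu>) = ennreal (m / 2)"
      using nn_integral_eq_integral[of \<mu> "\<lambda>z. (cmod z)\<^sup>2 / 2"] intsq by (simp add: m_def)
    have "(\<integral>\<^sup>+p. ennreal (((cmod (fst p))\<^sup>2 + (cmod (snd p))\<^sup>2) / 2) \<partial>?P)
      = (\<integral>\<^sup>+x. \<integral>\<^sup>+y. ennreal ((cmod x)\<^sup>2 / 2) + ennreal ((cmod y)\<^sup>2 / 2) \<partial>\<mu> \<partial>\<mu>)"
      by (subst pair) (simp_all add: add_divide_distrib)
    also have "\<dots> = (\<integral>\<^sup>+x. ennreal ((cmod x)\<^sup>2 / 2) + ennreal (m / 2) \<partial>\<mu>)"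
      by (subst nn_integral_add) (auto simp: msq2 emeasure_space_1)
    also have "\<dots> = ennreal (m / 2) + ennreal (m / 2)"
      by (subst nn_integral_add) (auto simp: msq2 emeasure_space_1)
    also have "\<dots> = ennreal m" using m0 by (simp flip: ennreal_plus)
    finally show ?thesis .
  qed
  have neg: "(\<integral>\<^sup>+p. logk_neg (fst p) (snd p) \<partial>?P) < \<infinity>"
  proof -
    have "(\<integral>\<^sup>+p. logk_neg (fst p) (snd p) \<partial>?P) = (\<integral>\<^sup>+x. \<integral>\<^sup>+y. logk_neg x y \<partial>\<mu> \<partial>\<mu>)"
      by (subst pair) auto
    also have "\<dots> \<le> (\<integral>\<^sup>+x. \<integral>\<^sup>+y. ennreal (2 * B) \<partial>\<mu> \<partial>\<mu>)"
    proof (rule nn_integral_mono_AE, use C(3) in eventually_elim)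
      fix x assume x: "x \<in> C"
      show "(\<integral>\<^sup>+y. logk_neg x y \<partial>\<mu>) \<le> (\<integral>\<^sup>+y. ennreal (2 * B) \<partial>\<mu>)"
      proof (rule nn_integral_mono_AE, use C(3) in eventually_elim)
        fix y assume y: "y \<in> C"
        have d: "cmod (x - y) \<le> 2 * B" using norm_triangle_ineq4[of x y] B(1)[OF x] B(1)[OF y] by linarith
        have "ln (cmod (x - y)) \<le> 2 * B"
        proof (cases "x = y")
          case False
          then have "ln (cmod (x - y)) \<le> cmod (x - y) - 1" by (intro ln_le_minus_one) simp
          then show ?thesis using d by linarith
        qed (use B in simp)
        then show "logk_neg x y \<le> ennreal (2 * B)" unfolding logk_neg_def using B by (intro ennreal_leI) simp
      qed
    qed
    also have "\<dots> < \<infinity>" by (simp add: emeasure_space_1)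
    finally show ?thesis .
  qed
  have "(\<integral>\<^sup>+p. logk_pos (fst p) (snd p) \<partial>?P) + ennreal m
      = (\<integral>\<^sup>+p. logk_pos (fst p) (snd p) + ennreal (((cmod (fst p))\<^sup>2 + (cmod (snd p))\<^sup>2) / 2) \<partial>?P)"
    unfolding quad[symmetric] by (intro nn_integral_add[symmetric] mb) measurable
  also have "\<dots> = (\<integral>\<^sup>+p. kk (fst p) (snd p) + logk_neg (fst p) (snd p) \<partial>?P)" unfolding kernel_split ..
  also have "\<dots> = (\<integral>\<^sup>+p. kk (fst p) (snd p) \<partial>?P) + (\<integral>\<^sup>+p. logk_neg (fst p) (snd p) \<partial>?P)"
    by (intro nn_integral_add mb) measurable
  finally have "enn2ereal ((\<integral>\<^sup>+p. logk_pos (fst p) (snd p) \<partial>?P) + ennreal m)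
     = enn2ereal ((\<integral>\<^sup>+p. kk (fst p) (snd p) \<partial>?P) + (\<integral>\<^sup>+p. logk_neg (fst p) (snd p) \<partial>?P))" by simp
  moreover obtain N where N: "enn2ereal (\<integral>\<^sup>+p. logk_neg (fst p) (snd p) \<partial>?P) = ereal N"
  proof -
    obtain x where "0 \<le> x" "(\<integral>\<^sup>+p. logk_neg (fst p) (snd p) \<partial>?P) = ennreal x"
      using neg by (cases "\<integral>\<^sup>+p. logk_neg (fst p) (snd p) \<partial>?P") auto
    then show ?thesis by (intro that[of x]) (simp add: enn2ereal_ennreal)
  qed
  ultimately have "enn2ereal (\<integral>\<^sup>+p. logk_pos (fst p) (snd p) \<partial>?P) + ereal m = enn2ereal (\<integral>\<^sup>+p. kk (fst p) (snd p) \<partial>?P) + ereal N"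
    using m0 by (simp add: plus_ennreal.rep_eq)
  then show ?thesis
    unfolding R_mu_def log_energy_def N m_def[symmetric]
    by (cases "enn2ereal (\<integral>\<^sup>+p. logk_pos (fst p) (snd p) \<partial>?P)"; cases "enn2ereal (\<integral>\<^sup>+p. kk (fst p) (snd p) \<partial>?P)") auto
qed

text \<open>A function cannot exceed a finite bound on its mean almost everywhere; otherwise the
  truncated difference would have integral 0 while being positive.\<close>

lemma prob_exists_le:
  assumes "prob_space \<mu>" and g: "g \<in> borel_measurable \<mu>" and C: "AE x in \<mu>. x \<in> C"
    and B: "(\<integral>\<^sup>+x. g x \<partial>\<mu>) \<le> B" "B < \<infinity>"
  shows "\<exists>x\<in>C. g x \<le> (B :: ennreal)"
proof (rule ccontr)
  assume neg: "\<not> ?thesis"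
  interpret prob_space \<mu> by fact
  have gt: "AE x in \<mu>. B < g x" using C by eventually_elim (use neg in \<open>auto simp: not_le\<close>)
  have "(\<integral>\<^sup>+x. g x - B \<partial>\<mu>) = (\<integral>\<^sup>+x. g x \<partial>\<mu>) - (\<integral>\<^sup>+x. B \<partial>\<mu>)"
    by (rule nn_integral_diff) (use g B gt in \<open>auto simp: emeasure_space_1 elim!: eventually_mono\<close>)
  also have "\<dots> = 0" using B by (simp add: emeasure_space_1 diff_eq_0_ennreal)
  finally have "AE x in \<mu>. g x - B = 0" using g by (subst (asm) nn_integral_0_iff_AE) auto
  with gt have "AE x in \<mu>. False"
    by eventually_elim (auto simp: diff_eq_0_iff_ennreal)
  then show False by simp
qed

text \<open>Points of small mutual energy are chosen one at a time so that the conditional expectation of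
  the energy, the remaining points being drawn from the measure, does not increase.\<close>

lemma greedy_points:
  assumes \<mu>: "prob_space \<mu>" "sets \<mu> = sets borel" and C: "AE x in \<mu>. x \<in> C"
    and E: "(\<integral>\<^sup>+x. \<integral>\<^sup>+y. kk y x \<partial>\<mu> \<partial>\<mu>) = E" "E < \<infinity>"
  shows "\<exists>w. (\<forall>i<n. w i \<in> C) \<and> (\<Sum>j<n. \<Sum>i<j. kk (w j) (w i)) \<le> of_nat (n choose 2) * E"
proof -
  interpret prob_space \<mu> by fact
  note [measurable_cong] = \<mu>(2)
  define p where "p x = (\<integral>\<^sup>+y. kk y x \<partial>\<mu>)" for x
  have kkm[measurable]: "(\<lambda>y. kk y x) \<in> borel_measurable borel" for x
    using measurable_compose[OF _ kernels_measurable(1), of "\<lambda>y. (y, x)" borel] by simp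
  have pm[measurable]: "p \<in> borel_measurable borel"
  proof -
    have "(\<lambda>q. kk (snd q) (fst q)) \<in> borel_measurable (borel \<Otimes>\<^sub>M borel)"
      using measurable_compose[OF _ kernels_measurable(1), of "\<lambda>q. (snd q, fst q)" "borel \<Otimes>\<^sub>M borel"] by simp
    moreover have eq: "sets (borel \<Otimes>\<^sub>M \<mu>) = sets (borel \<Otimes>\<^sub>M borel)"
      by (rule sets_pair_measure_cong[OF refl \<mu>(2)])
    ultimately have "(\<lambda>q. kk (snd q) (fst q)) \<in> borel_measurable (borel \<Otimes>\<^sub>M \<mu>)"
      unfolding measurable_cong_sets[OF eq refl] by blast
    from borel_measurable_nn_integral_fst[OF this] show ?thesis by (simp add: p_def[abs_def])
  qed
  have pE: "(\<integral>\<^sup>+x. p x \<partial>\<mu>) = E" using E(1) by (simp add: p_def)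
  \<comment> \<open>With \<open>n - m\<close> points still random, the three terms are the energy
    among the chosen points, the mean energy between chosen and random points, and the mean energy
    among random points. At \<open>m = 0\<close> the sum is the right-hand side.\<close>
  have "\<exists>w. (\<forall>i<m. w i \<in> C) \<and> (\<Sum>j<m. \<Sum>i<j. kk (w j) (w i)) + of_nat (n - m) * (\<Sum>i<m. p (w i)) + of_nat ((n - m) choose 2) * E
      \<le> of_nat (n choose 2) * E" if "m \<le> n" for m
    using that
  proof (induction m)
    case 0
    then show ?case by simp
  next
    case (Suc m)
    then obtain w where w: "\<forall>i<m. w i \<in> C" and
      le: "(\<Sum>j<m. \<Sum>i<j. kk (w j) (w i)) + of_nat (n - m) * (\<Sum>i<m. p (w i)) + of_nat ((n - m) choose 2) * E \<le> of_nat (n choose 2) * E"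
      by auto
    define k where "k = n - Suc m"
    have k: "n - m = Suc k" using Suc.prems by (simp add: k_def)
    let ?T = "\<Sum>j<m. \<Sum>i<j. kk (w j) (w i)"
    \<comment> \<open>The same quantity as a function of the next point. Its mean over the measure
      is the previous value, because k + (k choose 2) = (Suc k choose 2).\<close>
    define g where "g x = ?T + (\<Sum>i<m. kk x (w i)) + of_nat k * ((\<Sum>i<m. p (w i)) + p x) + of_nat (k choose 2) * E" for x
    have "(\<integral>\<^sup>+x. g x \<partial>\<mu>) = ?T + (\<Sum>i<m. p (w i)) + of_nat k * ((\<Sum>i<m. p (w i)) + E) + of_nat (k choose 2) * E"
      unfolding g_def by (simp add: nn_integral_add nn_integral_cmult nn_integral_sum emeasure_space_1 pE p_def[symmetric])
    also have "\<dots> = ?T + of_nat (Suc k) * (\<Sum>i<m. p (w i)) + of_nat (Suc k choose 2) * E"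
      by (simp add: numeral_2_eq_2 algebra_simps)
    also have "\<dots> \<le> of_nat (n choose 2) * E" using le unfolding k .
    finally have "(\<integral>\<^sup>+x. g x \<partial>\<mu>) \<le> of_nat (n choose 2) * E" .
    moreover have "of_nat (n choose 2) * E < \<infinity>" using E(2) by (simp add: ennreal_mult_less_top of_nat_less_top)
    moreover have "g \<in> borel_measurable \<mu>" unfolding g_def[abs_def] by measurable
    ultimately obtain x where x: "x \<in> C" "g x \<le> of_nat (n choose 2) * E"
      using prob_exists_le[OF \<mu>(1) _ C] by blast
    let ?w = "w(m := x)"
    have 1: "(\<Sum>j<Suc m. \<Sum>i<j. kk (?w j) (?w i)) = ?T + (\<Sum>i<m. kk x (w i))" by simp
    have 2: "(\<Sum>i<Suc m. p (?w i)) = (\<Sum>i<m. p (w i)) + p x" by simp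
    have "(\<Sum>j<Suc m. \<Sum>i<j. kk (?w j) (?w i)) + of_nat (n - Suc m) * (\<Sum>i<Suc m. p (?w i)) + of_nat ((n - Suc m) choose 2) * E \<le> of_nat (n choose 2) * E"
      unfolding 1 2 k_def[symmetric] using x(2) unfolding g_def .
    moreover have "\<forall>i<Suc m. ?w i \<in> C" using w x(1) by (auto simp: less_Suc_eq)
    ultimately show ?case by blast
  qed
  from this[of n] obtain w where "\<forall>i<n. w i \<in> C" "(\<Sum>j<n. \<Sum>i<j. kk (w j) (w i)) + of_nat (n - n) * (\<Sum>i<n. p (w i)) + of_nat ((n - n) choose 2) * E \<le> of_nat (n choose 2) * E" by auto
  then show ?thesis by (intro exI[of _ w]) (simp add: numeral_2_eq_2)
qed

lemma sum_pairs: "(\<Sum>j<n. \<Sum>i<j. (a j + a i :: real)) = (real n - 1) * (\<Sum>i<n. a i)"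
  by (induction n) (auto simp: sum.distrib algebra_simps)

text \<open>Passing from logarithms to \<open>kr\<close> adds half of each squared modulus per pair,
  and each particle belongs to n - 1 pairs. Hence \<open>wvd\<close> is the exponential of minus
  twice the pair energy.\<close>

lemma vd_exp:
  assumes "\<And>i j. i < j \<Longrightarrow> j < n \<Longrightarrow> z j \<noteq> z i"
  shows "vd {..<n} z = exp (- 2 * (\<Sum>j<n. \<Sum>i<j. kr (z j) (z i)) + (real n - 1) * (\<Sum>i<n. (cmod (z i))\<^sup>2))"
proof -
  have "(\<Prod>j<n. \<Prod>i<j. cmod (z j - z i)) = (\<Prod>j<n. \<Prod>i<j. exp (ln (cmod (z j - z i))))"
    using assms by (intro prod.cong refl) auto
  also have "\<dots> = exp (\<Sum>j<n. \<Sum>i<j. ln (cmod (z j - z i)))" by (simp add: exp_sum)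
  also have "(\<Sum>j<n. \<Sum>i<j. ln (cmod (z j - z i))) = - (\<Sum>j<n. \<Sum>i<j. kr (z j) (z i)) + (\<Sum>j<n. \<Sum>i<j. ((cmod (z j))\<^sup>2 + (cmod (z i))\<^sup>2)) / 2"
  proof -
    have "(\<Sum>j<n. \<Sum>i<j. ln (cmod (z j - z i))) = (\<Sum>j<n. \<Sum>i<j. ((cmod (z j))\<^sup>2 + (cmod (z i))\<^sup>2) / 2 - kr (z j) (z i))"
      by (intro sum.cong refl) (simp add: kr_def)
    also have "\<dots> = (\<Sum>j<n. \<Sum>i<j. ((cmod (z j))\<^sup>2 + (cmod (z i))\<^sup>2)) / 2 - (\<Sum>j<n. \<Sum>i<j. kr (z j) (z i))"
      by (simp only: sum_subtractf sum_divide_distrib[symmetric])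
    finally show ?thesis by linarith
  qed
  finally have e: "(\<Prod>j<n. \<Prod>i<j. cmod (z j - z i)) = exp (- (\<Sum>j<n. \<Sum>i<j. kr (z j) (z i)) + (real n - 1) * (\<Sum>i<n. (cmod (z i))\<^sup>2) / 2)"
    unfolding sum_pairs .
  have "vd {..<n} z = (\<Prod>j<n. \<Prod>i<j. cmod (z j - z i))\<^sup>2"
    unfolding vandermonde_vd[symmetric] by (simp add: prod_norm)
  also have "\<dots> = exp (- 2 * (\<Sum>j<n. \<Sum>i<j. kr (z j) (z i)) + (real n - 1) * (\<Sum>i<n. (cmod (z i))\<^sup>2))"
    unfolding e by (simp flip: exp_of_nat_mult)
  finally show ?thesis .
qed

lemma kk_sum_finite:
  fixes z :: "nat \<Rightarrow> complex" and n :: nat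
  assumes "(\<Sum>j<n. \<Sum>i<j. kk (z j) (z i)) \<le> ennreal T" "0 \<le> T"
  shows "\<And>i j. i < j \<Longrightarrow> j < n \<Longrightarrow> z j \<noteq> z i" and "(\<Sum>j<n. \<Sum>i<j. kr (z j) (z i)) \<le> T"
proof -
  show ne: "z j \<noteq> z i" if ij: "i < j" "j < n" for i j
  proof
    assume eq: "z j = z i"
    have "kk (z j) (z i) \<le> (\<Sum>i<j. kk (z j) (z i))" using ij by (intro member_le_sum) auto
    also have "\<dots> \<le> (\<Sum>j<n. \<Sum>i<j. kk (z j) (z i))" using ij by (intro member_le_sum) auto
    finally have "\<infinity> \<le> ennreal T" using assms(1) eq by (simp add: kk_def)
    then show False by (simp add: top_unique)
  qed
  have "(\<Sum>j<n. \<Sum>i<j. kk (z j) (z i)) = (\<Sum>j<n. \<Sum>i<j. ennreal (kr (z j) (z i)))"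
    using ne by (intro sum.cong refl) (auto simp: kk_def)
  also have "\<dots> = ennreal (\<Sum>j<n. \<Sum>i<j. kr (z j) (z i))"
  proof -
    have "(\<Sum>i<j. ennreal (kr (z j) (z i))) = ennreal (\<Sum>i<j. kr (z j) (z i))" if "j < n" for j
      by (rule sum_ennreal) (use ne kr_nonneg that in auto)
    then have "(\<Sum>j<n. \<Sum>i<j. ennreal (kr (z j) (z i))) = (\<Sum>j<n. ennreal (\<Sum>i<j. kr (z j) (z i)))"
      by (intro sum.cong refl) auto
    also have "\<dots> = ennreal (\<Sum>j<n. \<Sum>i<j. kr (z j) (z i))"
      by (rule sum_ennreal, rule sum_nonneg) (use ne kr_nonneg in auto)
    finally show ?thesis .
  qed
  finally show "(\<Sum>j<n. \<Sum>i<j. kr (z j) (z i)) \<le> T" using assms by simp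
qed

text \<open>A greedy configuration has pair energy at most (n choose 2) * R, and the density at this
  configuration bounds the partition function from below. Compactness of the support makes the
  constants independent of n and r.\<close>

lemma partfn_lower_energy:
  assumes th: "thick_in F' F" and F: "closed F" and F': "F' \<subseteq> F"
    and \<mu>: "prob_meas_in F' \<mu>" and R: "R_mu \<mu> = ereal R"
  obtains \<kappa> D where "0 < \<kappa>"
    "\<And>r n. 0 < r \<Longrightarrow> 1 \<le> n \<Longrightarrow> real n \<le> r\<^sup>2 \<Longrightarrow> r\<^sup>2 \<le> real n + 1 \<Longrightarrow>
       (\<kappa> / real n ^ 8) ^ n * exp (- (real n)\<^sup>2 * R - real n * D) \<le> partfn r F n" "0 \<le> R"
proof -
  obtain C where C: "compact C" "C \<subseteq> F'" "AE z in \<mu>. z \<in> C" and p: "prob_space \<mu>" and s: "sets \<mu> = sets borel"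
    using prob_meas_inE[OF \<mu>] .
  interpret prob_space \<mu> by fact
  obtain B where B: "\<And>z. z \<in> C \<Longrightarrow> cmod z \<le> B" using compact_imp_bounded[OF C(1)] by (auto simp: bounded_iff)
  have Req: "enn2ereal (\<integral>\<^sup>+p. kk (fst p) (snd p) \<partial>(\<mu> \<Otimes>\<^sub>M \<mu>)) = ereal R" using R R_mu_eq[OF \<mu>] by simp
  then have R0: "0 \<le> R" by (metis enn2ereal_nonneg ereal_less_eq(5))
  have "(\<integral>\<^sup>+p. kk (fst p) (snd p) \<partial>(\<mu> \<Otimes>\<^sub>M \<mu>)) = ennreal R"
    using Req by (metis e2ennreal_enn2ereal e2ennreal_ereal)
  moreover have "kk y x = kk x y" for x y
    by (simp add: kk_def kr_def norm_minus_commute add.commute)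
  ultimately have E: "(\<integral>\<^sup>+x. \<integral>\<^sup>+y. kk y x \<partial>\<mu> \<partial>\<mu>) = ennreal R"
    using nn_integral_pair[OF s p s finite_measure_axioms kernels_measurable(1)] by simp
  obtain \<kappa> where \<kappa>: "0 < \<kappa>" "\<And>r n w. 0 < r \<Longrightarrow> n \<ge> 1 \<Longrightarrow> r\<^sup>2 \<le> real n + 1 \<Longrightarrow> (\<forall>i<n. w i \<in> F' \<inter> cball 0 B) \<Longrightarrow>
     (\<kappa> / real n ^ 8) ^ n * ens r F n w \<le> partfn r F n"
    using partfn_lower_bound[OF th F F', of B] by auto
  have main: "(\<kappa> / real n ^ 8) ^ n * exp (- (real n)\<^sup>2 * R - real n * (2 * B\<^sup>2)) \<le> partfn r F n"
    if r: "0 < r" "1 \<le> n" "real n \<le> r\<^sup>2" "r\<^sup>2 \<le> real n + 1" for r n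
  proof -
    obtain w where w: "\<forall>i<n. w i \<in> C" "(\<Sum>j<n. \<Sum>i<j. kk (w j) (w i)) \<le> of_nat (n choose 2) * ennreal R"
      using greedy_points[OF p s C(3) E] by auto
    have T: "of_nat (n choose 2) * ennreal R = ennreal (real (n choose 2) * R)"
      using R0 by (simp add: ennreal_mult ennreal_of_nat_eq_real_of_nat)
    note kf = kk_sum_finite[OF w(2)[unfolded T]]
    have c2: "2 * real (n choose 2) \<le> (real n)\<^sup>2"
    proof -
      have "2 * (n choose 2) \<le> n * (n - 1)" unfolding choose_two by simp
      also have "\<dots> \<le> n\<^sup>2" by (simp add: power2_eq_square)
      finally have "real (2 * (n choose 2)) \<le> real (n\<^sup>2)" by (rule of_nat_mono)
      then show ?thesis by simp
    qed
    have S: "(\<Sum>i<n. (cmod (w i))\<^sup>2) \<le> real n * B\<^sup>2"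
    proof -
      have "(cmod (w i))\<^sup>2 \<le> B\<^sup>2" if "i \<in> {..<n}" for i
        using B w(1) that by (intro power_mono) auto
      from sum_mono[of "{..<n}" "\<lambda>i. (cmod (w i))\<^sup>2" "\<lambda>_. B\<^sup>2", OF this] show ?thesis by simp
    qed
    have S0: "0 \<le> (\<Sum>i<n. (cmod (w i))\<^sup>2)" by (intro sum_nonneg) auto
    have wF: "w i \<in> F" if "i < n" for i using w(1) C(2) F' that by auto
    have "ens r F n w = (\<Prod>i<n. exp (- (r * cmod (w i))\<^sup>2)) * vd {..<n} w"
      unfolding ens_def using wF by simp
    also have "(\<Prod>i<n. exp (- (r * cmod (w i))\<^sup>2)) = exp (- r\<^sup>2 * (\<Sum>i<n. (cmod (w i))\<^sup>2))"
      by (simp add: exp_sum[symmetric] sum_distrib_left power_mult_distrib sum_negf)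
    also have "vd {..<n} w = exp (- 2 * (\<Sum>j<n. \<Sum>i<j. kr (w j) (w i)) + (real n - 1) * (\<Sum>i<n. (cmod (w i))\<^sup>2))"
      by (rule vd_exp) (use kf(1) R0 in auto)
    finally have ens: "ens r F n w = exp (- 2 * (\<Sum>j<n. \<Sum>i<j. kr (w j) (w i)) - (r\<^sup>2 - real n + 1) * (\<Sum>i<n. (cmod (w i))\<^sup>2))"
      by (simp add: exp_add[symmetric] algebra_simps)
    have "2 * (\<Sum>j<n. \<Sum>i<j. kr (w j) (w i)) \<le> 2 * (real (n choose 2) * R)" using kf(2) R0 by simp
    also have "\<dots> \<le> (real n)\<^sup>2 * R" using mult_right_mono[OF c2 R0] by simp
    finally have 1: "2 * (\<Sum>j<n. \<Sum>i<j. kr (w j) (w i)) \<le> (real n)\<^sup>2 * R" .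
    \<comment> \<open>The field left over after completing the pair energy: its coefficient is at
      most 2 because r^2 is at most n + 1, and each |w i| is at most \<open>B\<close>.\<close>
    have "(r\<^sup>2 - real n + 1) * (\<Sum>i<n. (cmod (w i))\<^sup>2) \<le> 2 * (real n * B\<^sup>2)"
      using r S S0 by (intro mult_mono) auto
    then have "exp (- (real n)\<^sup>2 * R - real n * (2 * B\<^sup>2)) \<le> ens r F n w"
      unfolding ens using 1 by (simp add: algebra_simps)
    then have "(\<kappa> / real n ^ 8) ^ n * exp (- (real n)\<^sup>2 * R - real n * (2 * B\<^sup>2)) \<le> (\<kappa> / real n ^ 8) ^ n * ens r F n w"
      using \<kappa>(1) by (intro mult_left_mono) auto
    also have "\<dots> \<le> partfn r F n"
      using \<kappa>(2)[OF r(1,2,4), of w] w(1) C(2) B by auto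
    finally show ?thesis .
  qed
  show ?thesis by (rule that[OF \<kappa>(1) main R0])
qed

section \<open>Schoenberg's space-filling curve through the unit disc\<close>

section \<open>A space-filling curve\<close>

text \<open>A continuous function of period 2 that is 0 on [0, 1/3] and 1 on [2/3, 1], obtained by
  clamping a cosine.\<close>

definition digit_fun :: "real \<Rightarrow> real" where
  "digit_fun s = max 0 (min 1 (1 / 2 - cos (pi * s)))"

text \<open>A coordinate of Schoenberg's curve: ternary digits of a Cantor set point at positions of
  parity \<open>e\<close> are read as binary digits.\<close>

definition schoenberg :: "nat \<Rightarrow> real \<Rightarrow> real" where
  "schoenberg e t = (\<Sum>k. digit_fun (3 ^ (2 * k + e) * t) * (1 / 2) ^ Suc k)"

lemma digit_fun_bounds: "0 \<le> digit_fun s" "digit_fun s \<le> 1"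
  by (auto simp: digit_fun_def)

lemma continuous_digit_fun: "continuous_on A digit_fun"
  unfolding digit_fun_def by (intro continuous_intros)

lemma summable_half_Suc: "summable (\<lambda>k. (1 / 2 :: real) ^ Suc k)" "(\<Sum>k. (1 / 2 :: real) ^ Suc k) = 1"
  using sums_mult[OF geometric_sums[of "1 / 2 :: real"], of "1 / 2"] by (auto simp: sums_iff)

lemma continuous_schoenberg: "continuous_on UNIV (schoenberg e)"
proof -
  have "uniform_limit UNIV (\<lambda>n t. \<Sum>k<n. digit_fun (3 ^ (2 * k + e) * t) * (1 / 2) ^ Suc k) (schoenberg e) sequentially"
    unfolding schoenberg_def[abs_def]
  proof (rule Weierstrass_m_test)
    show "summable (\<lambda>k. (1 / 2 :: real) ^ Suc k)" by (rule summable_half_Suc)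
    show "norm (digit_fun (3 ^ (2 * n + e) * t) * (1 / 2) ^ Suc n) \<le> (1 / 2) ^ Suc n" for n t
      using digit_fun_bounds[of "3 ^ (2 * n + e) * t"] by (simp add: abs_mult)
  qed
  moreover have "continuous_on UNIV (\<lambda>t. \<Sum>k<n. digit_fun (3 ^ (2 * k + e) * t) * (1 / 2) ^ Suc k)" for n
    by (intro continuous_intros continuous_on_compose2[OF continuous_digit_fun[of UNIV]]) auto
  ultimately show ?thesis
    by (intro uniform_limit_theorem[where F=sequentially]) auto
qed

lemma schoenberg_bounds: "0 \<le> schoenberg e t" "schoenberg e t \<le> 1"
proof -
  have sm: "summable (\<lambda>k. digit_fun (3 ^ (2 * k + e) * t) * (1 / 2) ^ Suc k)"
    by (rule summable_comparison_test[OF _ summable_half_Suc(1)])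
       (use digit_fun_bounds in \<open>auto simp: abs_mult intro!: exI[of _ 0]\<close>)
  show "0 \<le> schoenberg e t" unfolding schoenberg_def
    by (intro suminf_nonneg sm mult_nonneg_nonneg digit_fun_bounds) auto
  have "schoenberg e t \<le> (\<Sum>k. (1 / 2) ^ Suc k)" unfolding schoenberg_def
    by (intro suminf_le sm summable_half_Suc) (use digit_fun_bounds in auto)
  then show "schoenberg e t \<le> 1" using summable_half_Suc(2) by simp
qed

text \<open>For a point of the Cantor set, 3^k * t is an even integer plus a remainder that lies in
  [0, 1/3] or in [2/3, 1] according to the k-th digit; the period 2 removes the integer.\<close>

lemma digit_fun_cantor:
  assumes b: "\<And>k. b k \<in> {0, 1 :: real}"
  defines "t \<equiv> (\<Sum>k. 2 * b k * (1 / 3) ^ Suc k)"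
  shows "digit_fun (3 ^ k * t) = b k" "0 \<le> t" "t \<le> 1"
proof -
  have s3: "(\<lambda>k. 2 * (1 / 3 :: real) ^ Suc k) sums 1"
    using sums_mult[OF geometric_sums[of "1 / 3 :: real"], of "2 / 3"] by simp
  have b01: "0 \<le> b k" "b k \<le> 1" for k using b[of k] by auto
  have sm: "summable (\<lambda>k. 2 * b (k + m) * (1 / 3) ^ Suc k)" for m
    by (rule summable_comparison_test[OF _ sums_summable[OF s3]])
       (use b01 in \<open>auto simp: abs_mult intro!: exI[of _ 0] mult_left_le\<close>)
  define r where "r m = (\<Sum>k. 2 * b (k + m) * (1 / 3) ^ Suc k)" for m
  have r0: "0 \<le> r m" for m unfolding r_def by (intro suminf_nonneg sm mult_nonneg_nonneg b01) auto
  have r1: "r m \<le> 1" for m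
  proof -
    have "r m \<le> (\<Sum>k. 2 * (1 / 3 :: real) ^ Suc k)" unfolding r_def
      by (intro suminf_le sm sums_summable[OF s3]) (use b01 in \<open>auto intro!: mult_left_le\<close>)
    then show ?thesis using sums_unique[OF s3] by simp
  qed
  have rec: "3 * r m = 2 * b m + r (Suc m)" for m
  proof -
    have "r m = 2 * b m * (1 / 3) + (\<Sum>k. 2 * b (Suc k + m) * (1 / 3) ^ Suc (Suc k))"
      unfolding r_def using suminf_split_head[OF sm[of m]] by simp
    also have "(\<Sum>k. 2 * b (Suc k + m) * (1 / 3) ^ Suc (Suc k)) = (\<Sum>k. (1 / 3) * (2 * b (k + Suc m) * (1 / 3) ^ Suc k))"
      by (intro suminf_cong) simp
    also have "\<dots> = (1 / 3) * r (Suc m)" unfolding r_def by (rule suminf_mult[OF sm])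
    finally show ?thesis by simp
  qed
  have t: "t = r 0" by (simp add: t_def r_def)
  show "0 \<le> t" "t \<le> 1" using r0 r1 t by auto
  have "\<exists>m::nat. 3 ^ k * t = 2 * real m + r k"
  proof (induction k)
    case 0
    then show ?case using t by (intro exI[of _ 0]) simp
  next
    case (Suc k)
    then obtain m where "3 ^ k * t = 2 * real m + r k" by blast
    then have "3 ^ Suc k * t = 2 * (3 * real m + b k) + r (Suc k)" using rec[of k] by simp
    moreover obtain c :: nat where "b k = real c" using b[of k] by (metis insertE of_nat_0 of_nat_1 singletonD)
    ultimately show ?case by (intro exI[of _ "3 * m + c"]) simp
  qed
  then obtain m :: nat where m: "3 ^ k * t = 2 * real m + r k" by blast
  have "cos (pi * (3 ^ k * t)) = cos (pi * r k + real m * (2 * pi))"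
    unfolding m by (simp add: algebra_simps)
  also have "\<dots> = cos (pi * r k)" using cos.plus_of_nat[of "pi * r k" m] by simp
  finally have c: "cos (pi * (3 ^ k * t)) = cos (pi * r k)" .
  show "digit_fun (3 ^ k * t) = b k"
  proof (cases "b k = 0")
    case True
    then have "r k \<le> 1 / 3" using rec[of k] r1[of "Suc k"] by simp
    then have "cos (pi / 3) \<le> cos (pi * r k)"
      using r0[of k] by (intro cos_monotone_0_pi_le) auto
    then show ?thesis using True c by (simp add: digit_fun_def cos_60)
  next
    case False
    then have b1: "b k = 1" using b[of k] by simp
    then have "2 / 3 \<le> r k" using rec[of k] r0[of "Suc k"] by simp
    then have "cos (pi * r k) \<le> cos (2 * pi / 3)"
      using r1[of k] by (intro cos_monotone_0_pi_le) (auto simp: field_simps)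
    then show ?thesis using b1 c by (simp add: digit_fun_def cos_120)
  qed
qed

lemma binary_expansion:
  assumes "0 \<le> x" "x < 1"
  obtains a :: "nat \<Rightarrow> real" where "\<And>k. a k \<in> {0, 1}" "(\<lambda>k. a k * (1 / 2) ^ Suc k) sums x"
proof -
  \<comment> \<open>The digit is the increment of the integer part under doubling, so the partial
    sums telescope to the truncation of \<open>x\<close> at level n.\<close>
  define a :: "nat \<Rightarrow> real" where "a k = of_int (\<lfloor>2 ^ Suc k * x\<rfloor> - 2 * \<lfloor>2 ^ k * x\<rfloor>)" for k
  have a: "a k \<in> {0, 1}" for k
  proof -
    have "\<lfloor>2 ^ Suc k * x\<rfloor> - 2 * \<lfloor>2 ^ k * x\<rfloor> \<in> {0, 1}"
    proof -
      have "2 ^ Suc k * x = 2 * (2 ^ k * x)" by simp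
      then have "2 * \<lfloor>2 ^ k * x\<rfloor> \<le> \<lfloor>2 ^ Suc k * x\<rfloor>" "\<lfloor>2 ^ Suc k * x\<rfloor> \<le> 2 * \<lfloor>2 ^ k * x\<rfloor> + 1"
        by linarith+
      then show ?thesis by auto
    qed
    then show ?thesis unfolding a_def by auto
  qed
  have ps: "(\<Sum>k<n. a k * (1 / 2) ^ Suc k) = of_int \<lfloor>2 ^ n * x\<rfloor> * (1 / 2) ^ n" for n
  proof (induction n)
    case 0
    have "\<lfloor>x\<rfloor> = 0" using assms by (simp add: floor_eq_iff)
    then show ?case by simp
  next
    case (Suc n)
    then show ?case by (simp add: a_def algebra_simps)
  qed
  have "(\<lambda>n. of_int \<lfloor>2 ^ n * x\<rfloor> * (1 / 2) ^ n) \<longlonglongrightarrow> x"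
  proof (rule tendsto_sandwich)
    show "\<forall>\<^sub>F n in sequentially. x - (1 / 2) ^ n \<le> of_int \<lfloor>2 ^ n * x\<rfloor> * (1 / 2) ^ n"
    proof (intro always_eventually allI)
      fix n
      have "(2 ^ n * x - 1) * (1 / 2) ^ n \<le> of_int \<lfloor>2 ^ n * x\<rfloor> * (1 / 2) ^ n"
        by (intro mult_right_mono) (linarith, simp)
      then show "x - (1 / 2) ^ n \<le> of_int \<lfloor>2 ^ n * x\<rfloor> * (1 / 2) ^ n"
      proof -
        assume le: "(2 ^ n * x - 1) * (1 / 2) ^ n \<le> of_int \<lfloor>2 ^ n * x\<rfloor> * (1 / 2) ^ n"
        have "(2 ^ n * x - 1) * (1 / 2) ^ n = x - (1 / 2 :: real) ^ n"
          by (simp add: field_simps power_one_over)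
        with le show ?thesis by simp
      qed
    qed
    show "\<forall>\<^sub>F n in sequentially. of_int \<lfloor>2 ^ n * x\<rfloor> * (1 / 2) ^ n \<le> x"
    proof (intro always_eventually allI)
      fix n
      have "of_int \<lfloor>2 ^ n * x\<rfloor> * (1 / 2) ^ n \<le> (2 ^ n * x) * (1 / 2 :: real) ^ n"
        by (intro mult_right_mono) auto
      then show "of_int \<lfloor>2 ^ n * x\<rfloor> * (1 / 2) ^ n \<le> x" by (simp add: power_one_over)
    qed
    have "(\<lambda>n. x - (1 / 2) ^ n) \<longlonglongrightarrow> x - 0"
      by (intro tendsto_diff tendsto_const LIMSEQ_power_zero) auto
    then show "(\<lambda>n. x - (1 / 2) ^ n) \<longlonglongrightarrow> x" by simp
  qed auto
  then have "(\<lambda>k. a k * (1 / 2) ^ Suc k) sums x" unfolding sums_def ps .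
  with a show ?thesis by (rule that)
qed

text \<open>The unit square is enlarged to the square with coordinates in [-2, 2], so that the unit
  disc corresponds to coordinates strictly below 1, as \<open>binary_expansion\<close>
  requires.\<close>

definition peano :: "real \<Rightarrow> complex" where
  "peano t = Complex (4 * schoenberg 0 t - 2) (4 * schoenberg 1 t - 2)"

lemma continuous_peano: "continuous_on UNIV peano"
  unfolding peano_def Complex_eq by (intro continuous_intros continuous_schoenberg)

lemma peano_surj:
  assumes "cmod z \<le> 1"
  obtains t where "0 \<le> t" "t \<le> 1" "peano t = z"
proof -
  have "\<bar>Re z\<bar> \<le> 1" "\<bar>Im z\<bar> \<le> 1"
    using abs_Re_le_cmod[of z] abs_Im_le_cmod[of z] assms by linarith+
  then have x: "0 \<le> (Re z + 2) / 4" "(Re z + 2) / 4 < 1" and y: "0 \<le> (Im z + 2) / 4" "(Im z + 2) / 4 < 1" by auto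
  obtain a :: "nat \<Rightarrow> real" where a: "\<And>k. a k \<in> {0, 1}" "(\<lambda>k. a k * (1 / 2) ^ Suc k) sums ((Re z + 2) / 4)"
    using binary_expansion[OF x] by blast
  obtain c :: "nat \<Rightarrow> real" where c: "\<And>k. c k \<in> {0, 1}" "(\<lambda>k. c k * (1 / 2) ^ Suc k) sums ((Im z + 2) / 4)"
    using binary_expansion[OF y] by blast
  \<comment> \<open>The binary digits of the two coordinates are interleaved into one ternary
    expansion with digits 0 and 2.\<close>
  define b where "b k = (if even k then a (k div 2) else c (k div 2))" for k
  have b: "b k \<in> {0, 1}" for k using a(1) c(1) by (simp add: b_def)
  define t where "t = (\<Sum>k. 2 * b k * (1 / 3) ^ Suc k)"
  have D: "digit_fun (3 ^ k * t) = b k" "0 \<le> t" "t \<le> 1" for k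
    unfolding t_def by (rule digit_fun_cantor[where b=b, OF b])+
  have "schoenberg 0 t = (\<Sum>k. a k * (1 / 2) ^ Suc k)"
    unfolding schoenberg_def D(1) by (simp add: b_def)
  then have 0: "schoenberg 0 t = (Re z + 2) / 4" using a(2) by (simp add: sums_iff)
  have "schoenberg 1 t = (\<Sum>k. c k * (1 / 2) ^ Suc k)"
    unfolding schoenberg_def D(1) by (simp add: b_def)
  then have 1: "schoenberg 1 t = (Im z + 2) / 4" using c(2) by (simp add: sums_iff)
  show ?thesis by (rule that[OF D(2,3)]) (unfold peano_def 0 1, simp add: complex_eq_iff field_simps)
qed

section \<open>Weak limits of empirical measures and the upper bound for configurations\<close>

section \<open>Weighted Fekete bound\<close>

text \<open>The logarithm cut off at height \<open>T\<close>. The squared distance and exp(-2T) make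
  it one formula, jointly continuous also on the diagonal.\<close>

definition kt :: "real \<Rightarrow> complex \<Rightarrow> complex \<Rightarrow> real" where
  "kt T z w = - ln (max ((cmod (z - w))\<^sup>2) (exp (- 2 * T))) / 2 + ((cmod z)\<^sup>2 + (cmod w)\<^sup>2) / 2"

lemma kt_eq: "z \<noteq> w \<Longrightarrow> kt T z w = min T (- ln (cmod (z - w))) + ((cmod z)\<^sup>2 + (cmod w)\<^sup>2) / 2"
  and kt_diag: "kt T z z = T + (cmod z)\<^sup>2"
proof -
  show "kt T z z = T + (cmod z)\<^sup>2" by (simp add: kt_def max_def)
  assume ne: "z \<noteq> w"
  have "ln (max ((cmod (z - w))\<^sup>2) (exp (- 2 * T))) = max (2 * ln (cmod (z - w))) (- 2 * T)"
  proof (cases "(cmod (z - w))\<^sup>2 \<le> exp (- 2 * T)")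
    case True
    then have "ln ((cmod (z - w))\<^sup>2) \<le> - 2 * T" using ne by (metis ln_exp ln_le_cancel_iff exp_gt_zero zero_less_norm_iff zero_less_power right_minus_eq)
    then show ?thesis using True ne by (simp add: max_def ln_realpow)
  next
    case False
    then have "exp (- 2 * T) \<le> (cmod (z - w))\<^sup>2" by simp
    then have "- 2 * T \<le> ln ((cmod (z - w))\<^sup>2)" using ne by (metis ln_exp ln_le_cancel_iff exp_gt_zero zero_less_norm_iff zero_less_power right_minus_eq)
    then show ?thesis using False ne by (simp add: max_def ln_realpow)
  qed
  then show "kt T z w = min T (- ln (cmod (z - w))) + ((cmod z)\<^sup>2 + (cmod w)\<^sup>2) / 2"
    unfolding kt_def by (simp add: max_def min_def)
qed

lemma kt_le_kr: "z \<noteq> w \<Longrightarrow> kt T z w \<le> kr z w"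
  by (simp add: kt_eq kr_def)

lemma kt_nonneg:
  assumes "0 \<le> T"
  shows "0 \<le> kt T z w"
proof (cases "z = w")
  case True
  then show ?thesis using assms kt_diag by simp
next
  case False
  then show ?thesis using kr_nonneg[OF False] assms
    by (auto simp: kt_eq kr_def min_def)
qed

lemma isCont_kt:
  assumes "(f \<longlongrightarrow> z) F" "(g \<longlongrightarrow> w) F"
  shows "((\<lambda>x. kt T (f x) (g x)) \<longlongrightarrow> kt T z w) F"
  unfolding kt_def
  by (intro tendsto_intros assms) (auto simp: max_def intro: order_less_le_trans[OF exp_gt_zero])

lemma kk_eq_SUP: "kk z w = (SUP m. ennreal (kt (real m) z w))"
proof (cases "z = w")
  case True
  have sup: "(SUP m. ennreal (kt (real m) z w)) = \<top>"
  proof (rule ennreal_SUP_eq_top)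
    show "\<exists>i\<in>UNIV. of_nat n \<le> ennreal (kt (real i) z w)" for n
      by (rule bexI[of _ n]) (auto simp: True kt_diag ennreal_of_nat_eq_real_of_nat intro!: ennreal_leI)
  qed
  have "kk z w = \<infinity>" using True by (simp add: kk_def)
  then show ?thesis by (simp only: sup infinity_ennreal_def)
next
  case False
  show ?thesis
  proof (rule antisym)
    obtain m where m: "- ln (cmod (z - w)) \<le> real m" using real_arch_simple by blast
    then have "kt (real m) z w = kr z w" using False by (simp add: kt_eq kr_def min_def)
    then show "kk z w \<le> (SUP m. ennreal (kt (real m) z w))"
      using False by (auto simp: kk_def intro!: SUP_upper2[of m])
    show "(SUP m. ennreal (kt (real m) z w)) \<le> kk z w"
      using False by (auto simp: kk_def intro!: SUP_least ennreal_leI kt_le_kr)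
  qed
qed

lemma kt_mono: "T \<le> T' \<Longrightarrow> kt T z w \<le> kt T' z w"
  by (cases "z = w") (auto simp: kt_diag kt_eq)

lemma kt_sym: "kt T z w = kt T w z"
  by (simp add: kt_def norm_minus_commute add.commute)

lemma kt_measurable [measurable]: "(\<lambda>p. ennreal (kt T (fst p) (snd p))) \<in> borel_measurable (borel \<Otimes>\<^sub>M borel)"
  unfolding kt_def by measurable

lemma sum_square_split:
  fixes f :: "nat \<Rightarrow> nat \<Rightarrow> real"
  assumes "\<And>i j. f i j = f j i"
  shows "(\<Sum>i<n. \<Sum>j<n. f i j) = 2 * (\<Sum>j<n. \<Sum>i<j. f j i) + (\<Sum>i<n. f i i)"
proof (induction n)
  case (Suc n)
  have "(\<Sum>i<Suc n. \<Sum>j<Suc n. f i j) = (\<Sum>i<n. \<Sum>j<n. f i j) + (\<Sum>i<n. f i n) + ((\<Sum>j<n. f n j) + f n n)"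
    by (simp add: sum.distrib)
  also have "(\<Sum>i<n. f i n) = (\<Sum>i<n. f n i)" by (intro sum.cong refl assms)
  finally show ?case using Suc by simp
qed simp

lemma AE_distr_closed:
  assumes "f \<in> borel_measurable M" "closed D"
  shows "(AE x in distr M borel f. x \<in> D) \<longleftrightarrow> (AE x in M. f x \<in> D)"
  by (rule AE_distr_iff) (use assms in auto)

text \<open>Skorohod's representation replaces weak convergence on the line by pointwise convergence
  on one probability space. On its square Fatou's lemma gives lower semicontinuity of the double
  integral, and closed supports pass to the limit pointwise.\<close>

lemma nn_integral_weak_limit_le:
  fixes \<mu> :: "nat \<Rightarrow> real measure"
  assumes \<mu>: "\<And>n. real_distribution (\<mu> n)" and M: "real_distribution M" and wc: "weak_conv_m \<mu> M"
    and f: "f \<in> borel_measurable (borel \<Otimes>\<^sub>M borel)"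
    and cont: "\<And>a b x y. a \<longlonglongrightarrow> x \<Longrightarrow> b \<longlonglongrightarrow> y \<Longrightarrow> (\<lambda>n. f (a n, b n)) \<longlonglongrightarrow> (f (x, y) :: ennreal)"
    and b: "\<And>n. (\<integral>\<^sup>+x. \<integral>\<^sup>+y. f (x, y) \<partial>\<mu> n \<partial>\<mu> n) \<le> b n" and lim: "b \<longlonglongrightarrow> B"
  shows "(\<integral>\<^sup>+x. \<integral>\<^sup>+y. f (x, y) \<partial>M \<partial>M) \<le> B"
    and "closed D \<Longrightarrow> (\<And>n. AE x in \<mu> n. x \<in> D) \<Longrightarrow> AE x in M. x \<in> D"
proof -
  obtain \<Omega> :: "real measure" and Ys Y where \<Omega>: "prob_space \<Omega>" and Ys[measurable]: "\<And>n. Ys n \<in> measurable \<Omega> borel"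
    and dYs: "\<And>n. distr \<Omega> borel (Ys n) = \<mu> n" and Y: "Y \<in> measurable \<Omega> lborel" and dY: "distr \<Omega> borel Y = M"
    and conv: "\<And>x. x \<in> space \<Omega> \<Longrightarrow> (\<lambda>n. Ys n x) \<longlonglongrightarrow> Y x"
    using Skorohod[OF \<mu> M wc] by blast
  have Y'[measurable]: "Y \<in> measurable \<Omega> borel" using Y by simp
  interpret prob_space \<Omega> by fact
  have fy: "(\<lambda>y. f (x, y)) \<in> borel_measurable borel" for x
    by (rule measurable_compose[OF _ f]) auto
  have push: "(\<integral>\<^sup>+x. \<integral>\<^sup>+y. f (x, y) \<partial>distr \<Omega> borel Z \<partial>distr \<Omega> borel Z) = (\<integral>\<^sup>+p. f (Z (fst p), Z (snd p)) \<partial>(\<Omega> \<Otimes>\<^sub>M \<Omega>))"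
    if Z[measurable]: "Z \<in> measurable \<Omega> borel" for Z
  proof -
    interpret D: prob_space "distr \<Omega> borel Z" by (rule prob_space_distr[OF Z])
    have m: "(\<lambda>x. \<integral>\<^sup>+y. f (x, y) \<partial>distr \<Omega> borel Z) \<in> borel_measurable borel"
    proof -
      have eq: "sets (borel \<Otimes>\<^sub>M distr \<Omega> borel Z) = sets (borel \<Otimes>\<^sub>M borel)"
        by (intro sets_pair_measure_cong) auto
      have "f \<in> borel_measurable (borel \<Otimes>\<^sub>M distr \<Omega> borel Z)"
        unfolding measurable_cong_sets[OF eq refl] by (rule f)
      from D.borel_measurable_nn_integral_fst[OF this] show ?thesis .
    qed
    have "(\<integral>\<^sup>+x. \<integral>\<^sup>+y. f (x, y) \<partial>distr \<Omega> borel Z \<partial>distr \<Omega> borel Z) = (\<integral>\<^sup>+x. \<integral>\<^sup>+y. f (Z x, y) \<partial>distr \<Omega> borel Z \<partial>\<Omega>)"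
      by (rule nn_integral_distr[OF Z]) (use m in simp)
    also have "\<dots> = (\<integral>\<^sup>+x. \<integral>\<^sup>+y. f (Z x, Z y) \<partial>\<Omega> \<partial>\<Omega>)"
      by (intro nn_integral_cong nn_integral_distr[OF Z]) (use fy in simp)
    also have "\<dots> = (\<integral>\<^sup>+p. f (Z (fst p), Z (snd p)) \<partial>(\<Omega> \<Otimes>\<^sub>M \<Omega>))"
    proof -
      have "(\<lambda>p. f (Z (fst p), Z (snd p))) \<in> borel_measurable (\<Omega> \<Otimes>\<^sub>M \<Omega>)"
        by (rule measurable_compose[OF _ f]) measurable
      from nn_integral_fst[OF this] show ?thesis by simp
    qed
    finally show ?thesis .
  qed
  have fm: "(\<lambda>p. f (Ys n (fst p), Ys n (snd p))) \<in> borel_measurable (\<Omega> \<Otimes>\<^sub>M \<Omega>)" for n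
    by (rule measurable_compose[OF _ f]) measurable
  have "(\<integral>\<^sup>+x. \<integral>\<^sup>+y. f (x, y) \<partial>M \<partial>M) = (\<integral>\<^sup>+p. f (Y (fst p), Y (snd p)) \<partial>(\<Omega> \<Otimes>\<^sub>M \<Omega>))"
    using push[OF Y'] unfolding dY .
  also have "\<dots> = (\<integral>\<^sup>+p. liminf (\<lambda>n. f (Ys n (fst p), Ys n (snd p))) \<partial>(\<Omega> \<Otimes>\<^sub>M \<Omega>))"
  proof (rule nn_integral_cong)
    fix p assume "p \<in> space (\<Omega> \<Otimes>\<^sub>M \<Omega>)"
    then have "fst p \<in> space \<Omega>" "snd p \<in> space \<Omega>" by (auto simp: space_pair_measure)
    then have "(\<lambda>n. f (Ys n (fst p), Ys n (snd p))) \<longlonglongrightarrow> f (Y (fst p), Y (snd p))"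
      by (intro cont conv)
    then show "f (Y (fst p), Y (snd p)) = liminf (\<lambda>n. f (Ys n (fst p), Ys n (snd p)))"
      by (intro lim_imp_Liminf[symmetric]) auto
  qed
  also have "\<dots> \<le> liminf (\<lambda>n. \<integral>\<^sup>+p. f (Ys n (fst p), Ys n (snd p)) \<partial>(\<Omega> \<Otimes>\<^sub>M \<Omega>))"
    by (rule nn_integral_liminf[OF fm])
  also have "\<dots> \<le> liminf b"
  proof (intro Liminf_mono always_eventually allI)
    fix n show "(\<integral>\<^sup>+p. f (Ys n (fst p), Ys n (snd p)) \<partial>(\<Omega> \<Otimes>\<^sub>M \<Omega>)) \<le> b n"
      using push[OF Ys[of n]] b[of n] unfolding dYs by simp
  qed
  also have "liminf b = B" by (rule lim_imp_Liminf[OF _ lim]) simp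
  finally show "(\<integral>\<^sup>+x. \<integral>\<^sup>+y. f (x, y) \<partial>M \<partial>M) \<le> B" .
  assume D: "closed D" and ae: "\<And>n. AE x in \<mu> n. x \<in> D"
  have Db: "D \<in> sets borel" using D by simp
  have "AE x in \<Omega>. Ys n x \<in> D" for n
    using ae[of n] unfolding dYs[of n, symmetric] by (subst (asm) AE_distr_iff) (use Db in auto)
  then have "AE x in \<Omega>. \<forall>n. Ys n x \<in> D" by (simp add: AE_all_countable)
  then have "AE x in \<Omega>. Y x \<in> D"
  proof (rule AE_mp, intro AE_I2 impI)
    fix x assume "x \<in> space \<Omega>" "\<forall>n. Ys n x \<in> D"
    then show "Y x \<in> D" using closed_sequentially[OF D, of "\<lambda>n. Ys n x" "Y x"] conv by blast
  qed
  then show "AE x in M. x \<in> D"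
    unfolding dY[symmetric] by (subst AE_distr_iff) (use Db in auto)
qed

text \<open>Otherwise, for infinitely many n there are configurations in the compact set with twice
  their pair energy below L n^2. A weak limit of their empirical measures is admissible for
  \<open>R_set U\<close> and has energy at most L, a contradiction.\<close>

lemma weighted_fekete_upper:
  assumes U: "open U" and L: "ereal L < R_set U"
  shows "\<forall>\<^sub>F n in sequentially. \<forall>z. (\<forall>i<n. z i \<in> - U \<inter> cball 0 1) \<longrightarrow> wvd n z \<le> exp (- L * (real n)\<^sup>2)"
proof (rule ccontr)
  let ?K = "- U \<inter> cball 0 1 :: complex set"
  have K: "compact ?K" using U by (simp add: closed_Compl compact_Int_closed Int_commute closed_Int_compact)
  assume "\<not> ?thesis"
  from not_eventually_sequentiallyD[OF this] obtain N :: "nat \<Rightarrow> nat" where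
    NN: "strict_mono N \<and> (\<forall>m. \<not> (\<forall>z. (\<forall>i<N m. z i \<in> ?K) \<longrightarrow> wvd (N m) z \<le> exp (- L * (real (N m))\<^sup>2)))"
    by blast
  note N = NN[THEN conjunct1] and nP = NN[THEN conjunct2]
  have "\<exists>z. (\<forall>i<N m. z i \<in> ?K) \<and> exp (- L * (real (N m))\<^sup>2) < wvd (N m) z" for m
    using nP[THEN spec[of _ m]] unfolding not_all not_imp not_le .
  then obtain z where zK: "\<And>m i. i < N m \<Longrightarrow> z m i \<in> ?K" and big: "\<And>m. exp (- L * (real (N m))\<^sup>2) < wvd (N m) (z m)"
    by metis
  have Npos: "0 < N m" for m
  proof (rule ccontr)
    assume "\<not> 0 < N m"
    then show False using big[of m] by (simp add: wvd_def vd_def)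
  qed
  have ne: "z m j \<noteq> z m i" if "i < j" "j < N m" for m i j
  proof
    assume "z m j = z m i"
    then have "vd {..<N m} (z m) = 0" unfolding vd_def using that
      by (intro prod_zero bexI[of _ j] bexI[of _ i]) auto
    then show False using big[of m] by (simp add: wvd_def)
  qed
  have en: "2 * (\<Sum>j<N m. \<Sum>i<j. kr (z m j) (z m i)) < L * (real (N m))\<^sup>2" for m
  proof -
    have "wvd (N m) (z m) = exp (- 2 * (\<Sum>j<N m. \<Sum>i<j. kr (z m j) (z m i)))"
      unfolding wvd_def using vd_exp[of "N m" "z m"] ne Npos[of m]
      by (simp add: of_nat_diff exp_add[symmetric])
    then show ?thesis using big[of m] by simp
  qed
  have "\<exists>t. 0 \<le> t \<and> t \<le> 1 \<and> peano t = w" if "w \<in> ?K" for w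
    using peano_surj[of w] that by auto
  \<comment> \<open>A choice of parameter for every point. The selection is arbitrary and no
    regularity is required, since only finitely many points are transported at each stage.\<close>
  then obtain g where g: "\<And>w. w \<in> ?K \<Longrightarrow> 0 \<le> g w \<and> g w \<le> 1 \<and> peano (g w) = w" by metis
  define t where "t m i = (if i < N m then g (z m i) else 0)" for m i
  have t: "0 \<le> t m i" "t m i \<le> 1" for m i using g[OF zK] by (auto simp: t_def)
  have pt: "peano (t m i) = z m i" if "i < N m" for m i using g[OF zK[OF that]] that by (simp add: t_def)
  \<comment> \<open>Empirical measures of the parameters in [0, 1]. They are tight, and composing
    with the continuous curve recovers the configurations.\<close>
  define \<mu> where "\<mu> m = distr (measure_pmf (pmf_of_set {..<N m})) borel (t m)" for m
  have ne0: "{..<N m} \<noteq> {}" for m using Npos[of m] by auto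
  have rd: "real_distribution (\<mu> m)" for m
    unfolding \<mu>_def by (intro prob_space.real_distribution_distr prob_space_measure_pmf) auto
  have nn: "(\<integral>\<^sup>+x. f x \<partial>\<mu> m) = (\<Sum>i<N m. f (t m i)) / of_nat (N m)" if "f \<in> borel_measurable borel" for f :: "real \<Rightarrow> ennreal" and m
    unfolding \<mu>_def using that ne0[of m] by (subst nn_integral_distr) (auto simp: nn_integral_pmf_of_set)
  have AE01: "AE x in \<mu> m. x \<in> peano -` ?K" for m
  proof -
    have D: "closed (peano -` ?K)" by (rule closed_vimage[OF compact_imp_closed[OF K] continuous_peano])
    have "AE i in measure_pmf (pmf_of_set {..<N m}). t m i \<in> peano -` ?K"
      using ne0[of m] pt zK by (auto simp: AE_measure_pmf_iff)
    then show ?thesis unfolding \<mu>_def by (subst AE_distr_closed[OF _ D]) auto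
  qed
  have tight: "tight \<mu>"
    unfolding tight_def
  proof (intro conjI allI impI rd)
    fix \<epsilon> :: real assume "0 < \<epsilon>"
    have "measure (\<mu> n) {-1<..1} = 1" for n
    proof -
      have "measure (\<mu> n) {-1<..1} = measure (measure_pmf (pmf_of_set {..<N n})) (t n -` {-1<..1})"
        unfolding \<mu>_def by (subst measure_distr) auto
      also have "t n -` {-1<..1} = UNIV"
      proof -
        have "-1 < t n i" for i using t(1)[of n i] by linarith
        then show ?thesis using t by auto
      qed
      finally show ?thesis by simp
    qed
    then show "\<exists>a b. a < b \<and> (\<forall>n. 1 - \<epsilon> < measure (\<mu> n) {a<..b})"
      using \<open>0 < \<epsilon>\<close> by (intro exI[of _ "-1"] exI[of _ 1]) auto
  qed
  obtain s M where s: "strict_mono s" and M: "real_distribution M" and wc: "weak_conv_m (\<mu> \<circ> id \<circ> s) M"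
    using tight_imp_convergent_subsubsequence[OF tight strict_mono_id] by blast
  interpret M: real_distribution M by fact
  have pm: "peano \<in> borel_measurable borel" using continuous_peano by (rule borel_measurable_continuous_onI)
  define \<nu> where "\<nu> = distr M borel peano"
  interpret \<nu>: prob_space \<nu> unfolding \<nu>_def by (rule M.prob_space_distr) (use pm in simp)
  have s\<nu>: "sets \<nu> = sets borel" by (simp add: \<nu>_def)
  have L0: "0 \<le> L"
  proof -
    have "0 \<le> (\<Sum>j<N 0. \<Sum>i<j. kr (z 0 j) (z 0 i))"
      using ne kr_nonneg by (intro sum_nonneg) auto
    then have "0 < L * (real (N 0))\<^sup>2" using en[of 0] by linarith
    then show ?thesis by (metis less_eq_real_def mult_nonpos_nonneg not_le zero_le_power2)
  qed
  have ft: "(\<lambda>p. ennreal (kt T (peano (fst p)) (peano (snd p)))) \<in> borel_measurable (borel \<Otimes>\<^sub>M borel)" for T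
    using measurable_compose[OF _ kt_measurable, of "\<lambda>p. (peano (fst p), peano (snd p))" "borel \<Otimes>\<^sub>M borel" T] pm by simp
  have fty: "(\<lambda>y. ennreal (kt T (peano x) (peano y))) \<in> borel_measurable borel" for T x
    using measurable_compose[OF _ ft, of "\<lambda>y. (x, y)" borel T] by simp
  \<comment> \<open>The double integral is the full double sum divided by N^2. The diagonal,
    infinite for the original kernel, contributes only (T + 1)/N after truncation; off the diagonal
    the truncated kernel is at most \<open>kr\<close>.\<close>
  have dbl: "(\<integral>\<^sup>+x. \<integral>\<^sup>+y. ennreal (kt (real T) (peano x) (peano y)) \<partial>\<mu> m \<partial>\<mu> m) \<le> ennreal (L + (real T + 1) / real (N m))" for T m
  proof -
    have n0: "0 < real (N m)" using Npos by simp
    have inner: "(\<integral>\<^sup>+y. ennreal (kt (real T) x (peano y)) \<partial>\<mu> m) = (\<Sum>j<N m. ennreal (kt (real T) x (z m j))) / of_nat (N m)" if "x \<in> range peano" for x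
      using that fty by (auto simp: nn pt)
    have "(\<integral>\<^sup>+x. \<integral>\<^sup>+y. ennreal (kt (real T) (peano x) (peano y)) \<partial>\<mu> m \<partial>\<mu> m)
       = (\<integral>\<^sup>+x. (\<Sum>j<N m. ennreal (kt (real T) (peano x) (z m j))) / of_nat (N m) \<partial>\<mu> m)"
      by (simp add: inner)
    also have "\<dots> = (\<Sum>i<N m. (\<Sum>j<N m. ennreal (kt (real T) (z m i) (z m j))) / of_nat (N m)) / of_nat (N m)"
    proof (subst nn)
      have "(\<lambda>x. ennreal (kt (real T) (peano x) (z m j))) \<in> borel_measurable borel" for j
        using measurable_compose[OF _ kt_measurable, of "\<lambda>x. (peano x, z m j)" borel "real T"] pm by simp
      then show "(\<lambda>x. (\<Sum>j<N m. ennreal (kt (real T) (peano x) (z m j))) / of_nat (N m)) \<in> borel_measurable borel" by measurable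
    qed (simp add: pt)
    also have "\<dots> = ennreal ((\<Sum>i<N m. (\<Sum>j<N m. kt (real T) (z m i) (z m j)) / real (N m)) / real (N m))"
    proof -
      have dv: "(\<Sum>j<N m. ennreal (f j)) / of_nat (N m) = ennreal ((\<Sum>j<N m. f j) / real (N m))"
        if "\<And>j. 0 \<le> f j" for f :: "nat \<Rightarrow> real"
      proof -
        have "(\<Sum>j<N m. ennreal (f j)) = ennreal (\<Sum>j<N m. f j)" by (rule sum_ennreal) (rule that)
        moreover have "0 \<le> (\<Sum>j<N m. f j)" by (rule sum_nonneg) (rule that)
        ultimately show ?thesis using n0 by (simp only: ennreal_of_nat_eq_real_of_nat divide_ennreal)
      qed
      have "(\<Sum>j<N m. ennreal (kt (real T) (z m i) (z m j))) / of_nat (N m) = ennreal ((\<Sum>j<N m. kt (real T) (z m i) (z m j)) / real (N m))" for i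
        by (rule dv) (simp add: kt_nonneg)
      moreover have "(\<Sum>i<N m. ennreal ((\<Sum>j<N m. kt (real T) (z m i) (z m j)) / real (N m))) / of_nat (N m)
          = ennreal ((\<Sum>i<N m. (\<Sum>j<N m. kt (real T) (z m i) (z m j)) / real (N m)) / real (N m))"
        by (rule dv) (simp add: kt_nonneg sum_nonneg)
      ultimately show ?thesis by (simp only:)
    qed
    also have "\<dots> = ennreal ((\<Sum>i<N m. \<Sum>j<N m. kt (real T) (z m i) (z m j)) / (real (N m))\<^sup>2)"
      by (simp add: sum_divide_distrib power2_eq_square)
    also have "\<dots> \<le> ennreal (L + (real T + 1) / real (N m))"
    proof (rule ennreal_leI)
      have "(\<Sum>i<N m. \<Sum>j<N m. kt (real T) (z m i) (z m j))
          = 2 * (\<Sum>j<N m. \<Sum>i<j. kt (real T) (z m j) (z m i)) + (\<Sum>i<N m. kt (real T) (z m i) (z m i))"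
        by (rule sum_square_split) (rule kt_sym)
      also have "\<dots> \<le> 2 * (\<Sum>j<N m. \<Sum>i<j. kr (z m j) (z m i)) + (\<Sum>i<N m. real T + 1)"
      proof (intro add_mono mult_left_mono sum_mono)
        fix j i assume "j \<in> {..<N m}" "i \<in> {..<j}"
        then show "kt (real T) (z m j) (z m i) \<le> kr (z m j) (z m i)" using ne by (intro kt_le_kr) auto
      next
        fix i assume "i \<in> {..<N m}"
        then have "cmod (z m i) \<le> 1" using zK by auto
        then have "(cmod (z m i))\<^sup>2 \<le> 1" by (simp add: power_le_one)
        then show "kt (real T) (z m i) (z m i) \<le> real T + 1" by (simp add: kt_diag)
      qed auto
      also have "\<dots> \<le> L * (real (N m))\<^sup>2 + real (N m) * (real T + 1)" using en[of m] by simp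
      finally have "(\<Sum>i<N m. \<Sum>j<N m. kt (real T) (z m i) (z m j)) / (real (N m))\<^sup>2 \<le> (L * (real (N m))\<^sup>2 + real (N m) * (real T + 1)) / (real (N m))\<^sup>2"
        by (intro divide_right_mono) auto
      also have "\<dots> = L + (real T + 1) / real (N m)" using n0 by (simp add: add_divide_distrib power2_eq_square)
      finally show "(\<Sum>i<N m. \<Sum>j<N m. kt (real T) (z m i) (z m j)) / (real (N m))\<^sup>2 \<le> L + (real T + 1) / real (N m)" .
    qed
    finally show ?thesis .
  qed
  have Ns: "filterlim (\<lambda>m. N (s m)) at_top sequentially"
    by (rule filterlim_subseq) (use N s in \<open>simp add: strict_mono_def\<close>)
  have lim: "(\<lambda>m. ennreal (L + (real T + 1) / real (N (s m)))) \<longlonglongrightarrow> ennreal L" for T :: nat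
  proof -
    have "(\<lambda>m. (real T + 1) / real (N (s m))) \<longlonglongrightarrow> 0"
      by (intro real_tendsto_divide_at_top[OF tendsto_const] filterlim_compose[OF filterlim_real_sequentially Ns])
    from tendsto_add[OF tendsto_const this, of L] show ?thesis by (intro tendsto_ennrealI) simp
  qed
  note WL = nn_integral_weak_limit_le[where \<mu>="\<mu> \<circ> id \<circ> s" and M=M]
  have cont: "(\<lambda>n. ennreal (kt T (peano (a n)) (peano (b n)))) \<longlonglongrightarrow> ennreal (kt T (peano x) (peano y))"
    if "a \<longlonglongrightarrow> x" "b \<longlonglongrightarrow> y" for a b x y T
    using that continuous_peano by (intro tendsto_ennrealI isCont_kt) (auto simp: continuous_on_eq_continuous_at intro: isCont_tendsto_compose)
  have lim_le: "(\<integral>\<^sup>+x. \<integral>\<^sup>+y. ennreal (kt (real T) (peano x) (peano y)) \<partial>M \<partial>M) \<le> ennreal L" for T :: nat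
    using WL(1)[OF _ M wc ft[of "real T"] _ _ lim[of T]] rd dbl cont by simp
  have supp: "AE x in M. x \<in> peano -` ?K"
  proof (rule WL(2)[OF _ M wc ft[of "real 0"] _ _ lim[of 0]])
    show "closed (peano -` ?K)" by (rule closed_vimage[OF compact_imp_closed[OF K] continuous_peano])
  qed (use rd dbl[of _ 0] cont[of _ _ _ _ 0] AE01 in \<open>simp_all only: o_apply id_apply of_nat_0 fst_conv snd_conv\<close>)
  have "prob_meas_in (- U) \<nu>"
    unfolding prob_meas_in_def
  proof (intro conjI s\<nu> \<nu>.prob_space_axioms exI[of _ ?K] K)
    have "AE x in \<nu>. x \<in> ?K"
      unfolding \<nu>_def using supp pm by (subst AE_distr_closed[OF _ compact_imp_closed[OF K]]) auto
    moreover have "UNIV - ?K \<in> sets \<nu>" using borel_closed[OF compact_imp_closed[OF K]] by (auto simp: s\<nu>)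
    ultimately show "emeasure \<nu> (UNIV - ?K) = 0"
      using sets_eq_imp_space_eq[OF s\<nu>] by (subst (asm) AE_iff_measurable[of "UNIV - ?K"]) auto
  qed auto
  then have "R_set U \<le> R_mu \<nu>" unfolding R_set_def by (intro INF_lower) simp
  also have "R_mu \<nu> = enn2ereal (\<integral>\<^sup>+p. kk (fst p) (snd p) \<partial>(\<nu> \<Otimes>\<^sub>M \<nu>))"
    by (rule R_mu_eq) fact
  \<comment> \<open>The cutoff is removed only after the weak limit: the bound L holds for every T,
    and the kernel is the supremum of its truncations.\<close>
  also have "(\<integral>\<^sup>+p. kk (fst p) (snd p) \<partial>(\<nu> \<Otimes>\<^sub>M \<nu>)) \<le> ennreal L"
  proof -
    have eq: "sets (\<nu> \<Otimes>\<^sub>M \<nu>) = sets (borel \<Otimes>\<^sub>M borel)" by (rule sets_pair_measure_cong[OF s\<nu> s\<nu>])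
    have "(\<integral>\<^sup>+p. kk (fst p) (snd p) \<partial>(\<nu> \<Otimes>\<^sub>M \<nu>)) = (SUP T. \<integral>\<^sup>+p. ennreal (kt (real T) (fst p) (snd p)) \<partial>(\<nu> \<Otimes>\<^sub>M \<nu>))"
      unfolding kk_eq_SUP
    proof (rule nn_integral_monotone_convergence_SUP)
      show "incseq (\<lambda>T p. ennreal (kt (real T) (fst p) (snd p)))"
        by (auto simp: incseq_def le_fun_def intro!: ennreal_leI kt_mono)
      show "(\<lambda>p. ennreal (kt (real T) (fst p) (snd p))) \<in> borel_measurable (\<nu> \<Otimes>\<^sub>M \<nu>)" for T
        unfolding measurable_cong_sets[OF eq refl] by measurable
    qed
    also have "\<dots> \<le> ennreal L"
    proof (rule SUP_least)
      fix T
      have "(\<integral>\<^sup>+p. ennreal (kt (real T) (fst p) (snd p)) \<partial>(\<nu> \<Otimes>\<^sub>M \<nu>)) = (\<integral>\<^sup>+x. \<integral>\<^sup>+y. ennreal (kt (real T) x y) \<partial>\<nu> \<partial>\<nu>)"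
        using nn_integral_pair[OF s\<nu> \<nu>.prob_space_axioms s\<nu> \<nu>.finite_measure_axioms kt_measurable[of "real T"]] by simp
      also have "\<dots> = (\<integral>\<^sup>+x. \<integral>\<^sup>+y. ennreal (kt (real T) (peano x) y) \<partial>\<nu> \<partial>M)"
      proof -
        have eq2: "sets (borel \<Otimes>\<^sub>M \<nu>) = sets (borel \<Otimes>\<^sub>M borel)" by (rule sets_pair_measure_cong[OF refl s\<nu>])
        have "(\<lambda>p. ennreal (kt (real T) (fst p) (snd p))) \<in> borel_measurable (borel \<Otimes>\<^sub>M \<nu>)"
          unfolding measurable_cong_sets[OF eq2 refl] by measurable
        from \<nu>.borel_measurable_nn_integral_fst[OF this]
        have "(\<lambda>x. \<integral>\<^sup>+y. ennreal (kt (real T) x y) \<partial>\<nu>) \<in> borel_measurable borel" by simp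
        then have "(\<integral>\<^sup>+x. \<integral>\<^sup>+y. ennreal (kt (real T) x y) \<partial>\<nu> \<partial>distr M borel peano) = (\<integral>\<^sup>+x. \<integral>\<^sup>+y. ennreal (kt (real T) (peano x) y) \<partial>\<nu> \<partial>M)"
          using pm by (intro nn_integral_distr) auto
        then show ?thesis by (simp add: \<nu>_def)
      qed
      also have "\<dots> = (\<integral>\<^sup>+x. \<integral>\<^sup>+y. ennreal (kt (real T) (peano x) (peano y)) \<partial>M \<partial>M)"
      proof (intro nn_integral_cong)
        fix x
        have "(\<lambda>y. ennreal (kt (real T) (peano x) y)) \<in> borel_measurable borel"
          using measurable_compose[OF _ kt_measurable, of "\<lambda>y. (peano x, y)" borel "real T"] by simp
        then show "(\<integral>\<^sup>+y. ennreal (kt (real T) (peano x) y) \<partial>\<nu>) = (\<integral>\<^sup>+y. ennreal (kt (real T) (peano x) (peano y)) \<partial>M)"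
          unfolding \<nu>_def using pm by (intro nn_integral_distr) auto
      qed
      also have "\<dots> \<le> ennreal L" by (rule lim_le)
      finally show "(\<integral>\<^sup>+p. ennreal (kt (real T) (fst p) (snd p)) \<partial>(\<nu> \<Otimes>\<^sub>M \<nu>)) \<le> ennreal L" .
    qed
    finally show ?thesis .
  qed
  then have "enn2ereal (\<integral>\<^sup>+p. kk (fst p) (snd p) \<partial>(\<nu> \<Otimes>\<^sub>M \<nu>)) \<le> ereal L"
    using L0 by (simp add: less_eq_ennreal.rep_eq enn2ereal_ennreal)
  finally show False using L by simp
qed

section \<open>The logarithmic potential of the uniform distribution on the disc\<close>

section \<open>The potential of the disc\<close>

text \<open>The antiderivative s - s ln s is continuous up to 0, so the singular endpoint
  \<open>b = 0\<close> is included.\<close>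

lemma has_integral_neg_ln:
  fixes b :: real
  assumes b: "0 \<le> b" "b \<le> 1"
  shows "((\<lambda>s. - ln s) has_integral (1 - b + b * ln b)) {b..1}"
proof -
  define F where "F s = s - s * ln s" for s :: real
  have lim: "((\<lambda>s::real. s * ln s) \<longlongrightarrow> 0) (at_right 0)" by real_asymp
  have cont: "continuous_on {b..1} F"
  proof (unfold continuous_on_eq_continuous_within, intro ballI)
    fix s assume s: "s \<in> {b..1}"
    show "continuous (at s within {b..1}) F"
    proof (cases "s = 0")
      case True
      then have "b = 0" using s b by simp
      have "(F \<longlongrightarrow> 0 - 0) (at_right 0)" unfolding F_def by (intro tendsto_diff lim) auto
      then show ?thesis using True \<open>b = 0\<close> by (simp add: continuous_within at_within_Icc_at_right F_def)
    next
      case False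
      then show ?thesis unfolding F_def by (intro continuous_intros) (auto simp: continuous_ident)
    qed
  qed
  have "(F has_vector_derivative - ln x) (at x)" if "x \<in> {b<..<1}" for x
  proof -
    have "0 < x" using that b by simp
    then have "(F has_real_derivative - ln x) (at x)" unfolding F_def by (auto intro!: derivative_eq_intros)
    then show ?thesis by (simp add: has_real_derivative_iff_has_vector_derivative)
  qed
  from fundamental_theorem_of_calculus_interior[OF b(2) cont this]
  show ?thesis by (simp add: F_def algebra_simps)
qed

text \<open>The constant piece on [0, b] cancels the term b ln b of the other piece. With b = |z|^2
  this becomes the potential inside the disc.\<close>

lemma nn_integral_neg_ln_max:
  fixes b :: real
  assumes b: "0 \<le> b" "b \<le> 1"
  shows "(\<integral>\<^sup>+s. ennreal (- ln (max b s)) * indicator {0..1} s \<partial>lborel) = ennreal (1 - b)"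
proof -
  have "((\<lambda>s. - ln (max b s)) has_integral (b * - ln b)) {0..b}"
    using has_integral_const_real[of "- ln b" 0 b] b by (auto intro: has_integral_eq[rotated])
  moreover have "((\<lambda>s. - ln (max b s)) has_integral (1 - b + b * ln b)) {b..1}"
    using has_integral_neg_ln[OF b] by (rule has_integral_eq[rotated]) auto
  ultimately have "((\<lambda>s. - ln (max b s)) has_integral (b * - ln b + (1 - b + b * ln b))) {0..1}"
    using b by (rule_tac has_integral_combine[of 0 b 1]) auto
  then have "((\<lambda>s. - ln (max b s)) has_integral (1 - b)) {0..1}" by simp
  then have "((\<lambda>s. if s \<in> {0..1} then - ln (max b s) else 0) has_integral (1 - b)) UNIV"
    by (subst has_integral_restrict_UNIV)
  then have "(\<integral>\<^sup>+s. ennreal (if s \<in> {0..1} then - ln (max b s) else 0) \<partial>lborel) = ennreal (1 - b)"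
  proof (rule nn_integral_has_integral_lborel[rotated 2])
    \<comment> \<open>The convention \<open>ln 0 = 0\<close> covers the corner b = s = 0.\<close>
    show "0 \<le> (if s \<in> {0..1} then - ln (max b s) else 0)" for s
      using b by (cases "max b s = 0") (auto simp: ln_le_zero_iff max_def)
  qed measurable
  moreover have "(\<integral>\<^sup>+s. ennreal (if s \<in> {0..1} then - ln (max b s) else 0) \<partial>lborel) = (\<integral>\<^sup>+s. ennreal (- ln (max b s)) * indicator {0..1} s \<partial>lborel)"
    by (intro nn_integral_cong) (auto simp: indicator_def)
  ultimately show ?thesis by simp
qed

lemma nn_integral_neg_ln_abs_le:
  fixes b :: real
  shows "(\<integral>\<^sup>+s. ennreal (max 0 (- ln \<bar>b - s\<bar>)) \<partial>lborel) \<le> 2"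
proof -
  have "(\<integral>\<^sup>+s. ennreal (max 0 (- ln \<bar>b - s\<bar>)) \<partial>lborel) = (\<integral>\<^sup>+s. ennreal (max 0 (- ln \<bar>s\<bar>)) \<partial>lborel)"
    by (subst nn_integral_real_affine[of _ 1 b]) auto
  also have "\<dots> \<le> (\<integral>\<^sup>+s. ennreal (- ln (max 0 s)) * indicator {0..1} s + ennreal (- ln (max 0 (0 + (-1) * s))) * indicator {0..1} (0 + (-1) * s) \<partial>lborel)"
  proof (rule nn_integral_mono)
    fix s :: real
    have "0 < s \<or> s < 0 \<or> s = 0" by linarith
    then show "ennreal (max 0 (- ln \<bar>s\<bar>)) \<le> ennreal (- ln (max 0 s)) * indicator {0..1} s + ennreal (- ln (max 0 (0 + (-1) * s))) * indicator {0..1} (0 + (-1) * s)"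
      by (auto simp: indicator_def max_def ln_ge_zero)
  qed
  also have "\<dots> = (\<integral>\<^sup>+s. ennreal (- ln (max 0 s)) * indicator {0..1} s \<partial>lborel) + (\<integral>\<^sup>+s. ennreal (- ln (max 0 (0 + (-1) * s))) * indicator {0..1} (0 + (-1) * s) \<partial>lborel)"
    by (rule nn_integral_add) auto
  also have "(\<integral>\<^sup>+s. ennreal (- ln (max 0 (0 + (-1) * s))) * indicator {0..1} (0 + (-1) * s) \<partial>lborel) = (\<integral>\<^sup>+s. ennreal (- ln (max 0 s)) * indicator {0..1::real} s \<partial>lborel)"
    using nn_integral_real_affine[of "\<lambda>s. ennreal (- ln (max 0 s)) * indicator {0..1::real} s" "-1" 0] by simp
  also have "(\<integral>\<^sup>+s. ennreal (- ln (max 0 s)) * indicator {0..1::real} s \<partial>lborel) = 1"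
    using nn_integral_neg_ln_max[of 0] by simp
  finally show ?thesis by simp
qed

text \<open>Circles are null sets. Their points are exactly those where |z| = |w|, excluded from the
  estimates for \<open>z ^ N - e * w ^ N\<close>.\<close>

lemma AE_cmod_neq: "AE w in lborel. cmod w \<noteq> a"
proof -
  have "(\<integral>\<^sup>+w. indicator {a\<^sup>2} ((cmod w)\<^sup>2) \<partial>lborel) = ennreal pi * (\<integral>\<^sup>+s. indicator {a\<^sup>2} s * indicator {0..} s \<partial>lborel)"
    by (rule nn_integral_radial) simp
  also have "(\<integral>\<^sup>+s. indicator {a\<^sup>2} s * indicator {0..} s \<partial>lborel) = (0::ennreal)"
    by (subst nn_integral_0_iff_AE) (use AE_lborel_singleton[of "a\<^sup>2"] in \<open>auto simp: indicator_def\<close>)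
  finally have "(\<integral>\<^sup>+w. indicator {a\<^sup>2} ((cmod w)\<^sup>2) \<partial>lborel) = (0::ennreal)" by simp
  then have "AE w in lborel. indicator {a\<^sup>2} ((cmod w)\<^sup>2) = (0::ennreal)" by (subst (asm) nn_integral_0_iff_AE) auto
  then show ?thesis by eventually_elim (auto simp: indicator_def split: if_splits)
qed

text \<open>After translating by z the integrand is dominated by -ln |u|^2 on the unit disc, a
  radial integral. The bound does not depend on z.\<close>

lemma nn_integral_logk_pos_le: "(\<integral>\<^sup>+w. logk_pos z w \<partial>lborel) \<le> ennreal pi"
proof -
  have m: "logk_pos z \<in> borel_measurable borel"
    unfolding logk_pos_def by measurable
  have "(\<integral>\<^sup>+w. logk_pos z w \<partial>lborel) = (\<integral>\<^sup>+u. logk_pos z (z + u) \<partial>lborel)"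
    by (subst nn_integral_scale[of 1 _ z]) (use m in auto)
  also have "\<dots> \<le> (\<integral>\<^sup>+u. (\<lambda>s. ennreal (- ln (max 0 s)) * indicator {0..1} s) ((cmod u)\<^sup>2) \<partial>lborel)"
  proof (rule nn_integral_mono_AE)
    have "AE u in lborel. cmod u \<noteq> 0" by (rule AE_cmod_neq)
    then show "AE u in lborel. logk_pos z (z + u) \<le> ennreal (- ln (max 0 ((cmod u)\<^sup>2))) * indicator {0..1} ((cmod u)\<^sup>2)"
    proof eventually_elim
      case (elim u)
      then have "0 < cmod u" by simp
      have "ln ((cmod u)\<^sup>2) = 2 * ln (cmod u)" using elim by (simp add: ln_realpow)
      moreover have "0 \<le> ln (cmod u)" if "1 < cmod u" using that by simp
      moreover have "ln (cmod u) \<le> 0" if "cmod u \<le> 1" using that \<open>0 < cmod u\<close> by simp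
      moreover have "(cmod u)\<^sup>2 \<le> 1 \<longleftrightarrow> cmod u \<le> 1" by (simp add: power_le_one_iff)
      ultimately show ?case
        using elim by (cases "cmod u \<le> 1") (auto simp: logk_pos_def max_def intro!: ennreal_leI)
    qed
  qed
  also have "\<dots> = ennreal pi * (\<integral>\<^sup>+s. ennreal (- ln (max 0 s)) * indicator {0..1} s * indicator {0..} s \<partial>lborel)"
    by (rule nn_integral_radial) measurable
  also have "(\<integral>\<^sup>+s. ennreal (- ln (max 0 s)) * indicator {0..1} s * indicator {0..} s \<partial>lborel) = (\<integral>\<^sup>+s. ennreal (- ln (max 0 s)) * indicator {0..1::real} s \<partial>lborel)"
    by (intro nn_integral_cong) (auto simp: indicator_def)
  also have "\<dots> = 1" using nn_integral_neg_ln_max[of 0] by simp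
  finally show ?thesis by simp
qed

lemma emeasure_unit_disc: "emeasure lborel (ball (0::complex) 1) = ennreal pi"
proof -
  have "emeasure lborel (ball (0::complex) 1) = (\<integral>\<^sup>+w. indicator (ball (0::complex) 1) w \<partial>lborel)" by simp
  also have "\<dots> = (\<integral>\<^sup>+w. indicator {..<1} ((cmod w)\<^sup>2) \<partial>lborel)"
    by (intro nn_integral_cong) (auto simp: indicator_def abs_square_less_1)
  also have "\<dots> = ennreal pi * (\<integral>\<^sup>+s. indicator {..<1::real} s * indicator {0..} s \<partial>lborel)"
    by (rule nn_integral_radial[of "indicator {..<1}"]) simp
  also have "(\<integral>\<^sup>+s. indicator {..<1::real} s * indicator {0..} s \<partial>lborel) = (\<integral>\<^sup>+s. indicator {0..<1::real} s \<partial>lborel)"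
    by (intro nn_integral_cong) (auto simp: indicator_def)
  finally show ?thesis by simp
qed

text \<open>Supplies the dominating function with its singularity on the circle |w| = a. Factoring
  a^2 - |w|^2 moves the singularity to the squared modulus, where the measure is one-dimensional
  Lebesgue measure.\<close>

lemma integrable_ln_radial:
  "integrable lborel (\<lambda>w. indicator (ball 0 1) w * max 0 (- ln \<bar>a - cmod w\<bar>))" if a: "0 \<le> (a::real)"
proof (rule integrableI_nonneg)
  have "(\<integral>\<^sup>+w. ennreal (indicator (ball 0 1) w * max 0 (- ln \<bar>a - cmod w\<bar>)) \<partial>lborel)
      \<le> (\<integral>\<^sup>+w. (\<lambda>s. ennreal (ln (a + 1)) * indicator {0..1} s + ennreal (max 0 (- ln \<bar>a\<^sup>2 - s\<bar>))) ((cmod w)\<^sup>2) \<partial>lborel)"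
  proof (rule nn_integral_mono)
    fix w :: complex
    show "ennreal (indicator (ball 0 1) w * max 0 (- ln \<bar>a - cmod w\<bar>))
        \<le> ennreal (ln (a + 1)) * indicator {0..1} ((cmod w)\<^sup>2) + ennreal (max 0 (- ln \<bar>a\<^sup>2 - (cmod w)\<^sup>2\<bar>))"
    proof (cases "cmod w < 1 \<and> a \<noteq> cmod w")
      case True
      have p: "0 < a + cmod w" using True a norm_ge_zero[of w] by linarith
      have "a\<^sup>2 - (cmod w)\<^sup>2 = (a - cmod w) * (a + cmod w)" by (simp add: power2_eq_square algebra_simps)
      then have "\<bar>a\<^sup>2 - (cmod w)\<^sup>2\<bar> = \<bar>a - cmod w\<bar> * (a + cmod w)" using p by (simp add: abs_mult)
      then have "ln \<bar>a\<^sup>2 - (cmod w)\<^sup>2\<bar> = ln \<bar>a - cmod w\<bar> + ln (a + cmod w)" using True p by (simp add: ln_mult)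
      moreover have "ln (a + cmod w) \<le> ln (a + 1)" using p True by (intro ln_mono) auto
      moreover have "0 \<le> ln (a + 1)" using a by simp
      ultimately have "max 0 (- ln \<bar>a - cmod w\<bar>) \<le> ln (a + 1) + max 0 (- ln \<bar>a\<^sup>2 - (cmod w)\<^sup>2\<bar>)" by linarith
      then have "ennreal (max 0 (- ln \<bar>a - cmod w\<bar>)) \<le> ennreal (ln (a + 1) + max 0 (- ln \<bar>a\<^sup>2 - (cmod w)\<^sup>2\<bar>))" by (rule ennreal_leI)
      also have "\<dots> = ennreal (ln (a + 1)) + ennreal (max 0 (- ln \<bar>a\<^sup>2 - (cmod w)\<^sup>2\<bar>))"
        using \<open>0 \<le> ln (a + 1)\<close> by (intro ennreal_plus) auto
      finally show ?thesis using True power_le_one[of "cmod w" 2] by (simp add: indicator_def)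
    qed (auto simp: indicator_def)
  qed
  also have "\<dots> = ennreal pi * (\<integral>\<^sup>+s. (ennreal (ln (a + 1)) * indicator {0..1} s + ennreal (max 0 (- ln \<bar>a\<^sup>2 - s\<bar>))) * indicator {0..} s \<partial>lborel)"
    by (rule nn_integral_radial) measurable
  also have "\<dots> \<le> ennreal pi * (\<integral>\<^sup>+s. ennreal (ln (a + 1)) * indicator {0..1} s + ennreal (max 0 (- ln \<bar>a\<^sup>2 - s\<bar>)) \<partial>lborel)"
    by (intro mult_left_mono nn_integral_mono) (auto simp: indicator_def)
  also have "\<dots> = ennreal pi * (ennreal (ln (a + 1)) + (\<integral>\<^sup>+s. ennreal (max 0 (- ln \<bar>a\<^sup>2 - s\<bar>)) \<partial>lborel))"
    by (subst nn_integral_add) (auto simp: nn_integral_cmult)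
  also have "\<dots> \<le> ennreal pi * (ennreal (ln (a + 1)) + 2)"
    by (intro mult_left_mono add_left_mono nn_integral_neg_ln_abs_le) auto
  also have "\<dots> < \<infinity>" by (simp add: ennreal_mult_less_top)
  finally show "(\<integral>\<^sup>+w. ennreal (indicator (ball 0 1) w * max 0 (- ln \<bar>a - cmod w\<bar>)) \<partial>lborel) < \<infinity>" .
qed (auto simp: indicator_def)

text \<open>X lies between |x|^N (1 - |y|/|x|) and 2 |x|^N, because the ratio |y|/|x| below 1 only
  decreases under powers. After taking logarithms both errors carry the factor 1/N.\<close>

lemma ln_power_diff_bounds:
  fixes x y :: complex
  assumes xy: "cmod y < cmod x" and N: "1 \<le> N" and X: "cmod x ^ N - cmod y ^ N \<le> X" "X \<le> cmod x ^ N + cmod y ^ N"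
  shows "ln (cmod x) + ln (1 - cmod y / cmod x) / real N \<le> ln X / real N"
    and "ln X / real N \<le> ln (cmod x) + ln 2 / real N"
proof -
  define A B where "A = cmod x" and "B = cmod y"
  have AB: "0 \<le> B" "B < A" "0 < A" using xy by (auto simp: A_def B_def)
  have q: "0 \<le> B / A" "B / A < 1" using AB by auto
  have "(B / A) ^ N \<le> (B / A) ^ 1" using q N by (intro power_decreasing) auto
  then have "A ^ N * (1 - B / A) \<le> A ^ N * (1 - (B / A) ^ N)" using AB by (intro mult_left_mono) auto
  also have "\<dots> = A ^ N - B ^ N" using AB by (simp add: power_divide right_diff_distrib)
  finally have l: "A ^ N * (1 - B / A) \<le> X" using X by (simp add: A_def B_def)
  have p: "0 < A ^ N * (1 - B / A)" using AB q by simp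
  have "B ^ N \<le> A ^ N" using AB by (intro power_mono) auto
  then have u: "X \<le> A ^ N * 2" using X by (simp add: A_def B_def)
  have "ln (A ^ N * (1 - B / A)) \<le> ln X" using p l by (intro ln_mono) auto
  moreover have "ln (A ^ N * (1 - B / A)) = real N * ln A + ln (1 - B / A)" using AB q by (simp add: ln_mult ln_realpow)
  moreover have "ln X \<le> ln (A ^ N * 2)" using p l u by (intro ln_mono) auto
  moreover have "ln (A ^ N * 2) = real N * ln A + ln 2" using AB by (simp add: ln_mult ln_realpow)
  ultimately have "(real N * ln A + ln (1 - B / A)) / real N \<le> ln X / real N" "ln X / real N \<le> (real N * ln A + ln 2) / real N"
    by (auto intro!: divide_right_mono simp del: times_divide_eq_right)
  then show "ln (cmod x) + ln (1 - cmod y / cmod x) / real N \<le> ln X / real N" "ln X / real N \<le> ln (cmod x) + ln 2 / real N"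
    using N by (simp_all add: A_def B_def add_divide_distrib)
qed

text \<open>The unimodular factor \<open>e\<close> covers the difference and the sum of the powers
  together. The first claim is the uniform bound for dominated convergence, the second the pointwise
  limit.\<close>

lemma ln_power_diff:
  fixes z w e :: complex
  assumes ne: "cmod z \<noteq> cmod w" and e: "cmod e = 1"
  defines "m \<equiv> max (cmod z) (cmod w)"
  shows "1 \<le> N \<Longrightarrow> \<bar>ln (cmod (z ^ N - e * w ^ N)) / real N\<bar> \<le> \<bar>m\<bar> + 2 + max 0 (- ln \<bar>cmod z - cmod w\<bar>)"
    and "filterlim Nj at_top sequentially \<Longrightarrow> (\<lambda>j. ln (cmod (z ^ Nj j - e * w ^ Nj j)) / real (Nj j)) \<longlonglongrightarrow> ln m"
proof -
  define x y where "x = (if cmod w < cmod z then z else w)" and "y = (if cmod w < cmod z then w else z)"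
  have xy: "cmod y < cmod x" "m = cmod x" "\<bar>cmod z - cmod w\<bar> = cmod x - cmod y" using ne by (auto simp: x_def y_def m_def)
  have X: "cmod x ^ N - cmod y ^ N \<le> cmod (z ^ N - e * w ^ N)" "cmod (z ^ N - e * w ^ N) \<le> cmod x ^ N + cmod y ^ N" for N
  proof -
    have n: "cmod (e * w ^ N) = cmod w ^ N" "cmod (z ^ N) = cmod z ^ N" using e by (auto simp: norm_mult norm_power)
    show "cmod (z ^ N - e * w ^ N) \<le> cmod x ^ N + cmod y ^ N"
      using norm_triangle_ineq4[of "z ^ N" "e * w ^ N"] n by (auto simp: x_def y_def)
    show "cmod x ^ N - cmod y ^ N \<le> cmod (z ^ N - e * w ^ N)"
      using norm_triangle_ineq3[of "z ^ N" "e * w ^ N"] n by (auto simp: x_def y_def)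
  qed
  have q: "0 \<le> cmod y / cmod x" "cmod y / cmod x < 1" using xy by (auto simp: divide_less_eq)
  have xpos: "0 < cmod x" using xy(1) norm_ge_zero[of y] by linarith
  have lneg: "ln (1 - cmod y / cmod x) \<le> 0" using q by simp
  note b = ln_power_diff_bounds[OF xy(1) _ X]
  show "\<bar>ln (cmod (z ^ N - e * w ^ N)) / real N\<bar> \<le> \<bar>m\<bar> + 2 + max 0 (- ln \<bar>cmod z - cmod w\<bar>)" if N: "1 \<le> N" for N
  proof -
    have "ln (1 - cmod y / cmod x) \<le> ln (1 - cmod y / cmod x) / real N"
      using N lneg mult_right_mono_neg[of 1 "real N" "ln (1 - cmod y / cmod x)"] by (simp add: pos_le_divide_eq mult.commute)
    moreover have "ln (cmod x) + ln (1 - cmod y / cmod x) = ln (cmod x - cmod y)"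
    proof -
      have "cmod x - cmod y = cmod x * (1 - cmod y / cmod x)" using xpos by (simp add: field_simps)
      then show ?thesis using xpos q by (simp add: ln_mult)
    qed
    moreover have "ln (cmod x) \<le> cmod x" using ln_le_minus_one[OF xpos] by simp
    moreover have "ln 2 / real N \<le> 2"
    proof -
      have "ln 2 \<le> (1::real)" using ln_le_minus_one[of "2::real"] by simp
      then have "ln 2 / real N \<le> 1 / 1" using N by (intro frac_le) auto
      then show ?thesis by simp
    qed
    ultimately show ?thesis using b[OF N] xpos unfolding xy(2,3) by linarith
  qed
  show "(\<lambda>j. ln (cmod (z ^ Nj j - e * w ^ Nj j)) / real (Nj j)) \<longlonglongrightarrow> ln m" if N: "filterlim Nj at_top sequentially" 
  proof (rule tendsto_sandwich)
    have z: "(\<lambda>j. c / real (Nj j)) \<longlonglongrightarrow> 0" for c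
      by (intro real_tendsto_divide_at_top[OF tendsto_const] filterlim_compose[OF filterlim_real_sequentially N])
    from tendsto_add[OF tendsto_const z, of "ln m"]
    show "(\<lambda>j. ln (cmod x) + ln (1 - cmod y / cmod x) / real (Nj j)) \<longlonglongrightarrow> ln m" "(\<lambda>j. ln (cmod x) + ln 2 / real (Nj j)) \<longlonglongrightarrow> ln m"
      by (auto simp: xy(2))
    have ev: "eventually (\<lambda>j. 1 \<le> Nj j) sequentially" using N by (simp add: filterlim_at_top)
    show "eventually (\<lambda>j. ln (cmod x) + ln (1 - cmod y / cmod x) / real (Nj j) \<le> ln (cmod (z ^ Nj j - e * w ^ Nj j)) / real (Nj j)) sequentially"
      using ev by eventually_elim (rule b(1))
    show "eventually (\<lambda>j. ln (cmod (z ^ Nj j - e * w ^ Nj j)) / real (Nj j) \<le> ln (cmod x) + ln 2 / real (Nj j)) sequentially"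
      using ev by eventually_elim (rule b(2))
  qed
qed

lemma integrable_ln_power_diff:
  assumes e: "cmod e = 1" and N: "1 \<le> N"
  shows "integrable lborel (\<lambda>w. indicator (ball 0 1) w * (ln (cmod (z ^ N - e * w ^ N)) / real N))"
    and "integrable lborel (\<lambda>w. indicator (ball 0 1) w * (cmod z + 3 + max 0 (- ln \<bar>cmod z - cmod w\<bar>)))"
    and "AE w in lborel. \<bar>indicator (ball 0 1) w * (ln (cmod (z ^ N - e * w ^ N)) / real N)\<bar> \<le> indicator (ball 0 1) w * (cmod z + 3 + max 0 (- ln \<bar>cmod z - cmod w\<bar>))"
proof -
  have "integrable lborel (indicator (ball (0::complex) 1) :: _ \<Rightarrow> real)"
    by (rule integrable_real_indicator) (auto simp: emeasure_unit_disc)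
  from Bochner_Integration.integrable_add[OF integrable_mult_left[OF this, of "cmod z + 3"] integrable_ln_radial[of "cmod z"]]
  show I: "integrable lborel (\<lambda>w. indicator (ball 0 1) w * (cmod z + 3 + max 0 (- ln \<bar>cmod z - cmod w\<bar>)))"
    by (simp add: distrib_left)
  show B: "AE w in lborel. \<bar>indicator (ball 0 1) w * (ln (cmod (z ^ N - e * w ^ N)) / real N)\<bar> \<le> indicator (ball 0 1) w * (cmod z + 3 + max 0 (- ln \<bar>cmod z - cmod w\<bar>))"
    using AE_cmod_neq[of "cmod z"]
  proof eventually_elim
    case (elim w)
    then have "cmod z \<noteq> cmod w" by simp
    from ln_power_diff(1)[OF this e N]
    have "cmod w < 1 \<Longrightarrow> \<bar>ln (cmod (z ^ N - e * w ^ N)) / real N\<bar> \<le> cmod z + 3 + max 0 (- ln \<bar>cmod z - cmod w\<bar>)"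
      using norm_ge_zero[of z] norm_ge_zero[of w] by linarith
    then show ?case by (simp add: indicator_def)
  qed
  show "integrable lborel (\<lambda>w. indicator (ball 0 1) w * (ln (cmod (z ^ N - e * w ^ N)) / real N))"
  proof (rule Bochner_Integration.integrable_bound[OF I])
    show "(\<lambda>w. indicator (ball 0 1) w * (ln (cmod (z ^ N - e * w ^ N)) / real N)) \<in> borel_measurable lborel"
      using borel_open[OF open_ball[of "0::complex" 1]] by measurable
  qed (use B in auto)
qed

text \<open>Averaging over rotations by \<open>2 ^ j\<close>-th roots of unity replaces
  \<open>ln \<bar>z - w\<bar>\<close> by \<open>ln \<bar>z ^ N - w ^ N\<bar> / N\<close> with \<open>N = 2 ^ j\<close>, which tends
  to \<open>ln (max \<bar>z\<bar> \<bar>w\<bar>)\<close>.\<close>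

lemma integral_ln_disc_max:
  "(\<integral>w. indicator (ball 0 1) w * ln (cmod (z - w)) \<partial>lborel) = (\<integral>w. indicator (ball 0 1) w * ln (max (cmod z) (cmod w)) \<partial>lborel)"
proof -
  define f where "f N e w = indicator (ball 0 1) w * (ln (cmod (z ^ N - e * w ^ N)) / real N)" for N :: nat and e w :: complex
  have fm: "f N e \<in> borel_measurable borel" for N e
    unfolding f_def using borel_open[OF open_ball[of "0::complex" 1]] by measurable
  \<comment> \<open>Rotating w by an angle pi/N changes the sign of its N-th power.\<close>
  have rot: "(\<integral>w. f N (-1) w \<partial>lborel) = (\<integral>w. f N 1 w \<partial>lborel)" if N: "1 \<le> N" for N
  proof -
    define u where "u = cis (pi / real N)"
    have u: "cmod u = 1" "u ^ N = -1" using N by (auto simp: u_def Complex.DeMoivre)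
    have "f N (-1) w = f N 1 (u * w)" for w using u by (simp add: f_def norm_mult power_mult_distrib indicator_def)
    then show ?thesis using integral_rotate[OF u(1) fm[of N 1]] by simp
  qed
  \<comment> \<open>z^(2N) - w^(2N) factors into the difference and the sum of the N-th powers,
    whose integrals agree by the rotation above.\<close>
  have step: "(\<integral>w. f (2 * N) 1 w \<partial>lborel) = (\<integral>w. f N 1 w \<partial>lborel)" if N: "1 \<le> N" for N
  proof -
    have "(\<integral>w. f (2 * N) 1 w \<partial>lborel) = (\<integral>w. (f N 1 w + f N (-1) w) / 2 \<partial>lborel)"
    proof (rule integral_cong_AE)
      show "AE w in lborel. f (2 * N) 1 w = (f N 1 w + f N (-1) w) / 2"
        using AE_cmod_neq[of "cmod z"]
      proof eventually_elim
        case (elim w)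
        have ne: "cmod z ^ N \<noteq> cmod w ^ N" using elim N power_eq_imp_eq_base[of "cmod z" N "cmod w"] by auto
        have "z ^ N \<noteq> w ^ N" "z ^ N \<noteq> - (w ^ N)" using ne by (metis norm_power, metis norm_minus_cancel norm_power)
        then have pos: "0 < cmod (z ^ N - w ^ N)" "0 < cmod (z ^ N + w ^ N)" by (auto simp: eq_neg_iff_add_eq_0)
        have "z ^ (2 * N) - w ^ (2 * N) = (z ^ N - w ^ N) * (z ^ N + w ^ N)"
          by (simp add: power_mult power2_eq_square power_mult_distrib mult_2 power_add algebra_simps)
        then have "ln (cmod (z ^ (2 * N) - w ^ (2 * N))) = ln (cmod (z ^ N - w ^ N)) + ln (cmod (z ^ N + w ^ N))"
          using pos by (simp add: norm_mult ln_mult)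
        then show ?case by (simp add: f_def add_divide_distrib distrib_left)
      qed
    qed (use fm in measurable)
    also have "\<dots> = ((\<integral>w. f N 1 w \<partial>lborel) + (\<integral>w. f N (-1) w \<partial>lborel)) / 2"
      using integrable_ln_power_diff(1)[of 1 N z] integrable_ln_power_diff(1)[of "-1" N z] N by (simp add: f_def)
    finally show ?thesis using rot[OF N] by simp
  qed
  have const: "(\<integral>w. f (2 ^ j) 1 w \<partial>lborel) = (\<integral>w. f 1 1 w \<partial>lborel)" for j
    by (induction j) (use step in auto)
  have "(\<lambda>j. \<integral>w. f (2 ^ j) 1 w \<partial>lborel) \<longlonglongrightarrow> (\<integral>w. indicator (ball 0 1) w * ln (max (cmod z) (cmod w)) \<partial>lborel)"
  proof (rule integral_dominated_convergence)
    show "integrable lborel (\<lambda>w. indicator (ball 0 1) w * (cmod z + 3 + max 0 (- ln \<bar>cmod z - cmod w\<bar>)))"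
      by (rule integrable_ln_power_diff(2)[of 1 1]) auto
    show "AE w in lborel. norm (f (2 ^ j) 1 w) \<le> indicator (ball 0 1) w * (cmod z + 3 + max 0 (- ln \<bar>cmod z - cmod w\<bar>))" for j
      using integrable_ln_power_diff(3)[of 1 "2 ^ j" z] by (simp add: f_def)
    have N: "filterlim (\<lambda>j. 2 ^ j :: nat) at_top sequentially" by real_asymp
    show "AE w in lborel. (\<lambda>j. f (2 ^ j) 1 w) \<longlonglongrightarrow> indicator (ball 0 1) w * ln (max (cmod z) (cmod w))"
      using AE_cmod_neq[of "cmod z"]
    proof eventually_elim
      case (elim w)
      then have "cmod z \<noteq> cmod w" by simp
      from ln_power_diff(2)[OF this, of 1, OF _ N] show ?case unfolding f_def by (intro tendsto_mult tendsto_const) auto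
    qed
    show "f (2 ^ j) 1 \<in> borel_measurable lborel" for j using fm by simp
    show "(\<lambda>w. indicator (ball 0 1) w * ln (max (cmod z) (cmod w))) \<in> borel_measurable lborel"
      using borel_open[OF open_ball[of "0::complex" 1]] by measurable
  qed
  then have "(\<integral>w. f 1 1 w \<partial>lborel) = (\<integral>w. indicator (ball 0 1) w * ln (max (cmod z) (cmod w)) \<partial>lborel)"
    unfolding const by (simp add: LIMSEQ_const_iff)
  then show ?thesis by (simp add: f_def)
qed

text \<open>The logarithmic potential of the uniform probability measure on the unit disc.\<close>

definition disc_pot :: "complex \<Rightarrow> real" where
  "disc_pot z = (if cmod z \<le> 1 then (1 - (cmod z)\<^sup>2) / 2 else - ln (cmod z))"

lemma integrable_disc_pot: "integrable lborel (\<lambda>w. indicator (ball 0 1) w * - ln (cmod (z - w)))"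
  using integrable_ln_power_diff(1)[of 1 1 z] by simp

text \<open>Once the distance is replaced by the larger modulus, the integrand is constant for |z| >
  1, and otherwise a function of |w|^2 to which \<open>nn_integral_neg_ln_max\<close>
  applies.\<close>

lemma disc_potential: "(\<integral>w. indicator (ball 0 1) w * - ln (cmod (z - w)) \<partial>lborel) = pi * disc_pot z"
proof -
  have eq: "(\<integral>w. indicator (ball 0 1) w * - ln (cmod (z - w)) \<partial>lborel) = (\<integral>w. indicator (ball 0 1) w * - ln (max (cmod z) (cmod w)) \<partial>lborel)"
    using integral_ln_disc_max[of z] by simp
  show ?thesis
  proof (cases "cmod z \<le> 1")
    case False
    have "(\<integral>w. indicator (ball 0 1) w * - ln (max (cmod z) (cmod w)) \<partial>lborel) = (\<integral>w. indicator (ball (0::complex) 1) w * - ln (cmod z) \<partial>lborel)"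
      by (rule Bochner_Integration.integral_cong) (use False in \<open>auto simp: indicator_def max_def\<close>)
    also have "\<dots> = pi * - ln (cmod z)" by (simp add: measure_def emeasure_unit_disc)
    finally show ?thesis using False unfolding eq by (simp add: disc_pot_def)
  next
    case True
    have sq: "(cmod z)\<^sup>2 \<le> 1" using True by (simp add: power_le_one)
    have h: "ln (max ((cmod z)\<^sup>2) ((cmod w)\<^sup>2)) = 2 * ln (max (cmod z) (cmod w))" for w
    proof -
      have "max ((cmod z)\<^sup>2) ((cmod w)\<^sup>2) = (max (cmod z) (cmod w))\<^sup>2" by (simp add: max_def power_mono_iff)
      then show ?thesis by (cases "max (cmod z) (cmod w) = 0") (auto simp: ln_realpow)
    qed
    have nn: "0 \<le> - ln (max (cmod z) (cmod w))" if "cmod w \<le> 1" for w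
      using True that by (cases "max (cmod z) (cmod w) = 0") (auto simp: ln_le_zero_iff max_def)
    have "(\<integral>\<^sup>+w. ennreal (indicator (ball 0 1) w * - ln (max (cmod z) (cmod w))) \<partial>lborel)
       = (\<integral>\<^sup>+w. (\<lambda>s. ennreal (1 / 2) * (ennreal (- ln (max ((cmod z)\<^sup>2) s)) * indicator {0..1} s)) ((cmod w)\<^sup>2) \<partial>lborel)"
    proof (intro nn_integral_cong)
      fix w
      consider "cmod w < 1" | "cmod w = 1" | "1 < cmod w" by linarith
      then show "ennreal (indicator (ball 0 1) w * - ln (max (cmod z) (cmod w)))
         = ennreal (1 / 2) * (ennreal (- ln (max ((cmod z)\<^sup>2) ((cmod w)\<^sup>2))) * indicator {0..1} ((cmod w)\<^sup>2))"
      proof cases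
        case 1
        then have "(cmod w)\<^sup>2 \<le> 1" by (simp add: power_le_one)
        moreover have "ennreal (1 / 2) * ennreal (2 * - ln (max (cmod z) (cmod w))) = ennreal (- ln (max (cmod z) (cmod w)))"
          using nn[of w] 1 by (subst ennreal_mult[symmetric]) auto
        ultimately show ?thesis using 1 unfolding h by (simp add: indicator_def)
      next
        case 2
        then show ?thesis using sq by (simp add: indicator_def max_def)
      next
        case 3
        then have "\<not> (cmod w)\<^sup>2 \<le> 1" by (simp add: power_le_one_iff)
        then show ?thesis using 3 by (simp add: indicator_def)
      qed
    qed
    also have "\<dots> = ennreal pi * (\<integral>\<^sup>+s. ennreal (1 / 2) * (ennreal (- ln (max ((cmod z)\<^sup>2) s)) * indicator {0..1} s) * indicator {0..} s \<partial>lborel)"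
      by (rule nn_integral_radial) measurable
    also have "(\<integral>\<^sup>+s. ennreal (1 / 2) * (ennreal (- ln (max ((cmod z)\<^sup>2) s)) * indicator {0..1} s) * indicator {0..} s \<partial>lborel)
        = (\<integral>\<^sup>+s. ennreal (1 / 2) * (ennreal (- ln (max ((cmod z)\<^sup>2) s)) * indicator {0..1} s) \<partial>lborel)"
      by (intro nn_integral_cong) (auto simp: indicator_def)
    also have "\<dots> = ennreal (1 / 2) * ennreal (1 - (cmod z)\<^sup>2)"
      using nn_integral_neg_ln_max[of "(cmod z)\<^sup>2"] sq by (simp add: nn_integral_cmult)
    also have "ennreal pi * \<dots> = ennreal (pi * disc_pot z)"
    proof -
      have "ennreal (1 / 2) * ennreal (1 - (cmod z)\<^sup>2) = ennreal (1 / 2 * (1 - (cmod z)\<^sup>2))" by (rule ennreal_mult'[symmetric]) simp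
      moreover have "ennreal pi * ennreal (1 / 2 * (1 - (cmod z)\<^sup>2)) = ennreal (pi * (1 / 2 * (1 - (cmod z)\<^sup>2)))" by (rule ennreal_mult'[symmetric]) simp
      ultimately have "ennreal pi * (ennreal (1 / 2) * ennreal (1 - (cmod z)\<^sup>2)) = ennreal (pi * (1 / 2 * (1 - (cmod z)\<^sup>2)))" by (simp only:)
      then show ?thesis using True by (simp add: disc_pot_def)
    qed
    finally have "(\<integral>w. indicator (ball 0 1) w * - ln (max (cmod z) (cmod w)) \<partial>lborel) = enn2real (ennreal (pi * disc_pot z))"
      using nn by (subst integral_eq_nn_integral) (auto simp: indicator_def)
    then show ?thesis unfolding eq using True sq by (simp add: disc_pot_def)
  qed
qed

text \<open>With \<open>disc_pot_eq\<close> these are the Euler-Lagrange conditions of the uniform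
  measure in the field |z|^2: equality with the constant 1/2 on the disc, inequality outside, from
  ln x being at most x - 1 at x = |z|^2.\<close>

lemma disc_pot_ge: "1 / 2 \<le> disc_pot z + (cmod z)\<^sup>2 / 2"
proof (cases "cmod z \<le> 1")
  case False
  have "ln ((cmod z)\<^sup>2) \<le> (cmod z)\<^sup>2 - 1" using False by (intro ln_le_minus_one) auto
  moreover have "ln ((cmod z)\<^sup>2) = 2 * ln (cmod z)" using False by (simp add: ln_realpow)
  ultimately show ?thesis using False by (simp add: disc_pot_def)
qed (simp add: disc_pot_def field_simps)

lemma disc_pot_eq: "cmod z \<le> 1 \<Longrightarrow> disc_pot z + (cmod z)\<^sup>2 / 2 = 1 / 2"
  by (simp add: disc_pot_def field_simps)

section \<open>Mixtures of Gaussian kernels and mutual energy\<close>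

section \<open>Positive definiteness of the logarithmic kernel\<close>

lemma nn_integral_inverse_Icc:
  fixes a b :: real
  assumes "0 < a" "a \<le> b"
  shows "(\<integral>\<^sup>+u. ennreal (1 / u) * indicator {a..b} u \<partial>lborel) = ennreal (ln b - ln a)"
proof (rule nn_integral_FTC_Icc)
  fix x assume "x \<in> {a..b}"
  then have "0 < x" using assms by simp
  then show "(ln has_real_derivative 1 / x) (at x)" by (rule DERIV_ln_divide)
  show "0 \<le> 1 / x" using \<open>0 < x\<close> by simp
qed (use assms in auto)

lemma ennreal_mult_cancel_le:
  assumes "0 < c" "ennreal c * x \<le> ennreal c * y"
  shows "x \<le> y"
proof -
  have "ennreal (1 / c) * (ennreal c * v) = v" for v
    using assms(1) by (simp add: mult.assoc[symmetric] ennreal_mult'[symmetric])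
  then show ?thesis using mult_left_mono[OF assms(2), of "ennreal (1 / c)"] by simp
qed

lemma nn_integral_exp_Ici:
  fixes u :: real
  assumes "0 < u"
  shows "(\<integral>\<^sup>+t. ennreal (exp (- (t * u))) * indicator {0..} t \<partial>lborel) = ennreal (1 / u)"
proof -
  have "(\<integral>\<^sup>+t. ennreal (exp (- (t * u))) * indicator {0..} t \<partial>lborel) = ennreal (0 - (- exp (- (0 * u)) / u))"
  proof (rule nn_integral_FTC_atLeast)
    show "DERIV (\<lambda>t. - exp (- (t * u)) / u) x :> exp (- (x * u))" for x
      using assms by (auto intro!: derivative_eq_intros)
    have "filterlim (\<lambda>t. t * u) at_top at_top"
      using assms by (intro filterlim_at_top_mult_tendsto_pos[OF tendsto_const _ filterlim_ident, of u, simplified mult.commute]) auto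
    then have "((\<lambda>t. exp (- (t * u))) \<longlongrightarrow> 0) at_top"
      by (intro filterlim_compose[OF exp_at_bot] filterlim_compose[OF filterlim_uminus_at_bot_at_top])
    from tendsto_divide[OF tendsto_minus[OF this] tendsto_const[of u]]
    show "((\<lambda>t. - exp (- (t * u)) / u) \<longlongrightarrow> 0) at_top" using assms by simp
  qed auto
  then show ?thesis by simp
qed

lemma nn_integral_cong_AE2:
  assumes "AE z in \<alpha>. P z" "AE w in \<beta>. Q w" and "\<And>z w. P z \<Longrightarrow> Q w \<Longrightarrow> f z w = g z w"
  shows "(\<integral>\<^sup>+z. \<integral>\<^sup>+w. f z w \<partial>\<beta> \<partial>\<alpha>) = (\<integral>\<^sup>+z. \<integral>\<^sup>+w. g z w \<partial>\<beta> \<partial>\<alpha>)"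
proof (rule nn_integral_cong_AE)
  show "AE z in \<alpha>. (\<integral>\<^sup>+w. f z w \<partial>\<beta>) = (\<integral>\<^sup>+w. g z w \<partial>\<beta>)"
    using assms(1)
  proof eventually_elim
    case (elim z)
    show ?case
    proof (rule nn_integral_cong_AE)
      show "AE w in \<beta>. f z w = g z w" using assms(2) by eventually_elim (rule assms(3)[OF elim])
    qed
  qed
qed

lemma ennreal_regroup:
  fixes x :: ennreal
  assumes "2 * x + 4 * (a + b) \<le> y + v + 4 * (a + b)"
  shows "2 * (x + 2 * (a + b)) \<le> (y + 2 * (a + a)) + (v + 2 * (b + b))"
proof -
  have four: "4 * u = u + u + u + u" for u :: ennreal
    using distrib_right[of 2 2 u] by (simp add: mult_2 add.assoc)
  show ?thesis using assms unfolding four by (simp add: mult_2 add_ac)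
qed

text \<open>Cancellation in \<open>ennreal\<close> is valid only for a finite term; this is where
  the finiteness of the shift enters.\<close>

lemma ennreal_cancel_shift:
  fixes x :: ennreal
  assumes "2 * (2 * x + 2 * d) \<le> (2 * y + 2 * d) + (2 * v + 2 * d)" and d: "d < \<infinity>"
  shows "2 * x \<le> y + v"
proof -
  have "ennreal 2 * (2 * d + 2 * x) \<le> ennreal 2 * (2 * d + (y + v))"
    using assms(1) by (simp add: mult_2 add_ac)
  then have "2 * d + 2 * x \<le> 2 * d + (y + v)" by (rule ennreal_mult_cancel_le[rotated]) simp
  moreover have "2 * d \<noteq> \<infinity>" using d by (simp add: ennreal_mult_eq_top_iff less_top[symmetric])
  ultimately show ?thesis unfolding ennreal_add_left_cancel_le by blast
qed

text \<open>The integrand of Frullani's integral for ln c - ln s. The coercion to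
  \<open>ennreal\<close> cuts it off at 0 when s > c.\<close>

definition gt :: "real \<Rightarrow> real \<Rightarrow> real \<Rightarrow> ennreal" where
  "gt c t s = ennreal ((exp (- (t * s)) - exp (- (t * c))) / t)"

text \<open>Write 1/u as the integral of exp(-t u) over t, integrate u from s to c, and exchange the
  order.\<close>

lemma frullani:
  fixes s c :: real
  assumes "0 < s" "s \<le> c"
  shows "(\<integral>\<^sup>+t. gt c t s * indicator {0<..} t \<partial>lborel) = ennreal (ln c - ln s)"
proof -
  have "ennreal (ln c - ln s) = (\<integral>\<^sup>+u. (\<integral>\<^sup>+t. ennreal (exp (- (t * u))) * indicator {0..} t \<partial>lborel) * indicator {s..c} u \<partial>lborel)"
    using assms by (subst nn_integral_inverse_Icc[symmetric]) (auto intro!: nn_integral_cong split: split_indicator simp: nn_integral_exp_Ici)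
  also have "\<dots> = (\<integral>\<^sup>+u. \<integral>\<^sup>+t. ennreal (exp (- (t * u))) * indicator {0..} t * indicator {s..c} u \<partial>lborel \<partial>lborel)"
    by (simp add: nn_integral_multc)
  also have "\<dots> = (\<integral>\<^sup>+t. \<integral>\<^sup>+u. ennreal (exp (- (t * u))) * indicator {0..} t * indicator {s..c} u \<partial>lborel \<partial>lborel)"
    by (rule lborel_pair.Fubini') measurable
  also have "\<dots> = (\<integral>\<^sup>+t. gt c t s * indicator {0<..} t \<partial>lborel)"
  proof (rule nn_integral_cong_AE)
    have "AE t in lborel. t \<noteq> (0::real)" by (rule AE_lborel_singleton)
    then show "AE t in lborel. (\<integral>\<^sup>+u. ennreal (exp (- (t * u))) * indicator {0..} t * indicator {s..c} u \<partial>lborel) = gt c t s * indicator {0<..} t"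
    proof eventually_elim
      case (elim t)
      show ?case
      proof (cases "0 < t")
        case True
        have "(\<integral>\<^sup>+u. ennreal (exp (- (t * u))) * indicator {s..c} u \<partial>lborel) = ennreal ((- exp (- (t * c)) / t) - (- exp (- (t * s)) / t))"
          by (rule nn_integral_FTC_Icc) (use assms True in \<open>auto intro!: derivative_eq_intros\<close>)
        then show ?thesis using True by (simp add: gt_def diff_divide_distrib)
      qed (use elim in auto)
    qed
  qed
  finally show ?thesis by simp
qed

text \<open>Makes the Gaussian representation valid on the diagonal too, where the logarithmic
  kernel is infinite.\<close>

lemma frullani_0:
  assumes "0 < (c::real)"
  shows "(\<integral>\<^sup>+t. gt c t 0 * indicator {0<..} t \<partial>lborel) = \<infinity>"
proof (rule ccontr)
  assume "\<not> ?thesis"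
  then obtain B where B: "(\<integral>\<^sup>+t. gt c t 0 * indicator {0<..} t \<partial>lborel) = ennreal B" "0 \<le> B"
    by (cases "(\<integral>\<^sup>+t. gt c t 0 * indicator {0<..} t \<partial>lborel)") auto
  \<comment> \<open>Chosen so that ln c - ln s = B + 1, which exceeds the supposed finite
    value.\<close>
  define s where "s = c * exp (- (B + 1))"
  have s: "0 < s" "s \<le> c" using assms B(2) by (auto simp: s_def mult_le_cancel_left1)
  have "ennreal (ln c - ln s) \<le> (\<integral>\<^sup>+t. gt c t 0 * indicator {0<..} t \<partial>lborel)"
    unfolding frullani[OF s, symmetric]
    by (intro nn_integral_mono) (use s in \<open>auto simp: gt_def indicator_def intro!: ennreal_leI divide_right_mono\<close>)
  then have "ln c - ln s \<le> B" using B by simp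
  then show False using assms by (simp add: s_def ln_mult)
qed

text \<open>The parallelogram identity at the midpoint of z and w separates the product of the two
  Gaussians into a factor depending on z - w and a centred Gaussian.\<close>

lemma gaussian_convolution:
  fixes z w :: complex and t :: real
  assumes t: "0 < t"
  shows "(\<integral>\<^sup>+u. ennreal (exp (- (2 * t * (cmod (z - u))\<^sup>2))) * ennreal (exp (- (2 * t * (cmod (w - u))\<^sup>2))) \<partial>lborel)
     = ennreal (pi / (4 * t)) * ennreal (exp (- (t * (cmod (z - w))\<^sup>2)))"
proof -
  define m where "m = (z + w) / 2"
  \<comment> \<open>Normalises the centred Gaussian: 4 t k^2 = 1, and the area factor k^2 times pi
    is the constant pi/(4t).\<close>
  define k where "k = 1 / (2 * sqrt t)"
  have k: "k \<noteq> 0" "4 * t * k\<^sup>2 = 1" "k\<^sup>2 = 1 / (4 * t)" using t by (auto simp: k_def power_divide power_mult_distrib)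
  have par: "2 * (cmod (z - (m + of_real k * u)))\<^sup>2 + 2 * (cmod (w - (m + of_real k * u)))\<^sup>2 = (cmod (z - w))\<^sup>2 + 4 * k\<^sup>2 * (cmod u)\<^sup>2" for u
    unfolding m_def cmod_power2 by (simp add: power2_eq_square field_simps)
  have "(\<integral>\<^sup>+u. ennreal (exp (- (2 * t * (cmod (z - u))\<^sup>2))) * ennreal (exp (- (2 * t * (cmod (w - u))\<^sup>2))) \<partial>lborel)
     = ennreal (k\<^sup>2) * (\<integral>\<^sup>+u. ennreal (exp (- (2 * t * (cmod (z - (m + of_real k * u)))\<^sup>2))) * ennreal (exp (- (2 * t * (cmod (w - (m + of_real k * u)))\<^sup>2))) \<partial>lborel)"
    by (rule nn_integral_scale[OF k(1)]) measurable
  also have "\<dots> = ennreal (k\<^sup>2) * (\<integral>\<^sup>+u. ennreal (exp (- (t * (cmod (z - w))\<^sup>2))) * ennreal ((cmod u) ^ (2 * 0) * exp (- (cmod u)\<^sup>2)) \<partial>lborel)"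
  proof (rule arg_cong[where f="\<lambda>x. ennreal (k\<^sup>2) * x"], rule nn_integral_cong)
    fix u
    have "- (2 * t * (cmod (z - (m + of_real k * u)))\<^sup>2) + - (2 * t * (cmod (w - (m + of_real k * u)))\<^sup>2)
       = - t * (2 * (cmod (z - (m + of_real k * u)))\<^sup>2 + 2 * (cmod (w - (m + of_real k * u)))\<^sup>2)" by (simp add: algebra_simps)
    also have "\<dots> = - (t * (cmod (z - w))\<^sup>2) + - ((4 * t * k\<^sup>2) * (cmod u)\<^sup>2)" unfolding par by (simp add: algebra_simps)
    also have "\<dots> = - (t * (cmod (z - w))\<^sup>2) + - (cmod u)\<^sup>2" unfolding k(2) by simp
    finally have "exp (- (2 * t * (cmod (z - (m + of_real k * u)))\<^sup>2)) * exp (- (2 * t * (cmod (w - (m + of_real k * u)))\<^sup>2))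
        = exp (- (t * (cmod (z - w))\<^sup>2)) * exp (- (cmod u)\<^sup>2)" by (simp only: exp_add[symmetric])
    then show "ennreal (exp (- (2 * t * (cmod (z - (m + of_real k * u)))\<^sup>2))) * ennreal (exp (- (2 * t * (cmod (w - (m + of_real k * u)))\<^sup>2)))
       = ennreal (exp (- (t * (cmod (z - w))\<^sup>2))) * ennreal ((cmod u) ^ (2 * 0) * exp (- (cmod u)\<^sup>2))"
      by (simp add: ennreal_mult[symmetric])
  qed
  also have "\<dots> = ennreal (k\<^sup>2) * (ennreal (exp (- (t * (cmod (z - w))\<^sup>2))) * ennreal pi)"
    using nn_integral_gaussian_moment_full[of 0] by (subst nn_integral_cmult) auto
  also have "\<dots> = ennreal (pi / (4 * t)) * ennreal (exp (- (t * (cmod (z - w))\<^sup>2)))"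
    using t by (simp add: k(3) ennreal_mult[symmetric] mult_ac)
  finally show ?thesis .
qed

text \<open>The kernel is a convolution square, so the mutual energy is a constant times the
  integral of the product of two smoothed densities, and 2xy is at most x^2 + y^2.\<close>

lemma gaussian_pos_def:
  assumes \<mu>: "sets \<mu> = sets borel" "prob_space \<mu>" and \<nu>: "sets \<nu> = sets borel" "prob_space \<nu>" and t: "0 < t"
  defines "G \<equiv> \<lambda>z w. ennreal (exp (- (t * (cmod (z - w))\<^sup>2)))"
  shows "2 * (\<integral>\<^sup>+z. \<integral>\<^sup>+w. G z w \<partial>\<nu> \<partial>\<mu>) \<le> (\<integral>\<^sup>+z. \<integral>\<^sup>+w. G z w \<partial>\<mu> \<partial>\<mu>) + (\<integral>\<^sup>+z. \<integral>\<^sup>+w. G z w \<partial>\<nu> \<partial>\<nu>)"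
proof -
  define h where "h z u = ennreal (exp (- (2 * t * (cmod (z - u))\<^sup>2)))" for z u :: complex
  define C where "C = ennreal (pi / (4 * t))"
  have hm: "(\<lambda>p. h (fst p) (snd p)) \<in> borel_measurable (borel \<Otimes>\<^sub>M borel)" unfolding h_def by measurable
  have rep: "C * (\<integral>\<^sup>+z. \<integral>\<^sup>+w. G z w \<partial>\<beta> \<partial>\<alpha>) = (\<integral>\<^sup>+u. (\<integral>\<^sup>+z. h z u \<partial>\<alpha>) * (\<integral>\<^sup>+w. h w u \<partial>\<beta>) \<partial>lborel)"
    and mm: "(\<lambda>u. \<integral>\<^sup>+z. h z u \<partial>\<alpha>) \<in> borel_measurable borel"
    if a: "sets \<alpha> = sets borel" "prob_space \<alpha>" and b: "sets \<beta> = sets borel" "prob_space \<beta>" for \<alpha> \<beta>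
  proof -
    interpret a: prob_space \<alpha> by fact
    interpret b: prob_space \<beta> by fact
    interpret la: pair_sigma_finite \<alpha> "lborel :: complex measure" ..
    interpret lb: pair_sigma_finite \<beta> "lborel :: complex measure" ..
    note sa[measurable_cong] = a(1) and sb[measurable_cong] = b(1)
    have [measurable]: "(\<lambda>p. h (fst p) (snd p)) \<in> borel_measurable (\<alpha> \<Otimes>\<^sub>M borel)" "(\<lambda>p. h (fst p) (snd p)) \<in> borel_measurable (\<beta> \<Otimes>\<^sub>M borel)"
      unfolding h_def by measurable
    show mm: "(\<lambda>u. \<integral>\<^sup>+z. h z u \<partial>\<alpha>) \<in> borel_measurable borel" unfolding h_def by measurable
    have mb: "(\<lambda>u. \<integral>\<^sup>+z. h z u \<partial>\<beta>) \<in> borel_measurable borel" unfolding h_def by measurable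
    have "C * (\<integral>\<^sup>+z. \<integral>\<^sup>+w. G z w \<partial>\<beta> \<partial>\<alpha>) = (\<integral>\<^sup>+z. \<integral>\<^sup>+w. C * G z w \<partial>\<beta> \<partial>\<alpha>)"
      unfolding G_def by (simp add: nn_integral_cmult[symmetric])
    also have "\<dots> = (\<integral>\<^sup>+z. \<integral>\<^sup>+w. \<integral>\<^sup>+u. h z u * h w u \<partial>lborel \<partial>\<beta> \<partial>\<alpha>)"
      unfolding G_def C_def h_def gaussian_convolution[OF t] ..
    also have "\<dots> = (\<integral>\<^sup>+z. \<integral>\<^sup>+u. \<integral>\<^sup>+w. h z u * h w u \<partial>\<beta> \<partial>lborel \<partial>\<alpha>)"
      unfolding h_def by (intro nn_integral_cong lb.Fubini'[symmetric]) measurable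
    also have "\<dots> = (\<integral>\<^sup>+z. \<integral>\<^sup>+u. h z u * (\<integral>\<^sup>+w. h w u \<partial>\<beta>) \<partial>lborel \<partial>\<alpha>)"
      unfolding h_def by (simp add: nn_integral_cmult)
    also have "\<dots> = (\<integral>\<^sup>+u. \<integral>\<^sup>+z. h z u * (\<integral>\<^sup>+w. h w u \<partial>\<beta>) \<partial>\<alpha> \<partial>lborel)"
      unfolding h_def by (intro la.Fubini'[symmetric]) measurable
    also have "\<dots> = (\<integral>\<^sup>+u. (\<integral>\<^sup>+z. h z u \<partial>\<alpha>) * (\<integral>\<^sup>+w. h w u \<partial>\<beta>) \<partial>lborel)"
      unfolding h_def by (simp add: nn_integral_multc)
    finally show "C * (\<integral>\<^sup>+z. \<integral>\<^sup>+w. G z w \<partial>\<beta> \<partial>\<alpha>) = (\<integral>\<^sup>+u. (\<integral>\<^sup>+z. h z u \<partial>\<alpha>) * (\<integral>\<^sup>+w. h w u \<partial>\<beta>) \<partial>lborel)" .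
  qed
  have sq: "2 * (x * y) \<le> x * x + y * (y::ennreal)" for x y
  proof (cases "x = \<infinity> \<or> y = \<infinity>")
    case True
    then show ?thesis by (auto simp: ennreal_top_mult ennreal_mult_top)
  next
    case False
    then obtain a b where "x = ennreal a" "0 \<le> a" "y = ennreal b" "0 \<le> b" by (cases x; cases y) auto
    moreover have "2 * (a * b) \<le> a * a + b * b" using sum_squares_bound[of a b] by (simp add: power2_eq_square)
    ultimately show ?thesis using ennreal_leI[of "2 * (a * b)" "a * a + b * b"] by (simp add: ennreal_mult ennreal_plus)
  qed
  note mm = mm[OF \<mu> \<mu>] mm[OF \<nu> \<nu>]
  have "C * (2 * (\<integral>\<^sup>+z. \<integral>\<^sup>+w. G z w \<partial>\<nu> \<partial>\<mu>)) = (\<integral>\<^sup>+u. 2 * ((\<integral>\<^sup>+z. h z u \<partial>\<mu>) * (\<integral>\<^sup>+w. h w u \<partial>\<nu>)) \<partial>lborel)"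
    using mm by (simp add: rep[OF \<mu> \<nu>, symmetric] nn_integral_cmult mult_ac)
  also have "\<dots> \<le> (\<integral>\<^sup>+u. (\<integral>\<^sup>+z. h z u \<partial>\<mu>) * (\<integral>\<^sup>+w. h w u \<partial>\<mu>) + (\<integral>\<^sup>+z. h z u \<partial>\<nu>) * (\<integral>\<^sup>+w. h w u \<partial>\<nu>) \<partial>lborel)"
    by (intro nn_integral_mono sq)
  also have "\<dots> = C * (\<integral>\<^sup>+z. \<integral>\<^sup>+w. G z w \<partial>\<mu> \<partial>\<mu>) + C * (\<integral>\<^sup>+z. \<integral>\<^sup>+w. G z w \<partial>\<nu> \<partial>\<nu>)"
    using mm by (simp add: rep[OF \<mu> \<mu>] rep[OF \<nu> \<nu>] nn_integral_add)
  finally have "C * (2 * (\<integral>\<^sup>+z. \<integral>\<^sup>+w. G z w \<partial>\<nu> \<partial>\<mu>)) \<le> C * ((\<integral>\<^sup>+z. \<integral>\<^sup>+w. G z w \<partial>\<mu> \<partial>\<mu>) + (\<integral>\<^sup>+z. \<integral>\<^sup>+w. G z w \<partial>\<nu> \<partial>\<nu>))"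
    by (simp add: distrib_left)
  then show ?thesis unfolding C_def by (rule ennreal_mult_cancel_le[rotated]) (use t in simp)
qed

text \<open>The logarithmic kernel is a mixture of Gaussian kernels, up to a constant which cancels because both measures have the same mass.\<close>

lemma log_kernel_pos_def:
  assumes \<mu>: "sets \<mu> = sets borel" "prob_space \<mu>" "AE z in \<mu>. cmod z \<le> \<rho>"
    and \<nu>: "sets \<nu> = sets borel" "prob_space \<nu>" "AE z in \<nu>. cmod z \<le> \<rho>" and \<rho>: "1 \<le> \<rho>"
  shows "2 * (\<integral>\<^sup>+z. \<integral>\<^sup>+w. kk z w \<partial>\<nu> \<partial>\<mu>) \<le> (\<integral>\<^sup>+z. \<integral>\<^sup>+w. kk z w \<partial>\<mu> \<partial>\<mu>) + (\<integral>\<^sup>+z. \<integral>\<^sup>+w. kk z w \<partial>\<nu> \<partial>\<nu>)"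
proof -
  \<comment> \<open>An upper bound for all squared distances between points of the supports, so that
    Frullani's formula applies; \<open>d\<close> below is half its logarithm.\<close>
  define c where "c = (2 * \<rho>)\<^sup>2"
  define d where "d = ln (2 * \<rho>)"
  define q where "q z = ennreal ((cmod z)\<^sup>2 / 2)" for z :: complex
  define L where "L z w = (\<integral>\<^sup>+t. gt c t ((cmod (z - w))\<^sup>2) * indicator {0<..} t \<partial>lborel)" for z w
  have c: "0 < c" using \<rho> by (simp add: c_def)
  have d: "0 \<le> d" using \<rho> by (simp add: d_def)
  \<comment> \<open>The factor 2 appears because Frullani's formula is used with the squared
    distance. The quadratic terms and \<open>d\<close> stand on opposite sides to avoid
    subtraction.\<close>
  have ker: "2 * kk z w + 2 * ennreal d = L z w + 2 * (q z + q w)" if zw: "cmod z \<le> \<rho>" "cmod w \<le> \<rho>" for z w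
  proof (cases "z = w")
    case True
    then show ?thesis using frullani_0[OF c] by (simp add: L_def kk_def)
  next
    case False
    have "cmod (z - w) \<le> 2 * \<rho>" using norm_triangle_ineq4[of z w] zw by simp
    then have le: "(cmod (z - w))\<^sup>2 \<le> c" using power_mono[of "cmod (z - w)" "2 * \<rho>" 2] by (simp add: c_def)
    have "L z w = ennreal (ln c - ln ((cmod (z - w))\<^sup>2))"
      unfolding L_def using False le by (intro frullani) auto
    also have "ln c = 2 * d" unfolding c_def d_def using \<rho> by (subst ln_realpow) auto
    also have "ln ((cmod (z - w))\<^sup>2) = 2 * ln (cmod (z - w))" using False by (simp add: ln_realpow)
    finally have L: "L z w = ennreal (2 * d - 2 * ln (cmod (z - w)))" .
    have "ln ((cmod (z - w))\<^sup>2) \<le> ln c" using False le by (intro ln_mono) auto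
    then have p: "0 \<le> 2 * d - 2 * ln (cmod (z - w))" using False \<open>ln c = 2 * d\<close> by (simp add: ln_realpow)
    have k: "0 \<le> kr z w" using False by (rule kr_nonneg)
    have m2: "2 * ennreal x = ennreal (2 * x)" for x using ennreal_mult'[of 2 x] by simp
    have "2 * kk z w + 2 * ennreal d = ennreal (2 * kr z w) + ennreal (2 * d)" using False by (simp add: kk_def m2)
    also have "\<dots> = ennreal (2 * kr z w + 2 * d)" by (rule ennreal_plus[symmetric]) (use d k in auto)
    also have "2 * kr z w + 2 * d = (2 * d - 2 * ln (cmod (z - w))) + 2 * ((cmod z)\<^sup>2 / 2 + (cmod w)\<^sup>2 / 2)"
      by (simp add: kr_def field_simps)
    also have "ennreal \<dots> = ennreal (2 * d - 2 * ln (cmod (z - w))) + ennreal (2 * ((cmod z)\<^sup>2 / 2 + (cmod w)\<^sup>2 / 2))"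
      by (rule ennreal_plus) (use p in auto)
    also have "\<dots> = L z w + 2 * (q z + q w)"
      unfolding L q_def m2[symmetric] by (subst ennreal_plus) auto
    finally show ?thesis .
  qed
  have two: "2 * (\<integral>\<^sup>+z. \<integral>\<^sup>+w. kk z w \<partial>\<beta> \<partial>\<alpha>) + 2 * ennreal d = (\<integral>\<^sup>+z. \<integral>\<^sup>+w. L z w \<partial>\<beta> \<partial>\<alpha>) + 2 * ((\<integral>\<^sup>+z. q z \<partial>\<alpha>) + (\<integral>\<^sup>+w. q w \<partial>\<beta>))"
    and Lrep: "(\<integral>\<^sup>+z. \<integral>\<^sup>+w. L z w \<partial>\<beta> \<partial>\<alpha>) = (\<integral>\<^sup>+t. (\<integral>\<^sup>+z. \<integral>\<^sup>+w. gt c t ((cmod (z - w))\<^sup>2) \<partial>\<beta> \<partial>\<alpha>) * indicator {0<..} t \<partial>lborel)"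
    and Gm: "(\<lambda>t. (\<integral>\<^sup>+z. \<integral>\<^sup>+w. gt c t ((cmod (z - w))\<^sup>2) \<partial>\<beta> \<partial>\<alpha>) * indicator {0<..} t) \<in> borel_measurable borel"
    and Gt: "0 < t \<Longrightarrow> (\<integral>\<^sup>+z. \<integral>\<^sup>+w. gt c t ((cmod (z - w))\<^sup>2) \<partial>\<beta> \<partial>\<alpha>) + ennreal (exp (- (t * c)) / t)
        = ennreal (1 / t) * (\<integral>\<^sup>+z. \<integral>\<^sup>+w. ennreal (exp (- (t * (cmod (z - w))\<^sup>2))) \<partial>\<beta> \<partial>\<alpha>)"
    if a: "sets \<alpha> = sets borel" "prob_space \<alpha>" "AE z in \<alpha>. cmod z \<le> \<rho>"
      and b: "sets \<beta> = sets borel" "prob_space \<beta>" "AE z in \<beta>. cmod z \<le> \<rho>" for \<alpha> \<beta> and t :: real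
  proof -
    interpret a: prob_space \<alpha> by fact
    interpret b: prob_space \<beta> by fact
    interpret la: pair_sigma_finite \<alpha> "lborel :: real measure" ..
    interpret lb: pair_sigma_finite \<beta> "lborel :: real measure" ..
    note sa[measurable_cong] = a(1) and sb[measurable_cong] = b(1)
    have km: "(\<lambda>w. kk z w) \<in> borel_measurable \<beta>" for z unfolding kk_def kr_def by measurable
    have km2: "(\<lambda>z. \<integral>\<^sup>+w. kk z w \<partial>\<beta>) \<in> borel_measurable \<alpha>" unfolding kk_def kr_def by measurable
    have Lm: "(\<lambda>w. L z w) \<in> borel_measurable \<beta>" for z unfolding L_def gt_def by measurable
    have Lm2: "(\<lambda>z. \<integral>\<^sup>+w. L z w \<partial>\<beta>) \<in> borel_measurable \<alpha>" unfolding L_def gt_def by measurable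
    have qm: "q \<in> borel_measurable \<alpha>" "q \<in> borel_measurable \<beta>" unfolding q_def by measurable
    have "2 * (\<integral>\<^sup>+z. \<integral>\<^sup>+w. kk z w \<partial>\<beta> \<partial>\<alpha>) + 2 * ennreal d = (\<integral>\<^sup>+z. \<integral>\<^sup>+w. 2 * kk z w + 2 * ennreal d \<partial>\<beta> \<partial>\<alpha>)"
      using km km2 by (simp add: nn_integral_add nn_integral_cmult a.emeasure_space_1 b.emeasure_space_1)
    also have "\<dots> = (\<integral>\<^sup>+z. \<integral>\<^sup>+w. L z w + 2 * (q z + q w) \<partial>\<beta> \<partial>\<alpha>)"
      by (rule nn_integral_cong_AE2[OF a(3) b(3)]) (rule ker)
    also have "\<dots> = (\<integral>\<^sup>+z. \<integral>\<^sup>+w. L z w \<partial>\<beta> \<partial>\<alpha>) + 2 * ((\<integral>\<^sup>+z. q z \<partial>\<alpha>) + (\<integral>\<^sup>+w. q w \<partial>\<beta>))"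
      using Lm Lm2 qm by (simp add: nn_integral_add nn_integral_cmult a.emeasure_space_1 b.emeasure_space_1)
    finally show "2 * (\<integral>\<^sup>+z. \<integral>\<^sup>+w. kk z w \<partial>\<beta> \<partial>\<alpha>) + 2 * ennreal d = (\<integral>\<^sup>+z. \<integral>\<^sup>+w. L z w \<partial>\<beta> \<partial>\<alpha>) + 2 * ((\<integral>\<^sup>+z. q z \<partial>\<alpha>) + (\<integral>\<^sup>+w. q w \<partial>\<beta>))" .
    have "(\<integral>\<^sup>+z. \<integral>\<^sup>+w. L z w \<partial>\<beta> \<partial>\<alpha>) = (\<integral>\<^sup>+z. \<integral>\<^sup>+t. \<integral>\<^sup>+w. gt c t ((cmod (z - w))\<^sup>2) * indicator {0<..} t \<partial>\<beta> \<partial>lborel \<partial>\<alpha>)"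
      unfolding L_def gt_def by (intro nn_integral_cong lb.Fubini'[symmetric]) measurable
    also have "\<dots> = (\<integral>\<^sup>+t. \<integral>\<^sup>+z. \<integral>\<^sup>+w. gt c t ((cmod (z - w))\<^sup>2) * indicator {0<..} t \<partial>\<beta> \<partial>\<alpha> \<partial>lborel)"
      unfolding gt_def by (intro la.Fubini'[symmetric]) measurable
    also have "\<dots> = (\<integral>\<^sup>+t. (\<integral>\<^sup>+z. \<integral>\<^sup>+w. gt c t ((cmod (z - w))\<^sup>2) \<partial>\<beta> \<partial>\<alpha>) * indicator {0<..} t \<partial>lborel)"
      unfolding gt_def by (simp add: nn_integral_multc)
    finally show "(\<integral>\<^sup>+z. \<integral>\<^sup>+w. L z w \<partial>\<beta> \<partial>\<alpha>) = (\<integral>\<^sup>+t. (\<integral>\<^sup>+z. \<integral>\<^sup>+w. gt c t ((cmod (z - w))\<^sup>2) \<partial>\<beta> \<partial>\<alpha>) * indicator {0<..} t \<partial>lborel)" .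
    show "(\<lambda>t. (\<integral>\<^sup>+z. \<integral>\<^sup>+w. gt c t ((cmod (z - w))\<^sup>2) \<partial>\<beta> \<partial>\<alpha>) * indicator {0<..} t) \<in> borel_measurable borel"
      unfolding gt_def by measurable
    show "(\<integral>\<^sup>+z. \<integral>\<^sup>+w. gt c t ((cmod (z - w))\<^sup>2) \<partial>\<beta> \<partial>\<alpha>) + ennreal (exp (- (t * c)) / t)
        = ennreal (1 / t) * (\<integral>\<^sup>+z. \<integral>\<^sup>+w. ennreal (exp (- (t * (cmod (z - w))\<^sup>2))) \<partial>\<beta> \<partial>\<alpha>)" if t: "0 < t"
    proof -
      have eq: "gt c t ((cmod (z - w))\<^sup>2) + ennreal (exp (- (t * c)) / t) = ennreal (1 / t) * ennreal (exp (- (t * (cmod (z - w))\<^sup>2)))"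
        if zw: "cmod z \<le> \<rho>" "cmod w \<le> \<rho>" for z w
      proof -
        have "cmod (z - w) \<le> 2 * \<rho>" using norm_triangle_ineq4[of z w] zw by simp
        then have "(cmod (z - w))\<^sup>2 \<le> c" using power_mono[of "cmod (z - w)" "2 * \<rho>" 2] by (simp add: c_def)
        then have "exp (- (t * c)) \<le> exp (- (t * (cmod (z - w))\<^sup>2))" using t by simp
        then have "0 \<le> (exp (- (t * (cmod (z - w))\<^sup>2)) - exp (- (t * c))) / t" using t by simp
        from ennreal_plus[OF this, of "exp (- (t * c)) / t"] show ?thesis
          unfolding gt_def using t ennreal_mult'[of "1 / t" "exp (- (t * (cmod (z - w))\<^sup>2))"] by (simp add: diff_divide_distrib)
      qed
      have gm: "(\<lambda>w. gt c t ((cmod (z - w))\<^sup>2)) \<in> borel_measurable \<beta>" "(\<lambda>w. ennreal (exp (- (t * (cmod (z - w))\<^sup>2)))) \<in> borel_measurable \<beta>" for z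
        unfolding gt_def by measurable
      have gm2: "(\<lambda>z. \<integral>\<^sup>+w. gt c t ((cmod (z - w))\<^sup>2) \<partial>\<beta>) \<in> borel_measurable \<alpha>" "(\<lambda>z. \<integral>\<^sup>+w. ennreal (exp (- (t * (cmod (z - w))\<^sup>2))) \<partial>\<beta>) \<in> borel_measurable \<alpha>"
        unfolding gt_def by measurable
      have "(\<integral>\<^sup>+z. \<integral>\<^sup>+w. gt c t ((cmod (z - w))\<^sup>2) \<partial>\<beta> \<partial>\<alpha>) + ennreal (exp (- (t * c)) / t)
        = (\<integral>\<^sup>+z. \<integral>\<^sup>+w. gt c t ((cmod (z - w))\<^sup>2) + ennreal (exp (- (t * c)) / t) \<partial>\<beta> \<partial>\<alpha>)"
        using gm gm2 by (simp add: nn_integral_add a.emeasure_space_1 b.emeasure_space_1)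
      also have "\<dots> = (\<integral>\<^sup>+z. \<integral>\<^sup>+w. ennreal (1 / t) * ennreal (exp (- (t * (cmod (z - w))\<^sup>2))) \<partial>\<beta> \<partial>\<alpha>)"
        by (rule nn_integral_cong_AE2[OF a(3) b(3)]) (rule eq)
      also have "\<dots> = ennreal (1 / t) * (\<integral>\<^sup>+z. \<integral>\<^sup>+w. ennreal (exp (- (t * (cmod (z - w))\<^sup>2))) \<partial>\<beta> \<partial>\<alpha>)"
        using gm gm2 by (simp only: nn_integral_cmult)
      finally show ?thesis .
    qed
  qed
  have "2 * (\<integral>\<^sup>+z. \<integral>\<^sup>+w. L z w \<partial>\<nu> \<partial>\<mu>) \<le> (\<integral>\<^sup>+z. \<integral>\<^sup>+w. L z w \<partial>\<mu> \<partial>\<mu>) + (\<integral>\<^sup>+z. \<integral>\<^sup>+w. L z w \<partial>\<nu> \<partial>\<nu>)"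
    unfolding Lrep[OF \<mu> \<mu>] Lrep[OF \<mu> \<nu>] Lrep[OF \<nu> \<nu>]
  proof (subst nn_integral_cmult[symmetric], use Gm[OF \<mu> \<nu>] in simp, subst nn_integral_add[symmetric])
    show "(\<lambda>t. (\<integral>\<^sup>+z. \<integral>\<^sup>+w. gt c t ((cmod (z - w))\<^sup>2) \<partial>\<mu> \<partial>\<mu>) * indicator {0<..} t) \<in> borel_measurable lborel" using Gm[OF \<mu> \<mu>] by simp
    show "(\<lambda>t. (\<integral>\<^sup>+z. \<integral>\<^sup>+w. gt c t ((cmod (z - w))\<^sup>2) \<partial>\<nu> \<partial>\<nu>) * indicator {0<..} t) \<in> borel_measurable lborel" using Gm[OF \<nu> \<nu>] by simp
    show "(\<integral>\<^sup>+t. 2 * ((\<integral>\<^sup>+z. \<integral>\<^sup>+w. gt c t ((cmod (z - w))\<^sup>2) \<partial>\<nu> \<partial>\<mu>) * indicator {0<..} t) \<partial>lborel)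
      \<le> (\<integral>\<^sup>+t. (\<integral>\<^sup>+z. \<integral>\<^sup>+w. gt c t ((cmod (z - w))\<^sup>2) \<partial>\<mu> \<partial>\<mu>) * indicator {0<..} t + (\<integral>\<^sup>+z. \<integral>\<^sup>+w. gt c t ((cmod (z - w))\<^sup>2) \<partial>\<nu> \<partial>\<nu>) * indicator {0<..} t \<partial>lborel)"
    proof (rule nn_integral_mono)
      fix t :: real
      define x y v where "x = (\<integral>\<^sup>+z. \<integral>\<^sup>+w. gt c t ((cmod (z - w))\<^sup>2) \<partial>\<nu> \<partial>\<mu>)" and "y = (\<integral>\<^sup>+z. \<integral>\<^sup>+w. gt c t ((cmod (z - w))\<^sup>2) \<partial>\<mu> \<partial>\<mu>)"
        and "v = (\<integral>\<^sup>+z. \<integral>\<^sup>+w. gt c t ((cmod (z - w))\<^sup>2) \<partial>\<nu> \<partial>\<nu>)"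
      show "2 * ((\<integral>\<^sup>+z. \<integral>\<^sup>+w. gt c t ((cmod (z - w))\<^sup>2) \<partial>\<nu> \<partial>\<mu>) * indicator {0<..} t)
        \<le> (\<integral>\<^sup>+z. \<integral>\<^sup>+w. gt c t ((cmod (z - w))\<^sup>2) \<partial>\<mu> \<partial>\<mu>) * indicator {0<..} t + (\<integral>\<^sup>+z. \<integral>\<^sup>+w. gt c t ((cmod (z - w))\<^sup>2) \<partial>\<nu> \<partial>\<nu>) * indicator {0<..} t"
      proof (cases "0 < t")
        case True
        \<comment> \<open>The part of the Frullani integrand that does not depend on the points.
          With masses 1 it is the same for all three pairs of measures and cancels.\<close>
        define e where "e = ennreal (exp (- (t * c)) / t)"
        have "2 * (x + e) \<le> (y + e) + (v + e)"
          unfolding x_def y_def v_def e_def Gt[OF \<mu> \<mu> True] Gt[OF \<mu> \<nu> True] Gt[OF \<nu> \<nu> True]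
          using mult_left_mono[OF gaussian_pos_def[OF \<mu>(1,2) \<nu>(1,2) True], of "ennreal (1 / t)"] by (simp add: distrib_left mult_ac)
        then have "(2 * e) + 2 * x \<le> (2 * e) + (y + v)" by (simp add: distrib_left mult_2 add_ac)
        moreover have "2 * e \<noteq> \<infinity>" by (simp add: e_def ennreal_mult_eq_top_iff)
        ultimately have "2 * x \<le> y + v" by (simp add: ennreal_add_left_cancel_le)
        then show ?thesis using True by (simp add: x_def y_def v_def)
      qed simp
    qed
  qed
  then have "2 * (\<integral>\<^sup>+z. \<integral>\<^sup>+w. L z w \<partial>\<nu> \<partial>\<mu>) + 4 * ((\<integral>\<^sup>+z. q z \<partial>\<mu>) + (\<integral>\<^sup>+w. q w \<partial>\<nu>))
     \<le> (\<integral>\<^sup>+z. \<integral>\<^sup>+w. L z w \<partial>\<mu> \<partial>\<mu>) + (\<integral>\<^sup>+z. \<integral>\<^sup>+w. L z w \<partial>\<nu> \<partial>\<nu>) + 4 * ((\<integral>\<^sup>+z. q z \<partial>\<mu>) + (\<integral>\<^sup>+w. q w \<partial>\<nu>))"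
    by (rule add_right_mono)
  then have "2 * ((\<integral>\<^sup>+z. \<integral>\<^sup>+w. L z w \<partial>\<nu> \<partial>\<mu>) + 2 * ((\<integral>\<^sup>+z. q z \<partial>\<mu>) + (\<integral>\<^sup>+w. q w \<partial>\<nu>)))
     \<le> ((\<integral>\<^sup>+z. \<integral>\<^sup>+w. L z w \<partial>\<mu> \<partial>\<mu>) + 2 * ((\<integral>\<^sup>+z. q z \<partial>\<mu>) + (\<integral>\<^sup>+z. q z \<partial>\<mu>))) + ((\<integral>\<^sup>+z. \<integral>\<^sup>+w. L z w \<partial>\<nu> \<partial>\<nu>) + 2 * ((\<integral>\<^sup>+z. q z \<partial>\<nu>) + (\<integral>\<^sup>+w. q w \<partial>\<nu>)))"
    by (rule ennreal_regroup)
  then have "2 * (2 * (\<integral>\<^sup>+z. \<integral>\<^sup>+w. kk z w \<partial>\<nu> \<partial>\<mu>) + 2 * ennreal d) \<le> (2 * (\<integral>\<^sup>+z. \<integral>\<^sup>+w. kk z w \<partial>\<mu> \<partial>\<mu>) + 2 * ennreal d) + (2 * (\<integral>\<^sup>+z. \<integral>\<^sup>+w. kk z w \<partial>\<nu> \<partial>\<nu>) + 2 * ennreal d)"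
    unfolding two[OF \<mu> \<mu>] two[OF \<mu> \<nu>] two[OF \<nu> \<nu>] .
  then show ?thesis by (rule ennreal_cancel_shift) simp
qed

section \<open>Polar sets, swept measures and their minimality\<close>

section \<open>Polar sets and balayage\<close>

lemma R_mu_iterated:
  assumes "prob_meas_in E \<mu>"
  shows "R_mu \<mu> = enn2ereal (\<integral>\<^sup>+z. \<integral>\<^sup>+w. kk z w \<partial>\<mu> \<partial>\<mu>)"
proof -
  obtain C where "prob_space \<mu>" "sets \<mu> = sets borel" using assms by (rule prob_meas_inE)
  then show ?thesis
    using R_mu_eq[OF assms] nn_integral_pair[of \<mu> \<mu> "\<lambda>p. kk (fst p) (snd p)"] prob_space.finite_measure[of \<mu>] kernels_measurable(1) by simp
qed

lemma kk_le_logk_pos: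
  assumes "cmod z \<le> \<rho>" "cmod w \<le> \<rho>"
  shows "kk z w \<le> logk_pos z w + ennreal (\<rho>\<^sup>2)"
proof -
  have "(cmod z)\<^sup>2 \<le> \<rho>\<^sup>2" "(cmod w)\<^sup>2 \<le> \<rho>\<^sup>2" using assms by (auto intro: power_mono)
  then have "ennreal (((cmod z)\<^sup>2 + (cmod w)\<^sup>2) / 2) \<le> ennreal (\<rho>\<^sup>2)" by (intro ennreal_leI) simp
  then have "logk_pos z w + ennreal (((cmod z)\<^sup>2 + (cmod w)\<^sup>2) / 2) \<le> logk_pos z w + ennreal (\<rho>\<^sup>2)" by (rule add_left_mono)
  then have "kk z w + logk_neg z w \<le> logk_pos z w + ennreal (\<rho>\<^sup>2)" by (simp only: kernel_split)
  moreover have "kk z w \<le> kk z w + logk_neg z w" by simp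
  ultimately show ?thesis by (rule order_trans[rotated])
qed

lemma logk_pos_measurable [measurable]: "logk_pos z \<in> borel_measurable borel"
  unfolding logk_pos_def by measurable

lemma logk_neg_measurable [measurable]: "logk_neg z \<in> borel_measurable borel"
  unfolding logk_neg_def by measurable

lemma kk_measurable [measurable]: "kk z \<in> borel_measurable borel"
  unfolding kk_def kr_def by measurable

lemma prob_meas_in_uniform:
  assumes K: "compact K" "K \<subseteq> E" and s: "sets M = sets borel" and pos: "emeasure M K \<noteq> 0" "emeasure M K \<noteq> \<infinity>"
  shows "prob_meas_in E (uniform_measure M K)"
  unfolding prob_meas_in_def
proof (intro conjI exI[of _ K] K)
  have Kb: "K \<in> sets M" using K s by (auto simp: compact_imp_closed borel_closed)
  show "sets (uniform_measure M K) = sets borel" using s by simp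
  show "prob_space (uniform_measure M K)" using pos by (intro prob_space_uniform_measure) auto
  have "UNIV - K \<in> sets M" using Kb s by auto
  then show "emeasure (uniform_measure M K) (UNIV - K) = 0" using Kb by simp
qed

lemma uniform_energy:
  assumes K: "compact K" and pos: "emeasure lborel K \<noteq> 0"
  shows "(\<integral>\<^sup>+z. \<integral>\<^sup>+w. kk z w \<partial>uniform_measure lborel K \<partial>uniform_measure lborel K) < \<infinity>"
proof -
  define \<mu> where "\<mu> = uniform_measure lborel K"
  have Kb: "K \<in> sets lborel" using K by (simp add: compact_imp_closed borel_closed)
  have fin: "emeasure lborel K < \<infinity>" using K by (rule emeasure_compact_finite)
  have p: "prob_meas_in UNIV \<mu>" unfolding \<mu>_def using fin pos K by (intro prob_meas_in_uniform) auto
  then interpret prob_space \<mu> by (simp add: prob_meas_in_def)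
  obtain \<rho> where \<rho>: "\<And>z. z \<in> K \<Longrightarrow> cmod z \<le> \<rho>" using compact_imp_bounded[OF K] by (auto simp: bounded_iff)
  define D where "D = (ennreal pi + ennreal (\<rho>\<^sup>2) * emeasure lborel K) / emeasure lborel K"
  have D: "D < \<infinity>" using fin pos by (simp add: D_def ennreal_divide_eq_top_iff ennreal_mult_less_top less_top[symmetric] ennreal_mult_eq_top_iff)
  have in_le: "(\<integral>\<^sup>+w. kk z w \<partial>\<mu>) \<le> D" if z: "z \<in> K" for z
  proof -
    have "(\<integral>\<^sup>+w. kk z w \<partial>\<mu>) = (\<integral>\<^sup>+w. kk z w * indicator K w \<partial>lborel) / emeasure lborel K"
      unfolding \<mu>_def by (rule nn_integral_uniform_measure) (use Kb in auto)
    also have "(\<integral>\<^sup>+w. kk z w * indicator K w \<partial>lborel) \<le> (\<integral>\<^sup>+w. logk_pos z w + ennreal (\<rho>\<^sup>2) * indicator K w \<partial>lborel)"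
    proof (rule nn_integral_mono)
      fix w show "kk z w * indicator K w \<le> logk_pos z w + ennreal (\<rho>\<^sup>2) * indicator K w"
        using kk_le_logk_pos[OF \<rho>[OF z] \<rho>, of w] by (cases "w \<in> K") auto
    qed
    also have "\<dots> = (\<integral>\<^sup>+w. logk_pos z w \<partial>lborel) + ennreal (\<rho>\<^sup>2) * emeasure lborel K"
      using Kb by (subst nn_integral_add) (auto simp: nn_integral_cmult)
    also have "\<dots> \<le> ennreal pi + ennreal (\<rho>\<^sup>2) * emeasure lborel K" by (intro add_right_mono nn_integral_logk_pos_le)
    finally show ?thesis unfolding D_def by (simp add: divide_right_mono_ennreal)
  qed
  have "AE z in \<mu>. z \<in> K" unfolding \<mu>_def by (rule AE_uniform_measureI) (use Kb in auto)
  then have "(\<integral>\<^sup>+z. \<integral>\<^sup>+w. kk z w \<partial>\<mu> \<partial>\<mu>) \<le> (\<integral>\<^sup>+z. D \<partial>\<mu>)"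
    by (intro nn_integral_mono_AE) (erule eventually_mono, erule in_le)
  also have "\<dots> = D" by (simp add: emeasure_space_1)
  finally show ?thesis using D by (simp add: \<mu>_def)
qed

text \<open>Otherwise inner regularity yields a compact subset K of positive mass. Conditioning on K
  multiplies the energy by at most the inverse square of the mass, since the kernel is nonnegative,
  and so produces a measure of finite energy on a polar set.\<close>

lemma polar_null:
  assumes \<mu>: "prob_meas_in E \<mu>" and fin: "(\<integral>\<^sup>+z. \<integral>\<^sup>+w. kk z w \<partial>\<mu> \<partial>\<mu>) < \<infinity>" and B: "B \<in> sets borel" "polar B"
  shows "emeasure \<mu> B = 0"
proof (rule ccontr)
  assume "emeasure \<mu> B \<noteq> 0"
  obtain p: "prob_space \<mu>" and s: "sets \<mu> = sets borel" using \<mu> by (rule prob_meas_inE)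
  interpret prob_space \<mu> by fact
  have "emeasure \<mu> B = (SUP K \<in> {K. K \<subseteq> B \<and> compact K}. emeasure \<mu> K)"
    using s B by (intro inner_regular) auto
  then have "(SUP K \<in> {K. K \<subseteq> B \<and> compact K}. emeasure \<mu> K) \<noteq> 0" using \<open>emeasure \<mu> B \<noteq> 0\<close> by simp
  then obtain K where K: "K \<subseteq> B" "compact K" "emeasure \<mu> K \<noteq> 0"
    by (metis (mono_tags, lifting) SUP_eq_const bot_ennreal SUP_bot_conv(1) mem_Collect_eq)
  define \<tau> where "\<tau> = uniform_measure \<mu> K"
  have Kb: "K \<in> sets \<mu>" using K s by (auto simp: compact_imp_closed borel_closed)
  have Kfin: "emeasure \<mu> K \<noteq> \<infinity>" by simp
  have \<tau>: "prob_meas_in B \<tau>" unfolding \<tau>_def using K s Kfin by (intro prob_meas_in_uniform) auto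
  have sm: "(\<lambda>z. \<integral>\<^sup>+w. kk z w \<partial>\<mu>) \<in> borel_measurable \<mu>"
  proof -
    have eq2: "sets (borel \<Otimes>\<^sub>M \<mu>) = sets (borel \<Otimes>\<^sub>M borel)" by (rule sets_pair_measure_cong[OF refl s])
    have "(\<lambda>p. kk (fst p) (snd p)) \<in> borel_measurable (borel \<Otimes>\<^sub>M \<mu>)"
      unfolding measurable_cong_sets[OF eq2 refl] by measurable
    from borel_measurable_nn_integral_fst[OF this] show ?thesis by (simp add: measurable_cong_sets[OF s refl])
  qed
  have km: "kk z \<in> borel_measurable \<mu>" for z by (simp add: measurable_cong_sets[OF s refl])
  have le: "(\<integral>\<^sup>+w. f w \<partial>\<tau>) \<le> (\<integral>\<^sup>+w. f w \<partial>\<mu>) / emeasure \<mu> K" if "f \<in> borel_measurable \<mu>" for f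
    unfolding \<tau>_def nn_integral_uniform_measure[OF that Kb]
    by (intro divide_right_mono_ennreal nn_integral_mono) (auto simp: indicator_def)
  have dm: "(\<lambda>z. g z / c) \<in> borel_measurable \<mu>" if "g \<in> borel_measurable \<mu>" for g and c :: ennreal
    using that by measurable
  have "(\<integral>\<^sup>+z. \<integral>\<^sup>+w. kk z w \<partial>\<tau> \<partial>\<tau>) \<le> (\<integral>\<^sup>+z. (\<integral>\<^sup>+w. kk z w \<partial>\<mu>) / emeasure \<mu> K \<partial>\<tau>)"
    by (intro nn_integral_mono le km)
  also have "\<dots> \<le> (\<integral>\<^sup>+z. (\<integral>\<^sup>+w. kk z w \<partial>\<mu>) / emeasure \<mu> K \<partial>\<mu>) / emeasure \<mu> K"
    by (intro le dm sm)
  also have "\<dots> = (\<integral>\<^sup>+z. \<integral>\<^sup>+w. kk z w \<partial>\<mu> \<partial>\<mu>) / emeasure \<mu> K / emeasure \<mu> K"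
    using sm by (simp add: nn_integral_divide)
  also have "\<dots> < \<infinity>" using fin K(3) by (simp add: ennreal_divide_eq_top_iff less_top[symmetric])
  finally have "R_mu \<tau> \<noteq> \<infinity>"
    unfolding R_mu_iterated[OF \<tau>] by (simp add: less_top[symmetric] enn2ereal_eq_top_iff)
  moreover have "log_energy \<tau> = \<infinity>" using B \<tau> unfolding polar_def by blast
  ultimately show False by (simp add: R_mu_def)
qed

text \<open>The uniform measures on discs have finite energy, and discs exhaust the plane.\<close>

lemma polar_lborel_null:
  assumes B: "B \<in> sets borel" "polar B"
  shows "B \<in> null_sets lborel"
proof -
  have "cball 0 (real n + 1) \<inter> B \<in> null_sets lborel" for n :: nat
  proof -
    let ?K = "cball (0::complex) (real n + 1)"
    have "emeasure lborel (ball (0::complex) 1) \<le> emeasure lborel ?K" by (intro emeasure_mono) auto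
    then have pos: "emeasure lborel ?K \<noteq> 0" by (auto simp: emeasure_unit_disc)
    have fin: "emeasure lborel ?K < \<infinity>" by (rule emeasure_compact_finite) simp
    have "prob_meas_in UNIV (uniform_measure lborel ?K)" using pos fin by (intro prob_meas_in_uniform) auto
    from polar_null[OF this uniform_energy[OF compact_cball pos] B]
    have "emeasure lborel (?K \<inter> B) / emeasure lborel ?K = 0" using B by simp
    then have "emeasure lborel (?K \<inter> B) = 0" using fin by (auto simp: ennreal_divide_eq_0_iff)
    then show ?thesis using B by (auto simp: null_sets_def)
  qed
  then have "(\<Union>n. cball 0 (real n + 1) \<inter> B) \<in> null_sets lborel" by (rule null_sets_UN)
  moreover have "(\<Union>n. cball 0 (real n + 1) \<inter> B) = B"
  proof (intro subset_antisym subsetI)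
    fix z assume "z \<in> B"
    obtain n where "cmod z \<le> real n" using real_arch_simple by blast
    then show "z \<in> (\<Union>n. cball 0 (real n + 1) \<inter> B)" using \<open>z \<in> B\<close> by (auto intro!: exI[of _ n])
  qed auto
  ultimately show ?thesis by simp
qed

text \<open>Will join the part of the uniform measure left in place to the part swept to the
  boundary; the formula for integrals is all that is used of the sum.\<close>

lemma sum_measure:
  assumes s: "sets a = sets borel" "sets b = sets (borel :: complex measure)"
  obtains \<mu> where "sets \<mu> = sets (borel :: complex measure)"
    "\<And>f. f \<in> borel_measurable borel \<Longrightarrow> (\<integral>\<^sup>+x. f x \<partial>\<mu>) = (\<integral>\<^sup>+x. f x \<partial>a) + (\<integral>\<^sup>+x. f x \<partial>b)"
proof -
  define \<mu> where "\<mu> = measure_of UNIV (sets borel) (\<lambda>A. emeasure a A + emeasure b A)"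
  have sm: "sets \<mu> = sets borel" unfolding \<mu>_def
    using sets.sigma_sets_eq[of "borel :: complex measure"] by (subst sets_measure_of) auto
  have em: "emeasure \<mu> A = emeasure a A + emeasure b A" if "A \<in> sets borel" for A
  proof (rule emeasure_measure_of[OF \<mu>_def])
    show "positive (sets \<mu>) (\<lambda>A. emeasure a A + emeasure b A)" by (simp add: positive_def)
    show "countably_additive (sets \<mu>) (\<lambda>A. emeasure a A + emeasure b A)"
    proof (rule countably_additiveI)
      fix A :: "nat \<Rightarrow> complex set" assume A: "range A \<subseteq> sets \<mu>" "disjoint_family A"
      show "(\<Sum>i. emeasure a (A i) + emeasure b (A i)) = emeasure a (\<Union>i. A i) + emeasure b (\<Union>i. A i)"
        using A s sm by (subst suminf_add[symmetric]) (auto simp: suminf_emeasure)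
    qed
  qed (use that sm in auto)
  have nn: "(\<integral>\<^sup>+x. f x \<partial>\<mu>) = (\<integral>\<^sup>+x. f x \<partial>a) + (\<integral>\<^sup>+x. f x \<partial>b)" if "f \<in> borel_measurable borel" for f
    using that
  proof (induction rule: borel_measurable_induct)
    case (cong f g)
    then have "f = g" by auto
    then show ?case using cong by simp
  next
    case (set A)
    then show ?case using s sm em by simp
  next
    case (mult u c)
    then have "u \<in> borel_measurable \<mu>" "u \<in> borel_measurable a" "u \<in> borel_measurable b" using s sm by (simp_all cong: measurable_cong_sets)
    then show ?case using mult by (simp add: nn_integral_cmult distrib_left)
  next
    case (add u v)
    then have "u \<in> borel_measurable \<mu>" "u \<in> borel_measurable a" "u \<in> borel_measurable b"
      "v \<in> borel_measurable \<mu>" "v \<in> borel_measurable a" "v \<in> borel_measurable b" using s sm by (simp_all cong: measurable_cong_sets)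
    then show ?case using add by (simp add: nn_integral_add add_ac)
  next
    case (seq U)
    have m: "U i \<in> borel_measurable \<mu>" "U i \<in> borel_measurable a" "U i \<in> borel_measurable b" for i using seq s sm by (simp_all cong: measurable_cong_sets)
    have inc: "incseq (\<lambda>i. \<integral>\<^sup>+x. U i x \<partial>M)" for M using \<open>incseq U\<close> by (auto simp: incseq_def le_fun_def intro!: nn_integral_mono)
    show ?case
      using m by (simp add: SUP_apply[abs_def] nn_integral_monotone_convergence_SUP[OF \<open>incseq U\<close>] seq image_comp ennreal_SUP_add inc)
  qed
  show ?thesis by (rule that[OF sm nn])
qed

lemma balayage_support:
  assumes "open V" "V \<subseteq> ball 0 1" and \<nu>: "is_balayage V \<nu>"
  shows "AE w in \<nu>. cmod w \<le> 1 \<and> w \<notin> V"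
proof -
  have s: "sets \<nu> = sets borel" and z: "emeasure \<nu> (UNIV - frontier V) = 0" using \<nu> by (auto simp: is_balayage_def)
  have "UNIV - frontier V \<in> sets \<nu>" using s by (auto intro!: borel_closed)
  then have "AE w in \<nu>. w \<in> frontier V" using z by (intro AE_I'[of "UNIV - frontier V"]) (auto simp: null_sets_def)
  moreover have "closure V \<subseteq> cball 0 1" using assms(2) closure_mono[of V "ball 0 1"] by simp
  ultimately show ?thesis
    by (auto elim!: eventually_mono simp: frontier_def interior_open[OF assms(1)])
qed

text \<open>A finite potential forces finite positive and negative parts, so
  \<open>kernel_split\<close> can be integrated and solved for the integral of \<open>kk\<close>.
  The two bounds for distant points say that the potential there is nearly the mass times -ln |z|;
  they determine the mass.\<close>

lemma balayage_potential:
  assumes V: "open V" "V \<subseteq> ball 0 1" and \<nu>: "is_balayage V \<nu>" and fin: "finite_measure \<nu>"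
    and pot: "log_pot \<nu> z = ereal c"
  shows "(\<integral>\<^sup>+w. kk z w \<partial>\<nu>) = ennreal (c + (cmod z)\<^sup>2 / 2 * measure \<nu> UNIV + (\<integral>w. (cmod w)\<^sup>2 \<partial>\<nu>) / 2)"
    and "0 \<le> c + (cmod z)\<^sup>2 / 2 * measure \<nu> UNIV + (\<integral>w. (cmod w)\<^sup>2 \<partial>\<nu>) / 2"
    and "2 \<le> cmod z \<Longrightarrow> ln (cmod z - 1) * measure \<nu> UNIV \<le> - c"
    and "2 \<le> cmod z \<Longrightarrow> - c \<le> ln (cmod z + 1) * measure \<nu> UNIV"
proof -
  interpret finite_measure \<nu> by fact
  have s: "sets \<nu> = sets borel" using \<nu> by (simp add: is_balayage_def)
  have sp: "space \<nu> = UNIV" using sets_eq_imp_space_eq[OF s] by simp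
  have AE1: "AE w in \<nu>. cmod w \<le> 1" using balayage_support[OF V \<nu>] by (rule eventually_mono) auto
  have meas: "f \<in> borel_measurable borel \<Longrightarrow> f \<in> borel_measurable \<nu>" for f :: "complex \<Rightarrow> 'b::topological_space"
    by (simp add: measurable_cong_sets[OF s refl])
  define b where "b = enn2real (\<integral>\<^sup>+w. logk_neg z w \<partial>\<nu>)"
  have "(\<integral>\<^sup>+w. logk_neg z w \<partial>\<nu>) \<le> (\<integral>\<^sup>+w. ennreal (cmod z + 1) \<partial>\<nu>)"
  proof (rule nn_integral_mono_AE)
    show "AE w in \<nu>. logk_neg z w \<le> ennreal (cmod z + 1)"
      using AE1
    proof eventually_elim
      case (elim w)
      have "ln (cmod (z - w)) \<le> cmod (z - w)"
        by (cases "z = w") (auto intro: order_trans[OF ln_le_minus_one])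
      also have "\<dots> \<le> cmod z + 1" using norm_triangle_ineq4[of z w] elim by simp
      finally show ?case unfolding logk_neg_def by (intro ennreal_leI) simp
    qed
  qed
  also have "\<dots> < \<infinity>" by (simp add: ennreal_mult_less_top emeasure_eq_measure)
  finally have b: "(\<integral>\<^sup>+w. logk_neg z w \<partial>\<nu>) = ennreal b" "0 \<le> b" by (auto simp: b_def)
  obtain a where a: "(\<integral>\<^sup>+w. logk_pos z w \<partial>\<nu>) = ennreal a" "0 \<le> a"
    using pot unfolding log_pot_def b by (cases "\<integral>\<^sup>+w. logk_pos z w \<partial>\<nu>") auto
  have c: "c = a - b" using pot unfolding log_pot_def a b using a b by simp
  have i2: "integrable \<nu> (\<lambda>w. (cmod w)\<^sup>2)"
    by (rule integrable_const_bound[where B=1]) (use AE1 in \<open>auto elim!: eventually_mono intro!: meas power_le_one\<close>)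
  define q where "q = (cmod z)\<^sup>2 / 2 * measure \<nu> UNIV + (\<integral>w. (cmod w)\<^sup>2 \<partial>\<nu>) / 2"
  have q0: "0 \<le> q" by (simp add: q_def)
  have q: "(\<integral>\<^sup>+w. ennreal (((cmod z)\<^sup>2 + (cmod w)\<^sup>2) / 2) \<partial>\<nu>) = ennreal q"
    using i2 by (subst nn_integral_eq_integral) (auto simp: q_def add_divide_distrib sp mult_ac)
  have "(\<integral>\<^sup>+w. logk_pos z w + ennreal (((cmod z)\<^sup>2 + (cmod w)\<^sup>2) / 2) \<partial>\<nu>) = (\<integral>\<^sup>+w. kk z w + logk_neg z w \<partial>\<nu>)"
    by (simp only: kernel_split)
  then have eq: "ennreal a + ennreal q = (\<integral>\<^sup>+w. kk z w \<partial>\<nu>) + ennreal b"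
    by (subst (asm) (1 2) nn_integral_add) (auto simp: a b q intro!: meas)
  then obtain k where k: "(\<integral>\<^sup>+w. kk z w \<partial>\<nu>) = ennreal k" "0 \<le> k"
    by (cases "\<integral>\<^sup>+w. kk z w \<partial>\<nu>") auto
  then have "ennreal (a + q) = ennreal (k + b)" using eq a b q0 by simp
  then have "a + q = k + b" using a b k q0 by (subst (asm) ennreal_inj) auto
  then have kq: "k = c + q" using c by simp
  then show "(\<integral>\<^sup>+w. kk z w \<partial>\<nu>) = ennreal (c + (cmod z)\<^sup>2 / 2 * measure \<nu> UNIV + (\<integral>w. (cmod w)\<^sup>2 \<partial>\<nu>) / 2)"
    "0 \<le> c + (cmod z)\<^sup>2 / 2 * measure \<nu> UNIV + (\<integral>w. (cmod w)\<^sup>2 \<partial>\<nu>) / 2"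
    using k by (auto simp: q_def add.assoc)
  \<comment> \<open>For |z| at least 2 and |w| at most 1 the distance lies between |z| - 1, which is
    at least 1, and |z| + 1, so only the negative part of the kernel is left.\<close>
  have far: "ennreal a = 0" "ennreal (ln (cmod z - 1)) * emeasure \<nu> UNIV \<le> ennreal b" "ennreal b \<le> ennreal (ln (cmod z + 1)) * emeasure \<nu> UNIV"
    if z: "2 \<le> cmod z"
  proof -
    have bd: "AE w in \<nu>. logk_pos z w = 0 \<and> ennreal (ln (cmod z - 1)) \<le> logk_neg z w \<and> logk_neg z w \<le> ennreal (ln (cmod z + 1))"
      using AE1
    proof eventually_elim
      case (elim w)
      have l: "cmod z - 1 \<le> cmod (z - w)" "cmod (z - w) \<le> cmod z + 1"
        using norm_triangle_ineq2[of z w] norm_triangle_ineq4[of z w] elim by auto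
      then have "ln (cmod z - 1) \<le> ln (cmod (z - w))" "ln (cmod (z - w)) \<le> ln (cmod z + 1)" "0 \<le> ln (cmod z - 1)"
        using z by (auto intro!: ln_mono)
      moreover have "z \<noteq> w" using z elim by auto
      moreover have "0 \<le> ln (cmod (z - w))" using l(1) z by simp
      ultimately show ?case by (auto simp: logk_pos_def logk_neg_def max_def ennreal_eq_0_iff intro!: ennreal_leI)
    qed
    have "(\<integral>\<^sup>+w. logk_pos z w \<partial>\<nu>) = (\<integral>\<^sup>+w. 0 \<partial>\<nu>)" by (intro nn_integral_cong_AE) (use bd in \<open>auto elim: eventually_mono\<close>)
    then show "ennreal a = 0" using a by simp
    have "(\<integral>\<^sup>+w. ennreal (ln (cmod z - 1)) \<partial>\<nu>) \<le> (\<integral>\<^sup>+w. logk_neg z w \<partial>\<nu>)" by (intro nn_integral_mono_AE) (use bd in \<open>auto elim: eventually_mono\<close>)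
    then show "ennreal (ln (cmod z - 1)) * emeasure \<nu> UNIV \<le> ennreal b" by (simp add: b sp)
    have "(\<integral>\<^sup>+w. logk_neg z w \<partial>\<nu>) \<le> (\<integral>\<^sup>+w. ennreal (ln (cmod z + 1)) \<partial>\<nu>)" by (intro nn_integral_mono_AE) (use bd in \<open>auto elim: eventually_mono\<close>)
    then show "ennreal b \<le> ennreal (ln (cmod z + 1)) * emeasure \<nu> UNIV" by (simp add: b sp)
  qed
  show "ln (cmod z - 1) * measure \<nu> UNIV \<le> - c" if z: "2 \<le> cmod z"
    using far(1,2)[OF z] a b z by (simp add: c emeasure_eq_measure ennreal_mult'[symmetric])
  show "- c \<le> ln (cmod z + 1) * measure \<nu> UNIV" if z: "2 \<le> cmod z"
    using far(1,3)[OF z] a b z by (simp add: c emeasure_eq_measure ennreal_mult'[symmetric])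
qed

lemma integrable_ln_subset:
  assumes "V \<in> sets borel" "V \<subseteq> ball 0 1"
  shows "integrable lborel (\<lambda>w. indicator V w * - ln (cmod (z - w)))"
proof -
  have "integrable lborel (\<lambda>w. indicator V w *\<^sub>R (indicator (ball 0 1) w * - ln (cmod (z - w))))"
    using assms by (intro integrable_mult_indicator integrable_disc_pot) auto
  moreover have "indicator V w *\<^sub>R (indicator (ball 0 1) w * - ln (cmod (z - w))) = indicator V w * - ln (cmod (z - w))" for w
    using assms(2) by (auto simp: indicator_def)
  ultimately show ?thesis by (simp only:)
qed

lemma disc_subset_finite:
  assumes "V \<in> sets borel" "V \<subseteq> ball (0::complex) 1"
  shows "emeasure lborel V = ennreal (measure lborel V)"
proof -
  have "emeasure lborel V \<le> emeasure lborel (ball (0::complex) 1)" using assms by (intro emeasure_mono) auto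
  also have "\<dots> < \<infinity>" by (simp add: emeasure_unit_disc)
  finally show ?thesis by (intro emeasure_eq_ennreal_measure) auto
qed

text \<open>The definition prescribes potentials, not the mass. Comparing both potentials along
  points tending to infinity off the exceptional set recovers it.\<close>

lemma balayage_mass:
  assumes V: "open V" "V \<subseteq> ball 0 1" and \<nu>: "is_balayage V \<nu>" and fin: "finite_measure \<nu>"
  shows "measure \<nu> UNIV = measure lborel V / pi"
proof -
  define m v where "m = measure \<nu> UNIV" and "v = measure lborel V"
  have mv: "0 \<le> m" "0 \<le> v" by (auto simp: m_def v_def)
  obtain P where P: "P \<in> sets borel" "polar P"
    and pot: "\<And>z. z \<notin> V \<Longrightarrow> z \<notin> P \<Longrightarrow> log_pot \<nu> z = ereal ((1 / pi) * (LINT w:V|lborel. - ln (cmod (z - w))))"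
    using \<nu> unfolding is_balayage_def by blast
  have Pn: "negligible P" using polar_lborel_null[OF P] by (simp add: negligible_iff_null_sets null_sets_completionI)
  \<comment> \<open>A polar set is null, so it contains no disc and misses points of arbitrarily
    large modulus.\<close>
  have "\<exists>z. real n + 3 \<le> cmod z \<and> z \<notin> P" for n :: nat
  proof (rule ccontr)
    assume "\<not> ?thesis"
    then have far: "z \<in> P" if "real n + 3 \<le> cmod z" for z using that by blast
    have "ball (of_real (real n + 5)) 1 \<subseteq> P"
    proof
      fix z :: complex assume "z \<in> ball (of_real (real n + 5)) 1"
      then have "cmod (of_real (real n + 5) - z) < 1" by (simp add: dist_norm)
      moreover have "cmod (of_real (real n + 5)) - cmod z \<le> cmod (of_real (real n + 5) - z)" by (rule norm_triangle_ineq2)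
      moreover have "cmod (of_real (real n + 5)) = real n + 5" by (simp only: norm_of_real)
      ultimately show "z \<in> P" by (intro far) linarith
    qed
    then have "negligible (ball (of_real (real n + 5) :: complex) 1)" using Pn negligible_subset by blast
    then show False using open_not_negligible[of "ball (of_real (real n + 5) :: complex) 1"] by simp
  qed
  then obtain g where g: "\<And>n::nat. real n + 3 \<le> cmod (g n)" "\<And>n. g n \<notin> P" by metis
  have ginf: "filterlim (\<lambda>n. cmod (g n)) at_top sequentially"
  proof (rule filterlim_at_top_mono[OF filterlim_real_sequentially], intro always_eventually allI)
    show "real n \<le> cmod (g n)" for n using g(1)[of n] by linarith
  qed
  define J where "J z = (LINT w:V|lborel. - ln (cmod (z - w)))" for z
  have Vb: "V \<in> sets borel" using V by simp
  have J: "ln (cmod z - 1) * v \<le> - J z" "- J z \<le> ln (cmod z + 1) * v" if z: "2 \<le> cmod z" for z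
  proof -
    have i1: "integrable lborel (\<lambda>w. indicator V w * x)" for x :: real
      using Vb disc_subset_finite[OF Vb V(2)] by (intro integrable_mult_left integrable_real_indicator) auto
    have e: "(\<integral>w. indicator V w * x \<partial>lborel) = x * v" for x :: real using Vb by (simp add: v_def)
    have mJ: "- J z = (\<integral>w. indicator V w * ln (cmod (z - w)) \<partial>lborel)"
      unfolding J_def set_lebesgue_integral_def by simp
    have i2: "integrable lborel (\<lambda>w. indicator V w * ln (cmod (z - w)))"
      using integrable_ln_subset[OF Vb V(2), of z] by simp
    have bd: "ln (cmod z - 1) \<le> ln (cmod (z - w)) \<and> ln (cmod (z - w)) \<le> ln (cmod z + 1)" if "w \<in> V" for w
    proof -
      have "cmod w \<le> 1" using that V by auto
      then have l: "cmod z - 1 \<le> cmod (z - w)" "cmod (z - w) \<le> cmod z + 1"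
        using norm_triangle_ineq2[of z w] norm_triangle_ineq4[of z w] by auto
      then show ?thesis using z by (auto intro!: ln_mono)
    qed
    show "ln (cmod z - 1) * v \<le> - J z"
      unfolding mJ e[symmetric] by (rule integral_mono[OF i1 i2]) (use bd in \<open>auto simp: indicator_def\<close>)
    show "- J z \<le> ln (cmod z + 1) * v"
      unfolding mJ e[symmetric] by (rule integral_mono[OF i2 i1]) (use bd in \<open>auto simp: indicator_def\<close>)
  qed
  have z2: "2 \<le> cmod (g n)" for n using g(1)[of n] by linarith
  have gV: "g n \<notin> V" for n using z2[of n] V by auto
  note bp = balayage_potential(3,4)[OF V \<nu> fin pot[OF gV g(2)] z2, folded J_def m_def]
  have lim: "(\<lambda>n. ln (cmod (g n) - 1) / ln (cmod (g n) + 1) * x) \<longlonglongrightarrow> 1 * x" for x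
  proof (intro tendsto_mult tendsto_const)
    have "((\<lambda>x. ln (x - 1) / ln (x + 1)) \<longlongrightarrow> 1) (at_top :: real filter)" by real_asymp
    from filterlim_compose[OF this ginf] show "(\<lambda>n. ln (cmod (g n) - 1) / ln (cmod (g n) + 1)) \<longlonglongrightarrow> 1" .
  qed
  have lp: "0 < ln (cmod (g n) + 1)" for n using z2[of n] by (intro ln_gt_zero) linarith
  have "1 * m \<le> v / pi"
  proof (rule LIMSEQ_le_const2[OF lim], intro exI[of _ 0] allI impI)
    fix n
    have "ln (cmod (g n) - 1) * m \<le> (1 / pi) * - J (g n)" using bp(1)[of n] by simp
    also have "\<dots> \<le> (1 / pi) * (ln (cmod (g n) + 1) * v)" by (intro mult_left_mono J(2) z2) auto
    finally show "ln (cmod (g n) - 1) / ln (cmod (g n) + 1) * m \<le> v / pi" using lp[of n] by (simp add: field_simps)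
  qed
  moreover have "1 * (v / pi) \<le> m"
  proof (rule LIMSEQ_le_const2[OF lim], intro exI[of _ 0] allI impI)
    fix n
    have "(1 / pi) * (ln (cmod (g n) - 1) * v) \<le> (1 / pi) * - J (g n)" by (intro mult_left_mono J(1) z2) auto
    also have "\<dots> \<le> ln (cmod (g n) + 1) * m" using bp(2)[of n] by simp
    finally show "ln (cmod (g n) - 1) / ln (cmod (g n) + 1) * (v / pi) \<le> m" using lp[of n] by (simp add: field_simps)
  qed
  ultimately show ?thesis by (simp add: m_def v_def)
qed

text \<open>The second moment of the uniform probability measure on the disc after its part in
  \<open>V\<close> has been replaced by the balayage.\<close>

definition sweep_moment :: "complex set \<Rightarrow> complex measure \<Rightarrow> real" where
  "sweep_moment V \<nu> = (\<integral>w. indicator (ball 0 1 - V) w * (cmod w)\<^sup>2 \<partial>lborel) / pi + (\<integral>w. (cmod w)\<^sup>2 \<partial>\<nu>)"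

lemma sweep_moment_nonneg: "0 \<le> sweep_moment V \<nu>"
  unfolding sweep_moment_def by (intro add_nonneg_nonneg divide_nonneg_pos integral_nonneg) auto

text \<open>The part left in place has the potential of the disc minus that of \<open>V\<close>; the
  last two summands of \<open>R\<close> integrate the quadratic terms of the kernel.\<close>

lemma swept_disc_kernel:
  fixes z :: complex
  assumes Vb: "V \<in> sets borel" "V \<subseteq> ball 0 1"
  defines "W \<equiv> ball 0 1 - V"
  defines "R \<equiv> pi * disc_pot z - (LINT w:V|lborel. - ln (cmod (z - w)))
      + (cmod z)\<^sup>2 / 2 * (pi - measure lborel V) + (\<integral>w. indicator W w * (cmod w)\<^sup>2 \<partial>lborel) / 2"
  shows "(\<integral>\<^sup>+w. kk z w * indicator W w \<partial>lborel) = ennreal R" and "0 \<le> R"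
proof -
  have Wb: "W \<in> sets borel" "W \<subseteq> ball 0 1" using Vb by (auto simp: W_def)
  have "emeasure lborel W = ennreal (measure lborel W)" by (rule disc_subset_finite[OF Wb])
  then have iW: "integrable lborel (indicator W :: complex \<Rightarrow> real)" using Wb by (intro integrable_real_indicator) auto
  have iV: "integrable lborel (indicator V :: complex \<Rightarrow> real)" using Vb disc_subset_finite[OF Vb] by (intro integrable_real_indicator) auto
  have iD: "integrable lborel (indicator (ball (0::complex) 1) :: complex \<Rightarrow> real)"
    by (rule integrable_real_indicator) (auto simp: emeasure_unit_disc)
  have i2: "integrable lborel (\<lambda>w. indicator W w * (cmod w)\<^sup>2)"
  proof (rule Bochner_Integration.integrable_bound[OF iW])
    show "(\<lambda>w. indicator W w * (cmod w)\<^sup>2) \<in> borel_measurable lborel" using Wb by measurable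
    show "AE w in lborel. norm (indicator W w * (cmod w)\<^sup>2) \<le> norm (indicator W w :: real)"
      using Wb by (intro AE_I2) (auto simp: indicator_def power_le_one)
  qed
  have iL: "integrable lborel (\<lambda>w. indicator W w * - ln (cmod (z - w)))" by (rule integrable_ln_subset[OF Wb])
  have split: "indicator W w * kr z w = indicator W w * - ln (cmod (z - w)) + indicator W w * ((cmod z)\<^sup>2 / 2) + indicator W w * (cmod w)\<^sup>2 / 2" for w
    by (simp add: kr_def field_simps)
  have int: "integrable lborel (\<lambda>w. indicator W w * kr z w)"
    unfolding split by (intro Bochner_Integration.integrable_add iL integrable_mult_left iW integrable_divide i2)
  have mW: "(\<integral>w. indicator W w \<partial>lborel) = pi - measure lborel V"
  proof -
    have "(\<integral>w. indicator W w \<partial>lborel) = (\<integral>w. (indicator (ball 0 1) w :: real) - indicator V w \<partial>lborel)"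
      by (rule Bochner_Integration.integral_cong) (use Vb in \<open>auto simp: W_def indicator_def\<close>)
    also have "\<dots> = (\<integral>w. indicator (ball (0::complex) 1) w \<partial>lborel) - (\<integral>w. indicator V w \<partial>lborel)"
      by (rule Bochner_Integration.integral_diff[OF iD iV])
    finally show ?thesis using Vb by (simp add: measure_def emeasure_unit_disc)
  qed
  have mL: "(\<integral>w. indicator W w * - ln (cmod (z - w)) \<partial>lborel) = pi * disc_pot z - (LINT w:V|lborel. - ln (cmod (z - w)))"
  proof -
    have "(\<integral>w. indicator W w * - ln (cmod (z - w)) \<partial>lborel)
      = (\<integral>w. indicator (ball 0 1) w * - ln (cmod (z - w)) - indicator V w * - ln (cmod (z - w)) \<partial>lborel)"
      by (rule Bochner_Integration.integral_cong) (use Vb in \<open>auto simp: W_def indicator_def\<close>)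
    also have "\<dots> = (\<integral>w. indicator (ball 0 1) w * - ln (cmod (z - w)) \<partial>lborel) - (\<integral>w. indicator V w * - ln (cmod (z - w)) \<partial>lborel)"
      by (rule Bochner_Integration.integral_diff[OF integrable_disc_pot integrable_ln_subset[OF Vb]])
    finally show ?thesis unfolding disc_potential by (simp add: set_lebesgue_integral_def)
  qed
  have R: "(\<integral>w. indicator W w * kr z w \<partial>lborel) = R"
    unfolding split R_def using iL iW i2 mL mW
    by (subst Bochner_Integration.integral_add, simp, simp)+ (simp add: mult.commute)
  have nn: "0 \<le> indicator W w * kr z w" if "w \<noteq> z" for w using kr_nonneg[of z w] that by auto
  have ae: "AE w in lborel. 0 \<le> indicator W w * kr z w" using AE_lborel_singleton[of z] by eventually_elim (rule nn)
  have "(\<integral>\<^sup>+w. kk z w * indicator W w \<partial>lborel) = (\<integral>\<^sup>+w. ennreal (indicator W w * kr z w) \<partial>lborel)"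
  proof (rule nn_integral_cong_AE)
    show "AE w in lborel. kk z w * indicator W w = ennreal (indicator W w * kr z w)"
      using AE_lborel_singleton[of z] by eventually_elim (auto simp: kk_def indicator_def)
  qed
  also have "\<dots> = ennreal R" using nn_integral_eq_integral[OF int ae] R by simp
  finally show "(\<integral>\<^sup>+w. kk z w * indicator W w \<partial>lborel) = ennreal R" .
  show "0 \<le> R" unfolding R[symmetric] by (rule integral_nonneg_AE[OF ae])
qed

text \<open>Sweeping the part of the uniform distribution of the disc lying in \<open>V\<close> onto the
  boundary of \<open>V\<close> does not change the potential quasi-everywhere off \<open>V\<close>, and that
  potential plus \<open>\<bar>z\<bar>\<^sup>2 / 2\<close> is constant on the disc and larger outside.\<close>

lemma balayage_measure:
  assumes V: "open V" "V \<subseteq> ball 0 1" and \<nu>: "is_balayage V \<nu>" and fin: "finite_measure \<nu>"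
  obtains \<mu> where "prob_meas_in (- V) \<mu>" "AE z in \<mu>. cmod z \<le> 1"
    "(\<integral>\<^sup>+z. \<integral>\<^sup>+w. kk z w \<partial>\<mu> \<partial>\<mu>) = ennreal (1 / 2 + sweep_moment V \<nu> / 2)"
    "\<And>\<mu>'. prob_meas_in (- V) \<mu>' \<Longrightarrow> (\<integral>\<^sup>+z. \<integral>\<^sup>+w. kk z w \<partial>\<mu>' \<partial>\<mu>') < \<infinity> \<Longrightarrow>
       ennreal (1 / 2 + sweep_moment V \<nu> / 2) \<le> (\<integral>\<^sup>+z. \<integral>\<^sup>+w. kk z w \<partial>\<mu> \<partial>\<mu>')"
proof -
  interpret \<nu>: finite_measure \<nu> by fact
  define W where "W = ball 0 1 - V"
  have Vb: "V \<in> sets borel" and Wb: "W \<in> sets borel" using V by (auto simp: W_def)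
  have s: "sets \<nu> = sets borel" and \<nu>P: "\<And>B. B \<in> sets borel \<Longrightarrow> polar B \<Longrightarrow> emeasure \<nu> B = 0" using \<nu> by (auto simp: is_balayage_def)
  have sp: "space \<nu> = UNIV" using sets_eq_imp_space_eq[OF s] by simp
  obtain P where P: "P \<in> sets borel" "polar P"
    and pot: "\<And>z. z \<notin> V \<Longrightarrow> z \<notin> P \<Longrightarrow> log_pot \<nu> z = ereal ((1 / pi) * (LINT w:V|lborel. - ln (cmod (z - w))))"
    using \<nu> unfolding is_balayage_def by blast
  \<comment> \<open>The unswept part: the uniform distribution of the disc restricted to the
    complement of \<open>V\<close>.\<close>
  define a where "a = density lborel (\<lambda>w. ennreal (1 / pi) * indicator W w)"
  have sa: "sets a = sets borel" by (simp add: a_def)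
  have dm: "(\<lambda>w. ennreal (1 / pi) * indicator W w) \<in> borel_measurable lborel" using Wb by measurable
  have na: "(\<integral>\<^sup>+w. f w \<partial>a) = ennreal (1 / pi) * (\<integral>\<^sup>+w. f w * indicator W w \<partial>lborel)" if f: "f \<in> borel_measurable borel" for f
  proof -
    have "(\<integral>\<^sup>+w. f w \<partial>a) = (\<integral>\<^sup>+w. ennreal (1 / pi) * (f w * indicator W w) \<partial>lborel)"
      unfolding a_def using f by (subst nn_integral_density[OF dm]) (auto simp: mult_ac)
    also have "\<dots> = ennreal (1 / pi) * (\<integral>\<^sup>+w. f w * indicator W w \<partial>lborel)"
      using f Wb by (intro nn_integral_cmult borel_measurable_times_ennreal borel_measurable_indicator) simp_all
    finally show ?thesis .
  qed
  obtain \<mu> where s\<mu>: "sets \<mu> = sets borel"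
    and nn: "\<And>f. f \<in> borel_measurable borel \<Longrightarrow> (\<integral>\<^sup>+x. f x \<partial>\<mu>) = (\<integral>\<^sup>+x. f x \<partial>a) + (\<integral>\<^sup>+x. f x \<partial>\<nu>)"
    using sum_measure[OF sa s] by blast
  have sp\<mu>: "space \<mu> = UNIV" using sets_eq_imp_space_eq[OF s\<mu>] by simp
  have em: "emeasure \<mu> A = ennreal (1 / pi) * emeasure lborel (A \<inter> W) + emeasure \<nu> A" if A: "A \<in> sets borel" for A
  proof -
    have "emeasure \<mu> A = (\<integral>\<^sup>+x. indicator A x \<partial>\<mu>)" using A s\<mu> by simp
    also have "\<dots> = ennreal (1 / pi) * (\<integral>\<^sup>+w. indicator A w * indicator W w \<partial>lborel) + (\<integral>\<^sup>+x. indicator A x \<partial>\<nu>)"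
      using A by (subst nn) (auto simp: na)
    also have "(\<lambda>w. indicator A w * indicator W w :: ennreal) = indicator (A \<inter> W)" by (auto simp: indicator_def)
    finally show ?thesis using A Wb s by simp
  qed
  have mass: "measure \<nu> UNIV = measure lborel V / pi" by (rule balayage_mass[OF V \<nu> fin])
  have emW: "emeasure lborel W = ennreal (pi - measure lborel V)" and vle: "measure lborel V \<le> pi"
  proof -
    have "emeasure lborel V \<le> emeasure lborel (ball (0::complex) 1)" using V by (intro emeasure_mono) auto
    then show "measure lborel V \<le> pi" by (simp add: disc_subset_finite[OF Vb V(2)] emeasure_unit_disc)
    have "emeasure lborel W = emeasure lborel (ball (0::complex) 1) - emeasure lborel V"
      unfolding W_def using V Vb by (intro emeasure_Diff) (auto simp: disc_subset_finite)
    then show "emeasure lborel W = ennreal (pi - measure lborel V)"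
      by (simp add: disc_subset_finite[OF Vb V(2)] emeasure_unit_disc ennreal_minus)
  qed
  have one: "emeasure \<mu> UNIV = 1"
  proof -
    have "emeasure \<mu> UNIV = ennreal (1 / pi) * ennreal (pi - measure lborel V) + ennreal (measure lborel V / pi)"
      using em[of UNIV] \<nu>.emeasure_eq_measure[of UNIV] by (simp add: emW mass)
    also have "\<dots> = ennreal (1 / pi * (pi - measure lborel V)) + ennreal (measure lborel V / pi)"
      by (simp only: ennreal_mult'[of "1 / pi"] zero_le_divide_1_iff pi_ge_zero)
    also have "\<dots> = ennreal (1 / pi * (pi - measure lborel V) + measure lborel V / pi)"
      using vle by (intro ennreal_plus[symmetric]) auto
    also have "1 / pi * (pi - measure lborel V) + measure lborel V / pi = 1" by (simp add: field_simps)
    finally show ?thesis by simp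
  qed
  interpret \<mu>: prob_space \<mu> by (rule prob_spaceI) (simp add: sp\<mu> one)
  define C where "C = cball 0 1 - V"
  have C: "compact C" unfolding C_def using V by (intro compact_diff) auto
  have Cb: "UNIV - C \<in> sets borel" using C by (auto simp: compact_imp_closed intro!: borel_closed)
  have C0: "emeasure \<mu> (UNIV - C) = 0"
  proof -
    have "(UNIV - C) \<inter> W = {}" by (auto simp: C_def W_def)
    moreover have "emeasure \<nu> (UNIV - C) = 0"
    proof -
      have "AE w in \<nu>. w \<in> C" using balayage_support[OF V \<nu>] by (rule eventually_mono) (auto simp: C_def)
      then show ?thesis using Cb s sp by (subst (asm) AE_iff_measurable[of "UNIV - C"]) auto
    qed
    ultimately show ?thesis using em[OF Cb] by simp
  qed
  have pm: "prob_meas_in (- V) \<mu>"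
    unfolding prob_meas_in_def using C C0 s\<mu> by (intro conjI \<mu>.prob_space_axioms exI[of _ C]) (auto simp: C_def)
  have AEC: "AE z in \<mu>. z \<in> C"
    using C0 Cb s\<mu> by (intro AE_I'[of "UNIV - C"]) (auto simp: null_sets_def)
  define M where "M = sweep_moment V \<nu>"
  \<comment> \<open>The potential of \<open>V\<close> missing from the unswept part is restored by
    the balayage outside \<open>P\<close>; the masses add up to 1, and the second moments to
    \<open>M\<close>.\<close>
  have K: "(\<integral>\<^sup>+w. kk z w \<partial>\<mu>) = ennreal (disc_pot z + (cmod z)\<^sup>2 / 2 + M / 2)" if z: "z \<notin> V" "z \<notin> P" for z
  proof -
    define J where "J = (LINT w:V|lborel. - ln (cmod (z - w)))"
    define m1 where "m1 = (\<integral>w. indicator W w * (cmod w)\<^sup>2 \<partial>lborel)"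
    define X where "X = pi * disc_pot z - J + (cmod z)\<^sup>2 / 2 * (pi - measure lborel V) + m1 / 2"
    define Y where "Y = 1 / pi * J + (cmod z)\<^sup>2 / 2 * (measure lborel V / pi) + (\<integral>w. (cmod w)\<^sup>2 \<partial>\<nu>) / 2"
    have X: "(\<integral>\<^sup>+w. kk z w * indicator W w \<partial>lborel) = ennreal X" "0 \<le> X"
      unfolding X_def J_def m1_def W_def by (rule swept_disc_kernel[OF Vb V(2)])+
    have Y: "(\<integral>\<^sup>+w. kk z w \<partial>\<nu>) = ennreal Y" "0 \<le> Y"
      unfolding Y_def J_def mass[symmetric] by (rule balayage_potential(1,2)[OF V \<nu> fin pot[OF z]])+
    have "(\<integral>\<^sup>+w. kk z w \<partial>\<mu>) = ennreal (1 / pi) * ennreal X + ennreal Y" using X Y by (simp add: nn na)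
    also have "\<dots> = ennreal (1 / pi * X + Y)"
      using X Y by (simp only: ennreal_mult'[of "1 / pi", symmetric] zero_le_divide_1_iff pi_ge_zero) (simp add: ennreal_plus)
    also have "1 / pi * X + Y = disc_pot z + (cmod z)\<^sup>2 / 2 + M / 2"
      unfolding X_def Y_def M_def sweep_moment_def W_def[symmetric] m1_def[symmetric] by (simp add: field_simps)
    finally show ?thesis .
  qed
  have M0: "0 \<le> M" unfolding M_def by (rule sweep_moment_nonneg)
  have energy: "(\<integral>\<^sup>+z. \<integral>\<^sup>+w. kk z w \<partial>\<mu> \<partial>\<mu>) = ennreal (1 / 2 + M / 2)"
  proof -
    \<comment> \<open>Both components ignore the exceptional set: it is Lebesgue null as a polar
      set, and a balayage does not charge polar sets by definition.\<close>
    have "emeasure \<mu> P = 0"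
    proof -
      have "emeasure lborel (P \<inter> W) \<le> emeasure lborel P" using P by (intro emeasure_mono) auto
      also have "\<dots> = 0" using polar_lborel_null[OF P] by auto
      finally show ?thesis using em[OF P(1)] \<nu>P[OF P] by simp
    qed
    then have "AE z in \<mu>. z \<notin> P" using P s\<mu> by (intro AE_I'[of P]) (auto simp: null_sets_def)
    with AEC have "AE z in \<mu>. (\<integral>\<^sup>+w. kk z w \<partial>\<mu>) = ennreal (1 / 2 + M / 2)"
    proof eventually_elim
      case (elim z)
      then show ?case using K[of z] disc_pot_eq[of z] by (auto simp: C_def)
    qed
    then have "(\<integral>\<^sup>+z. \<integral>\<^sup>+w. kk z w \<partial>\<mu> \<partial>\<mu>) = (\<integral>\<^sup>+z. ennreal (1 / 2 + M / 2) \<partial>\<mu>)" by (rule nn_integral_cong_AE)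
    then show ?thesis by (simp add: \<mu>.emeasure_space_1)
  qed
  show thesis
  proof (rule that[OF pm _ energy[unfolded M_def]])
    show "AE z in \<mu>. cmod z \<le> 1" using AEC by (rule eventually_mono) (auto simp: C_def)
    fix \<mu>' assume \<mu>': "prob_meas_in (- V) \<mu>'" "(\<integral>\<^sup>+z. \<integral>\<^sup>+w. kk z w \<partial>\<mu>' \<partial>\<mu>') < \<infinity>"
    obtain C' where C': "C' \<subseteq> - V" "AE z in \<mu>'. z \<in> C'" and p': "prob_space \<mu>'" and s': "sets \<mu>' = sets borel" using \<mu>'(1) by (rule prob_meas_inE)
    interpret \<mu>': prob_space \<mu>' by fact
    \<comment> \<open>A competitor of finite energy does not charge polar sets, so a bound holding
      off \<open>P\<close> may be integrated against it.\<close>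
    have "AE z in \<mu>'. z \<notin> P" using polar_null[OF \<mu>' P] P s' by (intro AE_I'[of P]) (auto simp: null_sets_def)
    with C'(2) have ae: "AE z in \<mu>'. ennreal (1 / 2 + M / 2) \<le> (\<integral>\<^sup>+w. kk z w \<partial>\<mu>)"
    proof eventually_elim
      case (elim z)
      then have "z \<notin> V" "z \<notin> P" using C'(1) by auto
      from K[OF this] show ?case using disc_pot_ge[of z] by (auto intro!: ennreal_leI)
    qed
    have "ennreal (1 / 2 + M / 2) = (\<integral>\<^sup>+z. ennreal (1 / 2 + M / 2) \<partial>\<mu>')" by (simp add: \<mu>'.emeasure_space_1)
    also have "\<dots> \<le> (\<integral>\<^sup>+z. \<integral>\<^sup>+w. kk z w \<partial>\<mu> \<partial>\<mu>')" using ae by (rule nn_integral_mono_AE)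
    finally show "ennreal (1 / 2 + sweep_moment V \<nu> / 2) \<le> (\<integral>\<^sup>+z. \<integral>\<^sup>+w. kk z w \<partial>\<mu> \<partial>\<mu>')" by (simp only: M_def)
  qed
qed

text \<open>Let \<beta> be the energy of the swept measure. Its mutual energy with any competitor of
  finite energy is at least \<beta>, and positive definiteness bounds twice the mutual energy by the
  sum of both energies; cancelling \<beta> shows that it is minimal.\<close>

lemma sweep_moment_le_R_mu:
  assumes V: "open V" "V \<subseteq> ball 0 1" and \<nu>: "is_balayage V \<nu>" and fin: "finite_measure \<nu>"
    and \<mu>': "prob_meas_in (- V) \<mu>'" and R: "R_mu \<mu>' < ereal R"
  shows "1 / 2 + sweep_moment V \<nu> / 2 < R"
proof -
  define E' where "E' = (\<integral>\<^sup>+z. \<integral>\<^sup>+w. kk z w \<partial>\<mu>' \<partial>\<mu>')"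
  define \<beta> where "\<beta> = 1 / 2 + sweep_moment V \<nu> / 2"
  have \<beta>0: "0 \<le> \<beta>" using sweep_moment_nonneg[of V \<nu>] by (simp add: \<beta>_def)
  have lt: "enn2ereal E' < ereal R" using R unfolding R_mu_iterated[OF \<mu>'] E'_def .
  then have E': "E' < \<infinity>" by (cases E') auto
  obtain \<mu> where \<mu>: "prob_meas_in (- V) \<mu>" "AE z in \<mu>. cmod z \<le> 1" "(\<integral>\<^sup>+z. \<integral>\<^sup>+w. kk z w \<partial>\<mu> \<partial>\<mu>) = ennreal \<beta>"
    and low: "ennreal \<beta> \<le> (\<integral>\<^sup>+z. \<integral>\<^sup>+w. kk z w \<partial>\<mu> \<partial>\<mu>')"
    using balayage_measure[OF V \<nu> fin] \<mu>' E' unfolding \<beta>_def E'_def by metis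
  obtain C where p: "prob_space \<mu>" "sets \<mu> = sets borel" using \<mu>(1) by (rule prob_meas_inE)
  obtain C' where C': "compact C'" "AE z in \<mu>'. z \<in> C'" and p': "prob_space \<mu>'" "sets \<mu>' = sets borel" using \<mu>' by (rule prob_meas_inE)
  obtain \<rho>0 where \<rho>0: "\<And>z. z \<in> C' \<Longrightarrow> cmod z \<le> \<rho>0" using compact_imp_bounded[OF C'(1)] by (auto simp: bounded_iff)
  have b1: "AE z in \<mu>'. cmod z \<le> max 1 \<rho>0" using C'(2) by (rule eventually_mono) (auto dest: \<rho>0)
  have b2: "AE z in \<mu>. cmod z \<le> max 1 \<rho>0" using \<mu>(2) by (rule eventually_mono) auto
  have "2 * (\<integral>\<^sup>+z. \<integral>\<^sup>+w. kk z w \<partial>\<mu> \<partial>\<mu>') \<le> E' + ennreal \<beta>"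
    unfolding E'_def \<mu>(3)[symmetric] by (rule log_kernel_pos_def[OF p'(2,1) b1 p(2,1) b2]) simp
  then have "2 * ennreal \<beta> \<le> E' + ennreal \<beta>" using mult_left_mono[OF low, of 2] by (auto intro: order_trans)
  then have "ennreal \<beta> + ennreal \<beta> \<le> ennreal \<beta> + E'" by (simp add: mult_2 add.commute)
  then have "ennreal \<beta> \<le> E'" unfolding ennreal_add_left_cancel_le by simp
  then have "enn2ereal (ennreal \<beta>) < ereal R" using lt by (auto simp: less_eq_ennreal.rep_eq)
  then show ?thesis using \<beta>0 by (simp add: enn2ereal_ennreal \<beta>_def)
qed

text \<open>The minimal energies are affine functions of swept second moments. Passing from
  \<open>U\<close> to the larger \<open>Us n\<close> only shrinks the part left in place, and the
  swept parts converge, so the swept measure of some \<open>Us n\<close> has energy below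
  \<open>R\<close>.\<close>

lemma weak_balayage_approx:
  assumes U: "open U" "U \<subseteq> ball 0 1" and \<nu>: "is_balayage U \<nu>"
    and Us: "\<And>n. open (Us n)" "\<And>n. closure U \<subseteq> Us n" "\<And>n. Us n \<subseteq> ball 0 1" and \<nu>s: "\<And>n::nat. is_balayage (Us n) (\<nu>s n)"
    and w: "weak_conv_cmeas \<nu>s \<nu>" and R: "R_set U < ereal R"
  shows "\<exists>n \<mu>. prob_meas_in (- Us n) \<mu> \<and> R_mu \<mu> < ereal R"
proof -
  have fin: "finite_measure \<nu>" "\<And>n. finite_measure (\<nu>s n)"
    and conv: "\<And>f :: complex \<Rightarrow> real. continuous_on UNIV f \<Longrightarrow> bounded (range f) \<Longrightarrow> (\<lambda>n. \<integral>z. f z \<partial>\<nu>s n) \<longlonglongrightarrow> (\<integral>z. f z \<partial>\<nu>)"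
    using w unfolding weak_conv_cmeas_def by auto
  obtain \<mu>' where "prob_meas_in (- U) \<mu>'" "R_mu \<mu>' < ereal R" using R unfolding R_set_def INF_less_iff by auto
  then have lt: "1 / 2 + sweep_moment U \<nu> / 2 < R" by (rule sweep_moment_le_R_mu[OF U \<nu> fin(1)])
  \<comment> \<open>The squared modulus is unbounded, hence not a test function; on the closed unit
    disc, which carries all the balayage measures, it agrees with this bounded one.\<close>
  define f where "f w = min ((cmod w)\<^sup>2) 1" for w :: complex
  have f: "continuous_on UNIV f" "bounded (range f)"
    unfolding f_def by (auto intro!: continuous_intros boundedI[of _ 1])
  have ff: "(\<integral>w. (cmod w)\<^sup>2 \<partial>\<alpha>) = (\<integral>w. f w \<partial>\<alpha>)" if V: "open V" "V \<subseteq> ball 0 1" and \<alpha>: "is_balayage V \<alpha>" for V \<alpha>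
  proof (rule integral_cong_AE)
    have s: "sets \<alpha> = sets borel" using \<alpha> by (simp add: is_balayage_def)
    show "(\<lambda>w. (cmod w)\<^sup>2) \<in> borel_measurable \<alpha>" "f \<in> borel_measurable \<alpha>"
      unfolding f_def by (auto simp: measurable_cong_sets[OF s refl])
    show "AE w in \<alpha>. (cmod w)\<^sup>2 = f w"
      using balayage_support[OF V \<alpha>] by (rule eventually_mono) (auto simp: f_def power_le_one)
  qed
  have le: "sweep_moment (Us n) (\<nu>s n) \<le> sweep_moment U \<nu> - (\<integral>w. f w \<partial>\<nu>) + (\<integral>w. f w \<partial>\<nu>s n)" for n
  proof -
    have "(\<integral>w. indicator (ball 0 1 - Us n) w * (cmod w)\<^sup>2 \<partial>lborel) \<le> (\<integral>w. indicator (ball 0 1 - U) w * (cmod w)\<^sup>2 \<partial>lborel)"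
    proof (rule integral_mono)
      have i: "integrable lborel (\<lambda>w. indicator (ball 0 1 - V) w * (cmod w)\<^sup>2)" if "open V" for V
      proof (rule Bochner_Integration.integrable_bound)
        have m: "ball 0 1 - V \<in> sets borel" using that by auto
        show "integrable lborel (indicator (ball (0::complex) 1) :: complex \<Rightarrow> real)"
          by (rule integrable_real_indicator) (auto simp: emeasure_unit_disc)
        show "(\<lambda>w. indicator (ball 0 1 - V) w * (cmod w)\<^sup>2) \<in> borel_measurable lborel" using m by measurable
        show "AE w in lborel. norm (indicator (ball 0 1 - V) w * (cmod w)\<^sup>2) \<le> norm (indicator (ball (0::complex) 1) w :: real)"
          by (intro AE_I2) (auto simp: indicator_def power_le_one)
      qed
      show "integrable lborel (\<lambda>w. indicator (ball 0 1 - Us n) w * (cmod w)\<^sup>2)" by (rule i[OF Us(1)])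
      show "integrable lborel (\<lambda>w. indicator (ball 0 1 - U) w * (cmod w)\<^sup>2)" by (rule i[OF U(1)])
      show "indicator (ball 0 1 - Us n) w * (cmod w)\<^sup>2 \<le> indicator (ball 0 1 - U) w * (cmod w)\<^sup>2" for w
        using Us(2)[of n] closure_subset[of U] by (auto simp: indicator_def)
    qed
    then show ?thesis
      unfolding sweep_moment_def ff[OF U \<nu>] ff[OF Us(1) Us(3) \<nu>s] by (simp add: divide_right_mono)
  qed
  have "(\<lambda>n. 1 / 2 + (sweep_moment U \<nu> - (\<integral>w. f w \<partial>\<nu>) + (\<integral>w. f w \<partial>\<nu>s n)) / 2) \<longlonglongrightarrow> 1 / 2 + (sweep_moment U \<nu> - (\<integral>w. f w \<partial>\<nu>) + (\<integral>w. f w \<partial>\<nu>)) / 2"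
    by (intro tendsto_intros conv f) simp
  then have "eventually (\<lambda>n. 1 / 2 + (sweep_moment U \<nu> - (\<integral>w. f w \<partial>\<nu>) + (\<integral>w. f w \<partial>\<nu>s n)) / 2 < R) sequentially"
    using lt by (intro order_tendstoD) auto
  then obtain n where n: "1 / 2 + (sweep_moment U \<nu> - (\<integral>w. f w \<partial>\<nu>) + (\<integral>w. f w \<partial>\<nu>s n)) / 2 < R"
    by (auto simp: eventually_sequentially)
  obtain \<mu> where \<mu>: "prob_meas_in (- Us n) \<mu>" "(\<integral>\<^sup>+z. \<integral>\<^sup>+w. kk z w \<partial>\<mu> \<partial>\<mu>) = ennreal (1 / 2 + sweep_moment (Us n) (\<nu>s n) / 2)"
    using balayage_measure[OF Us(1,3) \<nu>s fin(2)] by metis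
  have "R_mu \<mu> = ereal (1 / 2 + sweep_moment (Us n) (\<nu>s n) / 2)"
    unfolding R_mu_iterated[OF \<mu>(1)] \<mu>(2) using sweep_moment_nonneg[of "Us n" "\<nu>s n"] by (intro enn2ereal_ennreal) simp
  also have "ereal (1 / 2 + sweep_moment (Us n) (\<nu>s n) / 2) < ereal R"
  proof -
    have "1 / 2 + a / 2 < R" if "a \<le> b" "1 / 2 + b / 2 < R" for a b :: real using that by linarith
    then show ?thesis unfolding less_ereal.simps using le[of n] n by blast
  qed
  finally show ?thesis using \<mu>(1) by blast
qed

section \<open>Change of the number of particles, exponential rates and thickness\<close>

section \<open>Asymptotics\<close>

text \<open>Every term beyond index n of the series for e^x is at most 2^-(n+1) times the
  corresponding term of the series for e^(2x). The geometric decay makes the losses at large n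
  summable.\<close>

lemma erlang_CDF_le_geometric:
  assumes "0 \<le> x"
  shows "erlang_CDF n 1 x \<le> exp x * (1 / 2) ^ Suc n"
proof -
  let ?t = "\<lambda>y k. y ^ k / fact k :: real"
  have sm: "summable (?t y)" and ex: "suminf (?t y) = exp y" for y
    using exp_sums_real[of y] by (auto simp: sums_iff)
  have tail: "(\<Sum>k. ?t y (k + Suc n)) = exp y - (\<Sum>k<Suc n. ?t y k)" for y
    using suminf_minus_initial_segment[OF sm[of y], of "Suc n"] by (simp add: ex)
  have "exp x - (\<Sum>k<Suc n. ?t x k) \<le> (\<Sum>k. (1 / 2) ^ Suc n * ?t (2 * x) (k + Suc n))"
    unfolding tail[symmetric]
  proof (rule suminf_le)
    show "summable (\<lambda>k. ?t x (k + Suc n))" using sm by (subst summable_iff_shift)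
    show "summable (\<lambda>k. (1 / 2) ^ Suc n * ?t (2 * x) (k + Suc n))" using sm by (intro summable_mult) (subst summable_iff_shift)
    fix k
    have "x ^ (k + Suc n) * 1 \<le> x ^ (k + Suc n) * 2 ^ k" using assms by (intro mult_left_mono) auto
    then have "x ^ (k + Suc n) \<le> (1 / 2) ^ Suc n * (2 * x) ^ (k + Suc n)"
      by (simp add: power_mult_distrib power_add power_one_over field_simps)
    from divide_right_mono[OF this, of "fact (k + Suc n)"]
    show "?t x (k + Suc n) \<le> (1 / 2) ^ Suc n * ?t (2 * x) (k + Suc n)" by (simp only: times_divide_eq_right) simp
  qed
  also have "\<dots> = (1 / 2) ^ Suc n * (exp (2 * x) - (\<Sum>k<Suc n. ?t (2 * x) k))"
    using suminf_mult[OF summable_iff_shift[THEN iffD2, OF sm[of "2 * x"], of "Suc n"], of "(1 / 2) ^ Suc n"] tail[of "2 * x"]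
    by (simp only:)
  also have "\<dots> \<le> (1 / 2) ^ Suc n * exp (2 * x)"
  proof (rule mult_left_mono)
    have "0 \<le> (\<Sum>k<Suc n. ?t (2 * x) k)" using assms by (intro sum_nonneg) auto
    then show "exp (2 * x) - (\<Sum>k<Suc n. ?t (2 * x) k) \<le> exp (2 * x)" by linarith
  qed simp
  finally have "exp (- x) * (exp x - (\<Sum>k<Suc n. ?t x k)) \<le> exp (- x) * ((1 / 2) ^ Suc n * exp (2 * x))"
    by (intro mult_left_mono) auto
  also have "exp (- x) * ((1 / 2) ^ Suc n * exp (2 * x)) = (1 / 2) ^ Suc n * (exp (- x) * exp (2 * x))" by (simp only: mult_ac)
  also have "exp (- x) * exp (2 * x) = exp x" by (simp add: exp_add[symmetric])
  also have "exp (- x) * (exp x - (\<Sum>k<Suc n. ?t x k)) = erlang_CDF n 1 x"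
  proof -
    have "(\<Sum>k\<le>n. x ^ k * exp (- x) / fact k) = exp (- x) * (\<Sum>k<Suc n. ?t x k)"
      unfolding sum_distrib_left lessThan_Suc_atMost by (intro sum.cong) auto
    then show ?thesis using assms by (simp add: erlang_CDF_def right_diff_distrib exp_add[symmetric])
  qed
  finally show ?thesis by (simp add: mult.commute)
qed

text \<open>The passage from N to infinitely many functions is paid in three stages: exp(-r^2) at N,
  a factor 1/m for each index up to m, and a factor 1/2 altogether beyond m. The total is exp(-O(r^2
  log r)).\<close>

lemma hole_prob_bounds:
  assumes dpp: "determinantal_pp M S ginibre_kernel" and U: "open U" "U \<subseteq> ball 0 1" and r: "0 < r"
  defines "p \<equiv> measure M {\<omega>\<in>space M. S \<omega> \<inter> ((\<lambda>z. complex_of_real r * z) ` U) = {}}"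
    and "N \<equiv> nat \<lfloor>r\<^sup>2\<rfloor>"
  shows "p \<le> hole_det r U N"
    and "(1 / 2) * (1 / real (2 * N + 4)) ^ (2 * N + 4) * exp (- r\<^sup>2) * hole_det r U N \<le> p"
proof -
  define x where "x = r\<^sup>2"
  define D where "D = hole_det r U"
  \<comment> \<open>With x < N + 1 one has e^x 2^-m at most 4^(N+1) / 4^(N+2) = 1/4, below the 1/2
    needed for the tail.\<close>
  define m where "m = 2 * N + 4"
  have x: "0 < x" using r by (simp add: x_def)
  have Nx: "real N \<le> x" "x < real N + 1" unfolding N_def x_def[symmetric] using x by linarith+
  have Ub: "U \<in> sets borel" "U \<subseteq> cball 0 1" using U by (auto intro: order_trans)
  have "open ((\<lambda>z. complex_of_real r * z) ` U)" using open_scaling[of r U] U r by (simp add: scaleR_conv_of_real)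
  then have lim: "D \<longlonglongrightarrow> p" unfolding p_def D_def using hole_det_tendsto[OF dpp r Ub(1) _ Ub(2)] by simp
  have pos: "0 < D n" and dec: "D (Suc n) \<le> D n" and ge: "(1 - erlang_CDF n 1 x) * D n \<le> D (Suc n)" for n
    using hole_det_pos[OF r Ub] hole_det_Suc_le[OF r Ub] hole_det_Suc_ge[OF r Ub] by (auto simp: D_def x_def)
  have "decseq D" using dec by (rule decseq_SucI)
  then show "p \<le> hole_det r U N" using decseq_ge[OF _ lim] by (simp add: D_def)
  \<comment> \<open>At n = N the quotient x/(n + 1) may be arbitrarily close to 1, so this single
    step uses the other bound for the Erlang distribution.\<close>
  have s1: "exp (- x) * D N \<le> D (Suc N)"
  proof -
    have "exp (- x) * D N \<le> (1 - erlang_CDF N 1 x) * D N"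
      using erlang_CDF_bounds(2)[of x N] x pos[of N] by (intro mult_right_mono) auto
    then show ?thesis using ge[of N] by linarith
  qed
  \<comment> \<open>From N + 1 on, x is at most n, so each ratio is at least 1/(n + 1), which is at
    least 1/m.\<close>
  have s2: "(1 / real m) ^ k * D (Suc N) \<le> D (Suc N + k)" if "Suc N + k \<le> m" for k
    using that
  proof (induction k)
    case (Suc k)
    define n where "n = Suc N + k"
    have n: "real n + 1 \<le> real m" "x + 1 \<le> real n + 1" using Suc.prems Nx by (auto simp: n_def)
    have "erlang_CDF n 1 x \<le> x / (real n + 1)" using erlang_CDF_bounds(1)[of x n] x by (simp add: add.commute)
    also have "\<dots> \<le> (real n + 1 - 1) / (real n + 1)" using n by (intro divide_right_mono) auto
    also have "\<dots> = 1 - 1 / (real n + 1)" by (simp add: field_simps)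
    also have "\<dots> \<le> 1 - 1 / real m" using n by (simp add: frac_le)
    finally have "1 / real m * D n \<le> (1 - erlang_CDF n 1 x) * D n" using pos[of n] by (intro mult_right_mono) auto
    then have "1 / real m * D n \<le> D (Suc n)" using ge[of n] by linarith
    moreover have "1 / real m * ((1 / real m) ^ k * D (Suc N)) \<le> 1 / real m * D n"
      using Suc by (intro mult_left_mono) (auto simp: n_def)
    ultimately show ?case by (simp add: n_def mult.assoc)
  qed simp
  have "(1 / real m) ^ m * D (Suc N) \<le> (1 / real m) ^ (N + 3) * D (Suc N)"
    using pos[of "Suc N"] by (intro mult_right_mono power_decreasing) (auto simp: m_def)
  also have "\<dots> \<le> D (Suc N + (N + 3))" by (rule s2) (simp add: m_def)
  also have "Suc N + (N + 3) = m" by (simp add: m_def)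
  finally have s3: "(1 / real m) ^ m * D (Suc N) \<le> D m" .
  have ex: "exp x * (1 / 2) ^ m \<le> 1 / 2"
  proof -
    have "exp x \<le> exp (real (Suc N) * 1)" using Nx by simp
    also have "\<dots> = exp 1 ^ Suc N" by (rule exp_of_nat_mult)
    also have "\<dots> \<le> 4 ^ Suc N" using exp_le by (intro power_mono) auto
    finally have "exp x * (1 / 2) ^ m \<le> 4 ^ Suc N * (1 / 2) ^ m" by (intro mult_right_mono) auto
    also have "4 ^ Suc N * (1 / 2) ^ m = (1 / 4 :: real)"
      by (simp add: m_def power_add power_mult power_one_over power2_eq_square)
    finally have "exp x * (1 / 2) ^ m \<le> 1 / 4" .
    then show ?thesis by linarith
  qed
  \<comment> \<open>As the determinants decrease, each loss beyond m is at most \<open>D m\<close>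
    times a term of a geometric series; the losses are subtracted rather than multiplied, and their
    sum telescopes.\<close>
  have s4: "D m * (1 - exp x * ((1 / 2) ^ m - (1 / 2) ^ (m + k))) \<le> D (m + k)" for k
  proof (induction k)
    case (Suc k)
    have "D (m + k) - D m * (exp x * (1 / 2) ^ Suc (m + k)) \<le> D (m + k) - D (m + k) * (exp x * (1 / 2) ^ Suc (m + k))"
      using decseqD[OF \<open>decseq D\<close>, of m "m + k"] by (intro diff_left_mono mult_right_mono) auto
    also have "\<dots> \<le> D (m + k) - D (m + k) * erlang_CDF (m + k) 1 x"
      using pos[of "m + k"] x by (intro diff_left_mono mult_left_mono erlang_CDF_le_geometric) auto
    also have "\<dots> \<le> D (m + Suc k)" using ge[of "m + k"] by (simp add: algebra_simps)
    finally have "D (m + k) - D m * (exp x * (1 / 2) ^ Suc (m + k)) \<le> D (m + Suc k)" .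
    moreover have "D m * (1 - exp x * ((1 / 2) ^ m - (1 / 2) ^ (m + Suc k)))
      = D m * (1 - exp x * ((1 / 2) ^ m - (1 / 2) ^ (m + k))) - D m * (exp x * (1 / 2) ^ Suc (m + k))"
      by (simp add: field_simps)
    ultimately show ?case using Suc by linarith
  qed simp
  have "D m * (1 / 2) \<le> D n" for n
  proof -
    have "D m * (1 / 2) \<le> D m * (1 - exp x * ((1 / 2) ^ m - (1 / 2) ^ (m + n)))"
    proof (rule mult_left_mono)
      have "exp x * ((1 / 2) ^ m - (1 / 2) ^ (m + n)) \<le> exp x * (1 / 2) ^ m" by (intro mult_left_mono) auto
      then show "1 / 2 \<le> 1 - exp x * ((1 / 2) ^ m - (1 / 2) ^ (m + n))" using ex by linarith
    qed (use pos[of m] in auto)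
    also have "\<dots> \<le> D (m + n)" by (rule s4)
    also have "\<dots> \<le> D n" using \<open>decseq D\<close> by (simp add: decseqD)
    finally show ?thesis .
  qed
  then have s5: "D m * (1 / 2) \<le> p" by (intro LIMSEQ_le_const[OF lim]) auto
  have "(1 / 2) * (1 / real m) ^ m * exp (- x) * D N = (1 / 2) * (1 / real m) ^ m * (exp (- x) * D N)" by simp
  also have "\<dots> \<le> (1 / 2) * (1 / real m) ^ m * D (Suc N)" by (intro mult_left_mono s1) auto
  also have "\<dots> \<le> D m * (1 / 2)" using s3 by simp
  also note s5
  finally show "(1 / 2) * (1 / real (2 * N + 4)) ^ (2 * N + 4) * exp (- r\<^sup>2) * hole_det r U N \<le> p"
    by (simp add: m_def x_def D_def)
qed

lemma floor_square:
  assumes "1 \<le> (r::real)"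
  shows "real (nat \<lfloor>r\<^sup>2\<rfloor>) \<le> r\<^sup>2" "r\<^sup>2 \<le> real (nat \<lfloor>r\<^sup>2\<rfloor>) + 1" "1 \<le> nat \<lfloor>r\<^sup>2\<rfloor>"
proof -
  have "1 \<le> r\<^sup>2" using assms by (simp add: one_le_power)
  then show "real (nat \<lfloor>r\<^sup>2\<rfloor>) \<le> r\<^sup>2" "r\<^sup>2 \<le> real (nat \<lfloor>r\<^sup>2\<rfloor>) + 1" "1 \<le> nat \<lfloor>r\<^sup>2\<rfloor>" by linarith+
qed

lemma floor_square_asymp:
  defines "n \<equiv> \<lambda>r::real. real (nat \<lfloor>r\<^sup>2\<rfloor>)"
  shows "((\<lambda>r. (n r)\<^sup>2 / r ^ 4) \<longlongrightarrow> 1) at_top" "((\<lambda>r. n r / r ^ 4) \<longlongrightarrow> 0) at_top" "((\<lambda>r. n r * ln (n r) / r ^ 4) \<longlongrightarrow> 0) at_top"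
    and "filterlim (\<lambda>r::real. nat \<lfloor>r\<^sup>2\<rfloor>) at_top at_top"
proof -
  have ev: "eventually (\<lambda>r::real. 2 \<le> r) at_top" by (rule eventually_ge_at_top)
  have n: "r\<^sup>2 - 1 \<le> n r" "n r \<le> r\<^sup>2" "1 \<le> n r" "1 \<le> r\<^sup>2" "0 < r ^ 4" if "2 \<le> r" for r
    using floor_square[of r] that one_le_power[of r 2] by (auto simp: n_def)
  show "((\<lambda>r. (n r)\<^sup>2 / r ^ 4) \<longlongrightarrow> 1) at_top"
  proof (rule tendsto_sandwich)
    show "((\<lambda>r::real. (r\<^sup>2 - 1)\<^sup>2 / r ^ 4) \<longlongrightarrow> 1) at_top" by real_asymp
    show "((\<lambda>r::real. (r\<^sup>2)\<^sup>2 / r ^ 4) \<longlongrightarrow> 1) at_top" by real_asymp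
    show "eventually (\<lambda>r. (r\<^sup>2 - 1)\<^sup>2 / r ^ 4 \<le> (n r)\<^sup>2 / r ^ 4) at_top"
      using ev by eventually_elim (use n in \<open>auto intro!: divide_right_mono power_mono\<close>)
    show "eventually (\<lambda>r. (n r)\<^sup>2 / r ^ 4 \<le> (r\<^sup>2)\<^sup>2 / r ^ 4) at_top"
      using ev by eventually_elim (intro divide_right_mono power_mono n, auto simp: n_def)
  qed
  show "((\<lambda>r. n r / r ^ 4) \<longlongrightarrow> 0) at_top"
  proof (rule tendsto_sandwich)
    show "eventually (\<lambda>r. n r / r ^ 4 \<le> r\<^sup>2 / r ^ 4) at_top"
      using ev by eventually_elim (intro divide_right_mono n, auto)
    show "eventually (\<lambda>r. 0 \<le> n r / r ^ 4) at_top" by (auto simp: n_def)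
    show "((\<lambda>r::real. r\<^sup>2 / r ^ 4) \<longlongrightarrow> 0) at_top" by real_asymp
  qed (rule tendsto_const)
  show "((\<lambda>r. n r * ln (n r) / r ^ 4) \<longlongrightarrow> 0) at_top"
  proof (rule tendsto_sandwich)
    show "eventually (\<lambda>r. n r * ln (n r) / r ^ 4 \<le> r\<^sup>2 * ln (r\<^sup>2) / r ^ 4) at_top"
      using ev
    proof eventually_elim
      case (elim r)
      have "ln (n r) \<le> ln (r\<^sup>2)" "0 \<le> ln (n r)" using n[OF elim] by (auto intro: ln_mono)
      then have "n r * ln (n r) \<le> r\<^sup>2 * ln (r\<^sup>2)" using n[OF elim] by (intro mult_mono) auto
      then show ?case by (rule divide_right_mono) simp
    qed
    show "eventually (\<lambda>r. 0 \<le> n r * ln (n r) / r ^ 4) at_top"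
      using ev
    proof eventually_elim
      case (elim r)
      from n(3)[OF elim] have "0 \<le> n r * ln (n r)" by (intro mult_nonneg_nonneg) auto
      then show ?case by simp
    qed
    show "((\<lambda>r::real. r\<^sup>2 * ln (r\<^sup>2) / r ^ 4) \<longlongrightarrow> 0) at_top" by real_asymp
  qed (rule tendsto_const)
  have "filterlim (\<lambda>r::real. r\<^sup>2 - 1) at_top at_top" by real_asymp
  then have ninf: "filterlim n at_top at_top"
    by (rule filterlim_at_top_mono) (use ev in \<open>eventually_elim, auto dest: n(1)\<close>)
  show "filterlim (\<lambda>r::real. nat \<lfloor>r\<^sup>2\<rfloor>) at_top at_top"
    unfolding filterlim_at_top
  proof
    fix Z
    from ninf have "eventually (\<lambda>r. real Z \<le> n r) at_top" by (simp add: filterlim_at_top)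
    then show "eventually (\<lambda>r::real. Z \<le> nat \<lfloor>r\<^sup>2\<rfloor>) at_top" by (simp only: n_def of_nat_le_iff)
  qed
qed

lemma R_mu_nonneg: "prob_meas_in E \<mu> \<Longrightarrow> 0 \<le> R_mu \<mu>"
  by (simp add: R_mu_iterated)

lemma R_set_finite:
  assumes "U \<subseteq> ball 0 1"
  obtains u where "R_set U = ereal u" "0 \<le> u"
proof -
  \<comment> \<open>An annulus outside the unit disc avoids every admissible hole, and its uniform
    measure has finite energy.\<close>
  define K where "K = cball (0::complex) 2 - ball 0 1"
  have K: "compact K" unfolding K_def by (intro compact_diff) auto
  have KU: "K \<subseteq> - U" using assms by (auto simp: K_def)
  have sub: "ball (3 / 2 :: complex) (1 / 2) \<subseteq> K"
  proof
    fix z assume "z \<in> ball (3 / 2 :: complex) (1 / 2)"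
    then have "cmod (3 / 2 - z) < 1 / 2" by (simp add: dist_norm)
    then show "z \<in> K" using norm_triangle_ineq2[of "3 / 2" z] norm_triangle_ineq2[of z "3 / 2"]
      by (auto simp: K_def norm_minus_commute)
  qed
  have pos: "emeasure lborel K \<noteq> 0"
  proof
    assume "emeasure lborel K = 0"
    then have "K \<in> null_sets lborel" using K by (auto simp: null_sets_def compact_imp_closed)
    then have "negligible K" by (simp add: negligible_iff_null_sets null_sets_completionI)
    then have "negligible (ball (3 / 2 :: complex) (1 / 2))" using sub by (rule negligible_subset)
    then show False using open_not_negligible[of "ball (3 / 2 :: complex) (1 / 2)"] by simp
  qed
  have fin: "emeasure lborel K \<noteq> \<infinity>" using emeasure_compact_finite[OF K] by simp
  have pm: "prob_meas_in (- U) (uniform_measure lborel K)" by (rule prob_meas_in_uniform[OF K KU]) (use pos fin in auto)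
  have "R_set U \<le> R_mu (uniform_measure lborel K)" unfolding R_set_def using pm by (intro INF_lower) simp
  also have "\<dots> < \<infinity>" unfolding R_mu_iterated[OF pm] using uniform_energy[OF K pos] by (simp add: less_ennreal.rep_eq)
  finally have "R_set U < \<infinity>" .
  moreover have "0 \<le> R_set U" unfolding R_set_def by (rule INF_greatest) (auto intro: R_mu_nonneg)
  ultimately show ?thesis using that by (cases "R_set U") auto
qed

text \<open>The hypothesis \<open>app\<close> isolates the only use of conditions (a) and (b):
  nearly minimal measures supported where \<open>- U\<close> is thick. It also holds for the empty
  hole, so the same limit treats numerator and denominator.\<close>

lemma ln_partfn_tendsto:
  assumes U: "open U" "U \<subseteq> ball 0 1" and u: "R_set U = ereal u"
    and app: "\<And>R. R_set U < ereal R \<Longrightarrow> \<exists>F' \<mu>. thick_in F' (- U) \<and> F' \<subseteq> - U \<and> prob_meas_in F' \<mu> \<and> R_mu \<mu> < ereal R"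
  shows "((\<lambda>r. ln (partfn r (- U) (nat \<lfloor>r\<^sup>2\<rfloor>)) / r ^ 4) \<longlongrightarrow> - u) at_top"
proof -
  let ?N = "\<lambda>r::real. nat \<lfloor>r\<^sup>2\<rfloor>"
  have Ub: "U \<in> sets borel" "U \<subseteq> cball 0 1" using U by (auto intro: order_trans)
  have ev1: "eventually (\<lambda>r::real. 1 \<le> r) at_top" by (rule eventually_ge_at_top)
  have pos: "0 < partfn r (- U) n" if "0 < r" for r n
    using hole_det_pos[OF that Ub, of n] hole_det_partfn[OF that Ub(1), of n] by (simp add: zero_less_divide_iff)
  show ?thesis
  proof (rule order_tendstoI)
    fix a assume a: "a < - u"
    \<comment> \<open>The midpoint of \<open>u\<close> and \<open>-a\<close>: strictly above the
      infimum and strictly below the level to be reached.\<close>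
    define R where "R = (u - a) / 2"
    have "R_set U < ereal R" using a by (simp add: u R_def)
    then obtain F' \<mu> where th: "thick_in F' (- U)" "F' \<subseteq> - U" and \<mu>: "prob_meas_in F' \<mu>" "R_mu \<mu> < ereal R" using app by blast
    obtain R' where R': "R_mu \<mu> = ereal R'" "R' < R" using \<mu> R_mu_nonneg[OF \<mu>(1)] by (cases "R_mu \<mu>") auto
    obtain \<kappa> D where \<kappa>: "0 < \<kappa>" and low: "\<And>r n. 0 < r \<Longrightarrow> 1 \<le> n \<Longrightarrow> real n \<le> r\<^sup>2 \<Longrightarrow> r\<^sup>2 \<le> real n + 1 \<Longrightarrow>
       (\<kappa> / real n ^ 8) ^ n * exp (- (real n)\<^sup>2 * R' - real n * D) \<le> partfn r (- U) n"
      using partfn_lower_energy[OF th(1) _ th(2) \<mu>(1) R'(1)] U by (metis closed_Compl)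
    have "((\<lambda>r. ln \<kappa> * (real (?N r) / r ^ 4) - 8 * (real (?N r) * ln (real (?N r)) / r ^ 4) - R' * ((real (?N r))\<^sup>2 / r ^ 4) - D * (real (?N r) / r ^ 4))
        \<longlongrightarrow> ln \<kappa> * 0 - 8 * 0 - R' * 1 - D * 0) at_top"
      by (intro tendsto_diff tendsto_mult tendsto_const floor_square_asymp)
    moreover have "a < ln \<kappa> * 0 - 8 * 0 - R' * 1 - D * 0" using R' a by (simp add: R_def)
    ultimately have "eventually (\<lambda>r. a < ln \<kappa> * (real (?N r) / r ^ 4) - 8 * (real (?N r) * ln (real (?N r)) / r ^ 4) - R' * ((real (?N r))\<^sup>2 / r ^ 4) - D * (real (?N r) / r ^ 4)) at_top"
      by (rule order_tendstoD)
    then show "eventually (\<lambda>r. a < ln (partfn r (- U) (?N r)) / r ^ 4) at_top"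
      using ev1
    proof eventually_elim
      case (elim r)
      define n where "n = ?N r"
      have n: "1 \<le> n" "real n \<le> r\<^sup>2" "r\<^sup>2 \<le> real n + 1" using floor_square[OF elim(2)] by (auto simp: n_def)
      have "ln ((\<kappa> / real n ^ 8) ^ n * exp (- (real n)\<^sup>2 * R' - real n * D)) \<le> ln (partfn r (- U) n)"
        using \<kappa> n elim(2) by (intro ln_mono low) auto
      moreover have "ln ((\<kappa> / real n ^ 8) ^ n * exp (- (real n)\<^sup>2 * R' - real n * D)) = ln \<kappa> * real n - 8 * (real n * ln (real n)) - R' * (real n)\<^sup>2 - D * real n"
        using \<kappa> n by (simp add: ln_mult ln_realpow ln_div field_simps)
      ultimately have "(ln \<kappa> * real n - 8 * (real n * ln (real n)) - R' * (real n)\<^sup>2 - D * real n) / r ^ 4 \<le> ln (partfn r (- U) n) / r ^ 4"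
        by (intro divide_right_mono) auto
      then show ?case using elim(1) by (simp add: n_def diff_divide_distrib)
    qed
  next
    fix a assume a: "- u < a"
    \<comment> \<open>Again the midpoint of \<open>u\<close> and \<open>-a\<close>, now strictly
      below the infimum.\<close>
    define L where "L = (u - a) / 2"
    have "ereal L < R_set U" using a by (simp add: u L_def)
    from weighted_fekete_upper[OF U(1) this] floor_square_asymp(4)
    have "eventually (\<lambda>r. \<forall>z. (\<forall>i<?N r. z i \<in> - U \<inter> cball 0 1) \<longrightarrow> wvd (?N r) z \<le> exp (- L * (real (?N r))\<^sup>2)) at_top"
      by (rule eventually_compose_filterlim)
    moreover have "((\<lambda>r. ln pi * (real (?N r) / r ^ 4) - L * ((real (?N r))\<^sup>2 / r ^ 4)) \<longlongrightarrow> ln pi * 0 - L * 1) at_top"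
      by (intro tendsto_diff tendsto_mult tendsto_const floor_square_asymp)
    then have "eventually (\<lambda>r. ln pi * (real (?N r) / r ^ 4) - L * ((real (?N r))\<^sup>2 / r ^ 4) < a) at_top"
      by (rule order_tendstoD) (use a in \<open>simp add: L_def field_simps\<close>)
    ultimately show "eventually (\<lambda>r. ln (partfn r (- U) (?N r)) / r ^ 4 < a) at_top"
      using ev1
    proof eventually_elim
      case (elim r)
      define n where "n = ?N r"
      have n: "1 \<le> n" "real n \<le> r\<^sup>2" using floor_square[OF elim(3)] by (auto simp: n_def)
      have "partfn r (- U) n \<le> exp (- L * (real n)\<^sup>2) * pi ^ n"
        using elim(1,3) n by (intro partfn_le[OF _ Ub(1) U(2)]) (auto simp: n_def)
      then have "ln (partfn r (- U) n) \<le> ln (exp (- L * (real n)\<^sup>2) * pi ^ n)" using pos[of r n] elim(3) by (intro ln_mono) auto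
      also have "\<dots> = ln pi * real n - L * (real n)\<^sup>2" by (simp add: ln_mult ln_realpow)
      finally have "ln (partfn r (- U) n) / r ^ 4 \<le> (ln pi * real n - L * (real n)\<^sup>2) / r ^ 4" by (intro divide_right_mono) auto
      then show ?case using elim(2) by (simp add: n_def diff_divide_distrib)
    qed
  qed
qed

lemma thick_in_UNIV: "thick_in UNIV UNIV"
  unfolding thick_in_def
proof (intro exI[of _ "1::real"] conjI ballI)
  fix \<theta> \<rho> :: real and z :: complex
  assume "\<theta> \<in> {0<..1}" "\<rho> \<in> {0<..1}"
  then show "\<exists>c s. \<theta> * \<rho> \<le> s \<and> s \<le> \<rho> \<and> ball c s \<subseteq> UNIV \<and> cmod (z - c) \<le> (1 + \<theta>) * s"
    by (intro exI[of _ z] exI[of _ \<rho>]) (auto intro: mult_left_le_one_le)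
qed simp

text \<open>Compactness of the closure of \<open>U\<close> leaves a positive distance to the
  complement of \<open>V\<close>, and balls centred at the points themselves serve.\<close>

lemma thick_in_separated:
  assumes U: "bounded U" and V: "open V" "closure U \<subseteq> V"
  shows "thick_in (- V) (- U)"
proof -
  have "compact (closure U)" using U by (simp add: compact_closure)
  from compact_subset_open_imp_ball_epsilon_subset[OF this V]
  obtain \<epsilon> where \<epsilon>: "0 < \<epsilon>" "(\<Union>x\<in>closure U. ball x \<epsilon>) \<subseteq> V" by blast
  show ?thesis
    unfolding thick_in_def
  proof (intro exI[of _ \<epsilon>] conjI ballI \<epsilon>(1))
    fix \<theta> \<rho> z assume h: "\<theta> \<in> {0<..1::real}" "\<rho> \<in> {0<..\<epsilon>}" "z \<in> - V"
    have "ball z \<rho> \<subseteq> - U"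
    proof
      fix w assume w: "w \<in> ball z \<rho>"
      show "w \<in> - U"
      proof
        assume "w \<in> U"
        then have "w \<in> closure U" using closure_subset by blast
        moreover have "z \<in> ball w \<epsilon>" using w h by (auto simp: dist_commute)
        ultimately show False using \<epsilon>(2) h(3) by blast
      qed
    qed
    then show "\<exists>c s. \<theta> * \<rho> \<le> s \<and> s \<le> \<rho> \<and> ball c s \<subseteq> - U \<and> cmod (z - c) \<le> (1 + \<theta>) * s"
      using h by (intro exI[of _ z] exI[of _ \<rho>]) (auto intro: mult_left_le_one_le)
  qed
qed

text \<open>A point at distance at least \<theta>\<rho> from \<open>U\<close> has its own ball.
  Otherwise it is \<theta>\<rho>-close to a boundary point, and a ball of radius \<rho> inside the
  exterior ball, touching at that point, misses the given one by a relative amount of at most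
  \<theta>.\<close>

lemma thick_in_exterior_ball:
  fixes U :: "complex set"
  assumes \<epsilon>: "0 < \<epsilon>" and ext: "\<forall>z\<in>frontier U. \<exists>\<eta>\<in>- U. ball \<eta> \<epsilon> \<subseteq> - U \<and> cmod (z - \<eta>) = \<epsilon>"
  shows "thick_in (- U) (- U)"
  unfolding thick_in_def
proof (intro exI[of _ \<epsilon>] conjI ballI \<epsilon>)
  fix \<theta> \<rho> z assume h: "\<theta> \<in> {0<..1::real}" "\<rho> \<in> {0<..\<epsilon>}" "z \<in> - U"
  show "\<exists>c s. \<theta> * \<rho> \<le> s \<and> s \<le> \<rho> \<and> ball c s \<subseteq> - U \<and> cmod (z - c) \<le> (1 + \<theta>) * s"
  proof (cases "ball z (\<theta> * \<rho>) \<subseteq> - U")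
    case True
    then show ?thesis using h by (intro exI[of _ z] exI[of _ "\<theta> * \<rho>"]) (auto intro: mult_left_le_one_le)
  next
    case False
    then obtain y where y: "y \<in> U" "cmod (z - y) < \<theta> * \<rho>" by (auto simp: dist_norm)
    \<comment> \<open>The segment from a point outside \<open>U\<close> to one inside meets the
      boundary, at a distance bounded by its length.\<close>
    have "closed_segment z y \<inter> frontier U \<noteq> {}"
      using h(3) y(1) by (intro connected_Int_frontier) auto
    then obtain z0 where z0: "z0 \<in> closed_segment z y" "z0 \<in> frontier U" by blast
    then have d: "cmod (z - z0) \<le> \<theta> * \<rho>" using dist_in_closed_segment(1)[OF z0(1)] y(2) by (auto simp: dist_norm norm_minus_commute)
    obtain \<eta> where \<eta>: "ball \<eta> \<epsilon> \<subseteq> - U" "cmod (z0 - \<eta>) = \<epsilon>" using ext z0(2) by blast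
    \<comment> \<open>The centre of the ball of radius \<rho> internally tangent to the exterior
      ball at \<open>z0\<close>; its distance from \<open>z\<close> is at most \<rho> +
      \<theta>\<rho>.\<close>
    define c where "c = z0 + of_real (\<rho> / \<epsilon>) * (\<eta> - z0)"
    have "c - z0 = of_real (\<rho> / \<epsilon>) * (\<eta> - z0)" by (simp add: c_def)
    then have c1: "cmod (z0 - c) = \<rho>" using h \<epsilon> \<eta>(2) by (simp add: norm_minus_commute[of z0] norm_mult norm_divide)
    have "\<eta> - c = of_real (1 - \<rho> / \<epsilon>) * (\<eta> - z0)" by (simp add: c_def algebra_simps)
    then have "cmod (\<eta> - c) = \<bar>1 - \<rho> / \<epsilon>\<bar> * \<epsilon>" using \<eta>(2) by (simp only: norm_mult norm_of_real norm_minus_commute[of \<eta> z0])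
    also have "\<dots> = \<epsilon> - \<rho>" using h \<epsilon> by (simp add: abs_of_nonneg field_simps)
    finally have c2: "cmod (\<eta> - c) = \<epsilon> - \<rho>" .
    have "ball c \<rho> \<subseteq> ball \<eta> \<epsilon>"
    proof
      fix w assume "w \<in> ball c \<rho>"
      then have "cmod (c - w) < \<rho>" by (simp add: dist_norm)
      then have "cmod (\<eta> - w) < \<epsilon>" using norm_triangle_ineq[of "\<eta> - c" "c - w"] c2 by simp
      then show "w \<in> ball \<eta> \<epsilon>" by (simp add: dist_norm)
    qed
    moreover have "cmod (z - c) \<le> (1 + \<theta>) * \<rho>"
      using norm_triangle_ineq[of "z - z0" "z0 - c"] d c1 by (simp add: algebra_simps)
    ultimately show ?thesis using h \<eta>(1) by (intro exI[of _ c] exI[of _ \<rho>]) (auto intro: mult_left_le_one_le)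
  qed
qed

theorem theorem1p6:
  fixes M :: "'a measure" and S :: "'a \<Rightarrow> complex set" and U :: "complex set"
  assumes ginibre: "determinantal_pp M S ginibre_kernel"
    and U_open: "open U" and U_sub: "U \<subseteq> ball 0 1"
    and cond: "(\<exists>Us \<nu>s \<nu>. (\<forall>n. open (Us n) \<and> closure U \<subseteq> Us n \<and> Us n \<subseteq> ball 0 1 \<and>
                                  is_balayage (Us n) (\<nu>s n))
                         \<and> is_balayage U \<nu> \<and> weak_conv_cmeas \<nu>s \<nu>)
             \<or> (\<exists>\<epsilon>>0. \<forall>z\<in>frontier U. \<exists>\<eta>\<in>- U. ball \<eta> \<epsilon> \<subseteq> - U \<and> cmod (z - \<eta>) = \<epsilon>)"
  shows "((\<lambda>r::real. ereal (ln (measure M {\<omega>\<in>space M. S \<omega> \<inter> ((\<lambda>z. complex_of_real r * z) ` U) = {}})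
                             / r ^ 4))
          \<longlongrightarrow> R_set {} - R_set U) at_top"
proof -
  let ?N = "\<lambda>r::real. nat \<lfloor>r\<^sup>2\<rfloor>"
  define p where "p r = measure M {\<omega>\<in>space M. S \<omega> \<inter> ((\<lambda>z. complex_of_real r * z) ` U) = {}}" for r :: real
  obtain u where u: "R_set U = ereal u" using R_set_finite[OF U_sub] by blast
  obtain e where e: "R_set {} = ereal e" using R_set_finite[of "{}"] by blast
  have attained: "\<exists>\<mu>. prob_meas_in (- V) \<mu> \<and> R_mu \<mu> < ereal R" if "R_set V < ereal R" for V R
    using that unfolding R_set_def INF_less_iff by auto
  \<comment> \<open>In case (a) the measures live on the complement of some \<open>Us n\<close>,
    separated from \<open>U\<close>; in case (b) near-minimisers for \<open>U\<close> itself are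
    admissible, because its complement is thick in itself.\<close>
  have appU: "\<exists>F' \<mu>. thick_in F' (- U) \<and> F' \<subseteq> - U \<and> prob_meas_in F' \<mu> \<and> R_mu \<mu> < ereal R" if R: "R_set U < ereal R" for R
    using cond
  proof
    assume "\<exists>Us \<nu>s \<nu>. (\<forall>n. open (Us n) \<and> closure U \<subseteq> Us n \<and> Us n \<subseteq> ball 0 1 \<and> is_balayage (Us n) (\<nu>s n)) \<and> is_balayage U \<nu> \<and> weak_conv_cmeas \<nu>s \<nu>"
    then obtain Us \<nu>s \<nu> where Us: "\<And>n. open (Us n)" "\<And>n. closure U \<subseteq> Us n" "\<And>n. Us n \<subseteq> ball 0 1"
      and \<nu>: "\<And>n::nat. is_balayage (Us n) (\<nu>s n)" "is_balayage U \<nu>" "weak_conv_cmeas \<nu>s \<nu>" by blast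
    obtain n \<mu> where \<mu>: "prob_meas_in (- Us n) \<mu>" "R_mu \<mu> < ereal R"
      using weak_balayage_approx[OF U_open U_sub \<nu>(2) Us \<nu>(1) \<nu>(3) R] by blast
    have "bounded U" using U_sub bounded_ball bounded_subset by blast
    then have "thick_in (- Us n) (- U)" using Us by (intro thick_in_separated) auto
    moreover have "- Us n \<subseteq> - U" using Us(2)[of n] closure_subset[of U] by blast
    ultimately show ?thesis using \<mu> by blast
  next
    assume "\<exists>\<epsilon>>0. \<forall>z\<in>frontier U. \<exists>\<eta>\<in>- U. ball \<eta> \<epsilon> \<subseteq> - U \<and> cmod (z - \<eta>) = \<epsilon>"
    then have "thick_in (- U) (- U)" using thick_in_exterior_ball by blast
    then show ?thesis using attained[OF R] by blast
  qed
  \<comment> \<open>The normalising integral is the case of the empty hole, where balls are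
    unrestricted; it supplies \<open>R_set {}\<close>.\<close>
  have app0: "\<exists>F' \<mu>. thick_in F' (- {}) \<and> F' \<subseteq> - {} \<and> prob_meas_in F' \<mu> \<and> R_mu \<mu> < ereal R" if R: "R_set {} < ereal R" for R
    using attained[OF R] thick_in_UNIV by (intro exI[of _ UNIV]) auto
  have Ub: "U \<in> sets borel" "U \<subseteq> cball 0 1" using U_open U_sub by (auto intro: order_trans)
  have "((\<lambda>r. ln (partfn r (- U) (?N r)) / r ^ 4 - ln (partfn r (- {}) (?N r)) / r ^ 4) \<longlongrightarrow> - u - - e) at_top"
    by (intro tendsto_diff ln_partfn_tendsto[OF U_open U_sub u appU] ln_partfn_tendsto[OF open_empty _ e app0]) auto
  then have lim: "((\<lambda>r. ln (partfn r (- U) (?N r)) / r ^ 4 - ln (partfn r (- {}) (?N r)) / r ^ 4) \<longlongrightarrow> e - u) at_top" by simp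
  have ev: "eventually (\<lambda>r::real. 2 \<le> r) at_top" by (rule eventually_ge_at_top)
  have hd: "ln (hole_det r U n) / r ^ 4 = ln (partfn r (- U) n) / r ^ 4 - ln (partfn r (- {}) n) / r ^ 4" if r: "0 < r" for r n
  proof -
    have "0 < partfn r UNIV n" and eq: "hole_det r U n = partfn r (- U) n / partfn r UNIV n"
      by (rule hole_det_partfn[OF r Ub(1)])+
    moreover have "0 < partfn r (- U) n"
      using hole_det_pos[OF r Ub, of n] eq \<open>0 < partfn r UNIV n\<close> by (simp add: zero_less_divide_iff)
    ultimately show ?thesis by (simp add: ln_div diff_divide_distrib)
  qed
  have lim1: "((\<lambda>r. ln (hole_det r U (?N r)) / r ^ 4) \<longlongrightarrow> e - u) at_top"
    by (rule tendsto_cong[THEN iffD1, OF _ lim]) (use ev in \<open>eventually_elim, simp add: hd\<close>)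
  have "((\<lambda>r. ln (p r) / r ^ 4) \<longlongrightarrow> e - u) at_top"
  proof (rule tendsto_sandwich[OF _ _ _ lim1])
    \<comment> \<open>The logarithm of the loss from changing the number of particles, with 2 N + 4
      bounded by 2 r^2 + 4, is negligible against r^4.\<close>
    have "((\<lambda>r::real. (ln 2 + (2 * r\<^sup>2 + 4) * ln (2 * r\<^sup>2 + 4) + r\<^sup>2) / r ^ 4) \<longlongrightarrow> 0) at_top" by real_asymp
    from tendsto_diff[OF lim1 this]
    show "((\<lambda>r. ln (hole_det r U (?N r)) / r ^ 4 - (ln 2 + (2 * r\<^sup>2 + 4) * ln (2 * r\<^sup>2 + 4) + r\<^sup>2) / r ^ 4) \<longlongrightarrow> e - u) at_top" by simp
    have b: "ln (p r) \<le> ln (hole_det r U (?N r))" "ln (hole_det r U (?N r)) - (ln 2 + (2 * r\<^sup>2 + 4) * ln (2 * r\<^sup>2 + 4) + r\<^sup>2) \<le> ln (p r)"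
      if r: "2 \<le> r" for r
    proof -
      have r0: "0 < r" using r by simp
      define m where "m = 2 * ?N r + 4"
      have hp: "0 < hole_det r U (?N r)" by (rule hole_det_pos[OF r0 Ub])
      note hb = hole_prob_bounds[OF ginibre U_open U_sub r0, folded p_def m_def]
      have m: "0 < real m" by (subst of_nat_0_less_iff) (simp add: m_def)
      then have lp: "0 < (1 / 2) * (1 / real m) ^ m * exp (- r\<^sup>2) * hole_det r U (?N r)" using hp by (intro mult_pos_pos zero_less_power) auto
      then have pp: "0 < p r" using hb(2) by linarith
      show "ln (p r) \<le> ln (hole_det r U (?N r))" using pp hb(1) by (intro ln_mono) auto
      have "ln ((1 / 2) * (1 / real m) ^ m * exp (- r\<^sup>2) * hole_det r U (?N r)) \<le> ln (p r)" using lp hb(2) by (intro ln_mono) auto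
      moreover have "ln ((1 / 2) * (1 / real m) ^ m * exp (- r\<^sup>2) * hole_det r U (?N r)) = - ln 2 - real m * ln (real m) - r\<^sup>2 + ln (hole_det r U (?N r))"
      proof -
        have "ln ((1 / 2) * (1 / real m) ^ m * exp (- r\<^sup>2) * hole_det r U (?N r)) = ln (1 / 2) + ln ((1 / real m) ^ m) + - r\<^sup>2 + ln (hole_det r U (?N r))"
        proof -
          have "ln (a * b * exp c * d) = ln a + ln b + c + ln d" if "0 < a" "0 < b" "0 < d" for a b c d :: real
            using that by (simp add: ln_mult)
          from this[of "1 / 2" "(1 / real m) ^ m" "hole_det r U (?N r)" "- r\<^sup>2"] show ?thesis using m hp by auto
        qed
        also have "ln ((1 / real m) ^ m) = - (real m * ln (real m))" using m by (simp add: ln_realpow ln_div)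
        also have "ln (1 / 2 :: real) = - ln 2" by (simp add: ln_div)
        finally show ?thesis by simp
      qed
      moreover have "real m * ln (real m) \<le> (2 * r\<^sup>2 + 4) * ln (2 * r\<^sup>2 + 4)"
      proof (intro mult_mono ln_mono)
        show "real m \<le> 2 * r\<^sup>2 + 4" using floor_square(1)[of r] r by (simp add: m_def)
        then show "real m \<le> 2 * r\<^sup>2 + 4" .
        show "0 < real m" by (rule m)
        show "0 \<le> 2 * r\<^sup>2 + 4" by simp
        show "0 \<le> ln (real m)" by (simp add: m_def)
      qed
      ultimately show "ln (hole_det r U (?N r)) - (ln 2 + (2 * r\<^sup>2 + 4) * ln (2 * r\<^sup>2 + 4) + r\<^sup>2) \<le> ln (p r)" by linarith
    qed
    show "eventually (\<lambda>r. ln (p r) / r ^ 4 \<le> ln (hole_det r U (?N r)) / r ^ 4) at_top"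
      using ev by eventually_elim (intro divide_right_mono b, auto)
    show "eventually (\<lambda>r. ln (hole_det r U (?N r)) / r ^ 4 - (ln 2 + (2 * r\<^sup>2 + 4) * ln (2 * r\<^sup>2 + 4) + r\<^sup>2) / r ^ 4 \<le> ln (p r) / r ^ 4) at_top"
      using ev
    proof eventually_elim
      case (elim r)
      from divide_right_mono[OF b(2)[OF elim], of "r ^ 4"] show ?case by (simp add: diff_divide_distrib)
    qed
  qed
  then have "((\<lambda>r. ereal (ln (p r) / r ^ 4)) \<longlongrightarrow> ereal (e - u)) at_top" by (rule tendsto_ereal)
  then show ?thesis by (simp add: p_def u e)
qed

end
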